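(* Let $\Phi\in\mathbb{C}\langle\!\langle x,y\rangle\!\rangle$ be a Drinfeld associator, and let $\mathfrak g$ and $\mathfrak h$ be Lie algebras with chosen invariant elements $t_{\mathfrak g}\in(S^2\mathfrak g)^{\mathfrak g}$, $t_{\mathfrak h}\in(S^2\mathfrak h)^{\mathfrak h}$. (1) If $(A,m_0,\{\,,\}=0)$ is a $\mathfrak g$-quasi-Poisson-commutative algebra, then $A$ with the product $m_\hbar=m_0$ is a deformation quantization of it. (2) If $(A,m_\hbar)$ is a deformation quantization of a $\mathfrak g\oplus\mathfrak g\oplus\mathfrak h$-quasi-Poisson algebra $(A,m_0,\{\,,\})$, then the quantum fusion of $(A,m_\hbar)$ (an algebra in $U(\mathfrak g\oplus\mathfrak h)\text{-Mod}^\Phi$) is a deformation quantization of the quasi-Poisson fusion of $(A,m_0,\{\,,\})$ (a $\mathfrak g\oplus\mathfrak h$-quasi-Poisson algebra). (3) If $(A,m_\hbar)$ is a deformation quantization of a $\mathfrak g\oplus\mathfrak h$-quasi-Poisson algebra $(A,m_0,\{\,,\})$ and $\mathfrak c\subset\mathfrak g$ is a coisotropic Lie subalgebra, then the algebra of $\mathfrak c$-invariants $A^{\mathfrak c}$, with the product induced by $m_\hbar$, is a deformation quantization of the $\mathfrak h$-quasi-Poisson algebra $A^{\mathfrak c}$ (with the product and bracket induced by $m_0$ and $\{\,,\}$).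
   Context: **Drinfeld category.** For a Lie algebra $\mathfrak a$ with a chosen $t\in(S^2\mathfrak a)^{\mathfrak a}$ and a Drinfeld associator $\Phi\in\mathbb C\langle\!\langle x,y\rangle\!\rangle$ (normalized so that $\Phi(x,y)=1+\frac1{24}[x,y]+\cdots$), $U\mathfrak a\text{-Mod}^\Phi$ is the braided monoidal category with the same objects and tensor products as $U\mathfrak a\text{-Mod}$, with $\mathrm{Hom}_{U\mathfrak a\text{-Mod}^\Phi}(X,Y)=\mathrm{Hom}_{U\mathfrak a\text{-Mod}}(X,Y)[\![\hbar]\!]$, with associativity constraint $(X\otimes Y)\otimes Z\to X\otimes(Y\otimes Z)$ given by the action of $\Phi(\hbar t^{1,2},\hbar t^{2,3})$, and with braiding $X\otimes Y\to Y\otimes X$ given by the action of $\exp(\hbar t^{1,2}/2)$ followed by the flip. Here $t^{i,j}$ is $t$ acting in the $i$-th and $j$-th tensor factors. Everything is over $\mathbb C$. An associative algebra in this category is an object $A$ with $m_\hbar\in\mathrm{Hom}_{U\mathfrak a}(A\otimes A,A)[\![\hbar]\!]$ satisfying $m_\hbar\circ(1\otimes m_\hbar)\circ(\Phi(\hbar t^{1,2},\hbar t^{2,3})\cdot)=m_\hbar\circ(m_\hbar\otimes1)$. A direct sum of Lie algebras with chosen elements carries the sum of the chosen elements. **Coisotropic.** A Lie subalgebra $\mathfrak c\subset\mathfrak a$ is coisotropic if the image of $t$ in $S^2(\mathfrak a/\mathfrak c)$ vanishes. **Quasi-Poisson algebras.** Put $\phi=\frac14[t^{1,2},t^{2,3}]\in\bigwedge^3\mathfrak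 a\subset\mathfrak a^{\otimes3}$. An $\mathfrak a$-quasi-Poisson algebra is an $\mathfrak a$-module $A$ with an $\mathfrak a$-invariant commutative associative product $m_0$ and an $\mathfrak a$-invariant skew-symmetric bilinear bracket $\{\,,\}:A\times A\to A$, a derivation in each argument, such that $\{a_1,\{a_2,a_3\}\}+\text{c.p.}=-m_0^{(3)}(\phi\cdot(a_1\otimes a_2\otimes a_3))$, where $m_0^{(3)}:A^{\otimes 3}\to A$ is the triple product and c.p. denotes cyclic permutations. It is quasi-Poisson-commutative if $\{\,,\}=0$ and $m_0\circ(t^{1,2}\cdot)=0$. **Deformation quantization.** A deformation quantization of an $\mathfrak a$-quasi-Poisson algebra $(A,m_0,\{\,,\})$ is a series $m_\hbar=\sum_{i\ge0}\hbar^im_{(i)}$ making $A$ an associative algebra in $U\mathfrak a\text{-Mod}^\Phi$, with $m_{(0)}=m_0$, $\{a,b\}=m_{(1)}(a\otimes b-b\otimes a)$, and every $m_{(i)}$ a bidifferential operator with respect to the commutative algebra $(A,m_0)$. **Reduction.** For a coisotropic $\mathfrak c\subset\mathfrak g$ and a $\mathfrak g\oplus\mathfrak h$-quasi-Poisson algebra $A$, the subspace $A^{\mathfrak c}$ with the restricted product and bracket is an $\mathfrak h$-quasi-Poisson algebra (known fact). For an associative algebra $A$ in $U(\mathfrak g\oplus\mathfrak h)\text{-Mod}^\Phi$, $A^{\mathfrak c}$ with the restricted product is an associative algebra in $U\mathfrak h\text{-Mod}^\Phi$. **Fusion.** Make every $\mathfrak g\oplus\mathfrak g\oplus\mathfrak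 h$-module a $\mathfrak g\oplus\mathfrak h$-module via $(u,v)\mapsto(u,u,v)$. With $t=t_{\mathfrak g}$, let $$J=(\Phi^{1,3,24})^{-1}\,\Phi^{3,2,4}\,e^{\hbar t^{2,3}/2}\,(\Phi^{2,3,4})^{-1}\,\Phi^{1,2,34}\in(U\mathfrak g)^{\otimes4}[\![\hbar]\!]=\bigl(U(\mathfrak g\oplus\mathfrak g)\bigr)^{\otimes2}[\![\hbar]\!],$$ where $\Phi^{I,K,L}$ is $\Phi(\hbar t^{1,2},\hbar t^{2,3})\in (U\mathfrak g)^{\otimes 3}[\![\hbar]\!]$ placed in the indicated tensor slots, a multi-index such as $34$ meaning that the iterated coproduct is applied; slots 1,2 (resp. 3,4) are the two copies of $\mathfrak g$ acting on the first (resp. second) tensor factor of $A\otimes A$. (Equivalently, in $U\mathfrak g\text{-Mod}^\Phi$ the composite $(X_1\otimes Y_1)\otimes(X_2\otimes Y_2)\to(X_1\otimes X_2)\otimes(Y_1\otimes Y_2)$ of associativity constraints with the braiding of $Y_1$ with $X_2$ is the action of $J$ followed by the flip of the two middle factors.) One has $J=1+\frac\hbar2t^{2,3}+O(\hbar^2)$. The quantum fusion of an associative algebra $(A,m_\hbar)$ in $U(\mathfrak g\oplus\mathfrak g\oplus\mathfrak h)\text{-Mod}^\Phi$ is $A$ with the product $m_\hbar\circ(J\cdot)$, an associative algebra in $U(\mathfrak g\oplus\mathfrak h)\text{-Mod}^\Phi$. The quasi-Poisson fusion of a $\mathfrak g\oplus\mathfrak g\oplus\mathfrak h$-quasi-Poisson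 algebra $(A,m_0,\{\,,\})$ is the $\mathfrak g\oplus\mathfrak h$-quasi-Poisson algebra $(A,m_0,\{\,,\}')$ with $\{a,b\}'=\{a,b\}+\frac12m_0(t^{2,3}\cdot(a\otimes b-b\otimes a))$, where $t^{2,3}$ means: first leg of $t$ acting on the first tensor factor through the second copy of $\mathfrak g$, second leg acting on the second tensor factor through the first copy of $\mathfrak g$. *)

theory Defs
  imports Complex_Main "HOL-Library.Poly_Mapping" "HOL-Library.Product_Plus"
begin

section \<open>Complex vector spaces and Lie algebras\<close>

class complex_vector = ab_group_add +
  fixes scaleC :: "complex \<Rightarrow> 'a \<Rightarrow> 'a"  (infixr "*\<^sub>C" 75)
  assumes scaleC_add_right: "a *\<^sub>C (x + y) = a *\<^sub>C x + a *\<^sub>C y"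
    and scaleC_add_left: "(a + b) *\<^sub>C x = a *\<^sub>C x + b *\<^sub>C x"
    and scaleC_scaleC: "a *\<^sub>C b *\<^sub>C x = (a * b) *\<^sub>C x"
    and scaleC_one: "1 *\<^sub>C x = x"

global_interpretation cvec: vector_space "scaleC :: complex \<Rightarrow> 'a \<Rightarrow> 'a::complex_vector"
  by unfold_locales (simp_all add: scaleC_add_right scaleC_add_left scaleC_scaleC scaleC_one)

instantiation complex :: complex_vector
begin
definition scaleC_complex :: "complex \<Rightarrow> complex \<Rightarrow> complex" where
  "scaleC_complex = (*)"
instance by standard (simp_all add: scaleC_complex_def algebra_simps)
end

instantiation prod :: (complex_vector, complex_vector) complex_vector
begin
definition scaleC_prod :: "complex \<Rightarrow> 'a \<times> 'b \<Rightarrow> 'a \<times> 'b" where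
  "scaleC_prod c p = (c *\<^sub>C fst p, c *\<^sub>C snd p)"
instance
  by standard (simp_all add: scaleC_prod_def scaleC_add_right scaleC_add_left
      scaleC_scaleC scaleC_one)
end

instantiation poly_mapping :: (type, complex_vector) complex_vector
begin
definition scaleC_poly_mapping :: "complex \<Rightarrow> ('a \<Rightarrow>\<^sub>0 'b) \<Rightarrow> ('a \<Rightarrow>\<^sub>0 'b)" where
  "scaleC_poly_mapping c F = Poly_Mapping.map (scaleC c) F"

lemma lookup_scaleC: "Poly_Mapping.lookup (c *\<^sub>C F) k = c *\<^sub>C Poly_Mapping.lookup F k"
  for F :: "'a \<Rightarrow>\<^sub>0 'b"
  by (simp add: scaleC_poly_mapping_def Poly_Mapping.map.rep_eq when_def)

instance
  by standard (auto intro!: poly_mapping_eqI simp: lookup_scaleC lookup_add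
      scaleC_add_right scaleC_add_left scaleC_scaleC scaleC_one)
end

class lie_algebra = complex_vector +
  fixes lie :: "'a \<Rightarrow> 'a \<Rightarrow> 'a"
  assumes lie_add_left: "lie (x + y) z = lie x z + lie y z"
    and lie_add_right: "lie x (y + z) = lie x y + lie x z"
    and lie_scaleC_left: "lie (c *\<^sub>C x) y = c *\<^sub>C lie x y"
    and lie_scaleC_right: "lie x (c *\<^sub>C y) = c *\<^sub>C lie x y"
    and lie_self: "lie x x = 0"
    and lie_jacobi: "lie x (lie y z) + lie y (lie z x) + lie z (lie x y) = 0"

instantiation prod :: (lie_algebra, lie_algebra) lie_algebra
begin
definition lie_prod :: "'a \<times> 'b \<Rightarrow> 'a \<times> 'b \<Rightarrow> 'a \<times> 'b" where
  "lie_prod p q = (lie (fst p) (fst q), lie (snd p) (snd q))"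
instance
  by standard (auto simp: lie_prod_def scaleC_prod_def zero_prod_def plus_prod_def lie_self
      lie_add_left lie_add_right lie_scaleC_left lie_scaleC_right lie_jacobi)
end

definition lie_subalgebra :: "'g::lie_algebra set \<Rightarrow> bool" where
  "lie_subalgebra \<cc> \<longleftrightarrow> cvec.subspace \<cc> \<and> (\<forall>x\<in>\<cc>. \<forall>y\<in>\<cc>. lie x y \<in> \<cc>)"

definition linear_on :: "'a::complex_vector set \<Rightarrow> ('a \<Rightarrow> 'b::complex_vector) \<Rightarrow> bool" where
  "linear_on V f \<longleftrightarrow> (\<forall>x\<in>V. \<forall>y\<in>V. f (x + y) = f x + f y) \<and> (\<forall>c. \<forall>x\<in>V. f (c *\<^sub>C x) = c *\<^sub>C f x)"

definition bilinear_on ::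
  "'a::complex_vector set \<Rightarrow> 'b::complex_vector set \<Rightarrow> ('a \<Rightarrow> 'b \<Rightarrow> 'c::complex_vector) \<Rightarrow> bool" where
  "bilinear_on V W f \<longleftrightarrow> (\<forall>w\<in>W. linear_on V (\<lambda>v. f v w)) \<and> (\<forall>v\<in>V. linear_on W (f v))"

text \<open>
  The underlying space of a module is a subspace of a type, so that spaces of invariants are
  again modules.
\<close>

definition lie_module :: "'a::complex_vector set \<Rightarrow> ('g::lie_algebra \<Rightarrow> 'a \<Rightarrow> 'a) \<Rightarrow> bool" where
  "lie_module A \<rho> \<longleftrightarrow> cvec.subspace A \<and> (\<forall>x. \<forall>a\<in>A. \<rho> x a \<in> A) \<and> bilinear_on UNIV A \<rho> \<and>
     (\<forall>x y. \<forall>a\<in>A. \<rho> (lie x y) a = \<rho> x (\<rho> y a) - \<rho> y (\<rho> x a))"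


section \<open>Tensors\<close>

text \<open>
  Tensors are represented by formal linear combinations: \<open>x \<otimes> y\<close> in \<open>V \<otimes> V\<close> is the basis vector
  \<open>(x, y)\<close>, and two representatives give the same tensor iff they differ by an element
  of \<open>tensor_null\<close>, the span of the bilinearity relations. The vector space structure
  on \<open>V\<close> is an explicit argument, so that \<open>V\<close> can be a quotient space whose elements are cosets.
\<close>

definition tensor_null ::
  "'v set \<Rightarrow> ('v \<Rightarrow> 'v \<Rightarrow> 'v) \<Rightarrow> (complex \<Rightarrow> 'v \<Rightarrow> 'v) \<Rightarrow> ('v \<times> 'v \<Rightarrow>\<^sub>0 complex) set" where
  "tensor_null V add scale = cvec.span (
     {Poly_Mapping.single (add u v, w) 1 - Poly_Mapping.single (u, w) 1 - Poly_Mapping.single (v, w) 1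
        | u v w. u \<in> V \<and> v \<in> V \<and> w \<in> V} \<union>
     {Poly_Mapping.single (w, add u v) 1 - Poly_Mapping.single (w, u) 1 - Poly_Mapping.single (w, v) 1
        | u v w. u \<in> V \<and> v \<in> V \<and> w \<in> V} \<union>
     {Poly_Mapping.single (scale c u, v) 1 - Poly_Mapping.single (u, v) c
        | c u v. u \<in> V \<and> v \<in> V} \<union>
     {Poly_Mapping.single (u, scale c v) 1 - Poly_Mapping.single (u, v) c
        | c u v. u \<in> V \<and> v \<in> V})"

text \<open>Linear extension of a map between the bases of two spaces of formal combinations:\<close>

definition push :: "('k \<Rightarrow> 'l) \<Rightarrow> ('k \<Rightarrow>\<^sub>0 complex) \<Rightarrow> ('l \<Rightarrow>\<^sub>0 complex)" where
  "push f F = (\<Sum>k\<in>Poly_Mapping.keys F. Poly_Mapping.single (f k) (Poly_Mapping.lookup F k))"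

definition tensor_eq ::
  "('v::complex_vector \<times> 'v \<Rightarrow>\<^sub>0 complex) \<Rightarrow> ('v \<times> 'v \<Rightarrow>\<^sub>0 complex) \<Rightarrow> bool" where
  "tensor_eq F G \<longleftrightarrow> F - G \<in> tensor_null UNIV (+) scaleC"

text \<open>\<open>t \<in> (S\<^sup>2\<aa>)\<^sup>\<aa>\<close>, where \<open>S\<^sup>2\<aa>\<close> is the space of symmetric tensors in \<open>\<aa> \<otimes> \<aa>\<close>:\<close>

definition invariant_symmetric :: "('g::lie_algebra \<times> 'g \<Rightarrow>\<^sub>0 complex) \<Rightarrow> bool" where
  "invariant_symmetric t \<longleftrightarrow>
     tensor_eq (push (\<lambda>(x, y). (y, x)) t) t \<and>
     (\<forall>z. tensor_eq (push (\<lambda>(x, y). (lie z x, y)) t + push (\<lambda>(x, y). (x, lie z y)) t) 0)"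

definition dsum ::
  "('g::lie_algebra \<times> 'g \<Rightarrow>\<^sub>0 complex) \<Rightarrow> ('h::lie_algebra \<times> 'h \<Rightarrow>\<^sub>0 complex)
    \<Rightarrow> (('g \<times> 'h) \<times> ('g \<times> 'h) \<Rightarrow>\<^sub>0 complex)"  (infixr "\<oplus>\<^sub>t" 65) where
  "t \<oplus>\<^sub>t s = push (\<lambda>(x, y). ((x, 0), (y, 0))) t + push (\<lambda>(u, v). ((0, u), (0, v))) s"

definition coset_of :: "'v::complex_vector set \<Rightarrow> 'v \<Rightarrow> 'v set" where
  "coset_of U x = {x + u | u. u \<in> U}"

text \<open>
  The representatives of zero in \<open>(V/U) \<otimes> (V/U)\<close>. The product \<open>r \<cdot> X\<close> of a scalar and a coset is
  \<open>r X + U\<close> rather than \<open>r X\<close> because of the case \<open>r = 0\<close>.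
\<close>

definition quotient_tensor_null ::
  "'v::complex_vector set \<Rightarrow> ('v set \<times> 'v set \<Rightarrow>\<^sub>0 complex) set" where
  "quotient_tensor_null U = tensor_null (range (coset_of U))
     (\<lambda>X Y. {x + y | x y. x \<in> X \<and> y \<in> Y}) (\<lambda>r X. {r *\<^sub>C x + u | x u. x \<in> X \<and> u \<in> U})"

definition coisotropic :: "('g::lie_algebra \<times> 'g \<Rightarrow>\<^sub>0 complex) \<Rightarrow> 'g set \<Rightarrow> bool" where
  "coisotropic t \<cc> \<longleftrightarrow> lie_subalgebra \<cc> \<and>
     push (\<lambda>(x, y). (coset_of \<cc> x, coset_of \<cc> y)) t \<in> quotient_tensor_null \<cc>"

text \<open>
  Tensors in \<open>A \<otimes> \<dots> \<otimes> A\<close> are represented likewise, with \<open>a\<^sub>1 \<otimes> \<dots> \<otimes> a\<^sub>n\<close> being the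
  basis vector \<open>[a\<^sub>1, \<dots>, a\<^sub>n]\<close>. Such tensors only ever occur as arguments of multilinear maps
  (evaluated by \<open>teval\<close>), so their equality need not be spelled out.
\<close>

abbreviation tensor :: "'k \<Rightarrow> ('k \<Rightarrow>\<^sub>0 complex)" where
  "tensor k \<equiv> Poly_Mapping.single k 1"

definition teval :: "('k \<Rightarrow> 'b::complex_vector) \<Rightarrow> ('k \<Rightarrow>\<^sub>0 complex) \<Rightarrow> 'b" where
  "teval f F = (\<Sum>k\<in>Poly_Mapping.keys F. Poly_Mapping.lookup F k *\<^sub>C f k)"

text \<open>Action of \<open>f\<close> on the \<open>i\<close>-th tensor factor, factors being counted from 1:\<close>

definition at_factor :: "nat \<Rightarrow> ('a \<Rightarrow> 'a) \<Rightarrow> ('a list \<Rightarrow>\<^sub>0 complex) \<Rightarrow> ('a list \<Rightarrow>\<^sub>0 complex)" where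
  "at_factor i f = push (\<lambda>as. as[i - 1 := f (as ! (i - 1))])"

definition module_slots ::
  "('g \<Rightarrow> 'a \<Rightarrow> 'a) \<Rightarrow> nat \<Rightarrow> 'g \<Rightarrow> ('a list \<Rightarrow>\<^sub>0 complex) \<Rightarrow> ('a list \<Rightarrow>\<^sub>0 complex)" where
  "module_slots \<rho> i x = at_factor i (\<rho> x)"

text \<open>
  The action of \<open>t\<^bsup>I,K\<^esup>\<close>, where \<open>\<sigma> i x\<close> is the action of \<open>x \<in> \<gg>\<close> placed in slot \<open>i\<close>. The
  iterated coproduct spreads \<open>x\<close> over the slots in \<open>I\<close> as the sum of its placements in each of them.
\<close>

definition t_action ::
  "('g \<times> 'g \<Rightarrow>\<^sub>0 complex) \<Rightarrow> (nat \<Rightarrow> 'g \<Rightarrow> 'v \<Rightarrow> 'v) \<Rightarrow> nat set \<Rightarrow> nat set \<Rightarrow> 'v \<Rightarrow> 'v::complex_vector" where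
  "t_action t \<sigma> I K v = (\<Sum>i\<in>I. \<Sum>k\<in>K. teval (\<lambda>(x, y). \<sigma> i x (\<sigma> k y v)) t)"


section \<open>Noncommutative power series and their evaluation\<close>

datatype letter = Lx | Ly

text \<open>An element of \<open>\<complex>\<langle>\<langle>x,y\<rangle>\<rangle>\<close> is given by its coefficients.\<close>

type_synonym ncseries = "letter list \<Rightarrow> complex"

definition nc_one :: ncseries where
  "nc_one w = (if w = [] then 1 else 0)"

definition nc_mult :: "ncseries \<Rightarrow> ncseries \<Rightarrow> ncseries" where
  "nc_mult f g w = (\<Sum>k\<le>length w. f (take k w) * g (drop k w))"

definition nc_inverse :: "ncseries \<Rightarrow> ncseries" where
  "nc_inverse f = (THE g. nc_mult f g = nc_one \<and> nc_mult g f = nc_one)"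

text \<open>
  Group-like with respect to the continuous coproduct for which \<open>x\<close> and \<open>y\<close> are primitive: the
  right-hand side is the coefficient of \<open>u \<otimes> v\<close> in \<open>\<Delta>(f)\<close>, since \<open>\<Delta>(w)\<close> is the
  sum of \<open>w|\<^sub>S \<otimes> w|\<^sub>-\<^sub>S\<close> over all sets \<open>S\<close> of positions in \<open>w\<close>.
\<close>

definition group_like :: "ncseries \<Rightarrow> bool" where
  "group_like f \<longleftrightarrow> f [] = 1 \<and>
     (\<forall>u v. f u * f v = (\<Sum>w | length w = length u + length v.
        of_nat (card {S. S \<subseteq> {..<length w} \<and> nths w S = u \<and> nths w (- S) = v}) * f w))"

text \<open>Power series in \<open>\<hbar>\<close> of operators; the value at \<open>n\<close> is the coefficient of \<open>\<hbar>\<^sup>n\<close>.\<close>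

type_synonym 'v opseries = "nat \<Rightarrow> 'v \<Rightarrow> 'v"

definition op_mult :: "'v::complex_vector opseries \<Rightarrow> 'v opseries \<Rightarrow> 'v opseries"  (infixr "\<star>" 70) where
  "(P \<star> Q) n v = (\<Sum>i\<le>n. P i (Q (n - i) v))"

primrec word_op :: "('v \<Rightarrow> 'v) \<Rightarrow> ('v \<Rightarrow> 'v) \<Rightarrow> letter list \<Rightarrow> 'v \<Rightarrow> 'v" where
  "word_op P Q [] = id"
| "word_op P Q (l # w) = (case l of Lx \<Rightarrow> P | Ly \<Rightarrow> Q) \<circ> word_op P Q w"

text \<open>\<open>f(\<hbar>P, \<hbar>Q)\<close> and \<open>exp(\<hbar>P/2)\<close>:\<close>

definition nc_eval :: "ncseries \<Rightarrow> ('v \<Rightarrow> 'v) \<Rightarrow> ('v \<Rightarrow> 'v) \<Rightarrow> 'v::complex_vector opseries" where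
  "nc_eval f P Q n v = (\<Sum>w | length w = n. f w *\<^sub>C word_op P Q w v)"

definition exp_half :: "('v \<Rightarrow> 'v) \<Rightarrow> 'v::complex_vector opseries" where
  "exp_half P n v = (1 / (2 ^ n * fact n)) *\<^sub>C (P ^^ n) v"

text \<open>\<open>f\<^bsup>I,K,L\<^esup>\<close>, where \<open>\<tau> I K\<close> is the operator \<open>t\<^bsup>I,K\<^esup>\<close>:\<close>

definition placed ::
  "ncseries \<Rightarrow> (nat set \<Rightarrow> nat set \<Rightarrow> 'v \<Rightarrow> 'v) \<Rightarrow> nat set \<Rightarrow> nat set \<Rightarrow> nat set
    \<Rightarrow> 'v::complex_vector opseries" where
  "placed f \<tau> I K L = nc_eval f (\<tau> I K) (\<tau> K L)"


section \<open>Drinfeld associators\<close>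

text \<open>
  The free algebra on generators \<open>t\<^sup>i\<^sup>j = t\<^sup>j\<^sup>i\<close>, labelled by the sets \<open>{i, j}\<close>, has the words in them
  as a basis. The ideal below is generated by the infinitesimal braid relations on \<open>n\<close>
  strands; the quotient is the enveloping algebra of the Drinfeld-Kohno Lie algebra.
\<close>

definition braid_relations :: "nat \<Rightarrow> (nat set list \<Rightarrow>\<^sub>0 complex) set" where
  "braid_relations n =
     {tensor [{i, j}, {k, l}] - tensor [{k, l}, {i, j}]
        | i j k l. {i, j, k, l} \<subseteq> {1..n} \<and> distinct [i, j, k, l]} \<union>
     {(tensor [{i, j}, {i, k}] + tensor [{i, j}, {j, k}]) - (tensor [{i, k}, {i, j}] + tensor [{j, k}, {i, j}])
        | i j k. {i, j, k} \<subseteq> {1..n} \<and> distinct [i, j, k]}"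

definition braid_generators :: "nat \<Rightarrow> nat set set" where
  "braid_generators n = {{i, j} | i j. {i, j} \<subseteq> {1..n} \<and> i \<noteq> j}"

definition braid_ideal :: "nat \<Rightarrow> (nat set list \<Rightarrow>\<^sub>0 complex) set" where
  "braid_ideal n = cvec.span
     {push (\<lambda>w. u @ w @ v) r | r u v. r \<in> braid_relations n \<and>
        u \<in> lists (braid_generators n) \<and> v \<in> lists (braid_generators n)}"

text \<open>Left multiplication by \<open>t\<^bsup>I,K\<^esup>\<close> in the free algebra:\<close>

definition braid_t ::
  "nat set \<Rightarrow> nat set \<Rightarrow> (nat set list \<Rightarrow>\<^sub>0 complex) \<Rightarrow> (nat set list \<Rightarrow>\<^sub>0 complex)" where
  "braid_t I K F = (\<Sum>i\<in>I. \<Sum>k\<in>K. push ((#) {i, k}) F)"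

text \<open>
  Equality in the degree completion of the quotient algebra. The relations are homogeneous, so
  it may be checked degree by degree; elements are recovered from left multiplications by
  applying these to the unit \<open>[]\<close>.
\<close>

definition braid_eq ::
  "nat \<Rightarrow> (nat set list \<Rightarrow>\<^sub>0 complex) opseries \<Rightarrow> (nat set list \<Rightarrow>\<^sub>0 complex) opseries \<Rightarrow> bool" where
  "braid_eq n P Q \<longleftrightarrow> (\<forall>d. P d (tensor []) - Q d (tensor []) \<in> braid_ideal n)"

definition pentagon :: "ncseries \<Rightarrow> bool" where
  "pentagon \<Phi> \<longleftrightarrow> braid_eq 4
     (placed \<Phi> braid_t {1} {2} {3, 4} \<star> placed \<Phi> braid_t {1, 2} {3} {4})
     (placed \<Phi> braid_t {2} {3} {4} \<star> placed \<Phi> braid_t {1} {2, 3} {4} \<star> placed \<Phi> braid_t {1} {2} {3})"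

text \<open>
  The hexagon axioms for the associativity constraint \<open>\<Phi>\<close> from \<open>(X \<otimes> Y) \<otimes> Z\<close> to
  \<open>X \<otimes> (Y \<otimes> Z)\<close> and the braiding \<open>flip \<circ> exp(\<hbar>t\<^sup>1\<^sup>2/2)\<close>, with all flips moved to the left.
\<close>

definition hexagons :: "ncseries \<Rightarrow> bool" where
  "hexagons \<Phi> \<longleftrightarrow>
     braid_eq 3
       (placed \<Phi> braid_t {2} {3} {1} \<star> exp_half (braid_t {1} {2, 3}) \<star> placed \<Phi> braid_t {1} {2} {3})
       (exp_half (braid_t {1} {3}) \<star> placed \<Phi> braid_t {2} {1} {3} \<star> exp_half (braid_t {1} {2})) \<and>
     braid_eq 3
       (placed (nc_inverse \<Phi>) braid_t {3} {1} {2} \<star> exp_half (braid_t {1, 2} {3})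
          \<star> placed (nc_inverse \<Phi>) braid_t {1} {2} {3})
       (exp_half (braid_t {1} {3}) \<star> placed (nc_inverse \<Phi>) braid_t {1} {3} {2}
          \<star> exp_half (braid_t {2} {3}))"

text \<open>The conditions on coefficients say \<open>\<Phi>(x,y) = 1 + 1/24 [x,y] + \<dots>\<close> up to degree two.\<close>

definition drinfeld_associator :: "ncseries \<Rightarrow> bool" where
  "drinfeld_associator \<Phi> \<longleftrightarrow> group_like \<Phi> \<and> pentagon \<Phi> \<and> hexagons \<Phi> \<and>
     \<Phi> [Lx] = 0 \<and> \<Phi> [Ly] = 0 \<and> \<Phi> [Lx, Lx] = 0 \<and> \<Phi> [Ly, Ly] = 0 \<and>
     \<Phi> [Lx, Ly] = 1 / 24 \<and> \<Phi> [Ly, Lx] = - 1 / 24"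


section \<open>Algebras in the Drinfeld category\<close>

definition invariant_bilinear ::
  "'a::complex_vector set \<Rightarrow> ('g::lie_algebra \<Rightarrow> 'a \<Rightarrow> 'a) \<Rightarrow> ('a \<Rightarrow> 'a \<Rightarrow> 'a) \<Rightarrow> bool" where
  "invariant_bilinear A \<rho> m \<longleftrightarrow> bilinear_on A A m \<and> (\<forall>a\<in>A. \<forall>b\<in>A. m a b \<in> A) \<and>
     (\<forall>x. \<forall>a\<in>A. \<forall>b\<in>A. \<rho> x (m a b) = m (\<rho> x a) b + m a (\<rho> x b))"

text \<open>
  \<open>m i\<close> is the coefficient of \<open>\<hbar>\<^sup>i\<close> in \<open>m\<^sub>\<hbar>\<close>. A \<open>U\<gg>\<close>-linear map from \<open>A \<otimes> A\<close> to \<open>A\<close> is an invariant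
  bilinear map.
\<close>

definition assoc_algebra ::
  "ncseries \<Rightarrow> ('g::lie_algebra \<times> 'g \<Rightarrow>\<^sub>0 complex) \<Rightarrow> 'a::complex_vector set \<Rightarrow> ('g \<Rightarrow> 'a \<Rightarrow> 'a)
    \<Rightarrow> (nat \<Rightarrow> 'a \<Rightarrow> 'a \<Rightarrow> 'a) \<Rightarrow> bool" where
  "assoc_algebra \<Phi> t A \<rho> m \<longleftrightarrow> lie_module A \<rho> \<and> (\<forall>i. invariant_bilinear A \<rho> (m i)) \<and>
     (\<forall>n. \<forall>a\<in>A. \<forall>b\<in>A. \<forall>c\<in>A.
        (\<Sum>(i, j, k) | i + j + k = n.
           teval (\<lambda>as. m i (as ! 0) (m j (as ! 1) (as ! 2)))
             (placed \<Phi> (t_action t (module_slots \<rho>)) {1} {2} {3} k (tensor [a, b, c])))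
        = (\<Sum>(i, j) | i + j = n. m i (m j a b) c))"


section \<open>Quasi-Poisson algebras\<close>

definition phi_action ::
  "('g::lie_algebra \<times> 'g \<Rightarrow>\<^sub>0 complex) \<Rightarrow> ('g \<Rightarrow> 'a \<Rightarrow> 'a) \<Rightarrow> ('a list \<Rightarrow>\<^sub>0 complex)
    \<Rightarrow> ('a list \<Rightarrow>\<^sub>0 complex)" where
  "phi_action t \<rho> F = (let \<tau> = t_action t (module_slots \<rho>) in
     (1 / 4) *\<^sub>C (\<tau> {1} {2} (\<tau> {2} {3} F) - \<tau> {2} {3} (\<tau> {1} {2} F)))"

definition quasi_poisson ::
  "('g::lie_algebra \<times> 'g \<Rightarrow>\<^sub>0 complex) \<Rightarrow> 'a::complex_vector set \<Rightarrow> ('g \<Rightarrow> 'a \<Rightarrow> 'a)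
    \<Rightarrow> ('a \<Rightarrow> 'a \<Rightarrow> 'a) \<Rightarrow> ('a \<Rightarrow> 'a \<Rightarrow> 'a) \<Rightarrow> bool" where
  "quasi_poisson t A \<rho> m0 br \<longleftrightarrow> lie_module A \<rho> \<and>
     invariant_bilinear A \<rho> m0 \<and>
     (\<forall>a\<in>A. \<forall>b\<in>A. m0 a b = m0 b a) \<and>
     (\<forall>a\<in>A. \<forall>b\<in>A. \<forall>c\<in>A. m0 (m0 a b) c = m0 a (m0 b c)) \<and>
     invariant_bilinear A \<rho> br \<and>
     (\<forall>a\<in>A. \<forall>b\<in>A. br a b = - br b a) \<and>
     (\<forall>a\<in>A. \<forall>b\<in>A. \<forall>c\<in>A. br a (m0 b c) = m0 (br a b) c + m0 b (br a c)) \<and>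
     (\<forall>a\<in>A. \<forall>b\<in>A. \<forall>c\<in>A. br (m0 a b) c = m0 a (br b c) + m0 (br a c) b) \<and>
     (\<forall>a\<in>A. \<forall>b\<in>A. \<forall>c\<in>A. br a (br b c) + br b (br c a) + br c (br a b) =
        - teval (\<lambda>as. m0 (m0 (as ! 0) (as ! 1)) (as ! 2)) (phi_action t \<rho> (tensor [a, b, c])))"

definition quasi_poisson_commutative ::
  "('g::lie_algebra \<times> 'g \<Rightarrow>\<^sub>0 complex) \<Rightarrow> 'a::complex_vector set \<Rightarrow> ('g \<Rightarrow> 'a \<Rightarrow> 'a)
    \<Rightarrow> ('a \<Rightarrow> 'a \<Rightarrow> 'a) \<Rightarrow> ('a \<Rightarrow> 'a \<Rightarrow> 'a) \<Rightarrow> bool" where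
  "quasi_poisson_commutative t A \<rho> m0 br \<longleftrightarrow> quasi_poisson t A \<rho> m0 br \<and>
     (\<forall>a\<in>A. \<forall>b\<in>A. br a b = 0) \<and>
     (\<forall>a\<in>A. \<forall>b\<in>A. teval (\<lambda>as. m0 (as ! 0) (as ! 1))
        (t_action t (module_slots \<rho>) {1} {2} (tensor [a, b])) = 0)"


section \<open>Deformation quantization\<close>

text \<open>
  Differential operators in the sense of Grothendieck, for bilinear maps over the commutative
  algebra \<open>(A, m0)\<close>: \<open>bidiff_below A m0 n D\<close> says that \<open>D\<close> has total order less than \<open>n\<close>.
\<close>

primrec bidiff_below ::
  "'a::complex_vector set \<Rightarrow> ('a \<Rightarrow> 'a \<Rightarrow> 'a) \<Rightarrow> nat \<Rightarrow> ('a \<Rightarrow> 'a \<Rightarrow> 'a) \<Rightarrow> bool" where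
  "bidiff_below A m0 0 D \<longleftrightarrow> (\<forall>a\<in>A. \<forall>b\<in>A. D a b = 0)"
| "bidiff_below A m0 (Suc n) D \<longleftrightarrow> (\<forall>c\<in>A.
     bidiff_below A m0 n (\<lambda>a b. D (m0 c a) b - m0 c (D a b)) \<and>
     bidiff_below A m0 n (\<lambda>a b. D a (m0 c b) - m0 c (D a b)))"

definition bidifferential ::
  "'a::complex_vector set \<Rightarrow> ('a \<Rightarrow> 'a \<Rightarrow> 'a) \<Rightarrow> ('a \<Rightarrow> 'a \<Rightarrow> 'a) \<Rightarrow> bool" where
  "bidifferential A m0 D \<longleftrightarrow> bilinear_on A A D \<and> (\<forall>a\<in>A. \<forall>b\<in>A. D a b \<in> A) \<and>
     (\<exists>n. bidiff_below A m0 n D)"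

definition deformation_quantization ::
  "ncseries \<Rightarrow> ('g::lie_algebra \<times> 'g \<Rightarrow>\<^sub>0 complex) \<Rightarrow> 'a::complex_vector set \<Rightarrow> ('g \<Rightarrow> 'a \<Rightarrow> 'a)
    \<Rightarrow> ('a \<Rightarrow> 'a \<Rightarrow> 'a) \<Rightarrow> ('a \<Rightarrow> 'a \<Rightarrow> 'a) \<Rightarrow> (nat \<Rightarrow> 'a \<Rightarrow> 'a \<Rightarrow> 'a) \<Rightarrow> bool" where
  "deformation_quantization \<Phi> t A \<rho> m0 br m \<longleftrightarrow>
     quasi_poisson t A \<rho> m0 br \<and> assoc_algebra \<Phi> t A \<rho> m \<and>
     (\<forall>a\<in>A. \<forall>b\<in>A. m 0 a b = m0 a b) \<and>
     (\<forall>a\<in>A. \<forall>b\<in>A. br a b = m 1 a b - m 1 b a) \<and>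
     (\<forall>i. bidifferential A m0 (m i))"

definition constant_series :: "('a \<Rightarrow> 'a \<Rightarrow> 'a) \<Rightarrow> nat \<Rightarrow> 'a::complex_vector \<Rightarrow> 'a \<Rightarrow> 'a" where
  "constant_series m0 i = (if i = 0 then m0 else (\<lambda>a b. 0))"


section \<open>Fusion and reduction\<close>

definition diagonal_action :: "('g \<times> 'g \<times> 'h \<Rightarrow> 'a \<Rightarrow> 'a) \<Rightarrow> 'g \<times> 'h \<Rightarrow> 'a \<Rightarrow> 'a" where
  "diagonal_action \<rho> = (\<lambda>(u, v). \<rho> (u, u, v))"

text \<open>
  The four slots of \<open>(U(\<gg> \<oplus> \<gg>))\<^bsup>\<otimes>2\<^esup> = (U\<gg>)\<^bsup>\<otimes>4\<^esup>\<close> acting on \<open>A \<otimes> A\<close>.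
\<close>

definition fusion_slots ::
  "('g::lie_algebra \<times> 'g \<times> 'h::lie_algebra \<Rightarrow> 'a \<Rightarrow> 'a) \<Rightarrow> nat \<Rightarrow> 'g
    \<Rightarrow> ('a list \<Rightarrow>\<^sub>0 complex) \<Rightarrow> ('a list \<Rightarrow>\<^sub>0 complex)" where
  "fusion_slots \<rho> s x =
     (if s = 1 then at_factor 1 (\<rho> (x, 0, 0))
      else if s = 2 then at_factor 1 (\<rho> (0, x, 0))
      else if s = 3 then at_factor 2 (\<rho> (x, 0, 0))
      else at_factor 2 (\<rho> (0, x, 0)))"

definition fusion_J ::
  "ncseries \<Rightarrow> ('g::lie_algebra \<times> 'g \<Rightarrow>\<^sub>0 complex) \<Rightarrow> ('g \<times> 'g \<times> 'h::lie_algebra \<Rightarrow> 'a \<Rightarrow> 'a)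
    \<Rightarrow> ('a list \<Rightarrow>\<^sub>0 complex) opseries" where
  "fusion_J \<Phi> t \<rho> = (let \<tau> = t_action t (fusion_slots \<rho>) in
     placed (nc_inverse \<Phi>) \<tau> {1} {3} {2, 4} \<star> placed \<Phi> \<tau> {3} {2} {4} \<star> exp_half (\<tau> {2} {3})
       \<star> placed (nc_inverse \<Phi>) \<tau> {2} {3} {4} \<star> placed \<Phi> \<tau> {1} {2} {3, 4})"

definition fusion_product ::
  "ncseries \<Rightarrow> ('g::lie_algebra \<times> 'g \<Rightarrow>\<^sub>0 complex) \<Rightarrow> ('g \<times> 'g \<times> 'h::lie_algebra \<Rightarrow> 'a \<Rightarrow> 'a)
    \<Rightarrow> (nat \<Rightarrow> 'a::complex_vector \<Rightarrow> 'a \<Rightarrow> 'a) \<Rightarrow> nat \<Rightarrow> 'a \<Rightarrow> 'a \<Rightarrow> 'a" where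
  "fusion_product \<Phi> t \<rho> m n a b =
     (\<Sum>i\<le>n. teval (\<lambda>as. m i (as ! 0) (as ! 1)) (fusion_J \<Phi> t \<rho> (n - i) (tensor [a, b])))"

definition fusion_bracket ::
  "('g::lie_algebra \<times> 'g \<Rightarrow>\<^sub>0 complex) \<Rightarrow> ('g \<times> 'g \<times> 'h::lie_algebra \<Rightarrow> 'a \<Rightarrow> 'a)
    \<Rightarrow> ('a::complex_vector \<Rightarrow> 'a \<Rightarrow> 'a) \<Rightarrow> ('a \<Rightarrow> 'a \<Rightarrow> 'a) \<Rightarrow> 'a \<Rightarrow> 'a \<Rightarrow> 'a" where
  "fusion_bracket t \<rho> m0 br a b = br a b + (1 / 2) *\<^sub>C
     teval (\<lambda>as. m0 (as ! 0) (as ! 1))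
       (t_action t (fusion_slots \<rho>) {2} {3} (tensor [a, b] - tensor [b, a]))"

definition invariants ::
  "'g::lie_algebra set \<Rightarrow> 'a::complex_vector set \<Rightarrow> ('g \<times> 'h::lie_algebra \<Rightarrow> 'a \<Rightarrow> 'a) \<Rightarrow> 'a set" where
  "invariants \<cc> A \<rho> = {a \<in> A. \<forall>x\<in>\<cc>. \<rho> (x, 0) a = 0}"

end

theory Submission
  imports Defs "HOL-Computational_Algebra.Formal_Power_Series"
begin

text \<open>
  The quasi-Poisson axioms can be read off from associativity of \<open>m\<^sub>\<hbar>\<close> modulo \<open>\<hbar>\<^sup>3\<close>, since \<open>\<Phi>\<close> is known
  up to degree two. So only associativity, the terms of degree at most one and the
  bidifferential property have to be checked in each part.

  For fusion, associativity amounts to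
  \<open>\<Phi>\<^bsup>1,3,5\<^esup> \<Phi>\<^bsup>2,4,6\<^esup> J\<^bsup>13,24,5,6\<^esup> J\<^bsup>1,2,3,4\<^esup> = J\<^bsup>1,2,35,46\<^esup> J\<^bsup>3,4,5,6\<^esup> \<Phi>\<^bsup>12,34,56\<^esup>\<close>, which follows from the
  pentagon and hexagon axioms in the completed algebra of infinitesimal braids and is transported to
  the tensor cube of \<open>A\<close>, where each factor carries two strands for \<open>\<gg>\<close>. The associator of the sum
  \<open>\<gg> \<oplus> \<gg> \<oplus> \<hh>\<close> is the product of those of the summands because \<open>\<Phi>\<close> is group-like. If \<open>A\<close> is
  quasi-Poisson-commutative, the product kills all terms of \<open>\<Phi>\<close> of positive degree, as each
  begins with \<open>t\<^bsup>1,2\<^esup>\<close> or \<open>t\<^bsup>2,3\<^esup>\<close>. For coisotropic \<open>\<cc>\<close>, \<open>t\<^bsup>i,j\<^esup>\<close> for \<open>\<gg>\<close> acts by zero on tensors of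
  \<open>\<cc>\<close>-invariants.
\<close>

text \<open>Tensors are formal combinations, so operators on the tensor cube of \<open>A\<close>
  satisfy the braid relations only modulo null combinations, and only on a subspace of a type.
  Identities between long products are therefore proved where equality is strict: in an algebra of
  chords on arbitrarily many strands, as equations of power series in \<open>\<hbar>\<close>. The
  relation \<open>represents\<close> carries them back to operators. The axioms of
  \<open>\<Phi>\<close> concern three or four single strands, while fusion uses them for bundles of
  strands; replacing strands by disjoint blocks respects the infinitesimal braid relations, so the
  axioms hold for blocks as well. What remains of coherence is a word calculation in a monoid. The
  number 1/4 in \<open>\<phi>\<close> stems from the coefficient 1/24 of \<open>\<Phi>\<close>.
  Alternating the second-order associativity equation over the six permutations of the arguments
  cancels the second-order product, turns the first-order product into the Jacobi sum, and yields
  6/24 times the commutator of \<open>t^{1,2}\<close> and \<open>t^{2,3}\<close>, because this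
  commutator is antisymmetric.\<close>

unbundle fps_syntax

section \<open>Evaluation of noncommutative power series\<close>

class complex_algebra = complex_vector + ring_1 +
  assumes mult_scaleC_left: "(c *\<^sub>C x) * y = c *\<^sub>C (x * y)"
    and mult_scaleC_right: "x * (c *\<^sub>C y) = c *\<^sub>C (x * y)"

definition word_prod :: "'r::monoid_mult \<Rightarrow> 'r \<Rightarrow> letter list \<Rightarrow> 'r" where
  "word_prod p q w = prod_list (map (\<lambda>l. case l of Lx \<Rightarrow> p | Ly \<Rightarrow> q) w)"

text \<open>This is \<open>f(\<hbar>p, \<hbar>q)\<close>. Grading by word length makes every
  coefficient a finite sum, so the algebra itself is not completed.\<close>

definition nc_series :: "ncseries \<Rightarrow> 'r::complex_algebra \<Rightarrow> 'r \<Rightarrow> 'r fps" where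
  "nc_series f p q = Abs_fps (\<lambda>n. \<Sum>w | length w = n. f w *\<^sub>C word_prod p q w)"

definition exp_half_series :: "'r::complex_algebra \<Rightarrow> 'r fps" where
  "exp_half_series p = Abs_fps (\<lambda>n. (1 / (2 ^ n * fact n)) *\<^sub>C p ^ n)"

lemma UNIV_letter: "(UNIV :: letter set) = {Lx, Ly}"
  using letter.exhaust by auto

lemma finite_words [simp]: "finite {w :: letter list. length w = n}"
proof -
  have "finite (UNIV :: letter set)" by (simp add: UNIV_letter)
  from finite_lists_length_eq[OF this] show ?thesis by simp
qed

lemma words_0: "{w :: letter list. length w = 0} = {[]}"
  by auto

lemma words_Suc: "{w :: letter list. length w = Suc n} = (#) Lx ` {w. length w = n} \<union> (#) Ly ` {w. length w = n}"
proof -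
  have "w \<in> (#) Lx ` {w. length w = n} \<union> (#) Ly ` {w. length w = n}" if "length w = Suc n" for w :: "letter list"
  proof (cases w)
    case (Cons l u)
    then show ?thesis using that by (cases l) auto
  qed (use that in simp)
  then show ?thesis by auto
qed

lemma sum_words_Suc:
  "(\<Sum>w | length w = Suc n. F w) = (\<Sum>w | length w = n. F (Lx # w)) + (\<Sum>w | length w = n. F (Ly # w))"
  for F :: "letter list \<Rightarrow> 'b::comm_monoid_add"
  unfolding words_Suc by (subst sum.union_disjoint) (auto simp: sum.reindex)

lemma sum_words_split:
  "k \<le> n \<Longrightarrow> (\<Sum>w | length w = n. F (take k w) (drop k w)) = (\<Sum>u | length u = k. \<Sum>v | length v = n - k. F u v)"
  for F :: "letter list \<Rightarrow> letter list \<Rightarrow> 'b::comm_monoid_add"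
  unfolding sum.cartesian_product
  by (rule sum.reindex_bij_witness[where i = "\<lambda>(u, v). u @ v" and j = "\<lambda>w. (take k w, drop k w)"]) auto

lemma word_prod_simps [simp]:
  "word_prod p q [] = 1"
  "word_prod p q (Lx # w) = p * word_prod p q w"
  "word_prod p q (Ly # w) = q * word_prod p q w"
  "word_prod p q (u @ v) = word_prod p q u * word_prod p q v"
  by (simp_all add: word_prod_def)

text \<open>A word of length \<open>n\<close> arises once for each cut into a prefix of length
  \<open>k\<close> and a suffix; this matches convolution of coefficients of \<open>\<hbar>\<close>
  with convolution over words.\<close>

lemma nc_series_mult: "nc_series f p q * nc_series g p q = nc_series (nc_mult f g) p q"
proof (rule fps_ext)
  fix n
  have "(nc_series f p q * nc_series g p q) $ n =
      (\<Sum>k=0..n. \<Sum>u | length u = k. \<Sum>v | length v = n - k. (f u * g v) *\<^sub>C (word_prod p q (u @ v)))"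
    by (simp add: fps_mult_nth nc_series_def sum_product mult_scaleC_left mult_scaleC_right scaleC_scaleC
        mult.commute[where 'a = complex])
  also have "\<dots> = (\<Sum>k=0..n. \<Sum>w | length w = n. (f (take k w) * g (drop k w)) *\<^sub>C (word_prod p q w))"
  proof (rule sum.cong[OF refl])
    fix k assume "k \<in> {0..n}"
    then show "(\<Sum>u | length u = k. \<Sum>v | length v = n - k. (f u * g v) *\<^sub>C (word_prod p q (u @ v)))
        = (\<Sum>w | length w = n. (f (take k w) * g (drop k w)) *\<^sub>C (word_prod p q w))"
      using sum_words_split[of k n "\<lambda>u v. (f u * g v) *\<^sub>C (word_prod p q (u @ v))"]
      by (simp del: word_prod_simps)
  qed
  also have "\<dots> = (\<Sum>w | length w = n. nc_mult f g w *\<^sub>C word_prod p q w)"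
    by (subst sum.swap) (simp add: nc_mult_def cvec.scale_sum_left atLeast0AtMost)
  finally show "(nc_series f p q * nc_series g p q) $ n = nc_series (nc_mult f g) p q $ n"
    by (simp add: nc_series_def)
qed

lemma nc_series_one: "nc_series nc_one p q = 1"
proof (rule fps_ext)
  fix n
  have "(\<Sum>w | length w = n. nc_one w *\<^sub>C word_prod p q w) = (\<Sum>w\<in>(if n = 0 then {[]} else {}). word_prod p q w)"
    by (rule sum.mono_neutral_cong_right) (auto simp: nc_one_def scaleC_one split: if_splits)
  then show "nc_series nc_one p q $ n = 1 $ n"
    by (simp add: nc_series_def)
qed

section \<open>The monoid of noncommutative series and its inverses\<close>

lemma nc_mult_one_left: "nc_mult nc_one f = f"
proof
  fix w
  have "nc_mult nc_one f w = (\<Sum>k\<in>{0}. nc_one (take k w) * f (drop k w))"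
    unfolding nc_mult_def by (rule sum.mono_neutral_right) (auto simp: nc_one_def)
  then show "nc_mult nc_one f w = f w" by (simp add: nc_one_def)
qed

lemma nc_mult_one_right: "nc_mult f nc_one = f"
proof
  fix w
  have "nc_mult f nc_one w = (\<Sum>k\<in>{length w}. f (take k w) * nc_one (drop k w))"
    unfolding nc_mult_def by (rule sum.mono_neutral_right) (auto simp: nc_one_def)
  then show "nc_mult f nc_one w = f w" by (simp add: nc_one_def)
qed

lemma nc_mult_assoc: "nc_mult (nc_mult f g) h = nc_mult f (nc_mult g h)"
proof
  fix w
  have "nc_mult (nc_mult f g) h w
      = (\<Sum>k\<le>length w. \<Sum>j\<le>k. f (take j w) * g (take (k - j) (drop j w)) * h (drop k w))"
    unfolding nc_mult_def sum_distrib_right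
    by (intro sum.cong refl) (auto simp: min_absorb1 min_absorb2 drop_take)
  also have "\<dots> = (\<Sum>j\<le>length w. \<Sum>i\<le>length w - j. f (take j w) * g (take i (drop j w)) * h (drop (i + j) w))"
    unfolding sum.Sigma[OF finite_atMost ballI[OF finite_atMost]]
    by (rule sum.reindex_bij_witness[where i = "\<lambda>(j, i). (i + j, j)" and j = "\<lambda>(k, j). (j, k - j)"]) auto
  also have "\<dots> = nc_mult f (nc_mult g h) w"
    by (simp add: nc_mult_def sum_distrib_left mult.assoc)
  finally show "nc_mult (nc_mult f g) h w = nc_mult f (nc_mult g h) w" .
qed

text \<open>The equation \<open>nc_mult f g = nc_one\<close> with \<open>f [] = 1\<close>, solved
  for the coefficient of \<open>g\<close> at \<open>w\<close>: the sum starts at 1, so only proper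
  suffixes occur and the recursion ends.\<close>

function nc_right_inverse :: "ncseries \<Rightarrow> ncseries" where
  "nc_right_inverse f w =
     (if w = [] then 1 else - (\<Sum>k\<in>{1..length w}. f (take k w) * nc_right_inverse f (drop k w)))"
  by auto
termination by (relation "measure (\<lambda>(f, w). length w)") auto

declare nc_right_inverse.simps [simp del]

lemma nc_mult_right_inverse:
  assumes "f [] = 1"
  shows "nc_mult f (nc_right_inverse f) = nc_one"
proof
  fix w :: "letter list"
  have "{..length w} = insert 0 {1..length w}" by auto
  then have "nc_mult f (nc_right_inverse f) w
      = nc_right_inverse f w + (\<Sum>k\<in>{1..length w}. f (take k w) * nc_right_inverse f (drop k w))"
    by (simp add: nc_mult_def assms)
  then show "nc_mult f (nc_right_inverse f) w = nc_one w"
    by (cases "w = []") (simp_all add: nc_one_def nc_right_inverse.simps[of f w] nc_right_inverse.simps[of f "[]"])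
qed

text \<open>\<open>nc_inverse\<close> is a definite description, so unique existence of a two-sided
  inverse comes first. A right inverse \<open>g\<close> of \<open>f\<close> again has constant term
  1 and hence a right inverse of its own; by associativity the latter equals
  \<open>f\<close>.\<close>

lemma nc_inverse:
  assumes "f [] = 1"
  shows "nc_mult f (nc_inverse f) = nc_one" "nc_mult (nc_inverse f) f = nc_one"
proof -
  define g where "g = nc_right_inverse f"
  have fg: "nc_mult f g = nc_one"
    using nc_mult_right_inverse[of f, OF assms] by (simp add: g_def)
  have "g [] = 1" by (simp add: g_def nc_right_inverse.simps)
  then have gk: "nc_mult g (nc_right_inverse g) = nc_one"
    by (rule nc_mult_right_inverse[of g])
  have "f = nc_mult f (nc_mult g (nc_right_inverse g))"
    by (simp add: gk nc_mult_one_right)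
  also have "\<dots> = nc_right_inverse g"
    by (simp add: nc_mult_assoc[symmetric] fg nc_mult_one_left)
  finally have gf: "nc_mult g f = nc_one"
    using gk by simp
  have "\<exists>!g. nc_mult f g = nc_one \<and> nc_mult g f = nc_one"
  proof (rule ex1I[of _ g])
    fix h assume "nc_mult f h = nc_one \<and> nc_mult h f = nc_one"
    then show "h = g"
      by (metis fg nc_mult_assoc nc_mult_one_left nc_mult_one_right)
  qed (use fg gf in simp)
  from theI'[OF this] show "nc_mult f (nc_inverse f) = nc_one" "nc_mult (nc_inverse f) f = nc_one"
    by (simp_all add: nc_inverse_def)
qed

lemma nc_series_inverse:
  assumes "f [] = 1"
  shows "nc_series f p q * nc_series (nc_inverse f) p q = 1"
    "nc_series (nc_inverse f) p q * nc_series f p q = 1"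
  by (simp_all add: nc_series_mult nc_inverse[of f, OF assms] nc_series_one)

text \<open>Feeds the expansion of \<open>J\<close> up to first order in
  \<open>\<hbar>\<close>.\<close>

lemma nc_inverse_low:
  assumes "f [] = 1"
  shows "nc_inverse f [] = 1" "f [l] = 0 \<Longrightarrow> nc_inverse f [l] = 0"
proof -
  show 0: "nc_inverse f [] = 1"
    using nc_inverse(1)[of f, OF assms, THEN fun_cong, of "[]"] assms by (simp add: nc_mult_def nc_one_def)
  show "nc_inverse f [l] = 0" if "f [l] = 0"
    using nc_inverse(1)[of f, OF assms, THEN fun_cong, of "[l]"] assms that by (simp add: nc_mult_def nc_one_def)
qed

section \<open>Group-like series and sums of commuting variables\<close>

lemma sum_Pow_insert:
  fixes g :: "'a set \<Rightarrow> 'b::comm_monoid_add"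
  assumes "finite A" "x \<notin> A"
  shows "(\<Sum>S\<in>Pow (insert x A). g S) = (\<Sum>S\<in>Pow A. g S) + (\<Sum>S\<in>Pow A. g (insert x S))"
proof -
  have "inj_on (insert x) (Pow A)"
    using assms by (auto simp: inj_on_def)
  then show ?thesis
    unfolding Pow_insert using assms
    by (subst sum.union_disjoint) (auto simp: sum.reindex)
qed

lemma nths_cong_index: "(\<And>i. i < length xs \<Longrightarrow> i \<in> S \<longleftrightarrow> i \<in> T) \<Longrightarrow> nths xs S = nths xs T"
  unfolding nths_def by (rule arg_cong[where f = "map fst"], rule filter_cong) (auto simp: set_zip)

lemma word_prod_commute:
  assumes "x * p = p * x" "x * q = q * x"
  shows "x * word_prod p q w = word_prod p q w * x"
proof (induction w)
  case (Cons l w)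
  then show ?case using assms by (cases l) (auto simp: mult.assoc, (metis mult.assoc)+)
qed simp

text \<open>Expanding the product distributes the letters of \<open>w\<close> between the two commuting pairs.\<close>

lemma word_prod_add:
  fixes p q p' q' :: "'r::ring_1"
  assumes "p * p' = p' * p" "p * q' = q' * p" "q * p' = p' * q" "q * q' = q' * q"
  shows "word_prod (p + p') (q + q') w =
    (\<Sum>S\<in>Pow {..<length w}. word_prod p q (nths w S) * word_prod p' q' (nths w (- S)))"
proof (induction w rule: rev_induct)
  case (snoc l w)
  let ?n = "length w" and ?W = "word_prod p q" and ?W' = "word_prod p' q'"
  define x where "x = word_prod p q [l]"
  define x' where "x' = word_prod p' q' [l]"
  \<comment> \<open>The appended letter of the unprimed pair has to pass a word in the primed pair,
    whose letters commute with it.\<close>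
  have comm: "?W' u * x = x * ?W' u" for u
    unfolding x_def using assms by (cases l) (simp_all add: word_prod_commute)
  \<comment> \<open>The new letter sits at position \<open>?n\<close>; it belongs to the complement
    of \<open>S\<close> unless \<open>?n\<close> is inserted into \<open>S\<close>.\<close>
  have idx: "nths (w @ [l]) S = nths w S" "nths (w @ [l]) (- S) = nths w (- S) @ [l]"
    "nths (w @ [l]) (insert ?n S) = nths w S @ [l]" "nths (w @ [l]) (- insert ?n S) = nths w (- S)"
    if "S \<in> Pow {..<?n}" for S
    using that by (auto simp: nths_append intro!: nths_cong_index)
  have "word_prod (p + p') (q + q') (w @ [l]) = word_prod (p + p') (q + q') w * (x + x')"
    by (cases l) (simp_all add: x_def x'_def)
  also have "\<dots> = (\<Sum>S\<in>Pow {..<?n}. ?W (nths w S) * ?W' (nths w (- S)) * x + ?W (nths w S) * ?W' (nths w (- S)) * x')"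
    by (simp add: snoc.IH sum_distrib_right distrib_left sum.distrib)
  also have "\<dots> = (\<Sum>S\<in>Pow {..<?n}. ?W (nths w S @ [l]) * ?W' (nths w (- S)) + ?W (nths w S) * ?W' (nths w (- S) @ [l]))"
    by (rule sum.cong[OF refl]) (simp add: x_def[symmetric] x'_def[symmetric] mult.assoc comm sum.distrib)
  also have "\<dots> = (\<Sum>S\<in>Pow {..<length (w @ [l])}. ?W (nths (w @ [l]) S) * ?W' (nths (w @ [l]) (- S)))"
    by (simp add: lessThan_Suc sum_Pow_insert idx sum.distrib add.commute del: word_prod_simps)
  finally show ?case .
qed simp

lemma length_nths_add: "length (nths w S) + length (nths w (- S)) = length w"
proof -
  have "{..<length w} = {i. i < length w \<and> i \<in> S} \<union> {i. i < length w \<and> i \<in> - S}"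
    by auto
  then have "card {i. i < length w \<and> i \<in> S} + card {i. i < length w \<and> i \<in> - S} = card {..<length w}"
    by (simp add: card_Un_disjoint disjoint_iff)
  then show ?thesis by (simp add: length_nths)
qed

text \<open>When the two pairs commute, substituting sums amounts to the coproduct followed by
  evaluation on both pairs, and a group-like series has coproduct \<open>f\<close> tensor
  \<open>f\<close>.\<close>

lemma nc_series_group_like:
  fixes p q p' q' :: "'r::complex_algebra"
  assumes "group_like f"
    and comm: "p * p' = p' * p" "p * q' = q' * p" "q * p' = p' * q" "q * q' = q' * q"
  shows "nc_series f (p + p') (q + q') = nc_series f p q * nc_series f p' q'"
proof (rule fps_ext)
  fix n
  let ?W = "word_prod p q" and ?W' = "word_prod p' q'"
  define UV where "UV = (SIGMA k:{0..n}. {u :: letter list. length u = k} \<times> {v :: letter list. length v = n - k})"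
  define C where "C = (\<lambda>w u v. {S. S \<subseteq> {..<length w} \<and> nths w S = u \<and> nths w (- S) = (v :: letter list)})"
  have gl: "f u * f v = (\<Sum>w | length w = length u + length v. of_nat (card (C w u v)) * f w)" for u v
    using assms(1) by (simp add: group_like_def C_def)
  \<comment> \<open>Writing the multiplicity as a sum over sets of positions lets this sum be
    exchanged with the one over pairs of words.\<close>
  have card: "of_nat (card (C w u v)) *\<^sub>C x = (\<Sum>S\<in>Pow {..<length w}. if nths w S = u \<and> nths w (- S) = v then x else 0)"
    for w u v and x :: 'r
  proof -
    have "(\<Sum>S\<in>Pow {..<length w}. if nths w S = u \<and> nths w (- S) = v then x else 0) = (\<Sum>S\<in>C w u v. x)"
      by (rule sum.mono_neutral_cong_right) (auto simp: C_def)
    also have "\<dots> = (\<Sum>S\<in>C w u v. 1 *\<^sub>C x)"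
      by (simp add: scaleC_one)
    also have "\<dots> = of_nat (card (C w u v)) *\<^sub>C x"
      by (simp only: cvec.scale_sum_left[symmetric] sum_constant mult_1_right)
    finally show ?thesis by simp
  qed
  have "(nc_series f p q * nc_series f p' q') $ n
      = (\<Sum>k=0..n. \<Sum>u | length u = k. \<Sum>v | length v = n - k. (f u * f v) *\<^sub>C (?W u * ?W' v))"
    by (simp add: fps_mult_nth nc_series_def sum_product mult_scaleC_left mult_scaleC_right scaleC_scaleC
        mult.commute[where 'a = complex])
  also have "\<dots> = (\<Sum>(k, u, v)\<in>UV. (f u * f v) *\<^sub>C (?W u * ?W' v))"
    by (simp add: UV_def sum.Sigma[symmetric] sum.cartesian_product[symmetric])
  also have "\<dots> = (\<Sum>(k, u, v)\<in>UV. \<Sum>w | length w = n. f w *\<^sub>C of_nat (card (C w u v)) *\<^sub>C (?W u * ?W' v))"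
    by (rule sum.cong[OF refl]) (auto simp: gl UV_def cvec.scale_sum_left scaleC_scaleC mult.commute)
  also have "\<dots> = (\<Sum>w | length w = n. \<Sum>(k, u, v)\<in>UV. f w *\<^sub>C of_nat (card (C w u v)) *\<^sub>C (?W u * ?W' v))"
    by (simp add: case_prod_unfold) (rule sum.swap)
  also have "\<dots> = (\<Sum>w | length w = n. f w *\<^sub>C word_prod (p + p') (q + q') w)"
  proof (rule sum.cong[OF refl])
    fix w :: "letter list" assume w: "w \<in> {w. length w = n}"
    have "(\<Sum>(k, u, v)\<in>UV. of_nat (card (C w u v)) *\<^sub>C (?W u * ?W' v))
        = (\<Sum>S\<in>Pow {..<length w}. \<Sum>(k, u, v)\<in>UV. if nths w S = u \<and> nths w (- S) = v then ?W u * ?W' v else 0)"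
      by (simp only: card case_prod_unfold) (rule sum.swap)
    also have "\<dots> = (\<Sum>S\<in>Pow {..<length w}. ?W (nths w S) * ?W' (nths w (- S)))"
    proof (rule sum.cong[OF refl])
      fix S
      \<comment> \<open>A set \<open>S\<close> determines its two words and their lengths, so a
        single index contributes; it lies in \<open>UV\<close> because the lengths add up to
        \<open>n\<close>.\<close>
      have "(\<Sum>(k, u, v)\<in>UV. if nths w S = u \<and> nths w (- S) = v then ?W u * ?W' v else 0)
          = (\<Sum>(k, u, v)\<in>{(length (nths w S), nths w S, nths w (- S))}. ?W u * ?W' v)"
        using w length_nths_add[of w S]
        by (intro sum.mono_neutral_cong_right) (auto simp: UV_def split: if_splits)
      then show "(\<Sum>(k, u, v)\<in>UV. if nths w S = u \<and> nths w (- S) = v then ?W u * ?W' v else 0)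
          = ?W (nths w S) * ?W' (nths w (- S))" by simp
    qed
    also have "\<dots> = word_prod (p + p') (q + q') w"
      by (rule word_prod_add[OF comm, symmetric])
    finally show "(\<Sum>(k, u, v)\<in>UV. f w *\<^sub>C of_nat (card (C w u v)) *\<^sub>C (?W u * ?W' v))
        = f w *\<^sub>C word_prod (p + p') (q + q') w"
      by (simp add: case_prod_unfold cvec.scale_sum_right[symmetric] del: cvec.scale_scale)
  qed
  finally show "nc_series f (p + p') (q + q') $ n = (nc_series f p q * nc_series f p' q') $ n"
    by (simp add: nc_series_def)
qed

section \<open>Power series with commuting coefficients\<close>

lemma fps_commute_sums:
  fixes x y :: "'r::ring_1 fps"
  assumes "\<And>i j. x $ i * y $ j = y $ j * x $ i"
  shows "x * y = y * x"
proof (rule fps_ext)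
  fix n
  have "(y * x) $ n = (\<Sum>i=0..n. y $ (n - i) * x $ (n - (n - i)))"
    unfolding fps_mult_nth by (rule sum.reindex_bij_witness[where i = "\<lambda>i. n - i" and j = "\<lambda>i. n - i"]) auto
  also have "\<dots> = (x * y) $ n"
    unfolding fps_mult_nth by (rule sum.cong) (auto simp: assms)
  finally show "(x * y) $ n = (y * x) $ n" by simp
qed

lemma nc_series_commute_coeff:
  assumes "x * p = p * x" "x * q = q * x"
  shows "x * nc_series f p q $ n = nc_series f p q $ n * x"
  by (simp add: nc_series_def sum_distrib_left sum_distrib_right mult_scaleC_left mult_scaleC_right
      word_prod_commute[OF assms])

lemma exp_half_series_commute_coeff:
  assumes "x * p = p * x"
  shows "x * exp_half_series p $ n = exp_half_series p $ n * x"
  by (simp add: exp_half_series_def mult_scaleC_left mult_scaleC_right power_commuting_commutes[OF assms[symmetric]])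

lemma nc_series_commute:
  assumes "p * p' = p' * p" "p * q' = q' * p" "q * p' = p' * q" "q * q' = q' * q"
  shows "nc_series f p q * nc_series g p' q' = nc_series g p' q' * nc_series f p q"
  by (intro fps_commute_sums nc_series_commute_coeff nc_series_commute_coeff[symmetric] assms assms[symmetric])

lemma exp_half_series_nc_series_commute:
  assumes "x * p = p * x" "x * q = q * x"
  shows "exp_half_series x * nc_series f p q = nc_series f p q * exp_half_series x"
  by (intro fps_commute_sums nc_series_commute_coeff exp_half_series_commute_coeff[symmetric] assms[symmetric])

lemma exp_half_series_commute:
  assumes "x * p = p * x"
  shows "exp_half_series x * exp_half_series p = exp_half_series p * exp_half_series x"
  by (intro fps_commute_sums exp_half_series_commute_coeff exp_half_series_commute_coeff[symmetric] assms[symmetric])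


section \<open>Coherence for the interchange of tensor products\<close>

context monoid_mult
begin

text \<open>Products are kept associated to the right; in this form an equation rewrites two
  adjacent factors without undoing that.\<close>

lemma mult_ext: "p * q = r \<Longrightarrow> p * (q * t) = r * t"
  by (simp add: mult.assoc[symmetric])

lemma right_cancel: "x * p = y * p \<Longrightarrow> p * p' = 1 \<Longrightarrow> x = y"
  by (metis mult.assoc mult.right_neutral)

lemma move_left: "p * q = r \<Longrightarrow> p' * p = 1 \<Longrightarrow> q = p' * r"
  by (metis mult.assoc mult.left_neutral)

lemma commute_inverse: "p * q = q * p \<Longrightarrow> q * q' = 1 \<Longrightarrow> q' * q = 1 \<Longrightarrow> p * q' = q' * p"
  by (metis mult.assoc mult.right_neutral mult.left_neutral)

lemma commute_mult: "p * q = q * p \<Longrightarrow> p * r = r * p \<Longrightarrow> p * (q * r) = q * r * p"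
  by (metis mult.assoc)

text \<open>Rebracketing by the pentagons \<open>p1\<close>, \<open>p2\<close>, \<open>p3\<close>
  brings the hexagon \<open>h\<close> into position; \<open>c1\<close> and \<open>c2\<close> are
  naturality. The computation runs after right multiplication by the invertible
  \<open>A3 * A7\<close>, which is cancelled at the end.\<close>

lemma braid_past_product_monoid:
  assumes p1: "A1 * A2 = A4 * A5 * A6" and h: "A6 * R1 * A7 = R2 * A8 * R3"
    and p2: "A11 * A13 = A12 * A3 * A7" and p3: "A10 * A13 = A9 * A5 * A8"
    and c1: "R3 * A13 = A13 * R3" and c2: "R2 * A5 = A5 * R2"
    and i: "A3 * A3' = 1" "A3' * A3 = 1" "A7 * A7' = 1" "A9' * A9 = 1" "A11' * A11 = 1"
  shows "A1 * (A2 * R1 * A3') = (A4 * R2 * A9') * (A10 * R3 * A11') * A12"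
proof -
  have "A1 * (A2 * R1 * A3') * (A3 * A7) = A1 * A2 * (R1 * A7)"
    by (simp add: mult.assoc i(2)[THEN mult_ext])
  also have "\<dots> = A4 * A5 * (A6 * R1 * A7)"
    by (simp add: p1 mult.assoc)
  also have "\<dots> = A4 * (R2 * A5) * A8 * R3"
    by (simp add: h[unfolded mult.assoc] c2[THEN mult_ext] mult.assoc)
  also have "\<dots> = A4 * R2 * (A9' * A9) * A5 * A8 * R3"
    by (simp add: i mult.assoc)
  also have "\<dots> = A4 * R2 * A9' * (A9 * A5 * A8) * R3"
    by (simp add: mult.assoc)
  also have "\<dots> = A4 * R2 * A9' * A10 * (R3 * A13)"
    unfolding p3[symmetric] by (simp add: c1 mult.assoc)
  also have "\<dots> = A4 * R2 * A9' * A10 * R3 * (A11' * A11) * A13"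
    by (simp add: i mult.assoc)
  also have "\<dots> = A4 * R2 * A9' * A10 * R3 * A11' * (A12 * A3 * A7)"
    unfolding p2[symmetric] by (simp add: mult.assoc)
  also have "\<dots> = (A4 * R2 * A9') * (A10 * R3 * A11') * A12 * (A3 * A7)"
    by (simp add: mult.assoc)
  finally show ?thesis
    by (rule right_cancel[where p' = "A7' * A3'"]) (simp add: mult.assoc i i(3)[THEN mult_ext])
qed

text \<open>The counterpart for the second hexagon. That hexagon is stated with inverse associators,
  so it is first solved for \<open>R1\<close>.\<close>

lemma braid_product_past_monoid:
  assumes h: "E4' * R1 * E6' = R2 * E5' * R3" and p1: "E7 * E8 = E1 * E2 * E4"
    and p2: "E9 * E8 = E10 * E11 * E5" and p3: "E13 * E3 = E12 * E11 * E6"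
    and c1: "R2 * E8 = E8 * R2" and c2: "R3 * E11 = E11 * R3"
    and i: "E3 * E3' = 1" "E3' * E3 = 1" "E4 * E4' = 1" "E6' * E6 = 1" "E5 * E5' = 1" "E9' * E9 = 1" "E12' * E12 = 1"
  shows "E1 * (E2 * R1 * E3') = (E7 * R2 * E9') * (E10 * R3 * E12') * E13"
proof -
  have R1: "R1 = E4 * (R2 * E5' * R3) * E6"
    unfolding h[symmetric] by (simp add: mult.assoc i i(3)[THEN mult_ext])
  have E8: "E8 * E5' = E9' * E10 * E11"
    using move_left[OF p2 i(6)] by (simp add: mult.assoc i)
  have "E1 * (E2 * R1 * E3') * E3 = E1 * E2 * E4 * R2 * E5' * R3 * E6"
    by (simp add: mult.assoc i R1)
  also have "\<dots> = E7 * (E8 * R2) * E5' * R3 * E6"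
    unfolding p1[symmetric] by (simp add: mult.assoc)
  also have "\<dots> = E7 * R2 * (E8 * E5') * R3 * E6"
    by (simp add: c1[symmetric] mult.assoc)
  also have "\<dots> = E7 * R2 * E9' * E10 * (E11 * R3) * E6"
    by (simp add: E8 mult.assoc)
  also have "\<dots> = E7 * R2 * E9' * E10 * R3 * (E12' * E12) * E11 * E6"
    by (simp add: c2[symmetric] i mult.assoc)
  also have "\<dots> = E7 * R2 * E9' * E10 * R3 * E12' * (E12 * E11 * E6)"
    by (simp add: mult.assoc)
  also have "\<dots> = (E7 * R2 * E9') * (E10 * R3 * E12') * E13 * E3"
    unfolding p3[symmetric] by (simp add: mult.assoc)
  finally show ?thesis
    by (rule right_cancel[where p' = E3']) (rule i)
qed

text \<open>The two pentagons change the bracketing around the braiding \<open>R\<close>, and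
  \<open>c\<close> lets \<open>R\<close> pass the associator that treats the two braided objects as
  one.\<close>

lemma braid_inside_monoid:
  assumes p1: "D5 * D9 = D1 * D2 * D3" and p2: "D6 * D9 = D7 * D8 * D4" and c: "R * D9 = D9 * R"
    and i: "D4 * D4' = 1" "D4' * D4 = 1" "D6' * D6 = 1"
  shows "D1 * D2 * (D3 * R * D4') = (D5 * R * D6') * D7 * D8"
proof -
  have "D1 * D2 * (D3 * R * D4') * D4 = D1 * D2 * D3 * R"
    by (simp add: mult.assoc i)
  also have "\<dots> = D5 * (R * D9)"
    unfolding p1[symmetric] by (simp add: c mult.assoc)
  also have "\<dots> = D5 * R * (D6' * D6) * D9"
    by (simp add: i mult.assoc)
  also have "\<dots> = D5 * R * D6' * (D7 * D8 * D4)"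
    unfolding p2[symmetric] by (simp add: mult.assoc)
  also have "\<dots> = (D5 * R * D6') * D7 * D8 * D4"
    by (simp add: mult.assoc)
  finally show ?thesis
    by (rule right_cancel[where p' = D4']) (rule i)
qed

text \<open>\<open>B1\<close>, \<open>B2\<close>, \<open>B3\<close> are the three moves for a
  braiding inside a tensor product, \<open>Pa\<close>, \<open>Pb\<close>, \<open>Pc\<close> are
  pentagons and \<open>c\<close> collects the instances of naturality.\<close>

lemma interchange_monoid:
  assumes B1: "F2 * G1 = G2 * G3 * F3" and B2: "F8 * G5 = G2 * G4 * F13" and B3: "F13 * F14 * G6 = G3 * F5 * F15"
    and Pa: "F16 * F10 = F14 * F17 * F11" and Pb: "F4 * F6 = F15 * F17 * F12" and Pc: "F16 * F9 = F2 * F1 * F7"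
    and c: "F3 * F4 = F4 * F3" "G4 * F4 = F4 * G4" "G4 * G3 = G3 * G4" "F8 * F9 = F9 * F8"
      "F13 * F16 = F16 * F13" "G2 * F16 = F16 * G2" "G4 * F16 = F16 * G4" "G6 * F17 = F17 * G6" "F5 * F4 = F4 * F5"
    and i: "F1' * F1 = 1" "F2' * F2 = 1" "F3 * F3' = 1" "F9 * F9' = 1" "F9' * F9 = 1" "F11 * F11' = 1"
      "F16 * F16' = 1" "F16' * F16 = 1"
  shows "(F1' * G1 * F4) * (F3' * G4 * F5) * F6 = F7 * F8 * (F9' * G5 * F10) * (F11' * G6 * F12)"
proof -
  have G1: "G1 = F2' * G2 * G3 * F3"
    using move_left[OF B1 i(2)] by (simp add: mult.assoc)
  have F10: "F10 * F11' = F16' * F14 * F17"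
    using move_left[OF Pa i(8)] by (simp add: mult.assoc i)
  have "F16 * F9 * F9' * F16' = F2 * F1 * F7 * F9' * F16'"
    by (simp add: Pc)
  \<comment> \<open>The pentagon \<open>Pc\<close> written as a closed loop, to be inserted behind
    \<open>F1' * F2'\<close>.\<close>
  then have one: "F2 * F1 * F7 * F9' * F16' = 1"
    by (simp add: mult.assoc i i(4)[THEN mult_ext])
  have "F1' * F2' = F1' * F2' * (F2 * F1 * F7 * F9' * F16')"
    by (simp only: one mult_1_right)
  then have head: "F7 * F9' * F16' = F1' * F2'"
    by (simp add: mult.assoc i i(2)[THEN mult_ext] i(1)[THEN mult_ext])
  note c' = c(4)[THEN commute_inverse, OF i(4,5)] c(5)[THEN commute_inverse, OF i(7,8)]
    c(6)[THEN commute_inverse, OF i(7,8)] c(7)[THEN commute_inverse, OF i(7,8)]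
  have "(F1' * G1 * F4) * (F3' * G4 * F5) * F6 = F1' * F2' * G2 * G3 * (F3 * F4) * F3' * G4 * F5 * F6"
    by (simp add: G1 mult.assoc)
  also have "\<dots> = F1' * F2' * G2 * G3 * (F4 * G4) * F5 * F6"
    by (simp add: c(1) mult.assoc i(3)[THEN mult_ext])
  also have "\<dots> = F1' * F2' * G2 * (G3 * G4) * (F4 * F5) * F6"
    by (simp add: c(2)[symmetric] mult.assoc)
  also have "\<dots> = F1' * F2' * G2 * G4 * G3 * F5 * (F4 * F6)"
    by (simp add: c(3,9)[symmetric] mult.assoc)
  also have "\<dots> = F7 * F9' * F16' * G2 * G4 * (G3 * F5 * F15) * F17 * F12"
    unfolding head[symmetric] by (simp add: Pb mult.assoc)
  also have "\<dots> = F7 * F9' * (F16' * G2) * G4 * F13 * F14 * (G6 * F17) * F12"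
    unfolding B3[symmetric] by (simp add: mult.assoc)
  also have "\<dots> = F7 * F9' * G2 * (F16' * G4) * F13 * F14 * F17 * G6 * F12"
    by (simp add: c'(3)[symmetric] c(8) mult.assoc)
  also have "\<dots> = F7 * F9' * G2 * G4 * (F16' * F13) * F14 * F17 * G6 * F12"
    by (simp add: c'(4)[symmetric] mult.assoc)
  also have "\<dots> = F7 * F9' * (G2 * G4 * F13) * (F16' * F14 * F17) * G6 * F12"
    by (simp add: c'(2)[symmetric] mult.assoc)
  also have "\<dots> = F7 * (F9' * F8) * G5 * F10 * F11' * G6 * F12"
    unfolding B2[symmetric] F10[symmetric] by (simp add: mult.assoc)
  also have "\<dots> = F7 * F8 * (F9' * G5 * F10) * (F11' * G6 * F12)"
    by (simp add: c'(1)[symmetric] mult.assoc)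
  finally show ?thesis .
qed

end

text \<open>For a symmetric relation \<open>sorted_wrt\<close> is a condition on all pairs of
  positions, so permutations of blocks are again blocks.\<close>

definition blocks :: "nat set list \<Rightarrow> bool" where
  "blocks Is \<longleftrightarrow> (\<forall>I\<in>set Is. finite I) \<and> sorted_wrt (\<lambda>I K. I \<inter> K = {}) Is"

text \<open>
  \<open>a I K L\<close> stands for the associativity constraint \<open>(I \<otimes> K) \<otimes> L \<rightarrow> I \<otimes> (K \<otimes> L)\<close> and \<open>R I K\<close> for
  the braiding without its flip, for tensor products indexed by sets of strands.
\<close>

locale braided_system =
  fixes a a' :: "nat set \<Rightarrow> nat set \<Rightarrow> nat set \<Rightarrow> 'm::monoid_mult" and R :: "nat set \<Rightarrow> nat set \<Rightarrow> 'm"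
  assumes a_inverse: "a I K L * a' I K L = 1" "a' I K L * a I K L = 1"
    and pent: "blocks [I, K, L, M] \<Longrightarrow>
      a I K (L \<union> M) * a (I \<union> K) L M = a K L M * a I (K \<union> L) M * a I K L"
    and hex1: "blocks [I, K, L] \<Longrightarrow> a K L I * R I (K \<union> L) * a I K L = R I L * a K I L * R I K"
    and hex2: "blocks [I, K, L] \<Longrightarrow> a' L I K * R (I \<union> K) L * a' I K L = R I L * a' I L K * R K L"
    and comm_aa: "blocks [I, K, L] \<Longrightarrow> blocks [I', K', L'] \<Longrightarrow> I' \<union> K' \<union> L' = X \<Longrightarrow>
      X \<subseteq> I \<or> X \<subseteq> K \<or> X \<subseteq> L \<or> X \<inter> (I \<union> K \<union> L) = {} \<Longrightarrow> a I' K' L' * a I K L = a I K L * a I' K' L'"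
    and comm_Ra: "blocks [I, K, L] \<Longrightarrow> blocks [I', K'] \<Longrightarrow> I' \<union> K' = X \<Longrightarrow>
      X \<subseteq> I \<or> X \<subseteq> K \<or> X \<subseteq> L \<or> X \<inter> (I \<union> K \<union> L) = {} \<Longrightarrow> R I' K' * a I K L = a I K L * R I' K'"
    and comm_aR: "blocks [I, K] \<Longrightarrow> blocks [I', K', L'] \<Longrightarrow> I' \<union> K' \<union> L' = X \<Longrightarrow>
      X \<subseteq> I \<or> X \<subseteq> K \<or> X \<inter> (I \<union> K) = {} \<Longrightarrow> a I' K' L' * R I K = R I K * a I' K' L'"
    and comm_RR: "blocks [I, K] \<Longrightarrow> blocks [I', K'] \<Longrightarrow> I' \<union> K' = X \<Longrightarrow>
      X \<subseteq> I \<or> X \<subseteq> K \<or> X \<inter> (I \<union> K) = {} \<Longrightarrow> R I' K' * R I K = R I K * R I' K'"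
begin

text \<open>The braiding of the first factor of \<open>u \<otimes> (y \<otimes> v)\<close> with the second one:\<close>

definition b :: "nat set \<Rightarrow> nat set \<Rightarrow> nat set \<Rightarrow> 'm" where
  "b u y v = a y u v * R u y * a' u y v"

text \<open>Read from right to left, this rebrackets \<open>(x u)(y v)\<close>, braids
  \<open>u\<close> with \<open>y\<close>, and rebrackets to \<open>(x y)(u v)\<close>; the flip is
  left out.\<close>

definition J :: "nat set \<Rightarrow> nat set \<Rightarrow> nat set \<Rightarrow> nat set \<Rightarrow> 'm" where
  "J x u y v = a' x y (u \<union> v) * a y u v * R u y * a' u y v * a x u (y \<union> v)"

lemma J_b: "J x u y v = a' x y (u \<union> v) * b u y v * a x u (y \<union> v)"
  by (simp add: J_def b_def mult.assoc)

text \<open>Naturality. The inverse \<open>a'\<close> inherits commutation from \<open>a\<close> by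
  \<open>commute_inverse\<close>, and \<open>b\<close> inherits it from its three factors.\<close>

lemma comm_ba:
  assumes "blocks [I, K, L]" "blocks [I', K', L']" "I' \<union> K' \<union> L' = X"
    "X \<subseteq> I \<or> X \<subseteq> K \<or> X \<subseteq> L \<or> X \<inter> (I \<union> K \<union> L) = {}"
  shows "b I' K' L' * a I K L = a I K L * b I' K' L'"
proof -
  have bl: "blocks [K', I', L']" "blocks [I', K']"
    using assms(2) by (auto simp: blocks_def)
  have X: "K' \<union> I' \<union> L' = X" and sub: "I' \<union> K' \<subseteq> X"
    using assms(3) by auto
  have 1: "a K' I' L' * a I K L = a I K L * a K' I' L'"
    by (rule comm_aa[OF assms(1) bl(1) X assms(4)])
  have 2: "R I' K' * a I K L = a I K L * R I' K'"
    by (rule comm_Ra[OF assms(1) bl(2) refl]) (use assms(4) sub in blast)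
  have 3: "a' I' K' L' * a I K L = a I K L * a' I' K' L'"
    by (rule commute_inverse[OF comm_aa[OF assms(1-4), symmetric] a_inverse, symmetric])
  show ?thesis
    unfolding b_def by (metis (no_types, opaque_lifting) 1 2 3 mult.assoc)
qed

lemma comm_ab:
  assumes "blocks [I, K, L]" "blocks [I', K', L']" "I' \<union> K' \<union> L' = X"
    "X \<subseteq> I \<or> X \<subseteq> K \<or> X \<subseteq> L"
  shows "a I' K' L' * b I K L = b I K L * a I' K' L'"
proof -
  have bl: "blocks [K, I, L]" "blocks [I, K]"
    using assms(1) by (auto simp: blocks_def)
  \<comment> \<open>Acting inside the third object means acting away from the two objects that are
    braided.\<close>
  have "X \<inter> I = {} \<and> X \<inter> K = {}" if "X \<subseteq> L"
    using assms(1) that by (auto simp: blocks_def)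
  then have sub: "X \<subseteq> I \<or> X \<subseteq> K \<or> X \<inter> (I \<union> K) = {}"
    using assms(4) by blast
  have 1: "a I' K' L' * a K I L = a K I L * a I' K' L'"
    by (rule comm_aa[OF bl(1) assms(2,3)]) (use assms(4) in blast)
  have 2: "a I' K' L' * R I K = R I K * a I' K' L'"
    by (rule comm_aR[OF bl(2) assms(2,3) sub])
  have 3: "a I' K' L' * a' I K L = a' I K L * a I' K' L'"
    by (rule commute_inverse[OF comm_aa[OF assms(1-3)] a_inverse]) (use assms(4) in blast)
  show ?thesis
    unfolding b_def by (metis (no_types, opaque_lifting) 1 2 3 mult.assoc)
qed

lemma comm_Rb:
  assumes "blocks [I, K, L]" "blocks [I', K']" "I' \<union> K' = X"
    "X \<subseteq> I \<or> X \<subseteq> K \<or> X \<subseteq> L"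
  shows "R I' K' * b I K L = b I K L * R I' K'"
proof -
  have bl: "blocks [K, I, L]" "blocks [I, K]"
    using assms(1) by (auto simp: blocks_def)
  have "X \<inter> I = {} \<and> X \<inter> K = {}" if "X \<subseteq> L"
    using assms(1) that by (auto simp: blocks_def)
  then have sub: "X \<subseteq> I \<or> X \<subseteq> K \<or> X \<inter> (I \<union> K) = {}"
    using assms(4) by blast
  have 1: "R I' K' * a K I L = a K I L * R I' K'"
    by (rule comm_Ra[OF bl(1) assms(2,3)]) (use assms(4) in blast)
  have 2: "R I' K' * R I K = R I K * R I' K'"
    by (rule comm_RR[OF bl(2) assms(2,3) sub])
  have 3: "R I' K' * a' I K L = a' I K L * R I' K'"
    by (rule commute_inverse[OF comm_Ra[OF assms(1-3)] a_inverse]) (use assms(4) in blast)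
  show ?thesis
    unfolding b_def by (metis (no_types, opaque_lifting) 1 2 3 mult.assoc)
qed

lemma comm_bb:
  assumes "blocks [I, K, L]" "blocks [I', K', L']" "I' \<union> K' \<union> L' = X"
    "X \<subseteq> I \<or> X \<subseteq> K \<or> X \<subseteq> L"
  shows "b I' K' L' * b I K L = b I K L * b I' K' L'"
proof -
  have bl: "blocks [K', I', L']" "blocks [I', K']"
    using assms(2) by (auto simp: blocks_def)
  have X: "K' \<union> I' \<union> L' = X" and sub: "I' \<union> K' \<subseteq> X"
    using assms(3) by auto
  have 1: "a K' I' L' * b I K L = b I K L * a K' I' L'"
    by (rule comm_ab[OF assms(1) bl(1) X assms(4)])
  have 2: "R I' K' * b I K L = b I K L * R I' K'"
    by (rule comm_Rb[OF assms(1) bl(2) refl]) (use assms(4) sub in blast)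
  have 3: "a' I' K' L' * b I K L = b I K L * a' I' K' L'"
    by (rule commute_inverse[OF comm_ab[OF assms(1-4), symmetric] a_inverse, symmetric])
  show ?thesis
    unfolding b_def[of I' K' L'] by (metis (no_types, opaque_lifting) 1 2 3 mult.assoc)
qed

text \<open>Meant for the strands of \<open>\<hh>\<close>, which \<open>J\<close> does not
  touch.\<close>

lemma comm_aJ:
  assumes "blocks [x, u, y, v]" "blocks [I', K', L']" "(I' \<union> K' \<union> L') \<inter> (x \<union> u \<union> y \<union> v) = {}"
  shows "a I' K' L' * J x u y v = J x u y v * a I' K' L'"
proof -
  have a: "a I' K' L' * a I K L = a I K L * a I' K' L'"
    if "blocks [I, K, L]" "I \<union> K \<union> L \<subseteq> x \<union> u \<union> y \<union> v" for I K L
    by (rule comm_aa[OF that(1) assms(2) refl]) (use that(2) assms(3) in blast)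
  note a' = commute_inverse[OF a a_inverse]
  have R: "a I' K' L' * R u y = R u y * a I' K' L'"
    by (rule comm_aR[OF _ assms(2) refl]) (use assms(1,3) in \<open>auto simp: blocks_def\<close>)
  have bl: "blocks [x, y, u \<union> v]" "blocks [y, u, v]" "blocks [u, y, v]" "blocks [x, u, y \<union> v]"
    using assms(1) by (auto simp: blocks_def)
  show ?thesis
    unfolding J_def
    by (intro commute_mult a'[OF bl(1)] a[OF bl(2)] R a'[OF bl(3)] a[OF bl(4)]) auto
qed

text \<open>The first hexagon: \<open>u\<close> crosses \<open>y\<close> and then \<open>z\<close>.
  The pentagons carry the spectator \<open>v\<close> along.\<close>

lemma b_past_product:
  assumes "blocks [u, y, z, v]"
  shows "a y z (u \<union> v) * b u (y \<union> z) v = b u z v * b u y (z \<union> v) * a y z v"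
  unfolding b_def
proof (rule braid_past_product_monoid)
  show "a y z (u \<union> v) * a (y \<union> z) u v = a z u v * a y (z \<union> u) v * a y z u"
    using assms by (intro pent) (auto simp: blocks_def)
  show "a y z u * R u (y \<union> z) * a u y z = R u z * a y u z * R u y"
    using assms by (intro hex1) (auto simp: blocks_def)
  show "a u y (z \<union> v) * a (u \<union> y) z v = a y z v * a u (y \<union> z) v * a u y z"
    using assms by (intro pent) (auto simp: blocks_def)
  show "a y u (z \<union> v) * a (u \<union> y) z v = a u z v * a y (z \<union> u) v * a y u z"
    using assms pent[of y u z v] by (auto simp: blocks_def Un_commute)
  show "R u y * a (u \<union> y) z v = a (u \<union> y) z v * R u y"
    using assms by (intro comm_Ra[OF _ _ refl]) (auto simp: blocks_def)
  show "R u z * a y (z \<union> u) v = a y (z \<union> u) v * R u z"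
    using assms by (intro comm_Ra[OF _ _ refl]) (auto simp: blocks_def)
qed (rule a_inverse)+

text \<open>The second hexagon with spectator \<open>w\<close>: \<open>v\<close> crosses
  \<open>z\<close> first, then \<open>u\<close> does.\<close>

lemma b_product_past:
  assumes "blocks [u, v, z, w]"
  shows "a u v w * b (u \<union> v) z w = b u z (v \<union> w) * b v z w * a u v (z \<union> w)"
  unfolding b_def
proof (rule braid_product_past_monoid)
  show "a' z u v * R (u \<union> v) z * a' u v z = R u z * a' u z v * R v z"
    using assms by (intro hex2) (auto simp: blocks_def)
  show "a z u (v \<union> w) * a (u \<union> z) v w = a u v w * a z (u \<union> v) w * a z u v"
    using assms pent[of z u v w] by (auto simp: blocks_def Un_commute)
  show "a u z (v \<union> w) * a (u \<union> z) v w = a z v w * a u (v \<union> z) w * a u z v"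
    using assms pent[of u z v w] by (auto simp: blocks_def Un_commute)
  show "a u v (z \<union> w) * a (u \<union> v) z w = a v z w * a u (v \<union> z) w * a u v z"
    using assms by (intro pent) (auto simp: blocks_def)
  show "R u z * a (u \<union> z) v w = a (u \<union> z) v w * R u z"
    using assms by (intro comm_Ra[OF _ _ refl]) (auto simp: blocks_def)
  show "R v z * a u (v \<union> z) w = a u (v \<union> z) w * R v z"
    using assms by (intro comm_Ra[OF _ _ refl]) (auto simp: blocks_def)
qed (rule a_inverse)+

text \<open>Enlarging the spectator from \<open>v\<close> to the product of \<open>v\<close> and
  \<open>w\<close> only rebrackets around the same braiding of \<open>u\<close> with
  \<open>y\<close>.\<close>

lemma b_inside:
  assumes "blocks [u, y, v, w]"
  shows "a u v w * a y (u \<union> v) w * b u y v = b u y (v \<union> w) * a y v w * a u (y \<union> v) w"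
  unfolding b_def
proof (rule braid_inside_monoid)
  show "a y u (v \<union> w) * a (u \<union> y) v w = a u v w * a y (u \<union> v) w * a y u v"
    using assms pent[of y u v w] by (auto simp: blocks_def Un_commute)
  show "a u y (v \<union> w) * a (u \<union> y) v w = a y v w * a u (y \<union> v) w * a u y v"
    using assms by (intro pent) (auto simp: blocks_def)
  show "R u y * a (u \<union> y) v w = a (u \<union> y) v w * R u y"
    using assms by (intro comm_Ra[OF _ _ refl]) (auto simp: blocks_def)
qed (rule a_inverse)+

text \<open>Both sides lead from \<open>((x u)(y v))(z w)\<close> to
  \<open>(x(y z))(u(v w))\<close>, the left one through \<open>(x u)((y v)(z w))\<close> and the
  right one through \<open>((x y)(u v))(z w)\<close>.\<close>

theorem interchange:
  assumes "blocks [x, u, y, v, z, w]"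
  shows "J x u (y \<union> z) (v \<union> w) * J y v z w * a (x \<union> u) (y \<union> v) (z \<union> w)
    = a x y z * a u v w * J (x \<union> y) (u \<union> v) z w * J x u y v"
  unfolding J_b
proof (rule interchange_monoid)
  show "a y z (u \<union> (v \<union> w)) * b u (y \<union> z) (v \<union> w) = b u z (v \<union> w) * b u y (z \<union> (v \<union> w)) * a y z (v \<union> w)"
    using assms by (intro b_past_product) (auto simp: blocks_def)
  show "a u v w * b (u \<union> v) z w = b u z (v \<union> w) * b v z w * a u v (z \<union> w)"
    using assms by (intro b_product_past) (auto simp: blocks_def)
  have "blocks [u, y, v, z \<union> w]"
    using assms by (auto simp: blocks_def)
  from b_inside[OF this]
  show "a u v (z \<union> w) * a y (u \<union> v) (z \<union> w) * b u y v = b u y (z \<union> (v \<union> w)) * a y v (z \<union> w) * a u (y \<union> v) (z \<union> w)"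
    by (simp add: Un_ac)
  show "a x y (u \<union> v \<union> (z \<union> w)) * a (x \<union> y) (u \<union> v) (z \<union> w)
      = a y (u \<union> v) (z \<union> w) * a x (y \<union> (u \<union> v)) (z \<union> w) * a x y (u \<union> v)"
    using assms by (intro pent) (auto simp: blocks_def)
  have "blocks [x, u, y \<union> v, z \<union> w]"
    using assms by (auto simp: blocks_def)
  from pent[OF this]
  show "a x u (y \<union> z \<union> (v \<union> w)) * a (x \<union> u) (y \<union> v) (z \<union> w)
      = a u (y \<union> v) (z \<union> w) * a x (y \<union> (u \<union> v)) (z \<union> w) * a x u (y \<union> v)"
    by (simp add: Un_ac)
  have "blocks [x, y, z, u \<union> v \<union> w]"
    using assms by (auto simp: blocks_def)
  from pent[OF this]
  show "a x y (u \<union> v \<union> (z \<union> w)) * a (x \<union> y) z (u \<union> v \<union> w)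
      = a y z (u \<union> (v \<union> w)) * a x (y \<union> z) (u \<union> (v \<union> w)) * a x y z"
    by (simp add: Un_ac)
  show "a y z (v \<union> w) * a x u (y \<union> z \<union> (v \<union> w)) = a x u (y \<union> z \<union> (v \<union> w)) * a y z (v \<union> w)"
    using assms by (intro comm_aa[OF _ _ refl]) (auto simp: blocks_def)
  show "b v z w * a x u (y \<union> z \<union> (v \<union> w)) = a x u (y \<union> z \<union> (v \<union> w)) * b v z w"
    using assms by (intro comm_ba[OF _ _ refl]) (auto simp: blocks_def)
  show "b v z w * b u y (z \<union> (v \<union> w)) = b u y (z \<union> (v \<union> w)) * b v z w"
    using assms by (intro comm_bb[OF _ _ refl]) (auto simp: blocks_def)
  show "a u v w * a (x \<union> y) z (u \<union> v \<union> w) = a (x \<union> y) z (u \<union> v \<union> w) * a u v w"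
    using assms by (intro comm_aa[OF _ _ refl]) (auto simp: blocks_def)
  show "a u v (z \<union> w) * a x y (u \<union> v \<union> (z \<union> w)) = a x y (u \<union> v \<union> (z \<union> w)) * a u v (z \<union> w)"
    using assms by (intro comm_aa[OF _ _ refl]) (auto simp: blocks_def)
  show "b u z (v \<union> w) * a x y (u \<union> v \<union> (z \<union> w)) = a x y (u \<union> v \<union> (z \<union> w)) * b u z (v \<union> w)"
    using assms by (intro comm_ba[OF _ _ refl]) (auto simp: blocks_def)
  show "b v z w * a x y (u \<union> v \<union> (z \<union> w)) = a x y (u \<union> v \<union> (z \<union> w)) * b v z w"
    using assms by (intro comm_ba[OF _ _ refl]) (auto simp: blocks_def)
  show "b u y v * a x (y \<union> (u \<union> v)) (z \<union> w) = a x (y \<union> (u \<union> v)) (z \<union> w) * b u y v"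
    using assms by (intro comm_ba[OF _ _ refl]) (auto simp: blocks_def)
  show "a y v (z \<union> w) * a x u (y \<union> z \<union> (v \<union> w)) = a x u (y \<union> z \<union> (v \<union> w)) * a y v (z \<union> w)"
    using assms by (intro comm_aa[OF _ _ refl]) (auto simp: blocks_def)
  show "a' x (y \<union> z) (u \<union> (v \<union> w)) * a x (y \<union> z) (u \<union> (v \<union> w)) = 1"
    by (rule a_inverse)
  show "a (x \<union> y) z (u \<union> v \<union> w) * a' (x \<union> y) z (u \<union> v \<union> w) = 1"
    by (rule a_inverse)
qed (rule a_inverse)+

end


section \<open>Linear operators modulo a subspace\<close>

text \<open>
  A pair \<open>(V, N)\<close> stands for the quotient of \<open>V\<close> by \<open>N\<close>. Tensor products of modules arise in this
  way from formal linear combinations.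
\<close>

definition quot_space :: "'v::complex_vector set \<times> 'v set \<Rightarrow> bool" where
  "quot_space S \<longleftrightarrow> cvec.subspace (fst S) \<and> cvec.subspace (snd S)"

text \<open>Linearity is demanded on the whole type: the operators in question are linear extensions
  from a basis, and this removes membership conditions when sums are pulled through.\<close>

definition quot_hom ::
  "'v::complex_vector set \<times> 'v set \<Rightarrow> 'w::complex_vector set \<times> 'w set \<Rightarrow> ('v \<Rightarrow> 'w) \<Rightarrow> bool" where
  "quot_hom S S' M \<longleftrightarrow> (\<forall>x y. M (x + y) = M x + M y) \<and> (\<forall>c x. M (c *\<^sub>C x) = c *\<^sub>C M x) \<and>
     (\<forall>v\<in>fst S. M v \<in> fst S') \<and> (\<forall>v\<in>snd S. M v \<in> snd S')"

definition quot_cong ::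
  "'v::complex_vector set \<times> 'v set \<Rightarrow> 'w::complex_vector set \<times> 'w set \<Rightarrow> ('v \<Rightarrow> 'w) \<Rightarrow> ('v \<Rightarrow> 'w) \<Rightarrow> bool" where
  "quot_cong S S' P Q \<longleftrightarrow> (\<forall>v\<in>fst S. P v - Q v \<in> snd S')"

section \<open>Homomorphisms and congruences modulo null vectors\<close>

lemma quot_homD:
  assumes "quot_hom S S' M"
  shows "M (x + y) = M x + M y" "M (c *\<^sub>C x) = c *\<^sub>C M x"
    "v \<in> fst S \<Longrightarrow> M v \<in> fst S'" "v \<in> snd S \<Longrightarrow> M v \<in> snd S'"
  using assms by (auto simp: quot_hom_def)

lemma quot_hom_simps:
  assumes "quot_hom S S' M"
  shows "M 0 = 0" "M (- x) = - M x" "M (x - y) = M x - M y" "M (\<Sum>i\<in>I. f i) = (\<Sum>i\<in>I. M (f i))"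
proof -
  have "M (0 *\<^sub>C 0) = 0 *\<^sub>C M 0" by (rule quot_homD(2)[OF assms])
  then show 0: "M 0 = 0" by simp
  have "M (- 1 *\<^sub>C z) = - 1 *\<^sub>C M z" for z by (rule quot_homD(2)[OF assms])
  then show minus: "M (- x) = - M x" for x by (simp add: scaleC_one)
  show "M (x - y) = M x - M y"
    using quot_homD(1)[OF assms, of x "- y"] by (simp add: minus)
  show "M (\<Sum>i\<in>I. f i) = (\<Sum>i\<in>I. M (f i))"
    by (induction I rule: infinite_finite_induct) (simp_all add: 0 quot_homD(1)[OF assms])
qed

lemma quot_spaceD:
  assumes "quot_space S"
  shows "0 \<in> fst S" "x \<in> fst S \<Longrightarrow> y \<in> fst S \<Longrightarrow> x + y \<in> fst S" "x \<in> fst S \<Longrightarrow> c *\<^sub>C x \<in> fst S"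
    "(\<And>i. i \<in> I \<Longrightarrow> f i \<in> fst S) \<Longrightarrow> (\<Sum>i\<in>I. f i) \<in> fst S"
    "0 \<in> snd S" "x \<in> snd S \<Longrightarrow> y \<in> snd S \<Longrightarrow> x + y \<in> snd S" "x \<in> snd S \<Longrightarrow> c *\<^sub>C x \<in> snd S"
    "(\<And>i. i \<in> I \<Longrightarrow> f i \<in> snd S) \<Longrightarrow> (\<Sum>i\<in>I. f i) \<in> snd S"
    "x \<in> snd S \<Longrightarrow> - x \<in> snd S" "x \<in> snd S \<Longrightarrow> y \<in> snd S \<Longrightarrow> x - y \<in> snd S"
  using assms by (auto simp: quot_space_def cvec.subspace_0 cvec.subspace_add cvec.subspace_scale
      cvec.subspace_sum cvec.subspace_neg cvec.subspace_diff)

lemma quot_hom_id: "quot_hom S S (\<lambda>v. v)"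
  by (simp add: quot_hom_def)

lemma quot_hom_zero: "quot_space S' \<Longrightarrow> quot_hom S S' (\<lambda>v. 0)"
  by (simp add: quot_hom_def quot_spaceD)

lemma quot_hom_comp: "quot_hom S' S'' P \<Longrightarrow> quot_hom S S' Q \<Longrightarrow> quot_hom S S'' (\<lambda>v. P (Q v))"
  by (simp add: quot_hom_def)

lemma quot_hom_add: "quot_space S' \<Longrightarrow> quot_hom S S' P \<Longrightarrow> quot_hom S S' Q \<Longrightarrow> quot_hom S S' (\<lambda>v. P v + Q v)"
  by (simp add: quot_hom_def quot_spaceD scaleC_add_right)

lemma quot_hom_scale: "quot_space S' \<Longrightarrow> quot_hom S S' P \<Longrightarrow> quot_hom S S' (\<lambda>v. c *\<^sub>C P v)"
  by (simp add: quot_hom_def quot_spaceD scaleC_add_right mult.commute)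

lemma quot_hom_sum:
  "quot_space S' \<Longrightarrow> (\<And>i. i \<in> I \<Longrightarrow> quot_hom S S' (P i)) \<Longrightarrow> quot_hom S S' (\<lambda>v. \<Sum>i\<in>I. P i v)"
  by (induction I rule: infinite_finite_induct) (simp_all add: quot_hom_zero quot_hom_add)

lemma quot_cong_refl: "quot_space S' \<Longrightarrow> quot_cong S S' P P"
  by (simp add: quot_cong_def quot_spaceD)

lemma quot_cong_sym: "quot_space S' \<Longrightarrow> quot_cong S S' P Q \<Longrightarrow> quot_cong S S' Q P"
proof -
  assume "quot_space S'" "quot_cong S S' P Q"
  then have "- (P v - Q v) \<in> snd S'" if "v \<in> fst S" for v
    using that by (intro quot_spaceD(9)) (auto simp: quot_cong_def)
  then show ?thesis by (simp add: quot_cong_def)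
qed

lemma quot_cong_trans: "quot_space S' \<Longrightarrow> quot_cong S S' P Q \<Longrightarrow> quot_cong S S' Q R \<Longrightarrow> quot_cong S S' P R"
proof -
  assume "quot_space S'" "quot_cong S S' P Q" "quot_cong S S' Q R"
  then have "(P v - Q v) + (Q v - R v) \<in> snd S'" if "v \<in> fst S" for v
    using that by (intro quot_spaceD(6)) (auto simp: quot_cong_def)
  then show ?thesis by (simp add: quot_cong_def)
qed

text \<open>\<open>P\<close> must respect null vectors because it is applied to the difference of
  \<open>Q\<close> and \<open>Q'\<close>; the values of \<open>Q'\<close> must lie in the space on
  which \<open>P\<close> and \<open>P'\<close> are compared.\<close>

lemma quot_cong_comp:
  assumes "quot_space S''" "quot_hom S' S'' P" "\<And>v. v \<in> fst S \<Longrightarrow> Q' v \<in> fst S'"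
    and "quot_cong S' S'' P P'" "quot_cong S S' Q Q'"
  shows "quot_cong S S'' (\<lambda>v. P (Q v)) (\<lambda>v. P' (Q' v))"
  unfolding quot_cong_def
proof
  fix v assume v: "v \<in> fst S"
  have "P (Q v) - P' (Q' v) = P (Q v - Q' v) + (P (Q' v) - P' (Q' v))"
    by (simp add: quot_hom_simps[OF assms(2)])
  also have "\<dots> \<in> snd S''"
    using v assms(3-5)
    by (intro quot_spaceD(6)[OF assms(1)] quot_homD(4)[OF assms(2)]) (auto simp: quot_cong_def)
  finally show "P (Q v) - P' (Q' v) \<in> snd S''" .
qed

lemma quot_cong_add:
  "quot_space S' \<Longrightarrow> quot_cong S S' P P' \<Longrightarrow> quot_cong S S' Q Q' \<Longrightarrow> quot_cong S S' (\<lambda>v. P v + Q v) (\<lambda>v. P' v + Q' v)"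
  unfolding quot_cong_def by (simp add: add_diff_add quot_spaceD(6))

lemma quot_cong_scale:
  "quot_space S' \<Longrightarrow> quot_cong S S' P P' \<Longrightarrow> quot_cong S S' (\<lambda>v. c *\<^sub>C P v) (\<lambda>v. c *\<^sub>C P' v)"
  unfolding quot_cong_def by (simp add: cvec.scale_right_diff_distrib[symmetric] quot_spaceD(7)
      del: cvec.scale_right_diff_distrib)

lemma quot_cong_sum:
  "quot_space S' \<Longrightarrow> (\<And>i. i \<in> I \<Longrightarrow> quot_cong S S' (P i) (P' i)) \<Longrightarrow>
    quot_cong S S' (\<lambda>v. \<Sum>i\<in>I. P i v) (\<lambda>v. \<Sum>i\<in>I. P' i v)"
  unfolding quot_cong_def by (simp add: sum_subtractf[symmetric] quot_spaceD(8))

lemma quot_congD: "quot_cong S S' P Q \<Longrightarrow> v \<in> fst S \<Longrightarrow> P v - Q v \<in> snd S'"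
  by (simp add: quot_cong_def)


subsection \<open>Formal power series of operators\<close>

text \<open>\<open>\<star>\<close> composes operators on one space. Products lead from tensor cubes
  to tensor squares and from these to the algebra, so series between different types have to be
  composed as well.\<close>

definition series_comp :: "(nat \<Rightarrow> 'v \<Rightarrow> 'w::comm_monoid_add) \<Rightarrow> (nat \<Rightarrow> 'u \<Rightarrow> 'v) \<Rightarrow> nat \<Rightarrow> 'u \<Rightarrow> 'w"
    (infixr "\<odot>" 70) where
  "(P \<odot> Q) n v = (\<Sum>i\<le>n. P i (Q (n - i) v))"

lemma op_mult_eq_series_comp: "P \<star> Q = P \<odot> Q"
  by (intro ext) (simp add: op_mult_def series_comp_def)

text \<open>Linearity of \<open>P\<close> moves it through the inner sum; the rest is
  reindexing.\<close>

lemma series_comp_assoc: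
  assumes "\<And>n. quot_hom S S' (P n)"
  shows "(P \<odot> Q) \<odot> R = P \<odot> (Q \<odot> R)"
proof (intro ext)
  fix n v
  have "((P \<odot> Q) \<odot> R) n v = (\<Sum>k\<le>n. \<Sum>i\<le>k. P i (Q (k - i) (R (n - k) v)))"
    by (simp add: series_comp_def)
  also have "\<dots> = (\<Sum>i\<le>n. \<Sum>j\<le>n - i. P i (Q j (R (n - i - j) v)))"
    unfolding sum.Sigma[OF finite_atMost ballI[OF finite_atMost]]
    by (rule sum.reindex_bij_witness[where i = "\<lambda>(i, j). (i + j, i)" and j = "\<lambda>(k, i). (i, k - i)"]) auto
  also have "\<dots> = (P \<odot> (Q \<odot> R)) n v"
    by (simp add: series_comp_def quot_hom_simps[OF assms])
  finally show "((P \<odot> Q) \<odot> R) n v = (P \<odot> (Q \<odot> R)) n v" .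
qed

lemma quot_hom_series_comp:
  assumes "quot_space S''" "\<And>n. quot_hom S' S'' (P n)" "\<And>n. quot_hom S S' (Q n)"
  shows "quot_hom S S'' ((P \<odot> Q) n)"
  unfolding series_comp_def[abs_def]
  by (intro quot_hom_sum assms(1) quot_hom_comp[OF assms(2,3)])

lemma quot_cong_series_comp:
  assumes "quot_space S''" "\<And>n. quot_hom S' S'' (P n)" "\<And>n v. v \<in> fst S \<Longrightarrow> Q' n v \<in> fst S'"
    and "\<And>n. quot_cong S' S'' (P n) (P' n)" "\<And>n. quot_cong S S' (Q n) (Q' n)"
  shows "quot_cong S S'' ((P \<odot> Q) n) ((P' \<odot> Q') n)"
  unfolding series_comp_def[abs_def]
proof (rule quot_cong_sum[OF assms(1)])
  fix i
  show "quot_cong S S'' (\<lambda>v. P i (Q (n - i) v)) (\<lambda>v. P' i (Q' (n - i) v))"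
    by (rule quot_cong_comp[OF assms(1,2) assms(3) assms(4,5)])
qed

text \<open>\<open>M\<close> carries \<open>P\<close> to \<open>P'\<close> up to null vectors. The
  conditions on the two operators differ because in a composition \<open>P'\<close> is applied to
  the error left by the previous operator, whereas \<open>P\<close> has to keep vectors inside the
  space.\<close>

definition intertwines ::
  "'v::complex_vector set \<times> 'v set \<Rightarrow> 'w::complex_vector set \<times> 'w set \<Rightarrow> ('v \<Rightarrow> 'w) \<Rightarrow> ('v \<Rightarrow> 'v) \<Rightarrow> ('w \<Rightarrow> 'w) \<Rightarrow> bool" where
  "intertwines S S' M P P' \<longleftrightarrow> (\<forall>v\<in>fst S. P v \<in> fst S) \<and> quot_hom S' S' P' \<and>
     quot_cong S S' (\<lambda>v. M (P v)) (\<lambda>v. P' (M v))"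

lemma intertwines_id: "quot_space S' \<Longrightarrow> intertwines S S' M (\<lambda>v. v) (\<lambda>v. v)"
  by (simp add: intertwines_def quot_hom_id quot_cong_refl)

lemma intertwines_comp:
  assumes "quot_space S'" "intertwines S S' M P P'" "intertwines S S' M Q Q'"
  shows "intertwines S S' M (\<lambda>v. P (Q v)) (\<lambda>v. P' (Q' v))"
proof -
  have "M (P (Q v)) - P' (Q' (M v)) \<in> snd S'" if "v \<in> fst S" for v
  proof -
    have hom: "quot_hom S' S' P'" and Qv: "Q v \<in> fst S"
      using assms that by (auto simp: intertwines_def)
    have "M (P (Q v)) - P' (Q' (M v)) = (M (P (Q v)) - P' (M (Q v))) + P' (M (Q v) - Q' (M v))"
      by (simp add: quot_hom_simps[OF hom])
    also have "\<dots> \<in> snd S'"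
      using assms(2,3) Qv that
      by (intro quot_spaceD(6)[OF assms(1)] quot_homD(4)[OF hom]) (auto simp: intertwines_def quot_cong_def)
    finally show ?thesis .
  qed
  then show ?thesis
    using assms by (auto simp: intertwines_def quot_cong_def intro: quot_hom_comp)
qed

lemma intertwines_scale:
  assumes "quot_space S" "quot_space S'" "quot_hom S S' M" "intertwines S S' M P P'"
  shows "intertwines S S' M (\<lambda>v. c *\<^sub>C P v) (\<lambda>v. c *\<^sub>C P' v)"
  unfolding intertwines_def quot_homD(2)[OF assms(3)]
  using assms(4) unfolding intertwines_def
  by (intro conjI ballI quot_hom_scale[OF assms(2)] quot_cong_scale[OF assms(2)] quot_spaceD(3)[OF assms(1)]) simp_all

lemma intertwines_sum:
  assumes "quot_space S" "quot_space S'" "quot_hom S S' M" "\<And>i. i \<in> I \<Longrightarrow> intertwines S S' M (P i) (P' i)"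
  shows "intertwines S S' M (\<lambda>v. \<Sum>i\<in>I. P i v) (\<lambda>v. \<Sum>i\<in>I. P' i v)"
  unfolding intertwines_def quot_hom_simps(4)[OF assms(3)]
  using assms(4) unfolding intertwines_def
  by (intro conjI ballI quot_hom_sum[OF assms(2)] quot_cong_sum[OF assms(2)] quot_spaceD(4)[OF assms(1)]) simp_all

lemma intertwines_word_op:
  assumes "quot_space S'" "intertwines S S' M P P'" "intertwines S S' M Q Q'"
  shows "intertwines S S' M (word_op P Q w) (word_op P' Q' w)"
proof (induction w)
  case Nil
  then show ?case using intertwines_id[OF assms(1)] by (simp add: id_def)
next
  case (Cons l w)
  then show ?case
    using intertwines_comp[OF assms(1)] assms(2,3) by (cases l) (simp_all add: comp_def)
qed

lemma intertwines_nc_eval: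
  assumes "quot_space S" "quot_space S'" "quot_hom S S' M" "intertwines S S' M P P'" "intertwines S S' M Q Q'"
  shows "intertwines S S' M (nc_eval f P Q n) (nc_eval f P' Q' n)"
  unfolding nc_eval_def[abs_def]
  by (rule intertwines_sum[OF assms(1-3)], rule intertwines_scale[OF assms(1-3)],
      rule intertwines_word_op[OF assms(2,4,5)])

lemma intertwines_exp_half:
  assumes "quot_space S" "quot_space S'" "quot_hom S S' M" "intertwines S S' M P P'"
  shows "intertwines S S' M (exp_half P n) (exp_half P' n)"
proof -
  have "intertwines S S' M (P ^^ n) (P' ^^ n)" for n
  proof (induction n)
    case 0
    then show ?case using intertwines_id[OF assms(2)] by (simp add: id_def)
  next
    case (Suc n)
    then show ?case using intertwines_comp[OF assms(2,4)] by (simp add: comp_def)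
  qed
  from intertwines_scale[OF assms(1-3) this] show ?thesis
    unfolding exp_half_def[abs_def] .
qed

lemma intertwines_op_mult:
  assumes "quot_space S" "quot_space S'" "quot_hom S S' M"
    "\<And>n. intertwines S S' M (P n) (P' n)" "\<And>n. intertwines S S' M (Q n) (Q' n)"
  shows "intertwines S S' M ((P \<star> Q) n) ((P' \<star> Q') n)"
  unfolding op_mult_def[abs_def]
  by (rule intertwines_sum[OF assms(1-3)]) (rule intertwines_comp[OF assms(2,4,5)])

text \<open>The element \<open>J\<close> of the fusion with its four slots replaced by blocks of slots:\<close>

definition fusion_op ::
  "ncseries \<Rightarrow> (nat set \<Rightarrow> nat set \<Rightarrow> 'v \<Rightarrow> 'v) \<Rightarrow> nat set \<Rightarrow> nat set \<Rightarrow> nat set \<Rightarrow> nat set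
    \<Rightarrow> 'v::complex_vector opseries" where
  "fusion_op \<Phi> \<tau> A B C D = placed (nc_inverse \<Phi>) \<tau> A C (B \<union> D) \<star> placed \<Phi> \<tau> C B D \<star> exp_half (\<tau> B C)
     \<star> placed (nc_inverse \<Phi>) \<tau> B C D \<star> placed \<Phi> \<tau> A B (C \<union> D)"

lemma fusion_J_eq: "fusion_J \<Phi> t \<rho> = fusion_op \<Phi> (t_action t (fusion_slots \<rho>)) {1} {2} {3} {4}"
  by (simp only: fusion_J_def fusion_op_def Let_def Un_insert_left Un_empty_left)

text \<open>\<open>h\<close> sends a set of slots of the target to the block of slots of the source
  that it stands for; it respects unions because \<open>J\<close> contains the sets
  \<open>B \<union> D\<close> and \<open>C \<union> D\<close>.\<close>

lemma intertwines_fusion_op: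
  assumes "quot_space S" "quot_space S'" "quot_hom S S' M"
    and "\<And>I K. (I, K) \<in> {(A, C), (C, B \<union> D), (C, B), (B, D), (B, C), (C, D), (A, B), (B, C \<union> D)} \<Longrightarrow>
      intertwines S S' M (\<tau> (h I) (h K)) (\<tau>' I K)"
    and h: "\<And>I K. h (I \<union> K) = h I \<union> h K"
  shows "intertwines S S' M (fusion_op \<Phi> \<tau> (h A) (h B) (h C) (h D) n) (fusion_op \<Phi> \<tau>' A B C D n)"
  unfolding fusion_op_def placed_def h[symmetric]
  by (intro intertwines_op_mult[OF assms(1-3)] intertwines_nc_eval[OF assms(1-3)]
      intertwines_exp_half[OF assms(1-3)] assms(4)) simp_all

lemma intertwines_hom:
  assumes "quot_space S" "quot_hom S S P"
  shows "intertwines S S (\<lambda>v. v) P P"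
  using assms by (simp add: intertwines_def quot_cong_refl quot_homD)

lemma quot_hom_nc_eval:
  assumes "quot_space S" "quot_hom S S P" "quot_hom S S Q"
  shows "quot_hom S S (nc_eval f P Q n)"
  using intertwines_nc_eval[OF assms(1,1) quot_hom_id intertwines_hom[OF assms(1,2)] intertwines_hom[OF assms(1,3)]]
  by (simp add: intertwines_def)

lemma quot_hom_exp_half:
  assumes "quot_space S" "quot_hom S S P"
  shows "quot_hom S S (exp_half P n)"
  using intertwines_exp_half[OF assms(1,1) quot_hom_id intertwines_hom[OF assms]]
  by (simp add: intertwines_def)

lemma quot_hom_op_mult:
  assumes "quot_space S" "\<And>n. quot_hom S S (P n)" "\<And>n. quot_hom S S (Q n)"
  shows "quot_hom S S ((P \<star> Q) n)"
  unfolding op_mult_eq_series_comp by (rule quot_hom_series_comp) (fact assms)+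

section \<open>Linear maps on formal linear combinations\<close>

lemma poly_mapping_sum_singles: "F = (\<Sum>k\<in>Poly_Mapping.keys F. Poly_Mapping.single k (Poly_Mapping.lookup F k))"
  by (rule poly_mapping_eqI) (auto simp: lookup_sum lookup_single when_def in_keys_iff)

lemma poly_mapping_additive_induct [case_names zero single add]:
  fixes F :: "'k \<Rightarrow>\<^sub>0 'c::comm_monoid_add"
  assumes "P 0" "\<And>k c. k \<in> Poly_Mapping.keys F \<Longrightarrow> P (Poly_Mapping.single k c)"
    "\<And>x y. P x \<Longrightarrow> P y \<Longrightarrow> P (x + y)"
  shows "P F"
proof -
  have "P (\<Sum>k\<in>K. Poly_Mapping.single k (Poly_Mapping.lookup F k))" if "K \<subseteq> Poly_Mapping.keys F" for K
    using that assms by (induction K rule: infinite_finite_induct) auto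
  then show ?thesis
    using poly_mapping_sum_singles[of F] by force
qed

lemma teval_superset:
  assumes "finite K" "Poly_Mapping.keys F \<subseteq> K"
  shows "teval f F = (\<Sum>k\<in>K. Poly_Mapping.lookup F k *\<^sub>C f k)"
  unfolding teval_def using assms by (intro sum.mono_neutral_left) (auto simp: in_keys_iff)

lemma teval_zero [simp]: "teval f 0 = 0"
  by (simp add: teval_def)

lemma teval_single [simp]: "teval f (Poly_Mapping.single k c) = c *\<^sub>C f k"
  by (cases "c = 0") (simp_all add: teval_def)

lemma teval_add: "teval f (F + G) = teval f F + teval f G"
proof -
  let ?K = "Poly_Mapping.keys F \<union> Poly_Mapping.keys G"
  have "teval f (F + G) = (\<Sum>k\<in>?K. Poly_Mapping.lookup (F + G) k *\<^sub>C f k)"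
    using Poly_Mapping.keys_add[of F G] by (intro teval_superset) auto
  then show ?thesis
    by (simp add: teval_superset[of ?K] lookup_add scaleC_add_left sum.distrib)
qed

lemma teval_scale: "teval f (c *\<^sub>C F) = c *\<^sub>C teval f F"
proof -
  have "Poly_Mapping.keys (c *\<^sub>C F) \<subseteq> Poly_Mapping.keys F"
    by (auto simp: in_keys_iff lookup_scaleC)
  then have "teval f (c *\<^sub>C F) = (\<Sum>k\<in>Poly_Mapping.keys F. Poly_Mapping.lookup (c *\<^sub>C F) k *\<^sub>C f k)"
    by (intro teval_superset) auto
  then show ?thesis
    by (simp add: teval_def lookup_scaleC cvec.scale_sum_right scaleC_complex_def)
qed

lemma teval_hom: "quot_hom (UNIV, {0}) (UNIV, {0}) (teval f)"
  by (simp add: quot_hom_def teval_add teval_scale)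

lemmas teval_simps = quot_hom_simps[OF teval_hom]

text \<open>Makes \<open>push\<close> an instance of \<open>teval\<close>, so that linearity is
  proved once.\<close>

lemma push_eq_teval: "push f = teval (\<lambda>k. tensor (f k))"
proof (intro ext poly_mapping_eqI)
  fix F k
  have "c *\<^sub>C tensor k' = Poly_Mapping.single k' c" for c and k' :: 'b
    by (rule poly_mapping_eqI) (simp add: lookup_scaleC lookup_single when_def scaleC_complex_def)
  then show "Poly_Mapping.lookup (push f F) k = Poly_Mapping.lookup (teval (\<lambda>k. tensor (f k)) F) k"
    by (simp add: push_def teval_def)
qed

lemma scaleC_single: "c *\<^sub>C Poly_Mapping.single k a = Poly_Mapping.single k (c * a)"
  for a c :: complex
  by (rule poly_mapping_eqI) (simp add: lookup_scaleC lookup_single when_def scaleC_complex_def)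

lemma push_hom: "quot_hom (UNIV, {0}) (UNIV, {0}) (push f)"
  unfolding push_eq_teval by (rule teval_hom)

lemmas push_simps = quot_hom_simps[OF push_hom] quot_homD(1,2)[OF push_hom]

lemma push_single [simp]: "push f (Poly_Mapping.single k c) = Poly_Mapping.single (f k) c"
  by (simp add: push_eq_teval scaleC_single)

lemma linear_eqI:
  fixes F :: "'k \<Rightarrow>\<^sub>0 complex"
  assumes "quot_hom S S' P" "quot_hom T T' Q" "\<And>k. k \<in> Poly_Mapping.keys F \<Longrightarrow> P (tensor k) = Q (tensor k)"
  shows "P F = Q F"
proof (induction F rule: poly_mapping_additive_induct)
  case (single k c)
  have "Poly_Mapping.single k c = c *\<^sub>C tensor k" by (simp add: scaleC_single)
  then show ?case using assms(3)[OF single] quot_homD(2)[OF assms(1)] quot_homD(2)[OF assms(2)] by simp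
qed (simp_all add: quot_hom_simps[OF assms(1)] quot_hom_simps[OF assms(2)] quot_homD(1)[OF assms(1)] quot_homD(1)[OF assms(2)])

lemma hom_compUNIV: "quot_hom (UNIV, {0}) (UNIV, {0}) P \<Longrightarrow> quot_hom (UNIV, {0}) (UNIV, {0}) Q \<Longrightarrow>
  quot_hom (UNIV, {0}) (UNIV, {0}) (\<lambda>x. P (Q x))"
  by (rule quot_hom_comp)

lemma teval_push: "teval f (push g F) = teval (\<lambda>k. f (g k)) F"
  by (rule linear_eqI[OF hom_compUNIV[OF teval_hom push_hom] teval_hom]) simp

lemma teval_cong: "(\<And>k. k \<in> Poly_Mapping.keys F \<Longrightarrow> f k = g k) \<Longrightarrow> teval f F = teval g F"
  by (simp add: teval_def)

lemma teval_add_fun: "teval (\<lambda>k. f k + g k) F = teval f F + teval g F"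
  by (simp add: teval_def scaleC_add_right sum.distrib)

lemma teval_diff_fun: "teval (\<lambda>k. f k - g k) F = teval f F - teval g F"
  by (simp add: teval_def cvec.scale_right_diff_distrib sum_subtractf)

lemma teval_hom_fun: "quot_hom S S' M \<Longrightarrow> M (teval f F) = teval (\<lambda>k. M (f k)) F"
  by (simp add: teval_def quot_hom_simps quot_homD)

lemma keys_push: "Poly_Mapping.keys (push f F) \<subseteq> f ` Poly_Mapping.keys F"
proof -
  have "Poly_Mapping.keys (\<Sum>k\<in>K. Poly_Mapping.single (f k) (Poly_Mapping.lookup F k)) \<subseteq> f ` K" if "finite K" for K
    using that
  proof (induction K)
    case (insert k K)
    then show ?case
      using Poly_Mapping.keys_add[of "Poly_Mapping.single (f k) (Poly_Mapping.lookup F k)"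
        "\<Sum>k\<in>K. Poly_Mapping.single (f k) (Poly_Mapping.lookup F k)"]
      by (auto split: if_splits)
  qed simp
  then show ?thesis by (simp add: push_def)
qed


section \<open>The infinitesimal braid algebra\<close>

instance complex :: complex_algebra
  by standard (simp_all add: scaleC_complex_def)

instance poly_mapping :: (monoid_add, complex_algebra) complex_algebra
proof
  fix c and x y :: "'a \<Rightarrow>\<^sub>0 'b"
  \<comment> \<open>Scalars act as multiplication by the central element \<open>?c\<close>, so both
    laws reduce to associativity.\<close>
  let ?c = "Poly_Mapping.single 0 (c *\<^sub>C 1) :: 'a \<Rightarrow>\<^sub>0 'b"
  have scale: "c *\<^sub>C z = ?c * z" for z :: "'a \<Rightarrow>\<^sub>0 'b"
  proof -
    have "?c * z = Poly_Mapping.map ((*) (c *\<^sub>C 1)) z"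
      by (simp add: mult_map_scale_conv_mult)
    also have "\<dots> = c *\<^sub>C z"
      by (rule poly_mapping_eqI) (simp add: lookup_scaleC Poly_Mapping.map.rep_eq when_def mult_scaleC_left)
    finally show ?thesis by simp
  qed
  have central: "z * ?c = ?c * z" for z :: "'a \<Rightarrow>\<^sub>0 'b"
    by (induction z rule: poly_mapping_additive_induct)
      (simp_all add: mult_single mult_scaleC_left mult_scaleC_right distrib_left distrib_right)
  show "(c *\<^sub>C x) * y = c *\<^sub>C (x * y)"
    by (simp add: scale mult.assoc)
  show "x * (c *\<^sub>C y) = c *\<^sub>C (x * y)"
    by (simp add: scale mult.assoc[symmetric] central)
qed

text \<open>
  Words in generators labelled by pairs of strands. The relations identify the generators of
  \<open>(i, j)\<close> and \<open>(j, i)\<close>.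
\<close>

datatype strand_word = Strand_Word (letters: "(nat \<times> nat) list")

text \<open>Concatenation is written additively because the product of \<open>poly_mapping\<close>
  is convolution along \<open>+\<close>; the resulting ring is the free algebra.\<close>

instantiation strand_word :: monoid_add
begin
definition "0 = Strand_Word []"
definition "u + v = Strand_Word (letters u @ letters v)"
instance
  by standard (simp_all add: zero_strand_word_def plus_strand_word_def)
end

type_synonym free_braid = "strand_word \<Rightarrow>\<^sub>0 complex"

definition chord :: "nat \<Rightarrow> nat \<Rightarrow> free_braid" where
  "chord i j = tensor (Strand_Word [(i, j)])"

text \<open>Strands are arbitrary natural numbers, so one algebra contains every choice of blocks,
  including the strands for \<open>\<hh>\<close>.\<close>

definition chord_relations :: "free_braid set" where
  "chord_relations = {chord i j - chord j i | i j. True} \<union>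
     {chord i j * chord k l - chord k l * chord i j | i j k l. distinct [i, j, k, l]} \<union>
     {chord i j * (chord i k + chord j k) - (chord i k + chord j k) * chord i j | i j k. distinct [i, j, k]}"

text \<open>The two-sided ideal as an inductive set, which gives rule induction for its action on a
  space. Closure under scalars comes from left multiplication by multiples of 1.\<close>

inductive_set chord_ideal :: "free_braid set" where
  zero: "0 \<in> chord_ideal"
| add: "x \<in> chord_ideal \<Longrightarrow> y \<in> chord_ideal \<Longrightarrow> x + y \<in> chord_ideal"
| rel: "x \<in> chord_relations \<Longrightarrow> x \<in> chord_ideal"
| mult_left: "x \<in> chord_ideal \<Longrightarrow> a * x \<in> chord_ideal"
| mult_right: "x \<in> chord_ideal \<Longrightarrow> x * a \<in> chord_ideal"

lemma chord_ideal_uminus: "x \<in> chord_ideal \<Longrightarrow> - x \<in> chord_ideal"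
  using chord_ideal.mult_left[of x "- 1"] by simp

lemma chord_ideal_diff: "x \<in> chord_ideal \<Longrightarrow> y \<in> chord_ideal \<Longrightarrow> x - y \<in> chord_ideal"
  using chord_ideal.add[OF _ chord_ideal_uminus, of x y] by simp

lemma chord_ideal_scale: "x \<in> chord_ideal \<Longrightarrow> c *\<^sub>C x \<in> chord_ideal"
  using chord_ideal.mult_left[of x "c *\<^sub>C 1"] by (simp add: mult_scaleC_left)

definition word_action :: "(nat \<times> nat \<Rightarrow> 'v \<Rightarrow> 'v) \<Rightarrow> free_braid \<Rightarrow> 'v \<Rightarrow> 'v::complex_vector" where
  "word_action r F v = teval (\<lambda>w. foldr r (letters w) v) F"

definition braid_rep :: "'v::complex_vector set \<times> 'v set \<Rightarrow> (nat \<times> nat \<Rightarrow> 'v \<Rightarrow> 'v) \<Rightarrow> bool" where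
  "braid_rep S r \<longleftrightarrow> quot_space S \<and> (\<forall>g. quot_hom S S (r g)) \<and>
     (\<forall>i j. quot_cong S S (r (i, j)) (r (j, i))) \<and>
     (\<forall>i j k l. distinct [i, j, k, l] \<longrightarrow> quot_cong S S (\<lambda>v. r (i, j) (r (k, l) v)) (\<lambda>v. r (k, l) (r (i, j) v))) \<and>
     (\<forall>i j k. distinct [i, j, k] \<longrightarrow>
        quot_cong S S (\<lambda>v. r (i, j) (r (i, k) v + r (j, k) v)) (\<lambda>v. r (i, k) (r (i, j) v) + r (j, k) (r (i, j) v)))"

lemma word_action_simps:
  "word_action r 0 v = 0"
  "word_action r (F + G) v = word_action r F v + word_action r G v"
  "word_action r (F - G) v = word_action r F v - word_action r G v"
  "word_action r (c *\<^sub>C F) v = c *\<^sub>C word_action r F v"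
  "word_action r (\<Sum>i\<in>I. f i) v = (\<Sum>i\<in>I. word_action r (f i) v)"
  "word_action r (chord i j) v = r (i, j) v"
  "word_action r 1 v = v"
  by (simp_all add: word_action_def teval_simps teval_add teval_scale chord_def scaleC_one
      single_one[symmetric] zero_strand_word_def del: single_one)

lemma quot_hom_word_action:
  assumes "quot_space S" "\<And>g. quot_hom S S (r g)"
  shows "quot_hom S S (word_action r F)"
proof -
  have "quot_hom S S (\<lambda>v. foldr r w v)" for w
    by (induction w) (auto intro: quot_hom_id quot_hom_comp[OF assms(2)])
  then show ?thesis
    unfolding word_action_def[abs_def] teval_def
    by (intro quot_hom_sum quot_hom_scale assms(1))
qed

lemma word_action_mult:
  assumes "quot_space S" "\<And>g. quot_hom S S (r g)"
  shows "word_action r (F * G) v = word_action r F (word_action r G v)"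
proof (induction F rule: poly_mapping_additive_induct)
  case (single k c)
  show ?case
  proof (induction G rule: poly_mapping_additive_induct)
    case (single k' c')
    have "quot_hom S S (word_action r (Poly_Mapping.single k c))"
      by (rule quot_hom_word_action[OF assms])
    from quot_homD(2)[OF this, of c'] show ?case
      by (simp add: mult_single word_action_def plus_strand_word_def mult.commute)
  qed (simp_all add: word_action_simps distrib_left quot_hom_simps[OF quot_hom_word_action[OF assms]]
      quot_homD(1)[OF quot_hom_word_action[OF assms]])
qed (simp_all add: word_action_simps distrib_right)

text \<open>The relations act by null vectors by definition of \<open>braid_rep\<close>. A left
  factor keeps null vectors null, and a right factor keeps the argument in
  \<open>fst S\<close>.\<close>

lemma word_action_chord_ideal:
  assumes "braid_rep S r" "F \<in> chord_ideal" "v \<in> fst S"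
  shows "word_action r F v \<in> snd S"
proof -
  have S: "quot_space S" and hom: "\<And>g. quot_hom S S (r g)"
    using assms(1) by (auto simp: braid_rep_def)
  note act = quot_hom_word_action[OF S, of r, OF hom] and act_mult = word_action_mult[OF S, of r, OF hom]
  show ?thesis using assms(2,3)
  proof (induction arbitrary: v)
    case (rel x)
    then show ?case
      using assms(1) unfolding chord_relations_def braid_rep_def quot_cong_def
      by (auto simp: word_action_simps act_mult)
  qed (simp_all add: word_action_simps act_mult quot_spaceD[OF S] quot_homD[OF act])
qed

text \<open>Letting all chords act by zero on the complex numbers is a representation in which 1
  acts as the identity. The axiom \<open>0 \<noteq> 1\<close> of \<open>ring_1\<close> rests on
  this.\<close>

lemma one_notin_chord_ideal: "1 \<notin> chord_ideal"
proof
  assume "1 \<in> chord_ideal"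
  moreover have "braid_rep (UNIV, {0}) (\<lambda>g v. 0 :: complex)"
    by (simp add: braid_rep_def quot_space_def quot_cong_def quot_hom_def)
  ultimately have "word_action (\<lambda>g v. 0 :: complex) 1 1 \<in> {0}"
    using word_action_chord_ideal[of "(UNIV, {0})" "\<lambda>g v. 0 :: complex" 1 1] by simp
  then show False by (simp add: word_action_simps)
qed

definition chord_eq :: "free_braid \<Rightarrow> free_braid \<Rightarrow> bool" where
  "chord_eq x y \<longleftrightarrow> x - y \<in> chord_ideal"

quotient_type braid_algebra = free_braid / chord_eq
proof (rule equivpI)
  show "reflp chord_eq" by (simp add: reflp_def chord_eq_def chord_ideal.zero)
  show "symp chord_eq" unfolding symp_def chord_eq_def using chord_ideal_uminus by fastforce
  show "transp chord_eq" unfolding transp_def chord_eq_def using chord_ideal.add by fastforce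
qed

instantiation braid_algebra :: complex_algebra
begin

lift_definition zero_braid_algebra :: braid_algebra is 0 .
lift_definition one_braid_algebra :: braid_algebra is 1 .
lift_definition plus_braid_algebra :: "braid_algebra \<Rightarrow> braid_algebra \<Rightarrow> braid_algebra" is "(+)"
  unfolding chord_eq_def using chord_ideal.add by (metis add_diff_add)
lift_definition minus_braid_algebra :: "braid_algebra \<Rightarrow> braid_algebra \<Rightarrow> braid_algebra" is "(-)"
  unfolding chord_eq_def
proof -
  fix a b c d :: free_braid assume "a - b \<in> chord_ideal" "c - d \<in> chord_ideal"
  then show "a - c - (b - d) \<in> chord_ideal"
    using chord_ideal_diff[of "a - b" "c - d"] by (simp add: algebra_simps)
qed
lift_definition uminus_braid_algebra :: "braid_algebra \<Rightarrow> braid_algebra" is uminus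
  unfolding chord_eq_def
proof -
  fix a b :: free_braid assume "a - b \<in> chord_ideal"
  then show "- a - - b \<in> chord_ideal"
    using chord_ideal_uminus[of "a - b"] by (simp add: algebra_simps)
qed
lift_definition times_braid_algebra :: "braid_algebra \<Rightarrow> braid_algebra \<Rightarrow> braid_algebra" is "(*)"
  unfolding chord_eq_def
proof -
  fix a b c d :: free_braid assume "a - b \<in> chord_ideal" "c - d \<in> chord_ideal"
  then have "(a - b) * c + b * (c - d) \<in> chord_ideal"
    by (intro chord_ideal.add chord_ideal.mult_left chord_ideal.mult_right)
  then show "a * c - b * d \<in> chord_ideal" by (simp add: algebra_simps)
qed
lift_definition scaleC_braid_algebra :: "complex \<Rightarrow> braid_algebra \<Rightarrow> braid_algebra" is scaleC
  unfolding chord_eq_def using chord_ideal_scale by (metis cvec.scale_right_diff_distrib)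

instance
proof
  show "(0 :: braid_algebra) \<noteq> 1"
    by transfer (use one_notin_chord_ideal chord_ideal_uminus in \<open>force simp: chord_eq_def\<close>)
qed (transfer, simp add: chord_eq_def chord_ideal.zero algebra_simps scaleC_add_right scaleC_add_left
      mult_scaleC_left mult_scaleC_right)+

end

lemma abs_braid_simps:
  "abs_braid_algebra 0 = 0" "abs_braid_algebra 1 = 1"
  "abs_braid_algebra (x + y) = abs_braid_algebra x + abs_braid_algebra y"
  "abs_braid_algebra (x - y) = abs_braid_algebra x - abs_braid_algebra y"
  "abs_braid_algebra (x * y) = abs_braid_algebra x * abs_braid_algebra y"
  "abs_braid_algebra (c *\<^sub>C x) = c *\<^sub>C abs_braid_algebra x"
  by (simp_all add: zero_braid_algebra_def one_braid_algebra_def plus_braid_algebra.abs_eq minus_braid_algebra.abs_eq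
      times_braid_algebra.abs_eq scaleC_braid_algebra.abs_eq)

lemma abs_braid_eq_iff: "abs_braid_algebra x = abs_braid_algebra y \<longleftrightarrow> x - y \<in> chord_ideal"
  by (simp add: braid_algebra.abs_eq_iff chord_eq_def)


text \<open>The element \<open>t^{I,K}\<close> of the braid algebra.\<close>

definition block_chord :: "nat set \<Rightarrow> nat set \<Rightarrow> braid_algebra" where
  "block_chord I K = (\<Sum>i\<in>I. \<Sum>k\<in>K. abs_braid_algebra (chord i k))"

lemma chord_sym: "abs_braid_algebra (chord i j) = abs_braid_algebra (chord j i)"
  unfolding abs_braid_eq_iff by (rule chord_ideal.rel) (auto simp: chord_relations_def)

lemma chord_commute:
  assumes "distinct [i, j, k, l]"
  shows "abs_braid_algebra (chord i j) * abs_braid_algebra (chord k l)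
    = abs_braid_algebra (chord k l) * abs_braid_algebra (chord i j)"
  unfolding abs_braid_simps(5)[symmetric] abs_braid_eq_iff
  by (rule chord_ideal.rel) (use assms in \<open>unfold chord_relations_def, blast\<close>)

lemma chord_four_term:
  assumes "distinct [i, j, k]"
  shows "abs_braid_algebra (chord i j) * (abs_braid_algebra (chord i k) + abs_braid_algebra (chord j k))
    = (abs_braid_algebra (chord i k) + abs_braid_algebra (chord j k)) * abs_braid_algebra (chord i j)"
  unfolding abs_braid_simps(3,5)[symmetric] abs_braid_eq_iff
  by (rule chord_ideal.rel) (use assms in \<open>unfold chord_relations_def, blast\<close>)

lemma block_chord_sym: "block_chord I K = block_chord K I"
  unfolding block_chord_def by (subst sum.swap, intro sum.cong refl chord_sym)

lemma block_chord_Un_left: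
  "finite I \<Longrightarrow> finite J \<Longrightarrow> I \<inter> J = {} \<Longrightarrow> block_chord (I \<union> J) K = block_chord I K + block_chord J K"
  by (simp add: block_chord_def sum.union_disjoint)

lemma block_chord_Un_right:
  "finite I \<Longrightarrow> finite J \<Longrightarrow> I \<inter> J = {} \<Longrightarrow> block_chord K (I \<union> J) = block_chord K I + block_chord K J"
  by (simp add: block_chord_sym[of K] block_chord_Un_left)

lemma sum_mult_commute:
  fixes x :: "'r::ring_1"
  assumes "\<And>i. i \<in> I \<Longrightarrow> f i * x = x * f i"
  shows "(\<Sum>i\<in>I. f i) * x = x * (\<Sum>i\<in>I. f i)"
  using assms by (simp add: sum_distrib_left sum_distrib_right)

lemma block_chord_commute_disjoint:
  assumes "I \<inter> J = {}" "K \<inter> L = {}" "(I \<union> J) \<inter> (K \<union> L) = {}"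
  shows "block_chord I J * block_chord K L = block_chord K L * block_chord I J"
proof -
  have "abs_braid_algebra (chord i j) * block_chord K L = block_chord K L * abs_braid_algebra (chord i j)"
    if "i \<in> I" "j \<in> J" for i j
    unfolding block_chord_def
    by (rule sym, rule sum_mult_commute, rule sum_mult_commute, rule chord_commute) (use that assms in auto)
  then show ?thesis
    unfolding block_chord_def[of I J] by (intro sum_mult_commute) simp
qed

text \<open>The four-term relation for blocks: a chord inside \<open>U\<close> commutes with all chords between \<open>U\<close> and \<open>K\<close> together.\<close>

lemma block_chord_commute_inside:
  assumes "finite U" "I \<inter> J = {}" "I \<union> J \<subseteq> U" "U \<inter> K = {}"
  shows "block_chord I J * block_chord U K = block_chord U K * block_chord I J"
proof -
  have "block_chord U K * abs_braid_algebra (chord i j) = abs_braid_algebra (chord i j) * block_chord U K"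
    if ij: "i \<in> I" "j \<in> J" for i j
  proof -
    let ?x = "abs_braid_algebra (chord i j)"
    have "(\<Sum>u\<in>U. abs_braid_algebra (chord u k)) * ?x = ?x * (\<Sum>u\<in>U. abs_braid_algebra (chord u k))"
      if k: "k \<in> K" for k
    proof -
      let ?U = "U - {i, j}"
      have ne: "i \<noteq> j" "i \<noteq> k" "j \<noteq> k" "{i, j} \<subseteq> U"
        using ij k assms by auto
      \<comment> \<open>The endpoints of the chord satisfy a four-term relation with
        \<open>k\<close>; chords from the other strands of \<open>U\<close> to \<open>k\<close>
        commute with the given chord by disjointness.\<close>
      have "(\<Sum>u\<in>U. abs_braid_algebra (chord u k)) = (\<Sum>u\<in>{i, j}. abs_braid_algebra (chord u k))
          + (\<Sum>u\<in>?U. abs_braid_algebra (chord u k))"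
        using sum.subset_diff[OF ne(4) assms(1)] by (simp only: add.commute)
      moreover have "(\<Sum>u\<in>?U. abs_braid_algebra (chord u k)) * ?x = ?x * (\<Sum>u\<in>?U. abs_braid_algebra (chord u k))"
        by (rule sum_mult_commute, rule chord_commute) (use ne k assms in auto)
      ultimately show ?thesis
        using chord_four_term[of i j k] ne by (simp add: distrib_left distrib_right)
    qed
    moreover have "block_chord U K = (\<Sum>k\<in>K. \<Sum>u\<in>U. abs_braid_algebra (chord u k))"
      unfolding block_chord_def by (rule sum.swap)
    ultimately show ?thesis
      by (simp only: sum_mult_commute)
  qed
  then show ?thesis
    unfolding block_chord_def[of I J] by (intro sum_mult_commute) simp
qed

text \<open>The case of \<open>K\<close> follows from that of \<open>I\<close> by symmetry of
  \<open>block_chord\<close>.\<close>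

lemma block_chord_commute:
  assumes "finite I" "finite K" "I \<inter> K = {}" "P \<inter> Q = {}"
    "P \<union> Q \<subseteq> I \<or> P \<union> Q \<subseteq> K \<or> (P \<union> Q) \<inter> (I \<union> K) = {}"
  shows "block_chord P Q * block_chord I K = block_chord I K * block_chord P Q"
  using assms(5)
proof (elim disjE)
  assume "P \<union> Q \<subseteq> K"
  then show ?thesis
    using block_chord_commute_inside[of K P Q I] assms(1-4) by (simp add: block_chord_sym[of I] Int_commute)
qed (use assms block_chord_commute_inside[of I P Q K] block_chord_commute_disjoint in auto)


subsection \<open>Associators in the infinitesimal braid algebra\<close>

text \<open>Translates operator series into elements of an algebra: left multiplications compose
  like their multipliers.\<close>

lemma nc_eval_left_mult: "nc_eval f ((*) p) ((*) q) n = (*) (nc_series f p q $ n)"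
proof
  fix x
  have "word_op ((*) p) ((*) q) w x = word_prod p q w * x" for w
  proof (induction w)
    case (Cons l w)
    then show ?case by (cases l) (simp_all add: mult.assoc)
  qed simp
  then show "nc_eval f ((*) p) ((*) q) n x = nc_series f p q $ n * x"
    by (simp add: nc_eval_def nc_series_def sum_distrib_right mult_scaleC_left)
qed

lemma exp_half_left_mult: "exp_half ((*) p) n = (*) (exp_half_series p $ n)"
proof
  fix x
  have "((*) p ^^ k) x = p ^ k * x" for k
    by (induction k) (simp_all add: mult.assoc)
  then show "exp_half ((*) p) n x = exp_half_series p $ n * x"
    by (simp add: exp_half_def exp_half_series_def mult_scaleC_left)
qed

lemma op_mult_left_mult: "((\<lambda>n. (*) (X $ n)) \<star> (\<lambda>n. (*) (Y $ n))) n = (*) ((X * Y) $ n)"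
  for X Y :: "'r::complex_algebra fps"
  by (rule ext) (simp add: op_mult_def fps_mult_nth sum_distrib_right mult.assoc atLeast0AtMost)

lemma quot_space_UNIV: "quot_space (UNIV, {0})"
  by (simp add: quot_space_def cvec.subspace_def)

lemma quot_hom_left_mult: "quot_hom (UNIV, {0}) (UNIV, {0}) ((*) p)"
  for p :: "'r::complex_algebra"
  by (simp add: quot_hom_def distrib_left mult_scaleC_right)

text \<open>The algebra homomorphism out of the free algebra of \<open>braid_ideal\<close> with
  prescribed values on the generators.\<close>

definition word_eval :: "(nat set \<Rightarrow> 'r) \<Rightarrow> (nat set list \<Rightarrow>\<^sub>0 complex) \<Rightarrow> 'r::complex_algebra" where
  "word_eval c = teval (\<lambda>w. prod_list (map c w))"

abbreviation word_intertwines ::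
  "(nat set \<Rightarrow> 'r) \<Rightarrow> (nat set list \<Rightarrow>\<^sub>0 complex) opseries \<Rightarrow> 'r::complex_algebra fps \<Rightarrow> bool" where
  "word_intertwines c P X \<equiv>
     \<forall>n. intertwines (UNIV, {0}) (UNIV, {0}) (word_eval c) (P n) ((*) (X $ n))"

lemma word_eval_hom: "quot_hom (UNIV, {0}) (UNIV, {0}) (word_eval c)"
  unfolding word_eval_def by (rule teval_hom)

lemma word_eval_push: "word_eval c (push (\<lambda>w. u @ w @ v) F) = prod_list (map c u) * word_eval c F * prod_list (map c v)"
proof -
  have "quot_hom (UNIV, {0}) (UNIV, {0}) (\<lambda>x. prod_list (map c u) * x * prod_list (map c v))"
    by (simp add: quot_hom_def distrib_left distrib_right mult_scaleC_left mult_scaleC_right)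
  from teval_hom_fun[OF this, of "\<lambda>w. prod_list (map c w)" F] show ?thesis
    by (simp add: word_eval_def teval_push mult.assoc)
qed

lemma word_eval_braid_t:
  "word_eval c (braid_t I K F) = (\<Sum>i\<in>I. \<Sum>k\<in>K. c {i, k}) * word_eval c F"
proof -
  have "word_eval c (push ((#) {i, k}) F) = c {i, k} * word_eval c F" for i k
    using word_eval_push[of c "[{i, k}]" "[]" F] by simp
  then show ?thesis
    by (simp add: braid_t_def quot_hom_simps[OF word_eval_hom] sum_distrib_right)
qed

lemma word_intertwines_nc_eval:
  "word_intertwines c (placed f braid_t I K L)
     (nc_series f (\<Sum>i\<in>I. \<Sum>k\<in>K. c {i, k}) (\<Sum>k\<in>K. \<Sum>l\<in>L. c {k, l}))"
proof
  fix n
  have *: "intertwines (UNIV, {0}) (UNIV, {0}) (word_eval c) (braid_t I K) ((*) (\<Sum>i\<in>I. \<Sum>k\<in>K. c {i, k}))" for I K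
    by (simp add: intertwines_def quot_hom_left_mult quot_cong_def word_eval_braid_t)
  show "intertwines (UNIV, {0}) (UNIV, {0}) (word_eval c) (placed f braid_t I K L n)
      ((*) (nc_series f (\<Sum>i\<in>I. \<Sum>k\<in>K. c {i, k}) (\<Sum>k\<in>K. \<Sum>l\<in>L. c {k, l}) $ n))"
    unfolding placed_def nc_eval_left_mult[symmetric]
    by (rule intertwines_nc_eval[OF quot_space_UNIV quot_space_UNIV word_eval_hom * *])
qed

lemma word_intertwines_exp_half:
  "word_intertwines c (exp_half (braid_t I K)) (exp_half_series (\<Sum>i\<in>I. \<Sum>k\<in>K. c {i, k}))"
proof
  fix n
  have *: "intertwines (UNIV, {0}) (UNIV, {0}) (word_eval c) (braid_t I K) ((*) (\<Sum>i\<in>I. \<Sum>k\<in>K. c {i, k}))"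
    by (simp add: intertwines_def quot_hom_left_mult quot_cong_def word_eval_braid_t)
  show "intertwines (UNIV, {0}) (UNIV, {0}) (word_eval c) (exp_half (braid_t I K) n)
      ((*) (exp_half_series (\<Sum>i\<in>I. \<Sum>k\<in>K. c {i, k}) $ n))"
    unfolding exp_half_left_mult[symmetric]
    by (rule intertwines_exp_half[OF quot_space_UNIV quot_space_UNIV word_eval_hom *])
qed

lemma word_intertwines_op_mult:
  assumes "word_intertwines c P X" "word_intertwines c Q Y"
  shows "word_intertwines c (P \<star> Q) (X * Y)"
proof
  fix n
  show "intertwines (UNIV, {0}) (UNIV, {0}) (word_eval c) ((P \<star> Q) n) ((*) ((X * Y) $ n))"
    unfolding op_mult_left_mult[symmetric]
    by (rule intertwines_op_mult[OF quot_space_UNIV quot_space_UNIV word_eval_hom]) (use assms in auto)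
qed

text \<open>Universal property: \<open>word_eval\<close> kills the relations, hence the ideal. Since
  \<open>P d\<close> and \<open>Q d\<close> correspond to left multiplications, their values at the
  empty word determine the coefficients \<open>X $ d\<close> and \<open>Y $ d\<close>.\<close>

lemma braid_eq_transport:
  fixes c :: "nat set \<Rightarrow> 'r::complex_algebra"
  assumes "braid_eq n P Q"
    and commute: "\<And>i j k l. {i, j, k, l} \<subseteq> {1..n} \<Longrightarrow> distinct [i, j, k, l] \<Longrightarrow> c {i, j} * c {k, l} = c {k, l} * c {i, j}"
    and four_term: "\<And>i j k. {i, j, k} \<subseteq> {1..n} \<Longrightarrow> distinct [i, j, k] \<Longrightarrow>
      c {i, j} * (c {i, k} + c {j, k}) = (c {i, k} + c {j, k}) * c {i, j}"
    and PX: "word_intertwines c P X" and QY: "word_intertwines c Q Y"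
  shows "X = Y"
proof (rule fps_ext)
  fix d
  note hom = quot_homD(1,2)[OF word_eval_hom] quot_hom_simps[OF word_eval_hom]
  have "cvec.span {push (\<lambda>w. u @ w @ v) r | r u v. r \<in> braid_relations n \<and>
      u \<in> lists (braid_generators n) \<and> v \<in> lists (braid_generators n)} \<subseteq> {F. word_eval c F = 0}"
  proof (rule cvec.span_minimal)
    have pair: "word_eval c (tensor [X, Y]) = c X * c Y" for X Y
      by (simp add: word_eval_def scaleC_one)
    have "word_eval c r = 0" if "r \<in> braid_relations n" for r
      using that unfolding braid_relations_def
    proof (elim UnE CollectE exE conjE)
      fix i j k l
      assume "r = tensor [{i, j}, {k, l}] - tensor [{k, l}, {i, j}]" "{i, j, k, l} \<subseteq> {1..n}" "distinct [i, j, k, l]"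
      then show ?thesis using commute[of i j k l] by (simp add: hom pair)
    next
      fix i j k
      assume "r = tensor [{i, j}, {i, k}] + tensor [{i, j}, {j, k}] - (tensor [{i, k}, {i, j}] + tensor [{j, k}, {i, j}])"
        "{i, j, k} \<subseteq> {1..n}" "distinct [i, j, k]"
      then show ?thesis using four_term[of i j k] by (simp add: hom pair distrib_left distrib_right)
    qed
    then show "{push (\<lambda>w. u @ w @ v) r | r u v. r \<in> braid_relations n \<and>
      u \<in> lists (braid_generators n) \<and> v \<in> lists (braid_generators n)} \<subseteq> {F. word_eval c F = 0}"
      by (auto simp: word_eval_push)
    show "cvec.subspace {F. word_eval c F = 0}"
      by (simp add: cvec.subspace_def hom)
  qed
  then have "word_eval c F = 0" if "F \<in> braid_ideal n" for F
    using that by (auto simp: braid_ideal_def)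
  from this[of "P d (tensor []) - Q d (tensor [])"]
  have "word_eval c (P d (tensor []) - Q d (tensor [])) = 0"
    using assms(1) by (simp add: braid_eq_def)
  then have "word_eval c (P d (tensor [])) = word_eval c (Q d (tensor []))"
    by (simp add: hom)
  then have "X $ d * word_eval c (tensor []) = Y $ d * word_eval c (tensor [])"
    using PX[rule_format, of d] QY[rule_format, of d] by (simp add: intertwines_def quot_cong_def)
  then show "X $ d = Y $ d"
    by (simp add: word_eval_def scaleC_one)
qed

text \<open>Cabling: strand \<open>i\<close> becomes the block \<open>Is ! (i - 1)\<close>, strands
  being counted from 1. A generator is an unordered pair, so \<open>c\<close> reads off its ends as
  minimum and maximum; symmetry of \<open>block_chord\<close> makes this choice harmless.\<close>

lemma braid_eq_blocks:
  assumes "braid_eq (length Is) P Q" "blocks Is"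
    and c: "c = (\<lambda>X. block_chord (Is ! (Min X - 1)) (Is ! (Max X - 1)))"
    and "word_intertwines c P X" "word_intertwines c Q Y"
  shows "X = Y"
proof (rule braid_eq_transport[OF assms(1) _ _ assms(4,5)])
  let ?B = "\<lambda>i. Is ! (i - 1)"
  have c_pair: "c {i, j} = block_chord (?B i) (?B j)" for i j
  proof (cases "i \<le> j")
    case False
    then show ?thesis by (simp add: c min_def max_def block_chord_sym)
  qed (simp add: c min_def max_def)
  have fin: "finite (?B i)" if "i \<in> {1..length Is}" for i
    using assms(2) that by (auto simp: blocks_def)
  have disj: "?B i \<inter> ?B j = {}" if "i \<in> {1..length Is}" "j \<in> {1..length Is}" "i \<noteq> j" for i j
  proof -
    have "?B i \<inter> ?B j = {}" if "i \<in> {1..length Is}" "j \<in> {1..length Is}" "i < j" for i j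
    proof -
      have "i - 1 < j - 1" "j - 1 < length Is" using that by auto
      then show ?thesis
        using assms(2) by (auto simp: blocks_def sorted_wrt_iff_nth_less)
    qed
    from this[of i j] this[of j i] show ?thesis using that by (cases "i < j") auto
  qed
  show "c {i, j} * c {k, l} = c {k, l} * c {i, j}"
    if "{i, j, k, l} \<subseteq> {1..length Is}" "distinct [i, j, k, l]" for i j k l
    unfolding c_pair using that disj
    by (intro block_chord_commute_disjoint) (simp_all add: Int_Un_distrib Int_Un_distrib2)
  show "c {i, j} * (c {i, k} + c {j, k}) = (c {i, k} + c {j, k}) * c {i, j}"
    if "{i, j, k} \<subseteq> {1..length Is}" "distinct [i, j, k]" for i j k
  proof -
    have "c {i, k} + c {j, k} = block_chord (?B i \<union> ?B j) (?B k)"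
      using that fin disj by (simp add: c_pair block_chord_Un_left)
    moreover have "block_chord (?B i) (?B j) * block_chord (?B i \<union> ?B j) (?B k)
        = block_chord (?B i \<union> ?B j) (?B k) * block_chord (?B i) (?B j)"
      using that fin disj by (intro block_chord_commute_inside) (simp_all add: Int_Un_distrib Int_Un_distrib2)
    ultimately show ?thesis by (simp add: c_pair)
  qed
qed

section \<open>The axioms of the associator for blocks of strands\<close>

definition placed_series :: "ncseries \<Rightarrow> nat set \<Rightarrow> nat set \<Rightarrow> nat set \<Rightarrow> braid_algebra fps" where
  "placed_series f I K L = nc_series f (block_chord I K) (block_chord K L)"

lemma pentagon_blocks:
  assumes "pentagon \<Phi>" "blocks [I, K, L, M]"
  shows "placed_series \<Phi> I K (L \<union> M) * placed_series \<Phi> (I \<union> K) L M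
    = placed_series \<Phi> K L M * (placed_series \<Phi> I (K \<union> L) M * placed_series \<Phi> I K L)"
proof -
  let ?Is = "[I, K, L, M]"
  define c where "c = (\<lambda>X. block_chord (?Is ! (Min X - 1)) (?Is ! (Max X - 1)))"
  note bl = assms(2)[unfolded blocks_def, simplified]
  have len: "4 = length ?Is" by simp
  note bw = word_intertwines_nc_eval word_intertwines_exp_half word_intertwines_op_mult
  have c: "c {1, 2} = block_chord I K" "c {1, 3} = block_chord I L" "c {1, 4} = block_chord I M"
    "c {2, 3} = block_chord K L" "c {2, 4} = block_chord K M" "c {3, 4} = block_chord L M"
    by (simp_all add: c_def numeral_2_eq_2 numeral_3_eq_3 min_def max_def)
  have "word_intertwines c (placed \<Phi> braid_t {1} {2} {3, 4} \<star> placed \<Phi> braid_t {1, 2} {3} {4})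
      (placed_series \<Phi> I K (L \<union> M) * placed_series \<Phi> (I \<union> K) L M)"
    using bl bw(3)[OF bw(1)[of c \<Phi> "{1}" "{2}" "{3, 4}"] bw(1)[of c \<Phi> "{1, 2}" "{3}" "{4}"]]
    by (simp add: placed_series_def c block_chord_Un_left block_chord_Un_right del: One_nat_def)
  moreover have "word_intertwines c (placed \<Phi> braid_t {2} {3} {4} \<star> placed \<Phi> braid_t {1} {2, 3} {4} \<star> placed \<Phi> braid_t {1} {2} {3})
      (placed_series \<Phi> K L M * (placed_series \<Phi> I (K \<union> L) M * placed_series \<Phi> I K L))"
    using bl bw(3)[OF bw(1)[of c \<Phi> "{2}" "{3}" "{4}"] bw(3)[OF bw(1)[of c \<Phi> "{1}" "{2, 3}" "{4}"] bw(1)[of c \<Phi> "{1}" "{2}" "{3}"]]]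
    by (simp add: placed_series_def c block_chord_Un_left block_chord_Un_right del: One_nat_def)
  ultimately show ?thesis
    using assms braid_eq_blocks[OF _ _ c_def] unfolding pentagon_def len by blast
qed

lemma hexagons_blocks:
  assumes "hexagons \<Phi>" "blocks [I, K, L]"
  defines "A \<equiv> placed_series \<Phi>" and "A' \<equiv> placed_series (nc_inverse \<Phi>)"
    and "R \<equiv> \<lambda>I K. exp_half_series (block_chord I K)"
  shows "A K L I * (R I (K \<union> L) * A I K L) = R I L * (A K I L * R I K)"
    "A' L I K * (R (I \<union> K) L * A' I K L) = R I L * (A' I L K * R K L)"
proof -
  let ?Is = "[I, K, L]"
  define c where "c = (\<lambda>X. block_chord (?Is ! (Min X - 1)) (?Is ! (Max X - 1)))"
  note bl = assms(2)[unfolded blocks_def, simplified]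
  have len: "3 = length ?Is" by simp
  note bw = word_intertwines_nc_eval word_intertwines_exp_half word_intertwines_op_mult
  have c: "c {1, 2} = block_chord I K" "c {1, 3} = block_chord I L" "c {2, 3} = block_chord K L"
    "c {2, 1} = block_chord K I" "c {3, 1} = block_chord L I" "c {3, 2} = block_chord L K"
    by (simp_all add: c_def numeral_2_eq_2 numeral_3_eq_3 min_def max_def block_chord_sym)
  note simps = A_def A'_def R_def placed_series_def c block_chord_Un_left block_chord_Un_right
  have "word_intertwines c (placed \<Phi> braid_t {2} {3} {1} \<star> exp_half (braid_t {1} {2, 3}) \<star> placed \<Phi> braid_t {1} {2} {3})
      (A K L I * (R I (K \<union> L) * A I K L))"
    using bl bw(3)[OF bw(1)[of c \<Phi> "{2}" "{3}" "{1}"] bw(3)[OF bw(2)[of c "{1}" "{2, 3}"] bw(1)[of c \<Phi> "{1}" "{2}" "{3}"]]]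
    by (simp add: simps del: One_nat_def)
  moreover have "word_intertwines c (exp_half (braid_t {1} {3}) \<star> placed \<Phi> braid_t {2} {1} {3} \<star> exp_half (braid_t {1} {2}))
      (R I L * (A K I L * R I K))"
    using bl bw(3)[OF bw(2)[of c "{1}" "{3}"] bw(3)[OF bw(1)[of c \<Phi> "{2}" "{1}" "{3}"] bw(2)[of c "{1}" "{2}"]]]
    by (simp add: simps del: One_nat_def)
  ultimately show "A K L I * (R I (K \<union> L) * A I K L) = R I L * (A K I L * R I K)"
    using assms(1,2) braid_eq_blocks[OF _ _ c_def] unfolding hexagons_def len by blast
  let ?\<Phi>' = "nc_inverse \<Phi>"
  have "word_intertwines c (placed ?\<Phi>' braid_t {3} {1} {2} \<star> exp_half (braid_t {1, 2} {3}) \<star> placed ?\<Phi>' braid_t {1} {2} {3})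
      (A' L I K * (R (I \<union> K) L * A' I K L))"
    using bl bw(3)[OF bw(1)[of c ?\<Phi>' "{3}" "{1}" "{2}"] bw(3)[OF bw(2)[of c "{1, 2}" "{3}"] bw(1)[of c ?\<Phi>' "{1}" "{2}" "{3}"]]]
    by (simp add: simps del: One_nat_def)
  moreover have "word_intertwines c (exp_half (braid_t {1} {3}) \<star> placed ?\<Phi>' braid_t {1} {3} {2} \<star> exp_half (braid_t {2} {3}))
      (R I L * (A' I L K * R K L))"
    using bl bw(3)[OF bw(2)[of c "{1}" "{3}"] bw(3)[OF bw(1)[of c ?\<Phi>' "{1}" "{3}" "{2}"] bw(2)[of c "{2}" "{3}"]]]
    by (simp add: simps del: One_nat_def)
  ultimately show "A' L I K * (R (I \<union> K) L * A' I K L) = R I L * (A' I L K * R K L)"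
    using assms(1,2) braid_eq_blocks[OF _ _ c_def] unfolding hexagons_def len by blast
qed

lemma block_chord_commute_blocks:
  assumes "blocks [I, K]" "P \<inter> Q = {}" "P \<union> Q \<subseteq> X" "X \<subseteq> I \<or> X \<subseteq> K \<or> X \<inter> (I \<union> K) = {}"
  shows "block_chord P Q * block_chord I K = block_chord I K * block_chord P Q"
proof (rule block_chord_commute)
  show "P \<union> Q \<subseteq> I \<or> P \<union> Q \<subseteq> K \<or> (P \<union> Q) \<inter> (I \<union> K) = {}"
    using assms(3,4) by blast
qed (use assms in \<open>auto simp: blocks_def\<close>)

lemma block_chord_commute_blocks3:
  assumes "blocks [I, K, L]" "P \<inter> Q = {}" "P \<union> Q \<subseteq> X"
    "X \<subseteq> I \<or> X \<subseteq> K \<or> X \<subseteq> L \<or> X \<inter> (I \<union> K \<union> L) = {}"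
  shows "block_chord P Q * block_chord I K = block_chord I K * block_chord P Q"
    "block_chord P Q * block_chord K L = block_chord K L * block_chord P Q"
proof -
  have disj: "I \<inter> K = {}" "I \<inter> L = {}" "K \<inter> L = {}" and bl: "blocks [I, K]" "blocks [K, L]"
    using assms(1) by (auto simp: blocks_def)
  show "block_chord P Q * block_chord I K = block_chord I K * block_chord P Q"
    by (rule block_chord_commute_blocks[OF bl(1) assms(2,3)]) (use assms(4) disj in blast)
  show "block_chord P Q * block_chord K L = block_chord K L * block_chord P Q"
    by (rule block_chord_commute_blocks[OF bl(2) assms(2,3)]) (use assms(4) disj in blast)
qed

text \<open>Pentagon and hexagons are the transported axioms. Naturality holds because a chord
  inside one block, or disjoint from all blocks, commutes with the chords between them.\<close>

lemma braided_system_associator: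
  assumes "drinfeld_associator \<Phi>"
  shows "braided_system (placed_series \<Phi>) (placed_series (nc_inverse \<Phi>)) (\<lambda>I K. exp_half_series (block_chord I K))"
proof
  have \<Phi>: "\<Phi> [] = 1" "pentagon \<Phi>" "hexagons \<Phi>"
    using assms by (auto simp: drinfeld_associator_def group_like_def)
  show "placed_series \<Phi> I K L * placed_series (nc_inverse \<Phi>) I K L = 1"
    "placed_series (nc_inverse \<Phi>) I K L * placed_series \<Phi> I K L = 1" for I K L
    by (simp_all add: placed_series_def nc_series_inverse[of \<Phi>, OF \<Phi>(1)])
  show "placed_series \<Phi> I K (L \<union> M) * placed_series \<Phi> (I \<union> K) L M
    = placed_series \<Phi> K L M * placed_series \<Phi> I (K \<union> L) M * placed_series \<Phi> I K L"
    if "blocks [I, K, L, M]" for I K L M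
    using pentagon_blocks[OF \<Phi>(2) that] by (simp add: mult.assoc)
  show "placed_series \<Phi> K L I * exp_half_series (block_chord I (K \<union> L)) * placed_series \<Phi> I K L
      = exp_half_series (block_chord I L) * placed_series \<Phi> K I L * exp_half_series (block_chord I K)"
    "placed_series (nc_inverse \<Phi>) L I K * exp_half_series (block_chord (I \<union> K) L) * placed_series (nc_inverse \<Phi>) I K L
      = exp_half_series (block_chord I L) * placed_series (nc_inverse \<Phi>) I L K * exp_half_series (block_chord K L)"
    if "blocks [I, K, L]" for I K L
    using hexagons_blocks[OF \<Phi>(3) that] by (simp_all add: mult.assoc)
next
  fix I K L I' K' L' X :: "nat set"
  assume *: "blocks [I, K, L]" "blocks [I', K', L']" "I' \<union> K' \<union> L' = X"
    "X \<subseteq> I \<or> X \<subseteq> K \<or> X \<subseteq> L \<or> X \<inter> (I \<union> K \<union> L) = {}"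
  have sub: "I' \<inter> K' = {}" "I' \<union> K' \<subseteq> X" "K' \<inter> L' = {}" "K' \<union> L' \<subseteq> X"
    using *(2,3) by (auto simp: blocks_def)
  show "placed_series \<Phi> I' K' L' * placed_series \<Phi> I K L = placed_series \<Phi> I K L * placed_series \<Phi> I' K' L'"
    unfolding placed_series_def
    by (rule nc_series_commute)
      (rule block_chord_commute_blocks3[OF *(1) sub(1,2) *(4)] block_chord_commute_blocks3[OF *(1) sub(3,4) *(4)])+
next
  fix I K L I' K' X :: "nat set"
  assume *: "blocks [I, K, L]" "blocks [I', K']" "I' \<union> K' = X"
    "X \<subseteq> I \<or> X \<subseteq> K \<or> X \<subseteq> L \<or> X \<inter> (I \<union> K \<union> L) = {}"
  have sub: "I' \<inter> K' = {}" "I' \<union> K' \<subseteq> X"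
    using *(2,3) by (auto simp: blocks_def)
  show "exp_half_series (block_chord I' K') * placed_series \<Phi> I K L = placed_series \<Phi> I K L * exp_half_series (block_chord I' K')"
    unfolding placed_series_def
    by (rule exp_half_series_nc_series_commute) (rule block_chord_commute_blocks3[OF *(1) sub *(4)])+
next
  fix I K I' K' L' X :: "nat set"
  assume *: "blocks [I, K]" "blocks [I', K', L']" "I' \<union> K' \<union> L' = X" "X \<subseteq> I \<or> X \<subseteq> K \<or> X \<inter> (I \<union> K) = {}"
  have sub: "I' \<inter> K' = {}" "I' \<union> K' \<subseteq> X" "K' \<inter> L' = {}" "K' \<union> L' \<subseteq> X"
    using *(2,3) by (auto simp: blocks_def)
  show "placed_series \<Phi> I' K' L' * exp_half_series (block_chord I K) = exp_half_series (block_chord I K) * placed_series \<Phi> I' K' L'"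
    unfolding placed_series_def
    by (rule exp_half_series_nc_series_commute[symmetric])
      (rule block_chord_commute_blocks[OF *(1) sub(1,2) *(4), symmetric] block_chord_commute_blocks[OF *(1) sub(3,4) *(4), symmetric])+
next
  fix I K I' K' X :: "nat set"
  assume *: "blocks [I, K]" "blocks [I', K']" "I' \<union> K' = X" "X \<subseteq> I \<or> X \<subseteq> K \<or> X \<inter> (I \<union> K) = {}"
  have sub: "I' \<inter> K' = {}" "I' \<union> K' \<subseteq> X"
    using *(2,3) by (auto simp: blocks_def)
  show "exp_half_series (block_chord I' K') * exp_half_series (block_chord I K)
      = exp_half_series (block_chord I K) * exp_half_series (block_chord I' K')"
    by (rule exp_half_series_commute) (rule block_chord_commute_blocks[OF *(1) sub *(4)])
qed


subsection \<open>Representing operators by elements of the braid algebra\<close>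

text \<open>A relation rather than a function, since the action of words is not well defined on
  classes: equal elements of the quotient act equally only up to null vectors.\<close>

definition represents ::
  "'v::complex_vector set \<times> 'v set \<Rightarrow> (nat \<times> nat \<Rightarrow> 'v \<Rightarrow> 'v) \<Rightarrow> ('v \<Rightarrow> 'v) \<Rightarrow> braid_algebra \<Rightarrow> bool" where
  "represents S r P p \<longleftrightarrow> quot_hom S S P \<and> (\<exists>x. abs_braid_algebra x = p \<and> quot_cong S S P (word_action r x))"

text \<open>The bridge from the braid algebra to operators: two preimages of \<open>p\<close> differ
  by an element of the ideal, which acts by null vectors.\<close>

lemma represents_cong:
  assumes "braid_rep S r" "represents S r P p" "represents S r Q p"
  shows "quot_cong S S P Q"
proof -
  obtain x y where x: "abs_braid_algebra x = p" "quot_cong S S P (word_action r x)"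
    and y: "abs_braid_algebra y = p" "quot_cong S S Q (word_action r y)"
    using assms(2,3) by (auto simp: represents_def)
  have S: "quot_space S" using assms(1) by (simp add: braid_rep_def)
  have "x - y \<in> chord_ideal" using x y by (simp add: abs_braid_eq_iff[symmetric])
  then have "quot_cong S S (word_action r x) (word_action r y)"
    using word_action_chord_ideal[OF assms(1)] by (auto simp: quot_cong_def word_action_simps(3)[symmetric])
  then show ?thesis
    using quot_cong_trans[OF S] quot_cong_sym[OF S] x(2) y(2) by metis
qed

context
  fixes S :: "'v::complex_vector set \<times> 'v set" and r :: "nat \<times> nat \<Rightarrow> 'v \<Rightarrow> 'v"
  assumes S: "quot_space S" and hom: "\<And>g. quot_hom S S (r g)"
begin

lemma represents_chord: "represents S r (r (i, j)) (abs_braid_algebra (chord i j))"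
  unfolding represents_def
  by (intro conjI hom exI[of _ "chord i j"] refl) (simp add: quot_cong_def word_action_simps quot_spaceD[OF S])

lemma represents_id: "represents S r (\<lambda>v. v) 1"
  unfolding represents_def
  by (intro conjI quot_hom_id exI[of _ 1] abs_braid_simps)
    (simp add: quot_cong_def word_action_simps quot_spaceD[OF S])

lemma represents_add:
  assumes "represents S r P p" "represents S r Q q"
  shows "represents S r (\<lambda>v. P v + Q v) (p + q)"
proof -
  obtain x y where x: "abs_braid_algebra x = p" "quot_cong S S P (word_action r x)"
    and y: "abs_braid_algebra y = q" "quot_cong S S Q (word_action r y)"
    using assms by (auto simp: represents_def)
  have "quot_cong S S (\<lambda>v. P v + Q v) (word_action r (x + y))"
    using quot_cong_add[OF S x(2) y(2)] by (simp add: quot_cong_def word_action_simps)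
  then show ?thesis
    unfolding represents_def using assms x y
    by (intro conjI quot_hom_add[OF S] exI[of _ "x + y"]) (auto simp: represents_def abs_braid_simps)
qed

lemma represents_zero: "represents S r (\<lambda>v. 0) 0"
  unfolding represents_def
  by (intro conjI quot_hom_zero S exI[of _ 0] abs_braid_simps)
    (simp add: quot_cong_def word_action_simps quot_spaceD[OF S])

lemma represents_sum:
  "(\<And>i. i \<in> I \<Longrightarrow> represents S r (P i) (p i)) \<Longrightarrow> represents S r (\<lambda>v. \<Sum>i\<in>I. P i v) (\<Sum>i\<in>I. p i)"
  by (induction I rule: infinite_finite_induct) (simp_all add: represents_zero represents_add)

lemma represents_scale:
  assumes "represents S r P p"
  shows "represents S r (\<lambda>v. c *\<^sub>C P v) (c *\<^sub>C p)"
proof -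
  obtain x where x: "abs_braid_algebra x = p" "quot_cong S S P (word_action r x)"
    using assms by (auto simp: represents_def)
  have "quot_cong S S (\<lambda>v. c *\<^sub>C P v) (word_action r (c *\<^sub>C x))"
    using quot_cong_scale[OF S x(2)] by (simp add: quot_cong_def word_action_simps)
  then show ?thesis
    unfolding represents_def using assms x
    by (intro conjI quot_hom_scale[OF S] exI[of _ "c *\<^sub>C x"]) (auto simp: represents_def abs_braid_simps)
qed

lemma represents_comp:
  assumes "represents S r P p" "represents S r Q q"
  shows "represents S r (\<lambda>v. P (Q v)) (p * q)"
proof -
  obtain x y where x: "abs_braid_algebra x = p" "quot_cong S S P (word_action r x)"
    and y: "abs_braid_algebra y = q" "quot_cong S S Q (word_action r y)"
    using assms by (auto simp: represents_def)
  have homs: "quot_hom S S P" "quot_hom S S Q" using assms by (auto simp: represents_def)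
  have "quot_cong S S (\<lambda>v. P (Q v)) (\<lambda>v. word_action r x (word_action r y v))"
    by (rule quot_cong_comp[OF S homs(1) _ x(2) y(2)]) (rule quot_homD(3)[OF quot_hom_word_action[OF S hom]])
  then have "quot_cong S S (\<lambda>v. P (Q v)) (word_action r (x * y))"
    by (simp add: quot_cong_def word_action_mult[OF S hom])
  then show ?thesis
    unfolding represents_def using x y
    by (intro conjI quot_hom_comp[OF homs] exI[of _ "x * y"]) (simp_all add: abs_braid_simps)
qed

lemma represents_nc_eval:
  assumes "represents S r P p" "represents S r Q q"
  shows "represents S r (nc_eval f P Q n) (nc_series f p q $ n)"
proof -
  have "represents S r (word_op P Q w) (word_prod p q w)" for w
  proof (induction w)
    case Nil
    then show ?case using represents_id by (simp add: id_def)
  next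
    case (Cons l w)
    then show ?case using represents_comp assms by (cases l) (simp_all add: comp_def)
  qed
  then have "represents S r (\<lambda>v. \<Sum>w | length w = n. f w *\<^sub>C word_op P Q w v) (\<Sum>w | length w = n. f w *\<^sub>C word_prod p q w)"
    by (intro represents_sum represents_scale)
  then show ?thesis by (simp add: nc_eval_def[abs_def] nc_series_def)
qed

lemma represents_exp_half:
  assumes "represents S r P p"
  shows "represents S r (exp_half P n) (exp_half_series p $ n)"
proof -
  have "represents S r (P ^^ n) (p ^ n)" for n
  proof (induction n)
    case 0
    then show ?case using represents_id by (simp add: id_def)
  next
    case (Suc n)
    then show ?case using represents_comp[OF assms] by (simp add: comp_def)
  qed
  from represents_scale[OF this] show ?thesis
    by (simp add: exp_half_def[abs_def] exp_half_series_def)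
qed

lemma represents_op_mult:
  assumes "\<And>n. represents S r (P n) (X $ n)" "\<And>n. represents S r (Q n) (Y $ n)"
  shows "represents S r ((P \<star> Q) n) ((X * Y) $ n)"
  unfolding op_mult_def[abs_def] fps_mult_nth atLeast0AtMost
  by (rule represents_sum) (rule represents_comp[OF assms])

lemma represents_block_chord:
  assumes "\<And>i k. i \<in> I \<Longrightarrow> k \<in> K \<Longrightarrow> represents S r (P i k) (abs_braid_algebra (chord i k))"
  shows "represents S r (\<lambda>v. \<Sum>i\<in>I. \<Sum>k\<in>K. P i k v) (block_chord I K)"
  unfolding block_chord_def by (intro represents_sum assms)

end

lemma represents_cong_left:
  assumes "quot_space S" "represents S r P p" "quot_hom S S Q" "quot_cong S S Q P"
  shows "represents S r Q p"
  using assms quot_cong_trans[OF assms(1,4)] by (auto simp: represents_def)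


section \<open>Infinitesimal braid relations from invariant tensors\<close>

text \<open>Universal property of the tensor product for a map that is bilinear only modulo
  \<open>N\<close>. Addition and scaling are parameters because cosets are tensored as well.\<close>

lemma tensor_null_teval:
  assumes N: "cvec.subspace N"
    and "\<And>u v w. u \<in> V \<Longrightarrow> v \<in> V \<Longrightarrow> w \<in> V \<Longrightarrow> b (add u v) w - b u w - b v w \<in> N"
    and "\<And>u v w. u \<in> V \<Longrightarrow> v \<in> V \<Longrightarrow> w \<in> V \<Longrightarrow> b w (add u v) - b w u - b w v \<in> N"
    and "\<And>c u v. u \<in> V \<Longrightarrow> v \<in> V \<Longrightarrow> b (scale c u) v - c *\<^sub>C b u v \<in> N"
    and "\<And>c u v. u \<in> V \<Longrightarrow> v \<in> V \<Longrightarrow> b u (scale c v) - c *\<^sub>C b u v \<in> N"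
    and F: "F \<in> tensor_null V add scale"
  shows "teval (\<lambda>(x, y). b x y) F \<in> N"
proof -
  let ?f = "teval (\<lambda>(x, y). b x y)"
  have "tensor_null V add scale \<subseteq> {F. ?f F \<in> N}"
    unfolding tensor_null_def
  proof (rule cvec.span_minimal)
    show "cvec.subspace {F. ?f F \<in> N}"
      using N by (simp add: cvec.subspace_def teval_add teval_scale)
  qed (use assms(2-5) in \<open>auto simp: teval_simps scaleC_one\<close>)
  then show ?thesis using F by auto
qed

lemma tensor_eq_teval:
  fixes b :: "'g::complex_vector \<Rightarrow> 'g \<Rightarrow> 'v::complex_vector"
  assumes "cvec.subspace N"
    and "\<And>u v w. b (u + v) w - b u w - b v w \<in> N" "\<And>u v w. b w (u + v) - b w u - b w v \<in> N"
    and "\<And>c u v. b (c *\<^sub>C u) v - c *\<^sub>C b u v \<in> N" "\<And>c u v. b u (c *\<^sub>C v) - c *\<^sub>C b u v \<in> N"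
    and "tensor_eq F G"
  shows "teval (\<lambda>(x, y). b x y) F - teval (\<lambda>(x, y). b x y) G \<in> N"
  using tensor_null_teval[OF assms(1), of UNIV b "(+)" scaleC "F - G"] assms
  by (simp add: tensor_eq_def teval_simps)

lemma quot_hom_teval:
  "quot_space S' \<Longrightarrow> (\<And>k. quot_hom S S' (P k)) \<Longrightarrow> quot_hom S S' (\<lambda>v. teval (\<lambda>k. P k v) F)"
  unfolding teval_def by (intro quot_hom_sum quot_hom_scale)

lemma quot_cong_teval:
  "quot_space S' \<Longrightarrow> (\<And>k. quot_cong S S' (P k) (Q k)) \<Longrightarrow>
    quot_cong S S' (\<lambda>v. teval (\<lambda>k. P k v) F) (\<lambda>v. teval (\<lambda>k. Q k v) F)"
  unfolding teval_def by (intro quot_cong_sum quot_cong_scale)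

lemma teval_mem: "cvec.subspace N \<Longrightarrow> (\<And>k. f k \<in> N) \<Longrightarrow> teval f F \<in> N"
  unfolding teval_def by (intro cvec.subspace_sum cvec.subspace_scale)

definition commutes_mod :: "'v::complex_vector set \<times> 'v set \<Rightarrow> ('v \<Rightarrow> 'v) \<Rightarrow> ('v \<Rightarrow> 'v) \<Rightarrow> bool" where
  "commutes_mod S P Q \<longleftrightarrow> quot_cong S S (\<lambda>v. P (Q v)) (\<lambda>v. Q (P v))"

lemma commutes_mod_sym: "quot_space S \<Longrightarrow> commutes_mod S P Q \<Longrightarrow> commutes_mod S Q P"
  unfolding commutes_mod_def by (rule quot_cong_sym)

lemma commutes_mod_comp:
  assumes "quot_space S" "quot_hom S S P" "quot_hom S S Q" "quot_hom S S R" "commutes_mod S P Q" "commutes_mod S P R"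
  shows "commutes_mod S P (\<lambda>v. Q (R v))"
proof -
  have "quot_cong S S (\<lambda>v. P (Q (R v))) (\<lambda>v. Q (P (R v)))"
    using assms(5) quot_homD(3)[OF assms(4)] by (auto simp: commutes_mod_def quot_cong_def)
  moreover have "quot_cong S S (\<lambda>v. Q (P (R v))) (\<lambda>v. Q (R (P v)))"
    using quot_cong_comp[OF assms(1,3) _ quot_cong_refl[OF assms(1)] assms(6)[unfolded commutes_mod_def]]
      quot_homD(3)[OF assms(2)] quot_homD(3)[OF assms(4)] by simp
  ultimately show ?thesis
    unfolding commutes_mod_def by (rule quot_cong_trans[OF assms(1)])
qed

lemma commutes_mod_add:
  assumes "quot_space S" "quot_hom S S P" "commutes_mod S P Q" "commutes_mod S P R"
  shows "commutes_mod S P (\<lambda>v. Q v + R v)"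
  using quot_cong_add[OF assms(1) assms(3,4)[unfolded commutes_mod_def]]
  by (simp add: commutes_mod_def quot_homD(1)[OF assms(2)])

lemma commutes_mod_teval:
  assumes "quot_space S" "quot_hom S S P" "\<And>k. commutes_mod S P (Q k)"
  shows "commutes_mod S P (\<lambda>v. teval (\<lambda>k. Q k v) F)"
  unfolding commutes_mod_def teval_hom_fun[OF assms(2)]
  by (rule quot_cong_teval[OF assms(1)]) (rule assms(3)[unfolded commutes_mod_def])

lemma commutes_mod_sum:
  assumes "quot_space S" "quot_hom S S P" "\<And>k. k \<in> K \<Longrightarrow> commutes_mod S P (Q k)"
  shows "commutes_mod S P (\<lambda>v. \<Sum>k\<in>K. Q k v)"
  unfolding commutes_mod_def quot_hom_simps(4)[OF assms(2)]
  by (rule quot_cong_sum[OF assms(1)]) (rule assms(3)[unfolded commutes_mod_def])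

text \<open>Commuting actions of one Lie algebra, all laws holding up to null vectors: the abstract
  setting in which an invariant symmetric tensor yields braid relations.\<close>

definition slot_system ::
  "'v::complex_vector set \<times> 'v set \<Rightarrow> nat set \<Rightarrow> (nat \<Rightarrow> 'g::lie_algebra \<Rightarrow> 'v \<Rightarrow> 'v) \<Rightarrow> bool" where
  "slot_system S I \<sigma> \<longleftrightarrow> quot_space S \<and> (\<forall>i\<in>I. \<forall>x. quot_hom S S (\<sigma> i x)) \<and>
     (\<forall>i\<in>I. \<forall>x y. quot_cong S S (\<sigma> i (x + y)) (\<lambda>v. \<sigma> i x v + \<sigma> i y v)) \<and>
     (\<forall>i\<in>I. \<forall>c x. quot_cong S S (\<sigma> i (c *\<^sub>C x)) (\<lambda>v. c *\<^sub>C \<sigma> i x v)) \<and>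
     (\<forall>i\<in>I. \<forall>x y. quot_cong S S (\<sigma> i (lie x y)) (\<lambda>v. \<sigma> i x (\<sigma> i y v) - \<sigma> i y (\<sigma> i x v))) \<and>
     (\<forall>i\<in>I. \<forall>k\<in>I. i \<noteq> k \<longrightarrow> (\<forall>x y. commutes_mod S (\<sigma> i x) (\<sigma> k y)))"

lemma slot_systemD:
  assumes "slot_system S I \<sigma>"
  shows "quot_space S" "i \<in> I \<Longrightarrow> quot_hom S S (\<sigma> i x)"
    "i \<in> I \<Longrightarrow> quot_cong S S (\<sigma> i (x + y)) (\<lambda>v. \<sigma> i x v + \<sigma> i y v)"
    "i \<in> I \<Longrightarrow> quot_cong S S (\<sigma> i (c *\<^sub>C x)) (\<lambda>v. c *\<^sub>C \<sigma> i x v)"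
    "i \<in> I \<Longrightarrow> quot_cong S S (\<sigma> i (lie x y)) (\<lambda>v. \<sigma> i x (\<sigma> i y v) - \<sigma> i y (\<sigma> i x v))"
    "i \<in> I \<Longrightarrow> k \<in> I \<Longrightarrow> i \<noteq> k \<Longrightarrow> commutes_mod S (\<sigma> i x) (\<sigma> k y)"
  using assms by (auto simp: slot_system_def)

lemma t_action_pair: "t_action t \<sigma> {i} {k} = (\<lambda>v. teval (\<lambda>(x, y). \<sigma> i x (\<sigma> k y v)) t)"
  by (simp add: t_action_def fun_eq_iff)

lemma t_action_sum: "t_action t \<sigma> I K v = (\<Sum>i\<in>I. \<Sum>k\<in>K. t_action t \<sigma> {i} {k} v)"
  by (simp add: t_action_def)

context
  fixes S :: "'v::complex_vector set \<times> 'v set" and I :: "nat set" and \<sigma> :: "nat \<Rightarrow> 'g::lie_algebra \<Rightarrow> 'v \<Rightarrow> 'v"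
    and t :: "'g \<times> 'g \<Rightarrow>\<^sub>0 complex"
  assumes slots: "slot_system S I \<sigma>" and t: "invariant_symmetric t"
begin

lemma slot_space: "quot_space S" "cvec.subspace (snd S)"
  using slot_systemD(1)[OF slots] by (auto simp: quot_space_def)

lemma t_action_hom:
  assumes "A \<subseteq> I" "B \<subseteq> I"
  shows "quot_hom S S (t_action t \<sigma> A B)"
proof -
  have "quot_hom S S (\<lambda>v. case p of (x, y) \<Rightarrow> \<sigma> i x (\<sigma> k y v))" if "i \<in> A" "k \<in> B" for i k p
  proof -
    have "i \<in> I" "k \<in> I" using that assms by auto
    from quot_hom_comp[OF slot_systemD(2)[OF slots this(1)] slot_systemD(2)[OF slots this(2)]]
    show ?thesis by (cases p) simp
  qed
  then show ?thesis
    unfolding t_action_def[abs_def] by (intro quot_hom_sum quot_hom_teval slot_space)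
qed

text \<open>Symmetry and invariance of \<open>t\<close> are given only up to
  \<open>tensor_eq\<close>; here they become statements about operators.\<close>

lemma teval_tensor_eq:
  assumes "i \<in> I" "k \<in> I" "v \<in> fst S" "tensor_eq F G"
  shows "teval (\<lambda>(x, y). \<sigma> i x (\<sigma> k y v)) F - teval (\<lambda>(x, y). \<sigma> i x (\<sigma> k y v)) G \<in> snd S"
proof (rule tensor_eq_teval[OF slot_space(2) _ _ _ _ assms(4)])
  have hom: "quot_hom S S (\<sigma> i x)" "quot_hom S S (\<sigma> k x)" for x
    using assms slot_systemD(2)[OF slots] by auto
  have w: "\<sigma> k y v \<in> fst S" for y by (rule quot_homD(3)[OF hom(2) assms(3)])
  fix x y z :: 'g and c
  show "\<sigma> i (x + y) (\<sigma> k z v) - \<sigma> i x (\<sigma> k z v) - \<sigma> i y (\<sigma> k z v) \<in> snd S"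
    using quot_congD[OF slot_systemD(3)[OF slots assms(1)] w] by (simp add: algebra_simps)
  show "\<sigma> i (c *\<^sub>C x) (\<sigma> k z v) - c *\<^sub>C \<sigma> i x (\<sigma> k z v) \<in> snd S"
    using quot_congD[OF slot_systemD(4)[OF slots assms(1)] w] by simp
  have "\<sigma> i z (\<sigma> k (x + y) v - (\<sigma> k x v + \<sigma> k y v)) \<in> snd S"
    by (rule quot_homD(4)[OF hom(1)]) (rule quot_congD[OF slot_systemD(3)[OF slots assms(2)] assms(3)])
  then show "\<sigma> i z (\<sigma> k (x + y) v) - \<sigma> i z (\<sigma> k x v) - \<sigma> i z (\<sigma> k y v) \<in> snd S"
    by (simp add: quot_hom_simps[OF hom(1)] quot_homD(1)[OF hom(1)] algebra_simps)
  have "\<sigma> i z (\<sigma> k (c *\<^sub>C x) v - c *\<^sub>C \<sigma> k x v) \<in> snd S"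
    by (rule quot_homD(4)[OF hom(1)]) (rule quot_congD[OF slot_systemD(4)[OF slots assms(2)] assms(3)])
  then show "\<sigma> i z (\<sigma> k (c *\<^sub>C x) v) - c *\<^sub>C \<sigma> i z (\<sigma> k x v) \<in> snd S"
    by (simp add: quot_hom_simps[OF hom(1)] quot_homD(2)[OF hom(1)])
qed

text \<open>First the two commuting slots are interchanged, then the legs of
  \<open>t\<close>.\<close>

lemma t_action_sym:
  assumes "i \<in> I" "k \<in> I" "i \<noteq> k"
  shows "quot_cong S S (t_action t \<sigma> {i} {k}) (t_action t \<sigma> {k} {i})"
proof -
  have "quot_cong S S (t_action t \<sigma> {i} {k}) (\<lambda>v. teval (\<lambda>(x, y). \<sigma> k y (\<sigma> i x v)) t)"
    unfolding t_action_pair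
    by (intro quot_cong_teval slot_space) (use slot_systemD(6)[OF slots] assms in \<open>auto simp: commutes_mod_def\<close>)
  moreover have "quot_cong S S (\<lambda>v. teval (\<lambda>(x, y). \<sigma> k y (\<sigma> i x v)) t) (t_action t \<sigma> {k} {i})"
    unfolding quot_cong_def
  proof
    fix v assume v: "v \<in> fst S"
    have "teval (\<lambda>(x, y). \<sigma> k y (\<sigma> i x v)) t = teval (\<lambda>(x, y). \<sigma> k x (\<sigma> i y v)) (push (\<lambda>(x, y). (y, x)) t)"
      by (simp add: teval_push case_prod_unfold)
    then show "teval (\<lambda>(x, y). \<sigma> k y (\<sigma> i x v)) t - t_action t \<sigma> {k} {i} v \<in> snd S"
      using teval_tensor_eq[OF assms(2,1) v] t by (simp add: t_action_pair invariant_symmetric_def)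
  qed
  ultimately show ?thesis by (rule quot_cong_trans[OF slot_space(1)])
qed

lemma commutes_mod_t_action:
  assumes "i \<in> I" "k \<in> I" "quot_hom S S P" "\<And>x. commutes_mod S P (\<sigma> i x)" "\<And>x. commutes_mod S P (\<sigma> k x)"
  shows "commutes_mod S P (t_action t \<sigma> {i} {k})"
  unfolding t_action_pair
proof (rule commutes_mod_teval[OF slot_space(1) assms(3)])
  fix p
  show "commutes_mod S P (\<lambda>v. case p of (x, y) \<Rightarrow> \<sigma> i x (\<sigma> k y v))"
    using commutes_mod_comp[OF slot_space(1) assms(3) slot_systemD(2)[OF slots assms(1)] slot_systemD(2)[OF slots assms(2)] assms(4,5)]
    by (cases p) simp
qed

lemma t_action_commute:
  assumes "{i, j, k, l} \<subseteq> I" "distinct [i, j, k, l]"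
  shows "commutes_mod S (t_action t \<sigma> {i} {j}) (t_action t \<sigma> {k} {l})"
proof (rule commutes_mod_t_action)
  show "quot_hom S S (t_action t \<sigma> {i} {j})"
    using assms by (intro t_action_hom) auto
  have "commutes_mod S (\<sigma> m x) (t_action t \<sigma> {i} {j})" if "m \<in> {k, l}" for m x
    by (rule commutes_mod_t_action) (use assms that slot_systemD(2,6)[OF slots] in auto)
  then show "commutes_mod S (t_action t \<sigma> {i} {j}) (\<sigma> k x)" "commutes_mod S (t_action t \<sigma> {i} {j}) (\<sigma> l x)" for x
    by (auto intro: commutes_mod_sym[OF slot_space(1)])
qed (use assms in auto)

text \<open>The commutator of \<open>t^{i,j}\<close> with \<open>z\<close> placed in both slots is
  the action of the bracket of \<open>z\<close> with \<open>t\<close>, which vanishes by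
  invariance.\<close>

lemma t_action_invariant:
  assumes "i \<in> I" "j \<in> I" "i \<noteq> j"
  shows "commutes_mod S (t_action t \<sigma> {i} {j}) (\<lambda>v. \<sigma> i z v + \<sigma> j z v)"
proof (rule commutes_mod_sym[OF slot_space(1)])
  have hom: "quot_hom S S (\<sigma> i x)" "quot_hom S S (\<sigma> j x)" for x
    using assms slot_systemD(2)[OF slots] by auto
  let ?D = "\<lambda>v. \<sigma> i z v + \<sigma> j z v"
  have D: "quot_hom S S ?D" by (intro quot_hom_add slot_space hom)
  note lin = quot_hom_simps[OF hom(1)] quot_homD(1)[OF hom(1)]
  show "commutes_mod S ?D (t_action t \<sigma> {i} {j})"
    unfolding commutes_mod_def quot_cong_def
  proof
    fix v assume v: "v \<in> fst S"
    \<comment> \<open>For a single term of \<open>t\<close>, the commutator with \<open>z\<close>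
      brackets each leg. The four ingredients are the module law in slot \<open>i\<close>, two
      commutations of different slots, and the module law in slot \<open>j\<close>.\<close>
    have key: "(?D (\<sigma> i x (\<sigma> j y v)) - \<sigma> i x (\<sigma> j y (?D v)))
        - (\<sigma> i (lie z x) (\<sigma> j y v) + \<sigma> i x (\<sigma> j (lie z y) v)) \<in> snd S" for x y
    proof -
      let ?w = "\<sigma> j y v"
      have w: "?w \<in> fst S" by (rule quot_homD(3)[OF hom(2) v])
      have 1: "\<sigma> i z (\<sigma> i x ?w) - \<sigma> i x (\<sigma> i z ?w) - \<sigma> i (lie z x) ?w \<in> snd S"
        using quot_spaceD(9)[OF slot_space(1) quot_congD[OF slot_systemD(5)[OF slots assms(1)] w, of z x]] by simp
      have 2: "\<sigma> j z (\<sigma> i x ?w) - \<sigma> i x (\<sigma> j z ?w) \<in> snd S"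
        by (rule quot_congD[OF slot_systemD(6)[OF slots assms(2,1) assms(3)[symmetric], unfolded commutes_mod_def] w])
      have 3: "\<sigma> i x (\<sigma> i z ?w - \<sigma> j y (\<sigma> i z v)) \<in> snd S"
        by (rule quot_homD(4)[OF hom(1) quot_congD[OF slot_systemD(6)[OF slots assms, unfolded commutes_mod_def] v]])
      have 4: "\<sigma> i x (\<sigma> j z ?w - \<sigma> j y (\<sigma> j z v) - \<sigma> j (lie z y) v) \<in> snd S"
        using quot_spaceD(9)[OF slot_space(1) quot_congD[OF slot_systemD(5)[OF slots assms(2)] v, of z y]]
        by (intro quot_homD(4)[OF hom(1)]) simp
      have "(?D (\<sigma> i x (\<sigma> j y v)) - \<sigma> i x (\<sigma> j y (?D v)))
          - (\<sigma> i (lie z x) (\<sigma> j y v) + \<sigma> i x (\<sigma> j (lie z y) v))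
          = (\<sigma> i z (\<sigma> i x ?w) - \<sigma> i x (\<sigma> i z ?w) - \<sigma> i (lie z x) ?w) + (\<sigma> j z (\<sigma> i x ?w) - \<sigma> i x (\<sigma> j z ?w))
            + (\<sigma> i x (\<sigma> i z ?w - \<sigma> j y (\<sigma> i z v)) + \<sigma> i x (\<sigma> j z ?w - \<sigma> j y (\<sigma> j z v) - \<sigma> j (lie z y) v))"
        by (simp add: lin quot_homD(1)[OF hom(2)])
      also have "\<dots> \<in> snd S"
        by (intro quot_spaceD(6)[OF slot_space(1)] 1 2 3 4)
      finally show ?thesis .
    qed
    have "?D (t_action t \<sigma> {i} {j} v) - t_action t \<sigma> {i} {j} (?D v)
        = teval (\<lambda>(x, y). ?D (\<sigma> i x (\<sigma> j y v)) - \<sigma> i x (\<sigma> j y (?D v))) t"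
      unfolding t_action_pair teval_hom_fun[OF D]
      by (simp add: case_prod_unfold teval_diff_fun)
    also have "\<dots> = (teval (\<lambda>(x, y). ?D (\<sigma> i x (\<sigma> j y v)) - \<sigma> i x (\<sigma> j y (?D v))) t
        - teval (\<lambda>(x, y). \<sigma> i (lie z x) (\<sigma> j y v) + \<sigma> i x (\<sigma> j (lie z y) v)) t)
        + teval (\<lambda>(x, y). \<sigma> i (lie z x) (\<sigma> j y v) + \<sigma> i x (\<sigma> j (lie z y) v)) t"
      by simp
    also have "\<dots> \<in> snd S"
    proof (rule quot_spaceD(6)[OF slot_space(1)])
      show "teval (\<lambda>(x, y). ?D (\<sigma> i x (\<sigma> j y v)) - \<sigma> i x (\<sigma> j y (?D v))) t
        - teval (\<lambda>(x, y). \<sigma> i (lie z x) (\<sigma> j y v) + \<sigma> i x (\<sigma> j (lie z y) v)) t \<in> snd S"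
      unfolding teval_diff_fun[symmetric] case_prod_unfold by (rule teval_mem[OF slot_space(2)]) (rule key)
      show "teval (\<lambda>(x, y). \<sigma> i (lie z x) (\<sigma> j y v) + \<sigma> i x (\<sigma> j (lie z y) v)) t \<in> snd S"
      using teval_tensor_eq[OF assms(1,2) v, of "push (\<lambda>(x, y). (lie z x, y)) t + push (\<lambda>(x, y). (x, lie z y)) t" 0] t
      by (simp add: invariant_symmetric_def teval_add teval_push case_prod_unfold teval_add_fun)
    qed
    finally show "?D (t_action t \<sigma> {i} {j} v) - t_action t \<sigma> {i} {j} (?D v) \<in> snd S" .
  qed
qed

text \<open>In the sum of \<open>t^{i,k}\<close> and \<open>t^{j,k}\<close> each term of
  \<open>t\<close> has its first leg placed in both \<open>i\<close> and \<open>j\<close>, so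
  invariance applies; the leg in \<open>k\<close> commutes by disjointness.\<close>

lemma t_action_four_term:
  assumes "{i, j, k} \<subseteq> I" "distinct [i, j, k]"
  shows "commutes_mod S (t_action t \<sigma> {i} {j}) (\<lambda>v. t_action t \<sigma> {i} {k} v + t_action t \<sigma> {j} {k} v)"
proof -
  have eq: "(\<lambda>v. t_action t \<sigma> {i} {k} v + t_action t \<sigma> {j} {k} v)
      = (\<lambda>v. teval (\<lambda>p. \<sigma> i (fst p) (\<sigma> k (snd p) v) + \<sigma> j (fst p) (\<sigma> k (snd p) v)) t)"
    by (simp add: t_action_pair teval_add_fun case_prod_unfold)
  have hom: "quot_hom S S (t_action t \<sigma> {i} {j})"
    using assms by (intro t_action_hom) auto
  have "commutes_mod S (t_action t \<sigma> {i} {j}) (\<lambda>v. \<sigma> i x (\<sigma> k y v) + \<sigma> j x (\<sigma> k y v))" for x y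
  proof (rule commutes_mod_comp[OF slot_space(1) hom, where Q = "\<lambda>v. \<sigma> i x v + \<sigma> j x v"])
    show "commutes_mod S (t_action t \<sigma> {i} {j}) (\<lambda>v. \<sigma> i x v + \<sigma> j x v)"
      using assms by (intro t_action_invariant) auto
    show "commutes_mod S (t_action t \<sigma> {i} {j}) (\<sigma> k y)"
      by (rule commutes_mod_sym[OF slot_space(1)], rule commutes_mod_t_action)
        (use assms slot_systemD(2,6)[OF slots] in auto)
  qed (use assms slot_systemD(2)[OF slots] in \<open>auto intro!: quot_hom_add slot_space\<close>)
  then show ?thesis
    unfolding eq by (intro commutes_mod_teval[OF slot_space(1) hom])
qed

end


subsection \<open>Tensor powers of a module\<close>

definition multilinear_on :: "'a::complex_vector set \<Rightarrow> nat \<Rightarrow> ('a list \<Rightarrow> 'a) \<Rightarrow> bool" where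
  "multilinear_on A n f \<longleftrightarrow> (\<forall>as i. length as = n \<longrightarrow> set as \<subseteq> A \<longrightarrow> i < n \<longrightarrow> linear_on A (\<lambda>a. f (as[i := a])))"

text \<open>The null combinations are those that no multilinear map into the type of
  \<open>A\<close> detects. With this dual description congruences are tested by evaluation, and
  multilinear maps descend by definition.\<close>

definition tensor_power :: "'a::complex_vector set \<Rightarrow> nat \<Rightarrow> ('a list \<Rightarrow>\<^sub>0 complex) set \<times> ('a list \<Rightarrow>\<^sub>0 complex) set" where
  "tensor_power A n = (let V = {F. \<forall>as\<in>Poly_Mapping.keys F. length as = n \<and> set as \<subseteq> A} in
     (V, {F \<in> V. \<forall>f. multilinear_on A n f \<longrightarrow> teval f F = 0}))"

lemma tensor_power_fst: "F \<in> fst (tensor_power A n) \<longleftrightarrow> (\<forall>as\<in>Poly_Mapping.keys F. length as = n \<and> set as \<subseteq> A)"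
  by (simp add: tensor_power_def)

lemma tensor_power_snd: "F \<in> snd (tensor_power A n) \<longleftrightarrow> F \<in> fst (tensor_power A n) \<and> (\<forall>f. multilinear_on A n f \<longrightarrow> teval f F = 0)"
  by (simp add: tensor_power_def)

lemma tensor_power_tensor: "length as = n \<Longrightarrow> set as \<subseteq> A \<Longrightarrow> Poly_Mapping.single as c \<in> fst (tensor_power A n)"
  by (auto simp: tensor_power_fst split: if_splits)

lemma quot_space_tensor_power: "quot_space (tensor_power A n)"
proof -
  have 1: "cvec.subspace (fst (tensor_power A n))"
    unfolding cvec.subspace_def
  proof (intro conjI ballI allI)
    fix F G :: "'a list \<Rightarrow>\<^sub>0 complex" and c
    assume F: "F \<in> fst (tensor_power A n)"
    have "Poly_Mapping.keys (c *\<^sub>C F) \<subseteq> Poly_Mapping.keys F"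
      by (auto simp: in_keys_iff lookup_scaleC)
    then show "c *\<^sub>C F \<in> fst (tensor_power A n)"
      using F by (auto simp: tensor_power_fst)
    assume "G \<in> fst (tensor_power A n)"
    then show "F + G \<in> fst (tensor_power A n)"
      using F Poly_Mapping.keys_add[of F G] by (auto simp: tensor_power_fst)
  qed (simp add: tensor_power_fst)
  then show ?thesis
    by (auto simp: quot_space_def cvec.subspace_def tensor_power_snd teval_add teval_scale)
qed

text \<open>The induced map descends if every multilinear map on the target pulls back to a
  multilinear one. The pullback is compared only on lists of length \<open>n\<close> over
  \<open>A\<close>, since \<open>g\<close> may be arbitrary elsewhere.\<close>

lemma quot_hom_push:
  assumes "\<And>as. length as = n \<Longrightarrow> set as \<subseteq> A \<Longrightarrow> length (g as) = m \<and> set (g as) \<subseteq> B"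
    and "\<And>f. multilinear_on B m f \<Longrightarrow> \<exists>f'. multilinear_on A n f' \<and> (\<forall>as. length as = n \<longrightarrow> set as \<subseteq> A \<longrightarrow> f' as = f (g as))"
  shows "quot_hom (tensor_power A n) (tensor_power B m) (push g)"
proof -
  have 1: "push g F \<in> fst (tensor_power B m)" if "F \<in> fst (tensor_power A n)" for F
    using that keys_push[of g F] assms(1) by (fastforce simp: tensor_power_fst)
  have "teval f (push g F) = 0" if F: "F \<in> snd (tensor_power A n)" and f: "multilinear_on B m f" for F f
  proof -
    obtain f' where f': "multilinear_on A n f'" "\<And>as. length as = n \<Longrightarrow> set as \<subseteq> A \<Longrightarrow> f' as = f (g as)"
      using assms(2)[OF f] by blast
    have "teval f (push g F) = teval f' F"
      using F f'(2) by (auto simp: teval_push tensor_power_snd tensor_power_fst intro!: teval_cong)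
    then show ?thesis using F f'(1) by (simp add: tensor_power_snd)
  qed
  with 1 show ?thesis
    by (auto simp: quot_hom_def push_simps tensor_power_snd)
qed

section \<open>Operators acting on a single tensor factor\<close>

lemma linear_on_comp:
  assumes "linear_on B f" "linear_on A g" "\<And>a. a \<in> A \<Longrightarrow> g a \<in> B"
  shows "linear_on A (\<lambda>a. f (g a))"
  using assms(1,2) by (simp add: linear_on_def assms(3))

lemma multilinear_at_factor:
  assumes "multilinear_on A n f" "linear_on A \<phi>" "\<And>a. a \<in> A \<Longrightarrow> \<phi> a \<in> A" "p < n"
  shows "multilinear_on A n (\<lambda>as. f (as[p := \<phi> (as ! p)]))"
  unfolding multilinear_on_def
proof (intro allI impI)
  fix as i assume as: "length as = n" "set as \<subseteq> A" "i < n"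
  show "linear_on A (\<lambda>a. f (as[i := a, p := \<phi> (as[i := a] ! p)]))"
  proof (cases "i = p")
    case True
    have lin: "linear_on A (\<lambda>a. f (as[p := a]))"
      using assms(1) as True unfolding multilinear_on_def by blast
    have "(\<lambda>a. f (as[i := a, p := \<phi> (as[i := a] ! p)])) = (\<lambda>a. f (as[p := \<phi> a]))"
      using True as by simp
    then show ?thesis
      using linear_on_comp[OF lin assms(2,3)] by simp
  next
    case False
    have "as ! p \<in> A" using as assms(4) nth_mem by blast
    then have "\<phi> (as ! p) \<in> A" by (rule assms(3))
    then have "set (as[p := \<phi> (as ! p)]) \<subseteq> A"
      using as(2) set_update_subset_insert[of as p] by auto
    then have "linear_on A (\<lambda>a. f (as[p := \<phi> (as ! p), i := a]))"
      using assms(1) as unfolding multilinear_on_def by simp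
    then show ?thesis
      using False by (simp add: list_update_swap)
  qed
qed

lemma quot_hom_at_factor:
  assumes "linear_on A \<phi>" "\<And>a. a \<in> A \<Longrightarrow> \<phi> a \<in> A" "p \<in> {1..n}"
  shows "quot_hom (tensor_power A n) (tensor_power A n) (at_factor p \<phi>)"
  unfolding at_factor_def
proof (rule quot_hom_push)
  fix as :: "'a list" assume as: "length as = n" "set as \<subseteq> A"
  then have "\<phi> (as ! (p - 1)) \<in> A" using assms by (auto intro!: assms(2) simp: subset_iff)
  then show "length (as[p - 1 := \<phi> (as ! (p - 1))]) = n \<and> set (as[p - 1 := \<phi> (as ! (p - 1))]) \<subseteq> A"
    using as set_update_subset_insert[of as "p - 1"] by auto
next
  fix f :: "'a list \<Rightarrow> 'a" assume "multilinear_on A n f"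
  moreover have "p - 1 < n" using assms(3) by auto
  ultimately have "multilinear_on A n (\<lambda>as. f (as[p - 1 := \<phi> (as ! (p - 1))]))"
    using multilinear_at_factor assms(1,2) by blast
  then show "\<exists>f'. multilinear_on A n f' \<and> (\<forall>as. length as = n \<longrightarrow> set as \<subseteq> A \<longrightarrow> f' as = f (as[p - 1 := \<phi> (as ! (p - 1))]))"
    by blast
qed

lemma tensor_power_congI:
  assumes "quot_hom (tensor_power A n) (tensor_power B m) P" "quot_hom (tensor_power A n) (tensor_power B m) Q"
    and "\<And>as f. length as = n \<Longrightarrow> set as \<subseteq> A \<Longrightarrow> multilinear_on B m f \<Longrightarrow> teval f (P (tensor as)) = teval f (Q (tensor as))"
  shows "quot_cong (tensor_power A n) (tensor_power B m) P Q"
  unfolding quot_cong_def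
proof
  fix F assume F: "F \<in> fst (tensor_power A n)"
  have "teval f (P F) = teval f (Q F)" if f: "multilinear_on B m f" for f
  proof (rule linear_eqI[of "(UNIV, {0})" "(UNIV, {0})" "\<lambda>F. teval f (P F)" "(UNIV, {0})" "(UNIV, {0})" "\<lambda>F. teval f (Q F)"])
    have "quot_hom (UNIV, {0}) (UNIV, {0}) P" "quot_hom (UNIV, {0}) (UNIV, {0}) Q"
      using quot_hom_simps(1)[OF assms(1)] quot_hom_simps(1)[OF assms(2)] assms(1,2) by (auto simp: quot_hom_def)
    then show "quot_hom (UNIV, {0}) (UNIV, {0}) (\<lambda>F. teval f (P F))" "quot_hom (UNIV, {0}) (UNIV, {0}) (\<lambda>F. teval f (Q F))"
      by (auto intro: quot_hom_comp[OF teval_hom])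
    show "teval f (P (tensor as)) = teval f (Q (tensor as))" if "as \<in> Poly_Mapping.keys F" for as
      using that F f assms(3) by (auto simp: tensor_power_fst)
  qed
  moreover have "cvec.subspace (fst (tensor_power B m))"
    using quot_space_tensor_power[of B m] by (simp add: quot_space_def)
  from cvec.subspace_diff[OF this quot_homD(3)[OF assms(1) F] quot_homD(3)[OF assms(2) F]]
  have "P F - Q F \<in> fst (tensor_power B m)" .
  ultimately show "P F - Q F \<in> snd (tensor_power B m)"
    by (simp add: tensor_power_snd teval_simps)
qed

lemma lie_moduleD:
  assumes "lie_module A \<rho>"
  shows "cvec.subspace A" "a \<in> A \<Longrightarrow> \<rho> x a \<in> A" "linear_on A (\<rho> x)"
    "a \<in> A \<Longrightarrow> \<rho> (x + y) a = \<rho> x a + \<rho> y a" "a \<in> A \<Longrightarrow> \<rho> (c *\<^sub>C x) a = c *\<^sub>C \<rho> x a"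
    "a \<in> A \<Longrightarrow> \<rho> (lie x y) a = \<rho> x (\<rho> y a) - \<rho> y (\<rho> x a)"
    "a \<in> A \<Longrightarrow> \<rho> 0 a = 0"
proof -
  show add: "a \<in> A \<Longrightarrow> \<rho> (x + y) a = \<rho> x a + \<rho> y a" for a x y
    using assms by (auto simp: lie_module_def bilinear_on_def linear_on_def)
  show "a \<in> A \<Longrightarrow> \<rho> 0 a = 0" using add[of a 0 0] by simp
qed (use assms in \<open>auto simp: lie_module_def bilinear_on_def linear_on_def\<close>)

lemma multilinear_onD:
  assumes "multilinear_on A n f" "length as = n" "set as \<subseteq> A" "p < n"
  shows "a \<in> A \<Longrightarrow> b \<in> A \<Longrightarrow> f (as[p := a + b]) = f (as[p := a]) + f (as[p := b])"
    "a \<in> A \<Longrightarrow> f (as[p := c *\<^sub>C a]) = c *\<^sub>C f (as[p := a])"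
  using assms by (auto simp: multilinear_on_def linear_on_def)

lemma linear_on_0:
  assumes "cvec.subspace A" "linear_on A f"
  shows "f 0 = 0"
proof -
  have "f (0 *\<^sub>C 0) = 0 *\<^sub>C f 0"
    using assms cvec.subspace_0 unfolding linear_on_def by blast
  then show ?thesis by simp
qed

lemma linear_on_diff:
  assumes "cvec.subspace A" "linear_on A f" "a \<in> A" "b \<in> A"
  shows "f (a - b) = f a - f b"
proof -
  have "f ((a - b) + b) = f (a - b) + f b"
    using assms cvec.subspace_diff[OF assms(1,3,4)] by (simp only: linear_on_def)
  then show ?thesis by simp
qed

lemma at_factor_tensor: "at_factor p \<phi> (Poly_Mapping.single as c) = Poly_Mapping.single (as[p - 1 := \<phi> (as ! (p - 1))]) c"
  by (simp add: at_factor_def)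

lemma push_push: "push f (push g F) = push (\<lambda>k. f (g k)) F"
  by (simp only: push_eq_teval[of f] push_eq_teval[of "\<lambda>k. f (g k)"] teval_push)

lemma at_factor_commute:
  assumes "p - 1 \<noteq> q - 1"
  shows "at_factor p f (at_factor q g F) = at_factor q g (at_factor p f F)"
proof -
  have "as[q - 1 := g (as ! (q - 1)), p - 1 := f (as[q - 1 := g (as ! (q - 1))] ! (p - 1))]
      = as[p - 1 := f (as ! (p - 1)), q - 1 := g (as[p - 1 := f (as ! (p - 1))] ! (q - 1))]" for as
    by (simp only: nth_list_update_neq[OF assms] nth_list_update_neq[OF assms[symmetric]] list_update_swap[OF assms])
  then show ?thesis
    by (simp only: at_factor_def push_push)
qed

text \<open>Slot \<open>i\<close> acts on factor \<open>p i\<close> through the Lie homomorphism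
  \<open>e i\<close>. Several slots may share a factor, as the two copies of \<open>\<gg>\<close>
  do, provided their images commute.\<close>

lemma slot_system_at_factor:
  fixes e :: "nat \<Rightarrow> 'g::lie_algebra \<Rightarrow> 'k::lie_algebra" and \<rho> :: "'k \<Rightarrow> 'a::complex_vector \<Rightarrow> 'a"
  assumes \<rho>: "lie_module A \<rho>" and p: "\<And>i. i \<in> I \<Longrightarrow> p i \<in> {1..n}"
    and e: "\<And>i x y. e i (x + y) = e i x + e i y" "\<And>i c x. e i (c *\<^sub>C x) = c *\<^sub>C e i x"
      "\<And>i x y. e i (lie x y) = lie (e i x) (e i y)"
    and comm: "\<And>i k x y. i \<in> I \<Longrightarrow> k \<in> I \<Longrightarrow> i \<noteq> k \<Longrightarrow> p i = p k \<Longrightarrow> lie (e i x) (e k y) = 0"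
    and \<sigma>: "\<And>i x. i \<in> I \<Longrightarrow> \<sigma> i x = at_factor (p i) (\<rho> (e i x))"
  shows "slot_system (tensor_power A n) I \<sigma>"
proof -
  note D = lie_moduleD[OF \<rho>]
  let ?S = "tensor_power A n"
  have S: "quot_space ?S" by (rule quot_space_tensor_power)
  have hom: "quot_hom ?S ?S (at_factor (p i) (\<rho> x))" if "i \<in> I" for i x
    by (rule quot_hom_at_factor) (use D p that in auto)
  have nth: "as ! (p i - 1) \<in> A" if "i \<in> I" "length as = n" "set as \<subseteq> A" for as i
  proof -
    have "p i - 1 < length as" using p[OF that(1)] that(2) by auto
    then show ?thesis using that(3) nth_mem by blast
  qed
  have lt: "p i - 1 < n" if "i \<in> I" for i using p[OF that] by auto
  have add: "quot_cong ?S ?S (\<sigma> i (x + y)) (\<lambda>v. \<sigma> i x v + \<sigma> i y v)" if i: "i \<in> I" for i x y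
    unfolding \<sigma>[OF i]
  proof (rule tensor_power_congI[OF hom[OF i] quot_hom_add[OF S hom[OF i] hom[OF i]]])
    fix as f assume as: "length as = n" "set as \<subseteq> A" "multilinear_on A n f"
    show "teval f (at_factor (p i) (\<rho> (e i (x + y))) (tensor as))
        = teval f (at_factor (p i) (\<rho> (e i x)) (tensor as) + at_factor (p i) (\<rho> (e i y)) (tensor as))"
      using as nth[OF i as(1,2)] multilinear_onD(1)[OF as(3,1,2) lt[OF i]]
      by (simp add: at_factor_tensor teval_add e D)
  qed
  have scale: "quot_cong ?S ?S (\<sigma> i (c *\<^sub>C x)) (\<lambda>v. c *\<^sub>C \<sigma> i x v)" if i: "i \<in> I" for i c x
    unfolding \<sigma>[OF i]
  proof (rule tensor_power_congI[OF hom[OF i] quot_hom_scale[OF S hom[OF i]]])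
    fix as f assume as: "length as = n" "set as \<subseteq> A" "multilinear_on A n f"
    show "teval f (at_factor (p i) (\<rho> (e i (c *\<^sub>C x))) (tensor as)) = teval f (c *\<^sub>C at_factor (p i) (\<rho> (e i x)) (tensor as))"
      using as nth[OF i as(1,2)] multilinear_onD(2)[OF as(3,1,2) lt[OF i]]
      by (simp add: at_factor_tensor teval_scale e D)
  qed
  have upd: "length (as[p i - 1 := a]) = n" "set (as[p i - 1 := a]) \<subseteq> A" if "length as = n" "set as \<subseteq> A" "a \<in> A" for as i a
    using that set_update_subset_insert[of as "p i - 1" a] by auto
  have bracket: "quot_cong ?S ?S (\<lambda>v. at_factor (p i) (\<rho> (lie x y)) v)
      (\<lambda>v. at_factor (p i) (\<rho> x) (at_factor (p i) (\<rho> y) v) - at_factor (p i) (\<rho> y) (at_factor (p i) (\<rho> x) v))"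
    if i: "i \<in> I" for i x y
  proof -
    have minus: "(\<lambda>v. P v - Q v) = (\<lambda>v. P v + (- 1) *\<^sub>C Q v)" for P Q :: "('a list \<Rightarrow>\<^sub>0 complex) \<Rightarrow> ('a list \<Rightarrow>\<^sub>0 complex)"
      by (simp add: scaleC_one)
    have "quot_hom ?S ?S (\<lambda>v. at_factor (p i) (\<rho> x) (at_factor (p i) (\<rho> y) v) - at_factor (p i) (\<rho> y) (at_factor (p i) (\<rho> x) v))"
      unfolding minus by (intro quot_hom_add quot_hom_scale quot_hom_comp[OF hom[OF i] hom[OF i]] S)
    then show ?thesis
    proof (rule tensor_power_congI[OF hom[OF i]])
      fix as f assume as: "length as = n" "set as \<subseteq> A" "multilinear_on A n f"
      have "linear_on A (\<lambda>a. f (as[p i - 1 := a]))"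
        using as lt[OF i] by (simp add: multilinear_on_def)
      from linear_on_diff[OF D(1) this]
      show "teval f (at_factor (p i) (\<rho> (lie x y)) (tensor as))
        = teval f (at_factor (p i) (\<rho> x) (at_factor (p i) (\<rho> y) (tensor as)) - at_factor (p i) (\<rho> y) (at_factor (p i) (\<rho> x) (tensor as)))"
        using as nth[OF i as(1,2)] lt[OF i]
        by (simp add: at_factor_tensor teval_simps scaleC_one e D)
    qed
  qed
  have commutes: "commutes_mod ?S (\<sigma> i x) (\<sigma> k y)" if ik: "i \<in> I" "k \<in> I" "i \<noteq> k" for i k x y
  proof (cases "p i = p k")
    case True
    \<comment> \<open>On a common factor the commutator of the two slots is the action of their
      bracket, which is zero by \<open>comm\<close>.\<close>
    have "quot_cong ?S ?S (\<lambda>v. at_factor (p i) (\<rho> (lie (e i x) (e k y))) v) (\<lambda>v. 0)"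
    proof (rule tensor_power_congI[OF hom[OF ik(1)] quot_hom_zero[OF S]])
      fix as f assume as: "length as = n" "set as \<subseteq> A" "multilinear_on A n f"
      have "linear_on A (\<lambda>a. f (as[p i - 1 := a]))"
        using as lt[OF ik(1)] by (simp add: multilinear_on_def)
      from linear_on_0[OF D(1) this]
      show "teval f (at_factor (p i) (\<rho> (lie (e i x) (e k y))) (tensor as)) = teval f 0"
        using nth[OF ik(1) as(1,2)] by (simp add: at_factor_tensor comm[OF ik True] D(7))
    qed
    from quot_cong_trans[OF S quot_cong_sym[OF S bracket[OF ik(1)]] this]
    show ?thesis
      unfolding \<sigma>[OF ik(1)] \<sigma>[OF ik(2)] True[symmetric] commutes_mod_def quot_cong_def by (simp only: diff_zero)
  next
    case False
    \<comment> \<open>Factors are counted from 1 and list positions from 0; truncated subtraction is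
      injective on positive numbers.\<close>
    have "1 \<le> p i" "1 \<le> p k" using p[OF ik(1)] p[OF ik(2)] by auto
    then have "p i - 1 \<noteq> p k - 1" using False by arith
    then show ?thesis
      unfolding commutes_mod_def \<sigma>[OF ik(1)] \<sigma>[OF ik(2)]
      by (subst at_factor_commute) (simp_all only: quot_cong_refl[OF S])
  qed
  show ?thesis
    unfolding slot_system_def
  proof (intro conjI ballI allI impI)
    fix i x y assume i: "i \<in> I"
    show "quot_hom ?S ?S (\<sigma> i x)" unfolding \<sigma>[OF i] by (rule hom[OF i])
    show "quot_cong ?S ?S (\<sigma> i (lie x y)) (\<lambda>v. \<sigma> i x (\<sigma> i y v) - \<sigma> i y (\<sigma> i x v))"
      unfolding \<sigma>[OF i] e(3) by (rule bracket[OF i])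
  qed (fact S add scale commutes)+
qed


lemma commutes_mod_zero_left: "quot_hom S S P \<Longrightarrow> quot_space S \<Longrightarrow> commutes_mod S (\<lambda>v. 0) P"
  by (simp add: commutes_mod_def quot_cong_def quot_hom_simps(1) quot_spaceD(5))

lemma commutes_mod_zero_right: "quot_hom S S P \<Longrightarrow> quot_space S \<Longrightarrow> commutes_mod S P (\<lambda>v. 0)"
  by (simp add: commutes_mod_def quot_cong_def quot_hom_simps(1) quot_spaceD(5))

text \<open>Two families of slots, for two different Lie algebras, combined into one set of strands:\<close>

definition chord_op ::
  "nat set \<Rightarrow> ('g::lie_algebra \<times> 'g \<Rightarrow>\<^sub>0 complex) \<Rightarrow> (nat \<Rightarrow> 'g \<Rightarrow> 'v \<Rightarrow> 'v)
    \<Rightarrow> nat set \<Rightarrow> ('h::lie_algebra \<times> 'h \<Rightarrow>\<^sub>0 complex) \<Rightarrow> (nat \<Rightarrow> 'h \<Rightarrow> 'v \<Rightarrow> 'v)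
    \<Rightarrow> nat \<times> nat \<Rightarrow> 'v \<Rightarrow> 'v::complex_vector" where
  "chord_op I t \<sigma> I' t' \<sigma>' = (\<lambda>(i, k).
     if i \<in> I \<and> k \<in> I \<and> i \<noteq> k then t_action t \<sigma> {i} {k}
     else if i \<in> I' \<and> k \<in> I' \<and> i \<noteq> k then t_action t' \<sigma>' {i} {k} else (\<lambda>v. 0))"

text \<open>A chord between the two families acts by zero. This respects the relations because slots
  of different families commute, and because both chords to a strand \<open>k\<close> of the other
  family vanish in the four-term relation.\<close>

lemma braid_rep_chord_op:
  assumes 1: "slot_system S I \<sigma>" "invariant_symmetric t" and 2: "slot_system S I' \<sigma>'" "invariant_symmetric t'"
    and disj: "I \<inter> I' = {}"
    and comm: "\<And>i k x y. i \<in> I \<Longrightarrow> k \<in> I' \<Longrightarrow> commutes_mod S (\<sigma> i x) (\<sigma>' k y)"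
  shows "braid_rep S (chord_op I t \<sigma> I' t' \<sigma>')"
proof -
  let ?r = "chord_op I t \<sigma> I' t' \<sigma>'"
  have S: "quot_space S" by (rule slot_systemD(1)[OF 1(1)])
  have hom1: "quot_hom S S (t_action t \<sigma> {i} {k})" if "i \<in> I" "k \<in> I" for i k
    by (rule t_action_hom[OF 1]) (use that in auto)
  have hom2: "quot_hom S S (t_action t' \<sigma>' {i} {k})" if "i \<in> I'" "k \<in> I'" for i k
    by (rule t_action_hom[OF 2]) (use that in auto)
  have r1: "?r (i, k) = t_action t \<sigma> {i} {k}" if "i \<in> I" "k \<in> I" "i \<noteq> k" for i k
    using that by (simp add: chord_op_def)
  have r2: "?r (i, k) = t_action t' \<sigma>' {i} {k}" if "i \<in> I'" "k \<in> I'" "i \<noteq> k" for i k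
    using that disj by (auto simp: chord_op_def)
  have r0: "?r (i, k) = (\<lambda>v. 0)" if "\<not> (i \<in> I \<and> k \<in> I \<and> i \<noteq> k)" "\<not> (i \<in> I' \<and> k \<in> I' \<and> i \<noteq> k)" for i k
    unfolding chord_op_def using that by auto
  have cases: thesis if "i \<in> I \<Longrightarrow> k \<in> I \<Longrightarrow> i \<noteq> k \<Longrightarrow> thesis" "i \<in> I' \<Longrightarrow> k \<in> I' \<Longrightarrow> i \<noteq> k \<Longrightarrow> thesis"
    "?r (i, k) = (\<lambda>v. 0) \<Longrightarrow> thesis" for i k thesis
    using that r0 by blast
  have hom: "quot_hom S S (?r g)" for g
  proof (cases g)
    case (Pair i k)
    show ?thesis
      unfolding Pair by (rule cases[of i k]) (simp_all add: r1 r2 hom1 hom2 quot_hom_zero[OF S])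
  qed
  have comm12: "commutes_mod S (t_action t \<sigma> {i} {j}) (t_action t' \<sigma>' {k} {l})"
    if "i \<in> I" "j \<in> I" "k \<in> I'" "l \<in> I'" for i j k l
  proof (rule commutes_mod_t_action[OF 2 that(3,4) hom1[OF that(1,2)]])
    have "commutes_mod S (\<sigma>' m x) (t_action t \<sigma> {i} {j})" if m: "m \<in> I'" for m x
    proof (rule commutes_mod_t_action[OF 1 \<open>i \<in> I\<close> \<open>j \<in> I\<close> slot_systemD(2)[OF 2(1) m]])
      fix y
      show "commutes_mod S (\<sigma>' m x) (\<sigma> i y)" by (rule commutes_mod_sym[OF S comm[OF \<open>i \<in> I\<close> m]])
      show "commutes_mod S (\<sigma>' m x) (\<sigma> j y)" by (rule commutes_mod_sym[OF S comm[OF \<open>j \<in> I\<close> m]])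
    qed
    from commutes_mod_sym[OF S this]
    show "commutes_mod S (t_action t \<sigma> {i} {j}) (\<sigma>' k x)" "commutes_mod S (t_action t \<sigma> {i} {j}) (\<sigma>' l x)" for x
      using that(3,4) by blast+
  qed
  have commute: "commutes_mod S (?r (i, j)) (?r (k, l))" if d: "distinct [i, j, k, l]" for i j k l
  proof (rule cases[of i j])
    assume ij: "i \<in> I" "j \<in> I" "i \<noteq> j"
    show ?thesis
    proof (rule cases[of k l])
      assume kl: "k \<in> I" "l \<in> I" "k \<noteq> l"
      show ?thesis unfolding r1[OF ij] r1[OF kl]
        by (rule t_action_commute[OF 1 _ d]) (use ij kl in auto)
    next
      assume kl: "k \<in> I'" "l \<in> I'" "k \<noteq> l"
      show ?thesis unfolding r1[OF ij] r2[OF kl] by (rule comm12[OF ij(1,2) kl(1,2)])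
    next
      assume kl: "?r (k, l) = (\<lambda>v. 0)"
      show ?thesis unfolding kl by (rule commutes_mod_zero_right[OF hom S])
    qed
  next
    assume ij: "i \<in> I'" "j \<in> I'" "i \<noteq> j"
    show ?thesis
    proof (rule cases[of k l])
      assume kl: "k \<in> I" "l \<in> I" "k \<noteq> l"
      show ?thesis unfolding r2[OF ij] r1[OF kl]
        by (rule commutes_mod_sym[OF S comm12[OF kl(1,2) ij(1,2)]])
    next
      assume kl: "k \<in> I'" "l \<in> I'" "k \<noteq> l"
      show ?thesis unfolding r2[OF ij] r2[OF kl]
        by (rule t_action_commute[OF 2 _ d]) (use ij kl in auto)
    next
      assume kl: "?r (k, l) = (\<lambda>v. 0)"
      show ?thesis unfolding kl by (rule commutes_mod_zero_right[OF hom S])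
    qed
  next
    assume ij: "?r (i, j) = (\<lambda>v. 0)"
    show ?thesis unfolding ij by (rule commutes_mod_zero_left[OF hom S])
  qed
  have four_term: "commutes_mod S (?r (i, j)) (\<lambda>v. ?r (i, k) v + ?r (j, k) v)" if d: "distinct [i, j, k]" for i j k
  proof (rule cases[of i j])
    assume ij: "i \<in> I" "j \<in> I" "i \<noteq> j"
    show ?thesis
    proof (cases "k \<in> I")
      case True
      have ne: "i \<noteq> k" "j \<noteq> k" using d by auto
      show ?thesis unfolding r1[OF ij] r1[OF ij(1) True ne(1)] r1[OF ij(2) True ne(2)]
        by (rule t_action_four_term[OF 1 _ d]) (use ij True in auto)
    next
      case False
      have "?r (i, k) = (\<lambda>v. 0)" "?r (j, k) = (\<lambda>v. 0)"
        by (rule r0; use False ij disj in blast)+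
      then show ?thesis using commutes_mod_zero_right[OF hom S] by simp
    qed
  next
    assume ij: "i \<in> I'" "j \<in> I'" "i \<noteq> j"
    show ?thesis
    proof (cases "k \<in> I'")
      case True
      have ne: "i \<noteq> k" "j \<noteq> k" using d by auto
      show ?thesis unfolding r2[OF ij] r2[OF ij(1) True ne(1)] r2[OF ij(2) True ne(2)]
        by (rule t_action_four_term[OF 2 _ d]) (use ij True in auto)
    next
      case False
      have "?r (i, k) = (\<lambda>v. 0)" "?r (j, k) = (\<lambda>v. 0)"
        by (rule r0; use False ij disj in blast)+
      then show ?thesis using commutes_mod_zero_right[OF hom S] by simp
    qed
  next
    assume ij: "?r (i, j) = (\<lambda>v. 0)"
    show ?thesis unfolding ij by (rule commutes_mod_zero_left[OF quot_hom_add[OF S hom hom] S])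
  qed
  have sym: "quot_cong S S (?r (i, j)) (?r (j, i))" for i j
  proof (rule cases[of i j])
    assume ij: "i \<in> I" "j \<in> I" "i \<noteq> j"
    show ?thesis unfolding r1[OF ij] r1[OF ij(2,1) ij(3)[symmetric]] by (rule t_action_sym[OF 1 ij])
  next
    assume ij: "i \<in> I'" "j \<in> I'" "i \<noteq> j"
    show ?thesis unfolding r2[OF ij] r2[OF ij(2,1) ij(3)[symmetric]] by (rule t_action_sym[OF 2 ij])
  next
    assume ij: "?r (i, j) = (\<lambda>v. 0)"
    show ?thesis
    proof (cases "?r (j, i) = (\<lambda>v. 0)")
      case True
      then show ?thesis unfolding ij by (simp add: quot_cong_refl[OF S])
    next
      case False
      then consider (a) "i \<in> I" "j \<in> I" "i \<noteq> j" | (b) "i \<in> I'" "j \<in> I'" "i \<noteq> j"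
        using r0 by blast
      then show ?thesis
      proof cases
        case a
        show ?thesis unfolding r1[OF a] r1[OF a(2,1) a(3)[symmetric]] by (rule t_action_sym[OF 1 a])
      next
        case b
        show ?thesis unfolding r2[OF b] r2[OF b(2,1) b(3)[symmetric]] by (rule t_action_sym[OF 2 b])
      qed
    qed
  qed
  show ?thesis
    unfolding braid_rep_def
    using S hom sym commute four_term unfolding commutes_mod_def by blast
qed


section \<open>The semiclassical limit\<close>

lemma nc_eval_0: "f [] = 1 \<Longrightarrow> nc_eval f P Q 0 v = v"
  by (simp add: nc_eval_def words_0 scaleC_one)

lemma sum_words_1: "(\<Sum>w | length w = Suc 0. F w) = F [Lx] + F [Ly]"
  for F :: "letter list \<Rightarrow> 'b::comm_monoid_add"
  unfolding sum_words_Suc by simp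

lemma nc_eval_1:
  assumes "f [Lx] = 0" "f [Ly] = 0"
  shows "nc_eval f P Q (Suc 0) v = 0"
  unfolding nc_eval_def sum_words_1 by (simp add: assms)

text \<open>The normalization of the associator enters here: its degree-two part is 1/24 times the
  commutator.\<close>

lemma nc_eval_associator_2:
  assumes "drinfeld_associator \<Phi>"
  shows "nc_eval \<Phi> P Q (Suc (Suc 0)) v = (1 / 24) *\<^sub>C (P (Q v) - Q (P v))"
  using assms unfolding nc_eval_def sum_words_Suc[of _ "Suc 0"] sum_words_1
  by (simp add: drinfeld_associator_def scaleC_add_right cvec.scale_right_diff_distrib)

lemma associator_low:
  assumes "drinfeld_associator \<Phi>"
  shows "\<Phi> [] = 1" "\<Phi> [Lx] = 0" "\<Phi> [Ly] = 0"
  using assms by (auto simp: drinfeld_associator_def group_like_def)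

section \<open>Associativity as an identity between composed series\<close>

definition mult_op :: "(nat \<Rightarrow> 'a \<Rightarrow> 'a \<Rightarrow> 'a) \<Rightarrow> nat \<Rightarrow> ('a list \<Rightarrow>\<^sub>0 complex) \<Rightarrow> 'a::complex_vector" where
  "mult_op m i = teval (\<lambda>as. m i (as ! 0) (as ! 1))"

definition mult_right :: "(nat \<Rightarrow> 'a \<Rightarrow> 'a \<Rightarrow> 'a) \<Rightarrow> nat \<Rightarrow> ('a list \<Rightarrow>\<^sub>0 complex) \<Rightarrow> ('a list \<Rightarrow>\<^sub>0 complex)" where
  "mult_right m j = push (\<lambda>as. [as ! 0, m j (as ! 1) (as ! 2)])"

definition mult_left :: "(nat \<Rightarrow> 'a \<Rightarrow> 'a \<Rightarrow> 'a) \<Rightarrow> nat \<Rightarrow> ('a list \<Rightarrow>\<^sub>0 complex) \<Rightarrow> ('a list \<Rightarrow>\<^sub>0 complex)" where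
  "mult_left m j = push (\<lambda>as. [m j (as ! 0) (as ! 1), as ! 2])"

lemma sum_pairs: "(\<Sum>(i, j) | i + j = n. G i j) = (\<Sum>i\<le>n. G i (n - i))"
  for G :: "nat \<Rightarrow> nat \<Rightarrow> 'b::comm_monoid_add"
  by (rule sum.reindex_bij_witness[where i = "\<lambda>i. (i, n - i)" and j = fst]) auto

lemma sum_triples: "(\<Sum>(i, j, k) | i + j + k = n. G i j k) = (\<Sum>i\<le>n. \<Sum>j\<le>n - i. G i j (n - i - j))"
  for G :: "nat \<Rightarrow> nat \<Rightarrow> nat \<Rightarrow> 'b::comm_monoid_add"
  unfolding sum.Sigma[OF finite_atMost ballI[OF finite_atMost]]
  by (rule sum.reindex_bij_witness[where i = "\<lambda>(i, j). (i, j, n - i - j)" and j = "\<lambda>(i, j, k). (i, j)"]) auto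

lemma mult_op_hom: "quot_hom (UNIV, {0}) (UNIV, {0}) (mult_op m i)"
  unfolding mult_op_def by (rule teval_hom)

lemma mult_op_simps:
  "mult_op m i (tensor [a, b]) = m i a b"
  "mult_op m i (mult_right m' j F) = teval (\<lambda>as. m i (as ! 0) (m' j (as ! 1) (as ! 2))) F"
  "mult_op m i (mult_left m' j F) = teval (\<lambda>as. m i (m' j (as ! 0) (as ! 1)) (as ! 2)) F"
  by (simp_all add: mult_op_def mult_right_def mult_left_def teval_push scaleC_one)

text \<open>Brings the triple sum into the form of composed series, whose factors can be exchanged
  one at a time.\<close>

lemma assoc_algebra_iff:
  "assoc_algebra \<Phi> t A \<rho> m \<longleftrightarrow> lie_module A \<rho> \<and> (\<forall>i. invariant_bilinear A \<rho> (m i)) \<and>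
     (\<forall>n. \<forall>a\<in>A. \<forall>b\<in>A. \<forall>c\<in>A.
       (mult_op m \<odot> mult_right m \<odot> placed \<Phi> (t_action t (module_slots \<rho>)) {1} {2} {3}) n (tensor [a, b, c])
       = (mult_op m \<odot> mult_left m) n (tensor [a, b, c]))"
  unfolding assoc_algebra_def sum_pairs sum_triples series_comp_def
  by (simp add: quot_hom_simps(4)[OF mult_op_hom] mult_op_simps scaleC_one)

lemma bilinear_onD:
  assumes "bilinear_on A A m" "a \<in> A" "b \<in> A" "c \<in> A"
  shows "m (a + b) c = m a c + m b c" "m c (a + b) = m c a + m c b"
    "m (s *\<^sub>C a) c = s *\<^sub>C m a c" "m c (s *\<^sub>C a) = s *\<^sub>C m c a"
  using assms by (auto simp: bilinear_on_def linear_on_def)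

lemma invariant_bilinearD:
  assumes "invariant_bilinear A \<rho> m"
  shows "bilinear_on A A m" "a \<in> A \<Longrightarrow> b \<in> A \<Longrightarrow> m a b \<in> A"
    "a \<in> A \<Longrightarrow> b \<in> A \<Longrightarrow> \<rho> x (m a b) = m (\<rho> x a) b + m a (\<rho> x b)"
  using assms by (auto simp: invariant_bilinear_def)

lemma bilinear_on_cong:
  assumes "cvec.subspace A" "bilinear_on A A m" "\<And>a b. a \<in> A \<Longrightarrow> b \<in> A \<Longrightarrow> m' a b = m a b"
  shows "bilinear_on A A m'"
  unfolding bilinear_on_def linear_on_def
proof (intro conjI ballI allI)
  fix a b c s assume *: "a \<in> A" "b \<in> A" "c \<in> A"
  note mem = *[THEN cvec.subspace_scale[OF assms(1)]] cvec.subspace_add[OF assms(1) *(2,3)]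
  show "m' (b + c) a = m' b a + m' c a" "m' a (b + c) = m' a b + m' a c"
    using bilinear_onD(1,2)[OF assms(2) *(2,3,1)] * mem by (simp_all add: assms(3))
  show "m' (s *\<^sub>C b) a = s *\<^sub>C m' b a" "m' a (s *\<^sub>C b) = s *\<^sub>C m' a b"
    using bilinear_onD(3,4)[OF assms(2) *(2,2,1)] * mem by (simp_all add: assms(3))
qed

lemma invariant_bilinear_cong:
  assumes "lie_module A \<rho>" "invariant_bilinear A \<rho> m" "\<And>a b. a \<in> A \<Longrightarrow> b \<in> A \<Longrightarrow> m' a b = m a b"
  shows "invariant_bilinear A \<rho> m'"
  unfolding invariant_bilinear_def
  using bilinear_on_cong[OF lie_moduleD(1)[OF assms(1)] invariant_bilinearD(1)[OF assms(2)] assms(3)]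
    invariant_bilinearD(2,3)[OF assms(2)] lie_moduleD(2)[OF assms(1)]
  by (simp add: assms(3))

lemma slot_system_module_slots:
  assumes "lie_module A \<rho>"
  shows "slot_system (tensor_power A n) {1..n} (module_slots \<rho>)"
proof (rule slot_system_at_factor[where p = "\<lambda>i. i" and e = "\<lambda>i x. x" and I = "{1..n}", OF assms])
  show "module_slots \<rho> i x = at_factor i (\<rho> x)" for i x by (simp add: module_slots_def)
qed (rule refl | assumption | blast)+

text \<open>The Jacobiator \<open>\<phi>\<close> is antisymmetric by the four-term relation.\<close>

lemma chord_bracket_antisym:
  defines "x \<equiv> \<lambda>i j. abs_braid_algebra (chord i j)"
  shows "x 2 1 * x 1 3 - x 1 3 * x 2 1 = - (x 1 2 * x 2 3 - x 2 3 * x 1 2)"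
    "x 1 3 * x 3 2 - x 3 2 * x 1 3 = - (x 1 2 * x 2 3 - x 2 3 * x 1 2)"
proof -
  have s: "x i j = x j i" for i j unfolding x_def by (rule chord_sym)
  have 1: "x 1 2 * (x 1 3 + x 2 3) = (x 1 3 + x 2 3) * x 1 2"
    unfolding x_def by (rule chord_four_term) simp
  have 2: "x 2 3 * (x 2 1 + x 3 1) = (x 2 1 + x 3 1) * x 2 3"
    unfolding x_def by (rule chord_four_term) simp
  show "x 2 1 * x 1 3 - x 1 3 * x 2 1 = - (x 1 2 * x 2 3 - x 2 3 * x 1 2)"
    using 1 by (simp add: s[of 2 1] algebra_simps del: One_nat_def)
  show "x 1 3 * x 3 2 - x 3 2 * x 1 3 = - (x 1 2 * x 2 3 - x 2 3 * x 1 2)"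
    using 2 by (simp add: s[of 2 1] s[of 3 1] s[of 3 2] algebra_simps del: One_nat_def)
qed

lemma represents_diff:
  assumes "quot_space S" "\<And>g. quot_hom S S (r g)" "represents S r P p" "represents S r Q q"
  shows "represents S r (\<lambda>v. P v - Q v) (p - q)"
proof -
  have "represents S r (\<lambda>v. P v + (- 1) *\<^sub>C Q v) (p + (- 1) *\<^sub>C q)"
    by (rule represents_add[OF assms(1,2,3) represents_scale[OF assms(1,2,4)]])
  then show ?thesis by (simp add: scaleC_one)
qed

text \<open>Compares the commutator with the ones obtained by swapping two neighbouring tensor
  factors. The second family of slots in \<open>chord_op\<close> is empty, which leaves the three
  strands of one module.\<close>

lemma t_bracket_antisym:
  assumes "lie_module A \<rho>" "invariant_symmetric t"
  defines "\<tau> \<equiv> \<lambda>i j. t_action t (module_slots \<rho>) {i} {j}"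
  shows "quot_cong (tensor_power A 3) (tensor_power A 3) (\<lambda>v. \<tau> 2 1 (\<tau> 1 3 v) - \<tau> 1 3 (\<tau> 2 1 v))
      (\<lambda>v. \<tau> 2 3 (\<tau> 1 2 v) - \<tau> 1 2 (\<tau> 2 3 v))"
    "quot_cong (tensor_power A 3) (tensor_power A 3) (\<lambda>v. \<tau> 1 3 (\<tau> 3 2 v) - \<tau> 3 2 (\<tau> 1 3 v))
      (\<lambda>v. \<tau> 2 3 (\<tau> 1 2 v) - \<tau> 1 2 (\<tau> 2 3 v))"
proof -
  let ?S = "tensor_power A 3" and ?I = "{1..3 :: nat}"
  let ?r = "chord_op ?I t (module_slots \<rho>) {} t (module_slots \<rho>)"
  have S: "quot_space ?S" by (rule quot_space_tensor_power)
  have sl: "slot_system ?S ?I (module_slots \<rho>)" by (rule slot_system_module_slots[OF assms(1)])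
  have sl0: "slot_system ?S {} (module_slots \<rho>)" using S by (simp add: slot_system_def)
  have rep: "braid_rep ?S ?r"
    by (rule braid_rep_chord_op[OF sl assms(2) sl0 assms(2)]) auto
  then have hom: "quot_hom ?S ?S (?r g)" for g unfolding braid_rep_def by blast
  have "represents ?S ?r (\<tau> i j) (abs_braid_algebra (chord i j))" if "i \<in> ?I" "j \<in> ?I" "i \<noteq> j" for i j
    using represents_chord[OF S, where r = ?r and i = i and j = j, OF hom] that by (simp add: chord_op_def \<tau>_def)
  then have r: "represents ?S ?r (\<lambda>v. \<tau> i j (\<tau> k l v) - \<tau> k l (\<tau> i j v))
      (abs_braid_algebra (chord i j) * abs_braid_algebra (chord k l) - abs_braid_algebra (chord k l) * abs_braid_algebra (chord i j))"
    if "i \<in> ?I" "j \<in> ?I" "i \<noteq> j" "k \<in> ?I" "l \<in> ?I" "k \<noteq> l" for i j k l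
    using that by (intro represents_diff[OF S hom] represents_comp[OF S hom]) simp_all
  show "quot_cong ?S ?S (\<lambda>v. \<tau> 2 1 (\<tau> 1 3 v) - \<tau> 1 3 (\<tau> 2 1 v)) (\<lambda>v. \<tau> 2 3 (\<tau> 1 2 v) - \<tau> 1 2 (\<tau> 2 3 v))"
    using represents_cong[OF rep r[of 2 1 1 3]] r[of 2 3 1 2] chord_bracket_antisym(1) by simp
  show "quot_cong ?S ?S (\<lambda>v. \<tau> 1 3 (\<tau> 3 2 v) - \<tau> 3 2 (\<tau> 1 3 v)) (\<lambda>v. \<tau> 2 3 (\<tau> 1 2 v) - \<tau> 1 2 (\<tau> 2 3 v))"
    using represents_cong[OF rep r[of 1 3 3 2]] r[of 2 3 1 2] chord_bracket_antisym(2) by simp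
qed

lemma nth_3: "length as = 3 \<Longrightarrow> as = [as ! 0, as ! 1, as ! 2]"
  by (simp add: list_eq_iff_nth_eq nth_Cons numeral_3_eq_3 less_Suc_eq numeral_2_eq_2)

lemma nth_2: "length as = 2 \<Longrightarrow> as = [as ! 0, as ! 1]"
  by (simp add: list_eq_iff_nth_eq nth_Cons numeral_2_eq_2 less_Suc_eq)

lemma multilinear_triple:
  assumes "\<And>b c. b \<in> A \<Longrightarrow> c \<in> A \<Longrightarrow> linear_on A (\<lambda>a. f a b c)" "\<And>a c. a \<in> A \<Longrightarrow> c \<in> A \<Longrightarrow> linear_on A (\<lambda>b. f a b c)"
    "\<And>a b. a \<in> A \<Longrightarrow> b \<in> A \<Longrightarrow> linear_on A (\<lambda>c. f a b c)"
  shows "multilinear_on A 3 (\<lambda>as. f (as ! 0) (as ! 1) (as ! 2))"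
  unfolding multilinear_on_def
proof (intro allI impI)
  fix as :: "'a list" and i :: nat assume as: "length as = 3" "set as \<subseteq> A" "i < 3"
  obtain a b c where abc: "as = [a, b, c]" using nth_3[OF as(1)] by blast
  have "i = 0 \<or> i = 1 \<or> i = 2" using as(3) by auto
  then show "linear_on A (\<lambda>x. f (as[i := x] ! 0) (as[i := x] ! 1) (as[i := x] ! 2))"
    using as(2) assms unfolding abc by (elim disjE) simp_all
qed

lemma multilinear_pair:
  assumes "bilinear_on A A m"
  shows "multilinear_on A 2 (\<lambda>as. m (as ! 0) (as ! 1))"
  unfolding multilinear_on_def
proof (intro allI impI)
  fix as :: "'a list" and i :: nat assume as: "length as = 2" "set as \<subseteq> A" "i < 2"
  obtain a b where ab: "as = [a, b]" using nth_2[OF as(1)] by blast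
  have "i = 0 \<or> i = 1" using as(3) by auto
  then show "linear_on A (\<lambda>x. m (as[i := x] ! 0) (as[i := x] ! 1))"
    using as(2) assms unfolding ab bilinear_on_def by (elim disjE) simp_all
qed

lemma teval_quot_hom:
  "multilinear_on A n f \<Longrightarrow> quot_hom (tensor_power A n) (UNIV, {0}) (teval f)"
  by (simp add: quot_hom_def teval_add teval_scale tensor_power_snd)

lemma quot_cong_teval_eq:
  assumes "quot_cong (tensor_power A n) (tensor_power A n) P Q" "multilinear_on A n f" "v \<in> fst (tensor_power A n)"
  shows "teval f (P v) = teval f (Q v)"
proof -
  have "teval f (P v - Q v) = 0"
    using quot_congD[OF assms(1,3)] assms(2) unfolding tensor_power_snd by blast
  then show ?thesis by (simp add: teval_simps)
qed

lemma scaleC_six: "6 *\<^sub>C x = x + x + x + x + x + x" for x :: "'a::complex_vector"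
proof -
  have "(1 + 1 + 1 + 1 + 1 + 1) *\<^sub>C x = x + x + x + x + x + x"
    by (simp only: scaleC_add_left scaleC_one)
  moreover have "(1 + 1 + 1 + 1 + 1 + 1 :: complex) = 6" by simp
  ultimately show ?thesis by (simp only:)
qed

text \<open>Degree 0 is associativity of \<open>m0\<close>. Degree 1 says that \<open>m 1\<close> is
  a Hochschild cocycle, whose antisymmetrization is a biderivation because \<open>m0\<close> is
  commutative. Degree 2, alternated over the arguments, is the Jacobi identity.\<close>

theorem quasi_poisson_semiclassical:
  assumes \<Phi>: "drinfeld_associator \<Phi>" and t: "invariant_symmetric t" and assoc: "assoc_algebra \<Phi> t A \<rho> m"
    and m0: "\<And>a b. a \<in> A \<Longrightarrow> b \<in> A \<Longrightarrow> m 0 a b = m0 a b" and comm: "\<And>a b. a \<in> A \<Longrightarrow> b \<in> A \<Longrightarrow> m0 a b = m0 b a"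
    and br: "\<And>a b. a \<in> A \<Longrightarrow> b \<in> A \<Longrightarrow> br a b = m 1 a b - m 1 b a"
  shows "quasi_poisson t A \<rho> m0 br"
proof -
  let ?\<tau> = "\<lambda>i j. t_action t (module_slots \<rho>) {i} {j}"
  define \<Psi> where "\<Psi> = placed \<Phi> (t_action t (module_slots \<rho>)) {1} {2} {3}"
  let ?V = "tensor_power A 3"
  define M where "M = m 0"
  define B where "B = m 1"
  define C where "C = m 2"
  have \<rho>: "lie_module A \<rho>" and inv: "\<And>i. invariant_bilinear A \<rho> (m i)"
    and eq: "\<And>n a b c. a \<in> A \<Longrightarrow> b \<in> A \<Longrightarrow> c \<in> A \<Longrightarrow>
      (mult_op m \<odot> mult_right m \<odot> \<Psi>) n (tensor [a, b, c]) = (mult_op m \<odot> mult_left m) n (tensor [a, b, c])"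
    using assoc unfolding assoc_algebra_iff \<Psi>_def by blast+
  note sub = lie_moduleD(1)[OF \<rho>]
  note mem = inv[THEN invariant_bilinearD(2)] lie_moduleD(2)[OF \<rho>]
  have memM: "M a b \<in> A" and memB: "B a b \<in> A" and memC: "C a b \<in> A" if "a \<in> A" "b \<in> A" for a b
    using that mem(1) by (simp_all add: M_def B_def C_def)
  note mems = memM memB memC
  have bil: "bilinear_on A A (m i)" for i by (rule invariant_bilinearD(1)[OF inv])
  note bilM = bil[of 0, folded M_def] and bilB = bil[of 1, folded B_def]
  have Mcomm: "M a b = M b a" if "a \<in> A" "b \<in> A" for a b
    using that by (simp add: M_def m0 comm)
  note low = associator_low[OF \<Phi>]
  \<comment> \<open>The associator has no linear term, so it first shows up in degree two.\<close>
  have \<Psi>01: "\<Psi> 0 v = v" "\<Psi> (Suc 0) v = 0" for v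
    by (simp_all add: \<Psi>_def placed_def nc_eval_0[of \<Phi>, OF low(1)] nc_eval_1[of \<Phi>, OF low(2,3)])
  \<comment> \<open>The second-order term of the associator, followed by the triple product.\<close>
  define q where "q = (\<lambda>a b c. teval (\<lambda>as. M (as ! 0) (M (as ! 1) (as ! 2))) (\<Psi> 2 (tensor [a, b, c])))"
  note ser = series_comp_def atMost_Suc numeral_2_eq_2 mult_op_simps scaleC_one quot_hom_simps[OF mult_op_hom]
    quot_homD(1)[OF mult_op_hom]
  have zero: "mult_right m j 0 = 0" for j by (simp add: mult_right_def push_simps)
  have e0: "M a (M b c) = M (M a b) c" if "a \<in> A" "b \<in> A" "c \<in> A" for a b c
    using eq[OF that, of 0] by (simp add: ser \<Psi>01 M_def)
  have e1: "M a (B b c) + B a (M b c) = M (B a b) c + B (M a b) c" if "a \<in> A" "b \<in> A" "c \<in> A" for a b c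
    using eq[OF that, of 1] by (simp add: ser \<Psi>01 zero M_def B_def add.commute)
  have e2: "q a b c + M a (C b c) + B a (B b c) + C a (M b c) = M (C a b) c + B (B a b) c + C (M a b) c"
    if "a \<in> A" "b \<in> A" "c \<in> A" for a b c
    using eq[OF that, of 2] by (simp add: ser \<Psi>01 zero M_def B_def C_def q_def add.commute add.left_commute)
  have inv0: "invariant_bilinear A \<rho> m0"
    by (rule invariant_bilinear_cong[OF \<rho> inv[of 0]]) (simp add: m0)
  have inv_br: "invariant_bilinear A \<rho> (\<lambda>a b. B a b - B b a)"
  proof -
    have "linear_on A (\<lambda>a. B a b - B b a)" "linear_on A (\<lambda>a. B b a - B a b)" if b: "b \<in> A" for b
      using bilinear_onD[OF bilB] b
      by (simp_all add: linear_on_def cvec.scale_right_diff_distrib algebra_simps)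
    moreover have "\<rho> x (B a b - B b a) = (B (\<rho> x a) b - B b (\<rho> x a)) + (B a (\<rho> x b) - B (\<rho> x b) a)"
      if "a \<in> A" "b \<in> A" for x a b
    proof -
      have "\<rho> x (B a b - B b a) = \<rho> x (B a b) - \<rho> x (B b a)"
        using that by (intro linear_on_diff[OF sub lie_moduleD(3)[OF \<rho>]] memB)
      then show ?thesis
        using that invariant_bilinearD(3)[OF inv[of 1], folded B_def] by simp
    qed
    ultimately show ?thesis
      using memB cvec.subspace_diff[OF sub] by (simp add: invariant_bilinear_def bilinear_on_def)
  qed
  have inv_br': "invariant_bilinear A \<rho> br"
    by (rule invariant_bilinear_cong[OF \<rho> inv_br]) (simp add: br B_def)
  have deriv: "br a (m0 b c) = m0 (br a b) c + m0 b (br a c)" if *: "a \<in> A" "b \<in> A" "c \<in> A" for a b c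
  proof -
    have brA: "br x y = B x y - B y x" if "x \<in> A" "y \<in> A" for x y using br[OF that] by (simp add: B_def)
    have M: "m0 x y = M x y" if "x \<in> A" "y \<in> A" for x y using m0[OF that] by (simp add: M_def)
    have Mdiff: "M (x - y) z = M x z - M y z" "M z (x - y) = M z x - M z y" if "x \<in> A" "y \<in> A" "z \<in> A" for x y z
      using linear_on_diff[OF sub, of "\<lambda>x. M x z"] linear_on_diff[OF sub, of "M z"] bilM that
      by (auto simp: bilinear_on_def)
    \<comment> \<open>The cocycle identity at \<open>(a, b, c)\<close>, \<open>(b, c, a)\<close> and
      \<open>(b, a, c)\<close>. Solved for one term each, these three leave the Leibniz rule after
      cancellation.\<close>
    have 1: "M a (B b c) + B a (M b c) = M (B a b) c + B (M a b) c" by (rule e1[OF *])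
    have 2: "M b (B c a) + B b (M c a) = M (B b c) a + B (M b c) a" by (rule e1[OF *(2,3,1)])
    have 3: "M b (B a c) + B b (M a c) = M (B b a) c + B (M b a) c" by (rule e1[OF *(2,1,3)])
    have c: "M (B b c) a = M a (B b c)" "M c a = M a c" "M b a = M a b"
      using * memB by (simp_all add: Mcomm)
    have solve1: "B a (M b c) = M (B a b) c + B (M a b) c - M a (B b c)"
      using 1 by (simp add: eq_diff_eq add.commute)
    have solve2: "B (M b c) a = M b (B c a) + B b (M a c) - M a (B b c)"
      using 2 unfolding c by (simp add: eq_diff_eq add.commute)
    have solve3: "B (M a b) c = M b (B a c) + B b (M a c) - M (B b a) c"
      using 3 unfolding c by (simp add: eq_diff_eq add.commute)
    have "br a (m0 b c) = B a (M b c) - B (M b c) a"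
      using * by (simp add: M brA memM)
    also have "\<dots> = (M (B a b) c - M (B b a) c) + (M b (B a c) - M b (B c a))"
      unfolding solve1 solve2 solve3 by simp
    also have "\<dots> = m0 (br a b) c + m0 b (br a c)"
      using * by (simp add: brA M Mdiff memB cvec.subspace_diff[OF sub])
    finally show ?thesis .
  qed
  have brsym: "br a b = - br b a" if "a \<in> A" "b \<in> A" for a b
    using br[OF that] br[OF that(2,1)] by simp
  have deriv': "br (m0 a b) c = m0 a (br b c) + m0 (br a c) b" if *: "a \<in> A" "b \<in> A" "c \<in> A" for a b c
  proof -
    have bA: "br x y \<in> A" if "x \<in> A" "y \<in> A" for x y by (rule invariant_bilinearD(2)[OF inv_br' that])
    have neg: "m0 x (- y) = - m0 x y" if "x \<in> A" "y \<in> A" for x y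
      using bilinear_onD(4)[OF invariant_bilinearD(1)[OF inv0] that(2) that(2) that(1), of "- 1"] by (simp add: scaleC_one)
    have mA: "m0 a b \<in> A" using * by (rule_tac invariant_bilinearD(2)[OF inv0])
    have "br (m0 a b) c = - (m0 (br c a) b + m0 a (br c b))"
      using brsym[OF mA *(3)] deriv[OF *(3,1,2)] by simp
    also have "\<dots> = m0 a (- br c b) + m0 b (- br c a)"
      using * by (simp add: neg bA comm[OF bA[OF *(3,1)] *(2)])
    also have "\<dots> = m0 a (br b c) + m0 (br a c) b"
      using * by (simp add: brsym[OF *(2,3), symmetric] brsym[OF *(1,3), symmetric] comm[OF bA[OF *(1,3)] *(2)])
    finally show ?thesis .
  qed
  let ?f = "\<lambda>as. M (as ! 0) (M (as ! 1) (as ! 2))"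
  have linM: "linear_on A (\<lambda>x. M x y)" "linear_on A (M y)" if "y \<in> A" for y
    using bilM that by (auto simp: bilinear_on_def)
  have f: "multilinear_on A 3 ?f"
  proof (rule multilinear_triple)
    fix x y assume xy: "x \<in> A" "y \<in> A"
    show "linear_on A (\<lambda>a. M a (M x y))" by (rule linM(1)[OF memM[OF xy]])
    show "linear_on A (\<lambda>b. M x (M b y))"
      by (rule linear_on_comp[OF linM(2)[OF xy(1)] linM(1)[OF xy(2)] memM[OF _ xy(2)]])
    show "linear_on A (\<lambda>c. M x (M y c))"
      by (rule linear_on_comp[OF linM(2)[OF xy(1)] linM(2)[OF xy(2)] memM[OF xy(2)]])
  qed
  \<comment> \<open>The triple product is symmetric, so permuting the arguments amounts to permuting
    the strand labels of the chords.\<close>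
  have fs: "?f [y, x, z] = ?f [x, y, z]" "?f [x, z, y] = ?f [x, y, z]" if "x \<in> A" "y \<in> A" "z \<in> A" for x y z
  proof -
    show "?f [y, x, z] = ?f [x, y, z]"
      using that e0[of y x z] e0[of x y z] Mcomm[of x y] by simp
    show "?f [x, z, y] = ?f [x, y, z]" using that Mcomm[of y z] by simp
  qed
  let ?D = "\<lambda>v. ?\<tau> 1 2 (?\<tau> 2 3 v) - ?\<tau> 2 3 (?\<tau> 1 2 v)"
  have \<Psi>2: "\<Psi> 2 v = (1 / 24) *\<^sub>C ?D v" for v
    by (simp add: \<Psi>_def placed_def numeral_2_eq_2 nc_eval_associator_2[OF \<Phi>])
  note ev = t_action_pair module_slots_def at_factor_def teval_hom_fun[OF push_hom] teval_hom_fun[OF teval_hom] case_prod_unfold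
    scaleC_one
  have swap12: "teval ?f (?D (tensor [b, a, c])) = teval ?f (?\<tau> 2 1 (?\<tau> 1 3 (tensor [a, b, c])) - ?\<tau> 1 3 (?\<tau> 2 1 (tensor [a, b, c])))"
    if "a \<in> A" "b \<in> A" "c \<in> A" for a b c
    unfolding teval_simps(3)
    by (intro arg_cong2[where f = minus]) (use that fs mem(2) in \<open>simp_all add: ev\<close>)
  have swap23: "teval ?f (?D (tensor [a, c, b])) = teval ?f (?\<tau> 1 3 (?\<tau> 3 2 (tensor [a, b, c])) - ?\<tau> 3 2 (?\<tau> 1 3 (tensor [a, b, c])))"
    if "a \<in> A" "b \<in> A" "c \<in> A" for a b c
    unfolding teval_simps(3)
    by (intro arg_cong2[where f = minus]) (use that fs mem(2) in \<open>simp_all add: ev\<close>)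
  have q_eq: "q a b c = (1 / 24) *\<^sub>C teval ?f (?D (tensor [a, b, c]))" for a b c
    by (simp add: q_def \<Psi>2 teval_scale)
  have inV: "tensor [a, b, c] \<in> fst ?V" if "a \<in> A" "b \<in> A" "c \<in> A" for a b c
    using that by (intro tensor_power_tensor) auto
  \<comment> \<open>\<open>q\<close> changes sign under both transpositions of neighbouring
    arguments, hence is antisymmetric.\<close>
  have anti: "q b a c = - q a b c" "q a c b = - q a b c" if *: "a \<in> A" "b \<in> A" "c \<in> A" for a b c
    unfolding q_eq swap12[OF *] swap23[OF *]
      quot_cong_teval_eq[OF t_bracket_antisym(1)[OF \<rho> t] f inV[OF *]] quot_cong_teval_eq[OF t_bracket_antisym(2)[OF \<rho> t] f inV[OF *]]
    by (simp_all add: teval_simps cvec.scale_right_diff_distrib)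
  have jacobi: "br a (br b c) + br b (br c a) + br c (br a b)
      = - teval (\<lambda>as. m0 (m0 (as ! 0) (as ! 1)) (as ! 2)) (phi_action t \<rho> (tensor [a, b, c]))"
    if *: "a \<in> A" "b \<in> A" "c \<in> A" for a b c
  proof -
    have \<tau>V: "?\<tau> i j v \<in> fst ?V" if "v \<in> fst ?V" "i \<in> {1..3}" "j \<in> {1..3}" for v i j
      using quot_homD(3)[OF t_action_hom[OF slot_system_module_slots[OF \<rho>] t] that(1), of "{i}" "{j}"] that(2,3) by simp
    have phi: "phi_action t \<rho> (tensor [a, b, c]) = (1 / 4) *\<^sub>C ?D (tensor [a, b, c])"
      by (simp add: phi_action_def Let_def)
    have "?D (tensor [a, b, c]) \<in> fst ?V"
      using cvec.subspace_diff[of "fst ?V"] quot_space_tensor_power[of A 3] inV[OF *] by (simp add: quot_space_def \<tau>V)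
    then have "teval (\<lambda>as. m0 (m0 (as ! 0) (as ! 1)) (as ! 2)) (?D (tensor [a, b, c])) = teval ?f (?D (tensor [a, b, c]))"
    proof (intro teval_cong)
      fix as assume "?D (tensor [a, b, c]) \<in> fst ?V" "as \<in> Poly_Mapping.keys (?D (tensor [a, b, c]))"
      then have "length as = 3" "set as \<subseteq> A" by (simp_all add: tensor_power_fst)
      moreover from this obtain x y z where "as = [x, y, z]" using nth_3 by blast
      ultimately show "m0 (m0 (as ! 0) (as ! 1)) (as ! 2) = ?f as"
        by (simp add: m0[symmetric] M_def[symmetric] memM e0)
    qed
    \<comment> \<open>Six copies of the coefficient 1/24 in \<open>q\<close> make the 1/4 in the
      definition of \<open>\<phi>\<close>.\<close>
    then have rhs: "teval (\<lambda>as. m0 (m0 (as ! 0) (as ! 1)) (as ! 2)) (phi_action t \<rho> (tensor [a, b, c])) = 6 *\<^sub>C q a b c"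
      unfolding phi by (simp add: teval_scale q_eq)
    have perms: "q b a c = - q a b c" "q a c b = - q a b c" "q b c a = q a b c" "q c a b = q a b c" "q c b a = - q a b c"
      using anti(1)[OF *] anti(2)[OF *] anti(2)[OF *(2,1,3)] anti(1)[OF *(1,3,2)] anti(1)[OF *(2,3,1)] by simp_all
    have Bdiff: "B (x - y) z = B x z - B y z" "B z (x - y) = B z x - B z y" if "x \<in> A" "y \<in> A" "z \<in> A" for x y z
      using linear_on_diff[OF sub, of "\<lambda>x. B x z"] linear_on_diff[OF sub, of "B z"] bilB that
      by (auto simp: bilinear_on_def)
    have brB: "br x (br y z) = B x (B y z) - B x (B z y) - B (B y z) x + B (B z y) x" if "x \<in> A" "y \<in> A" "z \<in> A" for x y z
    proof -
      have brA: "br x y = B x y - B y x" if "x \<in> A" "y \<in> A" for x y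
        using br[OF that] by (simp add: B_def)
      have "br y z \<in> A" by (rule invariant_bilinearD(2)[OF inv_br' that(2,3)])
      then have "br x (br y z) = B x (br y z) - B (br y z) x" by (rule brA[OF that(1)])
      also have "\<dots> = (B x (B y z) - B x (B z y)) - (B (B y z) x - B (B z y) x)"
        unfolding brA[OF that(2,3)] Bdiff[OF memB[OF that(2,3)] memB[OF that(3,2)] that(1)] by (rule refl)
      finally show ?thesis by (simp add: algebra_simps)
    qed
    define E where "E = (\<lambda>a b c. q a b c + M a (C b c) + B a (B b c) + C a (M b c) - (M (C a b) c + B (B a b) c + C (M a b) c))"
    have E: "E x y z = 0" if "x \<in> A" "y \<in> A" "z \<in> A" for x y z
      unfolding E_def using e2[OF that] by simp
    have Mc: "M (C x y) z = M z (C x y)" if "x \<in> A" "y \<in> A" "z \<in> A" for x y z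
      using that by (intro Mcomm memC)
    have Ms: "M b a = M a b" "M c a = M a c" "M c b = M b c" using * by (auto intro: Mcomm)
    \<comment> \<open>In the alternating sum the terms with \<open>C\<close> cancel by commutativity
      of \<open>M\<close>, those with \<open>B\<close> form the iterated brackets, and
      \<open>q\<close> appears six times by antisymmetry.\<close>
    have "br a (br b c) + br b (br c a) + br c (br a b) + 6 *\<^sub>C q a b c
        = E a b c + E b c a + E c a b - E b a c - E a c b - E c b a"
      unfolding scaleC_six E_def perms Ms using * by (simp add: brB Mc)
    then have "br a (br b c) + br b (br c a) + br c (br a b) + 6 *\<^sub>C q a b c = 0"
      using * by (simp add: E)
    then show ?thesis unfolding rhs by (simp add: eq_neg_iff_add_eq_0)
  qed
  show ?thesis
    unfolding quasi_poisson_def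
  proof (intro conjI ballI)
    fix a b c assume "a \<in> A" "b \<in> A" "c \<in> A"
    then show "m0 (m0 a b) c = m0 a (m0 b c)"
      by (simp add: m0[symmetric] M_def[symmetric] memM e0)
  qed (fact \<rho> inv0 comm inv_br' brsym deriv deriv' jacobi)+
qed


section \<open>Bidifferential operators\<close>

locale comm_algebra =
  fixes A :: "'a::complex_vector set" and m0 :: "'a \<Rightarrow> 'a \<Rightarrow> 'a"
  assumes subspace: "cvec.subspace A" and bilinear: "bilinear_on A A m0"
    and closed: "a \<in> A \<Longrightarrow> b \<in> A \<Longrightarrow> m0 a b \<in> A"
    and comm: "a \<in> A \<Longrightarrow> b \<in> A \<Longrightarrow> m0 a b = m0 b a"
    and assoc: "a \<in> A \<Longrightarrow> b \<in> A \<Longrightarrow> c \<in> A \<Longrightarrow> m0 (m0 a b) c = m0 a (m0 b c)"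
begin

lemma mult_linear: "c \<in> A \<Longrightarrow> linear_on A (m0 c)"
  using bilinear unfolding bilinear_on_def by blast

lemma mult_simps:
  assumes "c \<in> A"
  shows "m0 c 0 = 0" "a \<in> A \<Longrightarrow> b \<in> A \<Longrightarrow> m0 c (a + b) = m0 c a + m0 c b"
    "a \<in> A \<Longrightarrow> b \<in> A \<Longrightarrow> m0 c (a - b) = m0 c a - m0 c b" "a \<in> A \<Longrightarrow> m0 c (s *\<^sub>C a) = s *\<^sub>C m0 c a"
    "a \<in> A \<Longrightarrow> b \<in> A \<Longrightarrow> m0 (a + b) c = m0 a c + m0 b c"
  using linear_on_0[OF subspace mult_linear[OF assms]] linear_on_diff[OF subspace mult_linear[OF assms]]
    bilinear_onD[OF bilinear _ _ assms] by blast+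

lemmas mem = closed cvec.subspace_0[OF subspace] cvec.subspace_add[OF subspace] cvec.subspace_diff[OF subspace]
  cvec.subspace_scale[OF subspace]

lemma left_commute: "a \<in> A \<Longrightarrow> b \<in> A \<Longrightarrow> c \<in> A \<Longrightarrow> m0 a (m0 b c) = m0 b (m0 a c)"
  using assoc[of a b c] assoc[of b a c] comm[of a b] by simp

section \<open>The order of bidifferential operators\<close>

lemma bidiff_below_cong:
  "bidiff_below A m0 n D \<Longrightarrow> (\<And>a b. a \<in> A \<Longrightarrow> b \<in> A \<Longrightarrow> D' a b = D a b) \<Longrightarrow> bidiff_below A m0 n D'"
proof (induction n arbitrary: D D')
  case (Suc n)
  show ?case
    unfolding bidiff_below.simps
  proof (intro ballI conjI)
    fix c assume c: "c \<in> A"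
    note IH = Suc.prems(1)[unfolded bidiff_below.simps, rule_format, OF c]
    show "bidiff_below A m0 n (\<lambda>a b. D' (m0 c a) b - m0 c (D' a b))"
      by (rule Suc.IH[OF conjunct1[OF IH]]) (simp add: Suc.prems(2) closed c)
    show "bidiff_below A m0 n (\<lambda>a b. D' a (m0 c b) - m0 c (D' a b))"
      by (rule Suc.IH[OF conjunct2[OF IH]]) (simp add: Suc.prems(2) closed c)
  qed
qed simp

lemma bidiff_below_zero: "(\<And>a b. a \<in> A \<Longrightarrow> b \<in> A \<Longrightarrow> D a b = 0) \<Longrightarrow> bidiff_below A m0 n D"
proof (induction n arbitrary: D)
  case (Suc n)
  show ?case
    unfolding bidiff_below.simps
    by (intro ballI conjI; rule Suc.IH) (simp_all add: Suc.prems closed mult_simps(1))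
qed simp

lemma bidiff_below_Suc: "bidiff_below A m0 n D \<Longrightarrow> bidiff_below A m0 (Suc n) D"
proof (induction n arbitrary: D)
  case 0
  then show ?case by (intro bidiff_below_zero) simp
next
  case (Suc n)
  show ?case
    unfolding bidiff_below.simps(2)[of _ _ "Suc n"]
    using Suc.prems[unfolded bidiff_below.simps(2)] Suc.IH by blast
qed

lemma bidiff_below_mono: "bidiff_below A m0 n D \<Longrightarrow> n \<le> k \<Longrightarrow> bidiff_below A m0 k D"
  by (induction k) (auto simp: le_Suc_eq intro: bidiff_below_Suc simp del: bidiff_below.simps)

text \<open>The rules for \<open>m0\<close> hold on \<open>A\<close> alone, so the values of
  \<open>D\<close> have to stay there when commutators are expanded.\<close>

definition "valued D \<longleftrightarrow> (\<forall>a\<in>A. \<forall>b\<in>A. D a b \<in> A)" for D :: "'a \<Rightarrow> 'a \<Rightarrow> 'a"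

lemma valued_commutator:
  assumes "valued D" "c \<in> A"
  shows "valued (\<lambda>a b. D (m0 c a) b - m0 c (D a b))" "valued (\<lambda>a b. D a (m0 c b) - m0 c (D a b))"
  using assms by (simp_all add: valued_def mem)

lemma bidiff_below_linear_comb:
  "valued D \<Longrightarrow> valued D' \<Longrightarrow> bidiff_below A m0 n D \<Longrightarrow> bidiff_below A m0 n D' \<Longrightarrow>
    bidiff_below A m0 n (\<lambda>a b. s *\<^sub>C D a b + D' a b)"
proof (induction n arbitrary: D D')
  case (Suc n)
  show ?case
    unfolding bidiff_below.simps
  proof (intro ballI conjI)
    fix c assume c: "c \<in> A"
    note D = Suc.prems(3)[unfolded bidiff_below.simps, rule_format, OF c] valued_commutator[OF Suc.prems(1) c]
    note D' = Suc.prems(4)[unfolded bidiff_below.simps, rule_format, OF c] valued_commutator[OF Suc.prems(2) c]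
    have v: "D a b \<in> A" "D' a b \<in> A" if "a \<in> A" "b \<in> A" for a b
      using that Suc.prems(1,2) by (simp_all add: valued_def)
    show "bidiff_below A m0 n (\<lambda>a b. (s *\<^sub>C D (m0 c a) b + D' (m0 c a) b) - m0 c (s *\<^sub>C D a b + D' a b))"
      by (rule bidiff_below_cong[OF Suc.IH[OF D(2) D'(2) conjunct1[OF D(1)] conjunct1[OF D'(1)]]])
        (simp add: v c mem mult_simps cvec.scale_right_diff_distrib)
    show "bidiff_below A m0 n (\<lambda>a b. (s *\<^sub>C D a (m0 c b) + D' a (m0 c b)) - m0 c (s *\<^sub>C D a b + D' a b))"
      by (rule bidiff_below_cong[OF Suc.IH[OF D(3) D'(3) conjunct2[OF D(1)] conjunct2[OF D'(1)]]])
        (simp add: v c mem mult_simps cvec.scale_right_diff_distrib)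
  qed
qed simp

text \<open>Multiplications by \<open>e\<close> and by \<open>c\<close> commute, so the commutators
  of the new map are \<open>m0 e\<close> applied to those of \<open>D\<close>.\<close>

lemma bidiff_below_mult:
  "valued D \<Longrightarrow> e \<in> A \<Longrightarrow> bidiff_below A m0 n D \<Longrightarrow> bidiff_below A m0 n (\<lambda>a b. m0 e (D a b))"
proof (induction n arbitrary: D)
  case 0
  then show ?case by (simp add: mult_simps(1))
next
  case (Suc n)
  show ?case
    unfolding bidiff_below.simps
  proof (intro ballI conjI)
    fix c assume c: "c \<in> A"
    note D = Suc.prems(3)[unfolded bidiff_below.simps, rule_format, OF c] valued_commutator[OF Suc.prems(1) c]
    have v: "D a b \<in> A" if "a \<in> A" "b \<in> A" for a b
      using that Suc.prems(1) by (simp add: valued_def)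
    show "bidiff_below A m0 n (\<lambda>a b. m0 e (D (m0 c a) b) - m0 c (m0 e (D a b)))"
      by (rule bidiff_below_cong[OF Suc.IH[OF D(2) Suc.prems(2) conjunct1[OF D(1)]]])
        (simp add: v c Suc.prems(2) mem mult_simps left_commute[of e c])
    show "bidiff_below A m0 n (\<lambda>a b. m0 e (D a (m0 c b)) - m0 c (m0 e (D a b)))"
      by (rule bidiff_below_cong[OF Suc.IH[OF D(3) Suc.prems(2) conjunct2[OF D(1)]]])
        (simp add: v c Suc.prems(2) mem mult_simps left_commute[of e c])
  qed
qed

lemma bidiff_below_swap: "bidiff_below A m0 n D \<Longrightarrow> bidiff_below A m0 n (\<lambda>a b. D b a)"
proof (induction n arbitrary: D)
  case (Suc n)
  show ?case
    unfolding bidiff_below.simps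
  proof (intro ballI conjI)
    fix c assume c: "c \<in> A"
    note D = Suc.prems[unfolded bidiff_below.simps, rule_format, OF c]
    show "bidiff_below A m0 n (\<lambda>a b. D b (m0 c a) - m0 c (D b a))"
      by (rule Suc.IH[OF conjunct2[OF D]])
    show "bidiff_below A m0 n (\<lambda>a b. D (m0 c b) a - m0 c (D b a))"
      by (rule Suc.IH[OF conjunct1[OF D]])
  qed
qed simp

text \<open>The commutator with \<open>c\<close> in the first argument is the commutator of
  \<open>D\<close> precomposed with \<open>\<delta>\<close>, handled by induction, plus
  \<open>D\<close> precomposed with multiplication by \<open>\<delta> c\<close>, whose order is that
  of \<open>D\<close>.\<close>

lemma bidiff_below_derivation:
  assumes \<delta>: "\<And>a. a \<in> A \<Longrightarrow> \<delta> a \<in> A" "\<And>a b. a \<in> A \<Longrightarrow> b \<in> A \<Longrightarrow> \<delta> (m0 a b) = m0 (\<delta> a) b + m0 a (\<delta> b)"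
  shows "valued D \<Longrightarrow> (\<And>a a' b. a \<in> A \<Longrightarrow> a' \<in> A \<Longrightarrow> b \<in> A \<Longrightarrow> D (a + a') b = D a b + D a' b) \<Longrightarrow>
    bidiff_below A m0 n D \<Longrightarrow> bidiff_below A m0 (Suc n) (\<lambda>a b. D (\<delta> a) b)"
proof (induction n arbitrary: D)
  case 0
  then show ?case by (intro bidiff_below_zero) (simp add: \<delta>(1))
next
  case (Suc n)
  have v: "D a b \<in> A" if "a \<in> A" "b \<in> A" for a b
    using that Suc.prems(1) by (simp add: valued_def)
  show ?case
    unfolding bidiff_below.simps(2)[of _ _ "Suc n"]
  proof (intro ballI conjI)
    fix c assume c: "c \<in> A"
    have \<delta>c: "\<delta> c \<in> A" by (rule \<delta>(1)[OF c])
    note D = Suc.prems(3)[unfolded bidiff_below.simps(2), rule_format, OF c] valued_commutator[OF Suc.prems(1) c]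
    note D\<delta> = Suc.prems(3)[unfolded bidiff_below.simps(2), rule_format, OF \<delta>c] valued_commutator[OF Suc.prems(1) \<delta>c]
    have 1: "bidiff_below A m0 (Suc n) (\<lambda>a b. D (m0 c (\<delta> a)) b - m0 c (D (\<delta> a) b))"
      by (rule Suc.IH[OF D(2) _ conjunct1[OF D(1)]]) (simp add: c mem mult_simps v Suc.prems(2))
    \<comment> \<open>\<open>D (m0 (\<delta> c) a) b\<close> is the commutator in \<open>2\<close>
      plus the multiple of \<open>D\<close> in \<open>3\<close>.\<close>
    have 2: "bidiff_below A m0 (Suc n) (\<lambda>a b. D (m0 (\<delta> c) a) b - m0 (\<delta> c) (D a b))"
      by (rule bidiff_below_Suc[OF conjunct1[OF D\<delta>(1)]])
    have 3: "bidiff_below A m0 (Suc n) (\<lambda>a b. m0 (\<delta> c) (D a b))"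
      by (rule bidiff_below_mult[OF Suc.prems(1) \<delta>c Suc.prems(3)])
    have v3: "valued (\<lambda>a b. m0 (\<delta> c) (D a b))" and v1: "valued (\<lambda>a b. D (m0 c (\<delta> a)) b - m0 c (D (\<delta> a) b))"
      by (simp_all add: valued_def v c \<delta>c \<delta>(1) mem)
    have 4: "bidiff_below A m0 (Suc n) (\<lambda>a b. 1 *\<^sub>C (D (m0 (\<delta> c) a) b - m0 (\<delta> c) (D a b)) + m0 (\<delta> c) (D a b))"
      by (rule bidiff_below_linear_comb[OF D\<delta>(2) v3 2 3])
    have v4: "valued (\<lambda>a b. 1 *\<^sub>C (D (m0 (\<delta> c) a) b - m0 (\<delta> c) (D a b)) + m0 (\<delta> c) (D a b))"
      by (simp add: valued_def v c \<delta>c mem scaleC_one)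
    show "bidiff_below A m0 (Suc n) (\<lambda>a b. D (\<delta> (m0 c a)) b - m0 c (D (\<delta> a) b))"
      by (rule bidiff_below_cong[OF bidiff_below_linear_comb[OF v1 v4 1 4, of 1]])
        (simp add: \<delta> c mem Suc.prems(2) scaleC_one)
    show "bidiff_below A m0 (Suc n) (\<lambda>a b. D (\<delta> a) (m0 c b) - m0 c (D (\<delta> a) b))"
      by (rule Suc.IH[OF D(3) _ conjunct2[OF D(1)]]) (simp add: c mem mult_simps v Suc.prems(2))
  qed
qed

lemma bidifferential_valued: "bidifferential A m0 D \<Longrightarrow> valued D"
  by (simp add: bidifferential_def valued_def)

lemma bidifferential_linear_comb:
  assumes "bidifferential A m0 D" "bidifferential A m0 D'"
  shows "bidifferential A m0 (\<lambda>a b. s *\<^sub>C D a b + D' a b)"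
proof -
  obtain n n' where n: "bidiff_below A m0 n D" "bidiff_below A m0 n' D'"
    using assms by (auto simp: bidifferential_def)
  note v = assms[THEN bidifferential_valued]
  have "bidiff_below A m0 (max n n') (\<lambda>a b. s *\<^sub>C D a b + D' a b)"
    by (intro bidiff_below_linear_comb v bidiff_below_mono[OF n(1)] bidiff_below_mono[OF n(2)]) simp_all
  moreover have "bilinear_on A A (\<lambda>a b. s *\<^sub>C D a b + D' a b)"
    using assms by (simp add: bidifferential_def bilinear_on_def linear_on_def scaleC_add_right mult.commute)
  ultimately show ?thesis
    using v by (auto simp: bidifferential_def valued_def mem)
qed

lemma bidifferential_zero: "bidifferential A m0 (\<lambda>a b. 0)"
proof -
  have "\<exists>n. bidiff_below A m0 n (\<lambda>a b. 0)" by (rule exI[of _ 0]) simp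
  then show ?thesis by (simp add: bidifferential_def bilinear_on_def linear_on_def mem(2))
qed

lemma bidifferential_mult: "bidifferential A m0 m0"
proof -
  have "bidiff_below A m0 (Suc 0) m0"
    using assoc left_commute by (simp add: closed)
  then show ?thesis
    using bilinear closed unfolding bidifferential_def by blast
qed

lemma bidifferential_cong:
  assumes "bidifferential A m0 D" "\<And>a b. a \<in> A \<Longrightarrow> b \<in> A \<Longrightarrow> D' a b = D a b"
  shows "bidifferential A m0 D'"
  using assms bidiff_below_cong bilinear_on_cong[OF subspace, of D D'] unfolding bidifferential_def by metis

text \<open>Chosen for its closure properties: composition and linear combinations reduce the
  coefficients of \<open>J\<close> to actions of single Lie algebra elements.\<close>

definition bidiff_op :: "(('a list \<Rightarrow>\<^sub>0 complex) \<Rightarrow> ('a list \<Rightarrow>\<^sub>0 complex)) \<Rightarrow> bool" where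
  "bidiff_op P \<longleftrightarrow> quot_hom (tensor_power A 2) (tensor_power A 2) P \<and>
     (\<forall>D. bidifferential A m0 D \<longrightarrow>
        bidifferential A m0 (\<lambda>a b. teval (\<lambda>as. D (as ! 0) (as ! 1)) (P (tensor [a, b]))))"

lemma bidiff_op_id: "bidiff_op (\<lambda>v. v)"
  by (simp add: bidiff_op_def quot_hom_id scaleC_one)

lemma bidiff_op_zero: "bidiff_op (\<lambda>v. 0)"
  by (simp add: bidiff_op_def quot_hom_zero[OF quot_space_tensor_power] bidifferential_zero)

lemma pair_tensor: "a \<in> A \<Longrightarrow> b \<in> A \<Longrightarrow> tensor [a, b] \<in> fst (tensor_power A 2)"
  by (rule tensor_power_tensor) auto

lemma teval_pair_eqI:
  assumes "F \<in> fst (tensor_power A 2)" "quot_hom S S' P" "quot_hom T T' Q"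
    "\<And>a b. a \<in> A \<Longrightarrow> b \<in> A \<Longrightarrow> P (tensor [a, b]) = Q (tensor [a, b])"
  shows "P F = Q F"
proof (rule linear_eqI[OF assms(2,3)])
  fix as assume "as \<in> Poly_Mapping.keys F"
  then have *: "length as = 2" "set as \<subseteq> A" using assms(1) by (auto simp: tensor_power_fst)
  obtain a b where as: "as = [a, b]" using nth_2[OF *(1)] by blast
  show "P (tensor as) = Q (tensor as)"
    using *(2) unfolding as by (intro assms(4)) auto
qed

lemma hom_UNIV: "quot_hom S S' P \<Longrightarrow> quot_hom (UNIV, {0}) (UNIV, {0}) P"
  using quot_hom_simps(1)[of S S' P] by (auto simp: quot_hom_def)

lemma bidiff_op_comp:
  assumes "bidiff_op P" "bidiff_op Q"
  shows "bidiff_op (\<lambda>v. P (Q v))"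
proof -
  have hom: "quot_hom (tensor_power A 2) (tensor_power A 2) P" "quot_hom (tensor_power A 2) (tensor_power A 2) Q"
    using assms by (simp_all add: bidiff_op_def)
  have "bidifferential A m0 (\<lambda>a b. teval (\<lambda>as. D (as ! 0) (as ! 1)) (P (Q (tensor [a, b]))))"
    if D: "bidifferential A m0 D" for D
  proof -
    let ?D = "\<lambda>a b. teval (\<lambda>as. D (as ! 0) (as ! 1)) (P (tensor [a, b]))"
    have "bidifferential A m0 ?D" using assms(1) D by (simp add: bidiff_op_def)
    then have "bidifferential A m0 (\<lambda>a b. teval (\<lambda>as. ?D (as ! 0) (as ! 1)) (Q (tensor [a, b])))"
      using assms(2) unfolding bidiff_op_def by blast
    then show ?thesis
    proof (rule bidifferential_cong)
      fix a b assume "a \<in> A" "b \<in> A"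
      then have "Q (tensor [a, b]) \<in> fst (tensor_power A 2)"
        by (intro quot_homD(3)[OF hom(2)] pair_tensor)
      then show "teval (\<lambda>as. D (as ! 0) (as ! 1)) (P (Q (tensor [a, b])))
          = teval (\<lambda>as. ?D (as ! 0) (as ! 1)) (Q (tensor [a, b]))"
        by (rule teval_pair_eqI[OF _ quot_hom_comp[OF teval_hom hom_UNIV[OF hom(1)]] teval_hom]) (simp add: scaleC_one)
    qed
  qed
  then show ?thesis
    unfolding bidiff_op_def using quot_hom_comp[OF hom] by blast
qed

lemma bidiff_op_linear_comb:
  assumes "bidiff_op P" "bidiff_op Q"
  shows "bidiff_op (\<lambda>v. s *\<^sub>C P v + Q v)"
proof -
  have "quot_hom (tensor_power A 2) (tensor_power A 2) (\<lambda>v. s *\<^sub>C P v + Q v)"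
    using assms by (intro quot_hom_add quot_hom_scale quot_space_tensor_power) (simp_all add: bidiff_op_def)
  then show ?thesis
    using assms by (simp add: bidiff_op_def teval_add teval_scale bidifferential_linear_comb)
qed

lemma bidiff_op_add: "bidiff_op P \<Longrightarrow> bidiff_op Q \<Longrightarrow> bidiff_op (\<lambda>v. P v + Q v)"
  using bidiff_op_linear_comb[of P Q 1] by (simp add: scaleC_one)

lemma bidiff_op_scale: "bidiff_op P \<Longrightarrow> bidiff_op (\<lambda>v. s *\<^sub>C P v)"
  using bidiff_op_linear_comb[OF _ bidiff_op_zero] by simp

lemma bidiff_op_sum: "(\<And>i. i \<in> I \<Longrightarrow> bidiff_op (P i)) \<Longrightarrow> bidiff_op (\<lambda>v. \<Sum>i\<in>I. P i v)"
  by (induction I rule: infinite_finite_induct) (simp_all add: bidiff_op_zero bidiff_op_add)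

lemma bidiff_op_nc_eval:
  assumes "bidiff_op P" "bidiff_op Q"
  shows "bidiff_op (nc_eval f P Q n)"
proof -
  have "bidiff_op (word_op P Q w)" for w
  proof (induction w)
    case Nil
    then show ?case using bidiff_op_id by (simp add: id_def)
  next
    case (Cons l w)
    then show ?case using bidiff_op_comp assms by (cases l) (simp_all add: comp_def)
  qed
  then show ?thesis
    unfolding nc_eval_def[abs_def] by (intro bidiff_op_sum bidiff_op_scale)
qed

lemma bidiff_op_exp_half:
  assumes "bidiff_op P"
  shows "bidiff_op (exp_half P n)"
proof -
  have "bidiff_op (P ^^ n)" for n
  proof (induction n)
    case 0
    then show ?case using bidiff_op_id by (simp add: id_def)
  next
    case (Suc n)
    then show ?case using bidiff_op_comp assms by (simp add: comp_def)
  qed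
  from bidiff_op_scale[OF this] show ?thesis
    unfolding exp_half_def[abs_def] .
qed

lemma bidiff_op_op_mult:
  assumes "\<And>n. bidiff_op (P n)" "\<And>n. bidiff_op (Q n)"
  shows "bidiff_op ((P \<star> Q) n)"
  unfolding op_mult_def[abs_def] by (rule bidiff_op_sum) (rule bidiff_op_comp[OF assms])

lemma bidiff_op_fusion_op:
  assumes "\<And>I K. (I, K) \<in> {(A', C), (C, B \<union> D), (C, B), (B, D), (B, C), (C, D), (A', B), (B, C \<union> D)} \<Longrightarrow>
      bidiff_op (\<tau> I K)"
  shows "bidiff_op (fusion_op \<Phi> \<tau> A' B C D n)"
  unfolding fusion_op_def placed_def
  by (intro bidiff_op_op_mult bidiff_op_nc_eval bidiff_op_exp_half assms) simp_all

lemma bidiff_op_at_factor: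
  assumes "linear_on A \<delta>" "\<And>a. a \<in> A \<Longrightarrow> \<delta> a \<in> A"
    and "\<And>a b. a \<in> A \<Longrightarrow> b \<in> A \<Longrightarrow> \<delta> (m0 a b) = m0 (\<delta> a) b + m0 a (\<delta> b)" and "p \<in> {1, 2}"
  shows "bidiff_op (at_factor p \<delta>)"
proof -
  have hom: "quot_hom (tensor_power A 2) (tensor_power A 2) (at_factor p \<delta>)"
    by (rule quot_hom_at_factor[OF assms(1,2)]) (use assms(4) in auto)
  have "bidifferential A m0 (\<lambda>a b. teval (\<lambda>as. D (as ! 0) (as ! 1)) (at_factor p \<delta> (tensor [a, b])))"
    if D: "bidifferential A m0 D" for D
  proof -
    obtain n where n: "bidiff_below A m0 n D" using D by (auto simp: bidifferential_def)
    have bil: "bilinear_on A A D" and v: "valued D" using D by (auto simp: bidifferential_def valued_def)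
    have v': "valued (\<lambda>a b. D b a)" using v by (simp add: valued_def)
    have "bidiff_below A m0 (Suc n) (\<lambda>a b. D (\<delta> a) b)"
      by (rule bidiff_below_derivation[OF assms(2,3) v bilinear_onD(1)[OF bil] n])
    \<comment> \<open>The second argument is treated by swapping the arguments before and
      after.\<close>
    moreover have "bidiff_below A m0 (Suc n) (\<lambda>a b. D a (\<delta> b))"
      using bidiff_below_swap[OF bidiff_below_derivation[OF assms(2,3) v' bilinear_onD(2)[OF bil] bidiff_below_swap[OF n]]] .
    moreover have "bilinear_on A A (\<lambda>a b. D (\<delta> a) b)" "bilinear_on A A (\<lambda>a b. D a (\<delta> b))"
      using bil assms(1,2) by (simp_all add: bilinear_on_def linear_on_def)
    moreover have "D (\<delta> a) b \<in> A" "D a (\<delta> b) \<in> A" if "a \<in> A" "b \<in> A" for a b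
      using v that assms(2) by (simp_all add: valued_def)
    ultimately have 12: "bidifferential A m0 (\<lambda>a b. D (\<delta> a) b)" "bidifferential A m0 (\<lambda>a b. D a (\<delta> b))"
      unfolding bidifferential_def by blast+
    show ?thesis
      using assms(4) 12 by (auto simp: at_factor_tensor scaleC_one)
  qed
  then show ?thesis using hom by (simp add: bidiff_op_def)
qed

end


section \<open>Fusion\<close>

text \<open>Serves the two inclusions into a direct sum: a linear map sends bilinearity relations to
  bilinearity relations.\<close>

lemma invariant_symmetric_push:
  fixes e :: "'g::lie_algebra \<Rightarrow> 'k::lie_algebra"
  assumes e: "\<And>x y. e (x + y) = e x + e y" "\<And>c x. e (c *\<^sub>C x) = c *\<^sub>C e x" and "tensor_eq F G"
  shows "tensor_eq (push (\<lambda>(x, y). (e x, e y)) F) (push (\<lambda>(x, y). (e x, e y)) G)"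
proof -
  let ?N = "tensor_null UNIV (+) scaleC :: ('k \<times> 'k \<Rightarrow>\<^sub>0 complex) set"
  have N: "cvec.subspace ?N" by (simp add: tensor_null_def cvec.subspace_span)
  have rel: "tensor (u + v, w) - tensor (u, w) - tensor (v, w) \<in> ?N" "tensor (w, u + v) - tensor (w, u) - tensor (w, v) \<in> ?N"
    "tensor (c *\<^sub>C u, v) - c *\<^sub>C tensor (u, v) \<in> ?N" "tensor (u, c *\<^sub>C v) - c *\<^sub>C tensor (u, v) \<in> ?N"
    for u v w :: 'k and c
    unfolding tensor_null_def scaleC_single mult_1_right by (rule cvec.span_base, blast)+
  have eq: "push (\<lambda>(x, y). (e x, e y)) H = teval (\<lambda>(x, y). tensor (e x, e y)) H" for H
    by (simp add: push_eq_teval case_prod_unfold)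
  show ?thesis
    unfolding eq tensor_eq_def[of "teval _ _"]
    by (rule tensor_eq_teval[OF N _ _ _ _ assms(3)]; simp only: e rel)
qed

lemma lie_zero: "lie (0 :: 'k::lie_algebra) x = 0" "lie x (0 :: 'k) = 0"
  using lie_scaleC_left[of 0 0 x] lie_scaleC_right[of x 0 0] by simp_all

lemma tensor_eq_add: "tensor_eq F G \<Longrightarrow> tensor_eq F' G' \<Longrightarrow> tensor_eq (F + F') (G + G')"
  unfolding tensor_eq_def tensor_null_def by (simp add: add_diff_add cvec.span_add)

lemma invariant_symmetric_dsum:
  fixes t :: "'g::lie_algebra \<times> 'g \<Rightarrow>\<^sub>0 complex" and s :: "'h::lie_algebra \<times> 'h \<Rightarrow>\<^sub>0 complex"
  assumes "invariant_symmetric t" "invariant_symmetric s"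
  shows "invariant_symmetric (t \<oplus>\<^sub>t s)"
proof -
  let ?p = "\<lambda>x :: 'g. (x, 0 :: 'h)" and ?q = "\<lambda>y :: 'h. (0 :: 'g, y)"
  have lin: "?p (x + y) = ?p x + ?p y" "?p (c *\<^sub>C x) = c *\<^sub>C ?p x" "?q (u + v) = ?q u + ?q v" "?q (c *\<^sub>C u) = c *\<^sub>C ?q u"
    for x y u v c by (simp_all add: scaleC_prod_def)
  note P = invariant_symmetric_push[OF lin(1,2)] and Q = invariant_symmetric_push[OF lin(3,4)]
  show ?thesis
    unfolding invariant_symmetric_def
  proof (intro conjI allI)
    have "tensor_eq (push (\<lambda>(x, y). (y, x)) t) t" "tensor_eq (push (\<lambda>(x, y). (y, x)) s) s"
      using assms by (simp_all add: invariant_symmetric_def)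
    from tensor_eq_add[OF P[OF this(1)] Q[OF this(2)]]
    show "tensor_eq (push (\<lambda>(x, y). (y, x)) (t \<oplus>\<^sub>t s)) (t \<oplus>\<^sub>t s)"
      by (simp add: dsum_def push_simps push_push case_prod_unfold)
  next
    fix z :: "'g \<times> 'h"
    have "tensor_eq (push (\<lambda>(x, y). (lie (fst z) x, y)) t + push (\<lambda>(x, y). (x, lie (fst z) y)) t) 0"
      "tensor_eq (push (\<lambda>(x, y). (lie (snd z) x, y)) s + push (\<lambda>(x, y). (x, lie (snd z) y)) s) 0"
      using assms by (simp_all add: invariant_symmetric_def)
    from tensor_eq_add[OF P[OF this(1)] Q[OF this(2)]]
    show "tensor_eq (push (\<lambda>(x, y). (lie z x, y)) (t \<oplus>\<^sub>t s) + push (\<lambda>(x, y). (x, lie z y)) (t \<oplus>\<^sub>t s)) 0"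
      by (simp add: dsum_def push_simps push_push case_prod_unfold lie_prod_def lie_zero algebra_simps)
  qed
qed

lemma t_action_dsum:
  "t_action (t \<oplus>\<^sub>t s) \<sigma> I K v = t_action t (\<lambda>i x. \<sigma> i (x, 0)) I K v + t_action s (\<lambda>i y. \<sigma> i (0, y)) I K v"
  by (simp add: t_action_def dsum_def teval_add teval_push case_prod_unfold sum.distrib)

text \<open>
  Six slots for \<open>\<gg>\<close> on \<open>A \<otimes> A \<otimes> A\<close>, extending the four slots on \<open>A \<otimes> A\<close>, and three slots for \<open>\<hh>\<close>,
  numbered from 7 to keep all strands apart.
\<close>

definition strand_slots ::
  "('g::lie_algebra \<times> 'g \<times> 'h::lie_algebra \<Rightarrow> 'a \<Rightarrow> 'a) \<Rightarrow> nat \<Rightarrow> 'g \<Rightarrow> ('a list \<Rightarrow>\<^sub>0 complex) \<Rightarrow> ('a list \<Rightarrow>\<^sub>0 complex)" where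
  "strand_slots \<rho> i x = at_factor ((i + 1) div 2) (\<rho> (if odd i then (x, 0, 0) else (0, x, 0)))"

definition extra_slots ::
  "('g::lie_algebra \<times> 'g \<times> 'h::lie_algebra \<Rightarrow> 'a \<Rightarrow> 'a) \<Rightarrow> nat \<Rightarrow> 'h \<Rightarrow> ('a list \<Rightarrow>\<^sub>0 complex) \<Rightarrow> ('a list \<Rightarrow>\<^sub>0 complex)" where
  "extra_slots \<rho> i y = at_factor (i - 6) (\<rho> (0, 0, y))"

lemma strand_slots_simps:
  "strand_slots \<rho> 1 x = at_factor 1 (\<rho> (x, 0, 0))" "strand_slots \<rho> 2 x = at_factor 1 (\<rho> (0, x, 0))"
  "strand_slots \<rho> 3 x = at_factor 2 (\<rho> (x, 0, 0))" "strand_slots \<rho> 4 x = at_factor 2 (\<rho> (0, x, 0))"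
  "strand_slots \<rho> 5 x = at_factor 3 (\<rho> (x, 0, 0))" "strand_slots \<rho> 6 x = at_factor 3 (\<rho> (0, x, 0))"
  by (simp_all add: strand_slots_def)

text \<open>\<open>fusion_slots\<close> sends every label other than 1, 2, 3 to the fourth slot, so
  it is compared with \<open>strand_slots\<close> only for sets of labels inside
  \<open>{1, 2, 3, 4}\<close>.\<close>

lemma fusion_J_strand_slots:
  "fusion_J \<Phi> t \<rho> = fusion_op \<Phi> (t_action t (strand_slots \<rho>)) {1} {2} {3} {4}"
proof -
  have "fusion_slots \<rho> s x = strand_slots \<rho> s x" if "s \<in> {1, 2, 3, 4}" for s x
    using that by (elim insertE) (simp_all only: strand_slots_simps fusion_slots_def, simp_all)
  then have "t_action t (fusion_slots \<rho>) I K = t_action t (strand_slots \<rho>) I K"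
    if "I \<subseteq> {1, 2, 3, 4}" "K \<subseteq> {1, 2, 3, 4}" for I K
    using that unfolding t_action_def by (intro ext sum.cong refl) (simp add: subset_iff)
  then show ?thesis
    unfolding fusion_J_eq fusion_op_def placed_def by simp
qed

lemma slot_system_strand_slots:
  assumes "lie_module A \<rho>"
  shows "slot_system (tensor_power A n) {1..2 * n} (strand_slots \<rho>)"
proof (rule slot_system_at_factor[where p = "\<lambda>i. (i + 1) div 2" and e = "\<lambda>i x. if odd i then (x, 0, 0) else (0, x, 0)", OF assms])
  fix i k :: nat and x y :: 'b and c
  show "(i + 1) div 2 \<in> {1..n}" if "i \<in> {1..2 * n}" using that by auto
  show "(if odd i then (x + y, 0, 0) else (0, x + y, 0)) = (if odd i then (x, 0, 0) else (0, x, 0)) + (if odd i then (y, 0, 0) else (0, y, 0 :: 'c))"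
    by simp
  show "(if odd i then (c *\<^sub>C x, 0, 0) else (0, c *\<^sub>C x, 0)) = c *\<^sub>C (if odd i then (x, 0, 0) else (0, x, 0 :: 'c))"
    by (simp add: scaleC_prod_def)
  show "(if odd i then (lie x y, 0, 0) else (0, lie x y, 0)) = lie (if odd i then (x, 0, 0) else (0, x, 0)) (if odd i then (y, 0, 0) else (0, y, 0 :: 'c))"
    by (simp add: lie_prod_def lie_zero)
  show "lie (if odd i then (x, 0, 0) else (0, x, 0)) (if odd k then (y, 0, 0) else (0, y, 0 :: 'c)) = 0"
    if "i \<in> {1..2 * n}" "k \<in> {1..2 * n}" "i \<noteq> k" "(i + 1) div 2 = (k + 1) div 2"
  proof -
    \<comment> \<open>Two different strands on one factor have opposite parity, that is, they belong
      to different copies of \<open>\<gg>\<close>, and these commute.\<close>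
    have "odd i \<noteq> odd k"
    proof
      assume "odd i = odd k"
      with that(4) have "i = k" by presburger
      with that(3) show False ..
    qed
    then show ?thesis by (auto simp: lie_prod_def lie_zero zero_prod_def)
  qed
  show "strand_slots \<rho> i x = at_factor ((i + 1) div 2) (\<rho> (if odd i then (x, 0, 0) else (0, x, 0)))"
    by (rule strand_slots_def)
qed

lemma slot_system_extra_slots:
  assumes "lie_module A \<rho>"
  shows "slot_system (tensor_power A n) {7..6 + n} (extra_slots \<rho>)"
proof (rule slot_system_at_factor[where p = "\<lambda>i. i - 6" and e = "\<lambda>i y. (0, 0, y)", OF assms])
  fix i k :: nat and x y :: 'c and c
  show "i - 6 \<in> {1..n}" if "i \<in> {7..6 + n}" using that by auto
  show "(0 :: 'b, 0 :: 'b, x + y) = (0, 0, x) + (0, 0, y)" "(0 :: 'b, 0 :: 'b, c *\<^sub>C x) = c *\<^sub>C (0, 0, x)"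
    "(0 :: 'b, 0 :: 'b, lie x y) = lie (0, 0, x) (0, 0, y)"
    by (simp_all add: scaleC_prod_def lie_prod_def lie_zero)
  show "lie (0 :: 'b, 0 :: 'b, x) (0, 0, y) = 0"
    if "i \<in> {7..6 + n}" "k \<in> {7..6 + n}" "i \<noteq> k" "i - 6 = k - 6" using that by auto
  show "extra_slots \<rho> i x = at_factor (i - 6) (\<rho> (0, 0, x))"
    by (rule extra_slots_def)
qed

lemma commutes_mod_at_factor:
  assumes "lie_module A \<rho>" "p \<in> {1..n}" "q \<in> {1..n}" "p = q \<Longrightarrow> lie x y = 0"
  shows "commutes_mod (tensor_power A n) (at_factor p (\<rho> x)) (at_factor q (\<rho> y))"
proof (cases "p = q")
  case False
  have "p - 1 \<noteq> q - 1" using False assms(2,3) by auto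
  then show ?thesis
    unfolding commutes_mod_def by (subst at_factor_commute) (simp_all only: quot_cong_refl[OF quot_space_tensor_power])
next
  case True
  note D = lie_moduleD[OF assms(1)]
  let ?S = "tensor_power A n"
  have hom: "quot_hom ?S ?S (at_factor p (\<rho> z))" for z
    by (rule quot_hom_at_factor[OF D(3) D(2) assms(2)])
  have "quot_cong ?S ?S (\<lambda>v. at_factor p (\<rho> x) (at_factor p (\<rho> y) v)) (\<lambda>v. at_factor p (\<rho> y) (at_factor p (\<rho> x) v))"
  proof (rule tensor_power_congI[OF quot_hom_comp[OF hom hom] quot_hom_comp[OF hom hom]])
    fix as f assume as: "length as = n" "set as \<subseteq> A"
    have lt: "p - 1 < length as" using assms(2) as(1) by auto
    then have "as ! (p - 1) \<in> A" using as(2) nth_mem by blast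
    then have "\<rho> x (\<rho> y (as ! (p - 1))) = \<rho> y (\<rho> x (as ! (p - 1)))"
      using D(6)[of "as ! (p - 1)" x y] D(7) assms(4)[OF True] by simp
    then show "teval f (at_factor p (\<rho> x) (at_factor p (\<rho> y) (tensor as))) = teval f (at_factor p (\<rho> y) (at_factor p (\<rho> x) (tensor as)))"
      using lt by (simp add: at_factor_tensor)
  qed
  then show ?thesis by (simp add: commutes_mod_def True)
qed

lemma braid_rep_strands:
  assumes "lie_module A \<rho>" "invariant_symmetric t" "invariant_symmetric s"
  shows "braid_rep (tensor_power A 3) (chord_op {1..6} t (strand_slots \<rho>) {7..9} s (extra_slots \<rho>))"
proof (rule braid_rep_chord_op[OF _ assms(2) _ assms(3)])
  show "slot_system (tensor_power A 3) {1..6} (strand_slots \<rho>)"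
    using slot_system_strand_slots[OF assms(1), of 3] by simp
  show "slot_system (tensor_power A 3) {7..9} (extra_slots \<rho>)"
    using slot_system_extra_slots[OF assms(1), of 3] by simp
  show "commutes_mod (tensor_power A 3) (strand_slots \<rho> i x) (extra_slots \<rho> k y)"
    if "i \<in> {1..6}" "k \<in> {7..9}" for i k x y
    unfolding strand_slots_def extra_slots_def
    by (rule commutes_mod_at_factor[OF assms(1)])
      (use that in \<open>auto simp: lie_prod_def lie_zero zero_prod_def\<close>)
qed auto

lemma quot_hom_fusion_op:
  assumes "quot_space S"
    and "\<And>I K. (I, K) \<in> {(A, C), (C, B \<union> D), (C, B), (B, D), (B, C), (C, D), (A, B), (B, C \<union> D)} \<Longrightarrow> quot_hom S S (\<tau> I K)"
  shows "quot_hom S S (fusion_op \<Phi> \<tau> A B C D n)"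
  unfolding fusion_op_def placed_def
  by (intro quot_hom_op_mult quot_hom_nc_eval quot_hom_exp_half assms(1)) (rule assms(2), simp)+

text \<open>Group-likeness splits the associator of a direct sum into associators on disjoint
  strands. The one for \<open>\<hh>\<close> commutes with \<open>J\<close>, and what remains is
  \<open>interchange\<close> for the strands 1 to 6.\<close>

lemma associativity_braid:
  assumes "drinfeld_associator \<Phi>"
  defines "a \<equiv> placed_series \<Phi>" and "J \<equiv> braided_system.J (placed_series \<Phi>) (placed_series (nc_inverse \<Phi>)) (\<lambda>I K. exp_half_series (block_chord I K))"
  shows "nc_series \<Phi> (block_chord {1} {3} + block_chord {2} {4} + block_chord {7} {8})
        (block_chord {3} {5} + block_chord {4} {6} + block_chord {8} {9}) * (J {1, 3} {2, 4} {5} {6} * J {1} {2} {3} {4})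
    = J {1} {2} {3, 5} {4, 6} * (J {3} {4} {5} {6} * nc_series \<Phi> (block_chord {1, 2} {3, 4} + block_chord {7} {8})
        (block_chord {3, 4} {5, 6} + block_chord {8} {9}))"
proof -
  interpret B: braided_system "placed_series \<Phi>" "placed_series (nc_inverse \<Phi>)" "\<lambda>I K. exp_half_series (block_chord I K)"
    by (rule braided_system_associator[OF assms(1)])
  have gl: "group_like \<Phi>" using assms(1) by (simp add: drinfeld_associator_def)
  have comm: "block_chord I K * block_chord P Q = block_chord P Q * block_chord I K"
    if "I \<inter> K = {}" "P \<inter> Q = {}" "(I \<union> K) \<inter> (P \<union> Q) = {}" for I K P Q
    by (rule block_chord_commute_disjoint[OF that])
  have comm_add: "(p + q) * z = z * (p + q)" if "p * z = z * p" "q * z = z * q" for p q z :: braid_algebra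
    using that by (simp add: distrib_left distrib_right)
  have 1: "nc_series \<Phi> (block_chord {1} {3} + block_chord {2} {4}) (block_chord {3} {5} + block_chord {4} {6})
      = a {1} {3} {5} * a {2} {4} {6}"
    unfolding a_def placed_series_def by (rule nc_series_group_like[OF gl]; rule comm; simp)
  \<comment> \<open>The strands of both copies of \<open>\<gg>\<close> are disjoint from those of
    \<open>\<hh>\<close>, so group-likeness applies a second time.\<close>
  have 2: "nc_series \<Phi> (block_chord {1} {3} + block_chord {2} {4} + block_chord {7} {8})
        (block_chord {3} {5} + block_chord {4} {6} + block_chord {8} {9}) = a {1} {3} {5} * a {2} {4} {6} * a {7} {8} {9}"
    unfolding 1[symmetric] unfolding a_def placed_series_def
    by (rule nc_series_group_like[OF gl]; rule comm_add; rule comm; simp)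
  have 3: "nc_series \<Phi> (block_chord {1, 2} {3, 4} + block_chord {7} {8}) (block_chord {3, 4} {5, 6} + block_chord {8} {9})
      = a {1, 2} {3, 4} {5, 6} * a {7} {8} {9}"
    unfolding a_def placed_series_def by (rule nc_series_group_like[OF gl]; rule comm; simp)
  have c1: "a {7} {8} {9} * J {1, 3} {2, 4} {5} {6} = J {1, 3} {2, 4} {5} {6} * a {7} {8} {9}"
    unfolding a_def J_def by (rule B.comm_aJ) (simp_all add: blocks_def)
  have c2: "a {7} {8} {9} * J {1} {2} {3} {4} = J {1} {2} {3} {4} * a {7} {8} {9}"
    unfolding a_def J_def by (rule B.comm_aJ) (simp_all add: blocks_def)
  have "blocks [{1}, {2}, {3}, {4}, {5}, {6}]" by (simp add: blocks_def)
  from B.interchange[OF this]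
  have main: "J {1} {2} {3, 5} {4, 6} * J {3} {4} {5} {6} * a {1, 2} {3, 4} {5, 6}
      = a {1} {3} {5} * a {2} {4} {6} * J {1, 3} {2, 4} {5} {6} * J {1} {2} {3} {4}"
    by (simp only: a_def J_def Un_insert_left Un_empty_left)
  have "a {1} {3} {5} * a {2} {4} {6} * a {7} {8} {9} * (J {1, 3} {2, 4} {5} {6} * J {1} {2} {3} {4})
      = a {1} {3} {5} * a {2} {4} {6} * J {1, 3} {2, 4} {5} {6} * J {1} {2} {3} {4} * a {7} {8} {9}"
    unfolding mult.assoc[of _ "a {7} {8} {9}"] commute_mult[OF c1 c2] by (simp only: mult.assoc)
  then show ?thesis
    unfolding 2 3 main[symmetric] by (simp add: mult.assoc)
qed


section \<open>Blocks of slots under maps of tensor powers\<close>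

lemma intertwines_teval:
  assumes "quot_space S" "quot_space S'" "quot_hom S S' M" "\<And>k. intertwines S S' M (P k) (P' k)"
  shows "intertwines S S' M (\<lambda>v. teval (\<lambda>k. P k v) F) (\<lambda>v. teval (\<lambda>k. P' k v) F)"
  unfolding teval_def by (rule intertwines_sum[OF assms(1-3)], rule intertwines_scale[OF assms(1-3)], rule assms(4))

text \<open>Expanding blockwise makes the coproducts of both legs of \<open>t\<close> appear as
  inner sums over the blocks.\<close>

lemma t_action_blocks:
  fixes \<sigma> :: "nat \<Rightarrow> 'g \<Rightarrow> 'v \<Rightarrow> 'v::complex_vector"
  assumes "finite I" "finite K" "\<And>i. i \<in> I \<union> K \<Longrightarrow> finite (B i)"
    and "\<And>i j. i \<in> I \<union> K \<Longrightarrow> j \<in> I \<union> K \<Longrightarrow> i \<noteq> j \<Longrightarrow> B i \<inter> B j = {}"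
    and lin: "\<And>i x. i \<in> \<Union>(B ` I) \<Longrightarrow> quot_hom S S (\<sigma> i x)"
  shows "t_action t \<sigma> (\<Union>(B ` I)) (\<Union>(B ` K))
    = (\<lambda>v. \<Sum>i\<in>I. \<Sum>k\<in>K. teval (\<lambda>(x, y). \<Sum>i'\<in>B i. \<sigma> i' x (\<Sum>k'\<in>B k. \<sigma> k' y v)) t)"
proof
  fix v
  have sum_teval: "(\<Sum>i\<in>X. teval (f i) t) = teval (\<lambda>p. \<Sum>i\<in>X. f i p) t" for X :: "nat set" and f :: "nat \<Rightarrow> 'g \<times> 'g \<Rightarrow> 'v"
    by (simp add: teval_def cvec.scale_sum_right) (rule sum.swap)
  have U: "(\<Sum>i\<in>\<Union>(B ` X). f i) = (\<Sum>i\<in>X. \<Sum>i'\<in>B i. f i')" if "X \<subseteq> I \<union> K" for X and f :: "nat \<Rightarrow> 'v"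
  proof (rule sum.UNION_disjoint)
    show "finite X" using that assms(1,2) finite_subset by blast
  qed (use that assms(3,4) in \<open>auto simp: subset_iff\<close>)
  have lin': "\<sigma> i' x (\<Sum>k'\<in>X. \<sigma> k' y v) = (\<Sum>k'\<in>X. \<sigma> i' x (\<sigma> k' y v))" if "i \<in> I" "i' \<in> B i" for i i' x y X
    using that lin[of i'] by (auto intro!: quot_hom_simps(4)[of S S])
  have "t_action t \<sigma> (\<Union>(B ` I)) (\<Union>(B ` K)) v
      = (\<Sum>i\<in>I. \<Sum>i'\<in>B i. \<Sum>k\<in>K. \<Sum>k'\<in>B k. teval (\<lambda>(x, y). \<sigma> i' x (\<sigma> k' y v)) t)"
    by (simp add: t_action_def U)
  also have "\<dots> = (\<Sum>i\<in>I. \<Sum>k\<in>K. \<Sum>i'\<in>B i. \<Sum>k'\<in>B k. teval (\<lambda>(x, y). \<sigma> i' x (\<sigma> k' y v)) t)"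
    by (intro sum.cong refl) (rule sum.swap)
  also have "\<dots> = (\<Sum>i\<in>I. \<Sum>k\<in>K. teval (\<lambda>(x, y). \<Sum>i'\<in>B i. \<sigma> i' x (\<Sum>k'\<in>B k. \<sigma> k' y v)) t)"
    by (intro sum.cong refl) (simp add: sum_teval case_prod_unfold lin')
  finally show "t_action t \<sigma> (\<Union>(B ` I)) (\<Union>(B ` K)) v
      = (\<Sum>i\<in>I. \<Sum>k\<in>K. teval (\<lambda>(x, y). \<Sum>i'\<in>B i. \<sigma> i' x (\<Sum>k'\<in>B k. \<sigma> k' y v)) t)" .
qed

text \<open>If \<open>M\<close> turns the sum of the slots in \<open>B i\<close> into the single
  slot \<open>i\<close>, then it turns \<open>t\<close> on blocks into \<open>t\<close> on slots. In
  this way invariance of a product produces the coproducts of \<open>J\<close>.\<close>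

lemma intertwines_t_action:
  fixes \<sigma> :: "nat \<Rightarrow> 'g \<Rightarrow> 'v \<Rightarrow> 'v::complex_vector" and \<sigma>' :: "nat \<Rightarrow> 'g \<Rightarrow> 'w \<Rightarrow> 'w::complex_vector"
  assumes spaces: "quot_space S" "quot_space S'" "quot_hom S S' M"
    and fin: "finite I" "finite K" "\<And>i. i \<in> I \<union> K \<Longrightarrow> finite (B i)"
    and disj: "\<And>i j. i \<in> I \<union> K \<Longrightarrow> j \<in> I \<union> K \<Longrightarrow> i \<noteq> j \<Longrightarrow> B i \<inter> B j = {}"
    and lin: "\<And>i j x. i \<in> I \<union> K \<Longrightarrow> j \<in> B i \<Longrightarrow> quot_hom S S (\<sigma> j x)"
    and M: "\<And>i x. i \<in> I \<union> K \<Longrightarrow> intertwines S S' M (\<lambda>v. \<Sum>j\<in>B i. \<sigma> j x v) (\<sigma>' i x)"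
  shows "intertwines S S' M (t_action t \<sigma> (\<Union>(B ` I)) (\<Union>(B ` K))) (t_action t \<sigma>' I K)"
proof -
  have eq: "t_action t \<sigma> (\<Union>(B ` I)) (\<Union>(B ` K))
      = (\<lambda>v. \<Sum>i\<in>I. \<Sum>k\<in>K. teval (\<lambda>(x, y). \<Sum>i'\<in>B i. \<sigma> i' x (\<Sum>k'\<in>B k. \<sigma> k' y v)) t)"
  proof (rule t_action_blocks[where S = S])
    show "quot_hom S S (\<sigma> j x)" if "j \<in> \<Union>(B ` I)" for j x
      using that lin by blast
  qed (fact fin disj)+
  show ?thesis
    unfolding eq t_action_def[of t \<sigma>', abs_def]
  proof (rule intertwines_sum[OF spaces], rule intertwines_sum[OF spaces], rule intertwines_teval[OF spaces])
    fix i k and p :: "'g \<times> 'g" assume ik: "i \<in> I" "k \<in> K"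
    obtain x y where p: "p = (x, y)" by (cases p)
    have "intertwines S S' M (\<lambda>v. \<Sum>i'\<in>B i. \<sigma> i' x (\<Sum>k'\<in>B k. \<sigma> k' y v)) (\<lambda>v. \<sigma>' i x (\<sigma>' k y v))"
      by (rule intertwines_comp[OF spaces(2) M M]) (use ik in auto)
    then show "intertwines S S' M (\<lambda>v. case p of (x, y) \<Rightarrow> \<Sum>i'\<in>B i. \<sigma> i' x (\<Sum>k'\<in>B k. \<sigma> k' y v))
        (\<lambda>v. case p of (x, y) \<Rightarrow> \<sigma>' i x (\<sigma>' k y v))"
      by (simp add: p)
  qed
qed

lemma intertwines_fusion_op_slots:
  assumes spaces: "quot_space S" "quot_space S'" "quot_hom S S' M"
    and fin: "\<And>i. i \<in> {i1, i2, i3, i4} \<Longrightarrow> finite (B i)"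
    and disj: "\<And>i j. i \<in> {i1, i2, i3, i4} \<Longrightarrow> j \<in> {i1, i2, i3, i4} \<Longrightarrow> i \<noteq> j \<Longrightarrow> B i \<inter> B j = {}"
    and lin: "\<And>i j x. i \<in> {i1, i2, i3, i4} \<Longrightarrow> j \<in> B i \<Longrightarrow> quot_hom S S (\<sigma> j x)"
    and M: "\<And>i x. i \<in> {i1, i2, i3, i4} \<Longrightarrow> intertwines S S' M (\<lambda>v. \<Sum>j\<in>B i. \<sigma> j x v) (\<sigma>' i x)"
  shows "intertwines S S' M (fusion_op \<Phi> (t_action t \<sigma>) (B i1) (B i2) (B i3) (B i4) n)
    (fusion_op \<Phi> (t_action t \<sigma>') {i1} {i2} {i3} {i4} n)"
proof -
  define h where "h = (\<lambda>I. \<Union>(B ` I))"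
  have hU: "h (I \<union> K) = h I \<union> h K" for I K by (simp add: h_def)
  have h1: "h {i} = B i" for i by (simp add: h_def)
  have base: "intertwines S S' M (t_action t \<sigma> (h I) (h K)) (t_action t \<sigma>' I K)"
    if IK: "I \<union> K \<subseteq> {i1, i2, i3, i4}" "finite I" "finite K" for I K
    unfolding h_def
  proof (rule intertwines_t_action[OF spaces IK(2,3)])
    fix i j x assume i: "i \<in> I \<union> K"
    then have i': "i \<in> {i1, i2, i3, i4}" using IK(1) by blast
    show "finite (B i)" by (rule fin[OF i'])
    show "intertwines S S' M (\<lambda>v. \<Sum>j\<in>B i. \<sigma> j x v) (\<sigma>' i x)" by (rule M[OF i'])
    show "quot_hom S S (\<sigma> j x)" if "j \<in> B i" by (rule lin[OF i' that])
    show "B i \<inter> B j = {}" if "j \<in> I \<union> K" "i \<noteq> j"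
      using disj[OF i' _ that(2)] that(1) IK(1) by blast
  qed
  have "intertwines S S' M (fusion_op \<Phi> (t_action t \<sigma>) (h {i1}) (h {i2}) (h {i3}) (h {i4}) n)
    (fusion_op \<Phi> (t_action t \<sigma>') {i1} {i2} {i3} {i4} n)"
  proof (rule intertwines_fusion_op[OF spaces _ hU])
    fix I K assume "(I, K) \<in> {({i1}, {i3}), ({i3}, {i2} \<union> {i4}), ({i3}, {i2}), ({i2}, {i4}), ({i2}, {i3}), ({i3}, {i4}),
      ({i1}, {i2}), ({i2}, {i3} \<union> {i4})}"
    then have "I \<union> K \<subseteq> {i1, i2, i3, i4}" "finite I" "finite K" by auto
    then show "intertwines S S' M (t_action t \<sigma> (h I) (h K)) (t_action t \<sigma>' I K)" by (rule base)
  qed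
  then show ?thesis by (simp only: h1)
qed

lemma linear_on_sum:
  assumes "cvec.subspace A" "linear_on A g" "\<And>i. i \<in> I \<Longrightarrow> f i \<in> A"
  shows "g (\<Sum>i\<in>I. f i) = (\<Sum>i\<in>I. g (f i))"
  using assms(3)
proof (induction I rule: infinite_finite_induct)
  case (insert i I)
  have "(\<Sum>i\<in>I. f i) \<in> A" by (rule cvec.subspace_sum[OF assms(1)]) (use insert in auto)
  then show ?case using insert assms(2) by (simp add: linear_on_def)
qed (simp_all add: linear_on_0[OF assms(1,2)])

lemma linear_on_teval:
  assumes "cvec.subspace A" "linear_on A g" "\<And>k. k \<in> Poly_Mapping.keys F \<Longrightarrow> h k \<in> A"
  shows "g (teval h F) = teval (\<lambda>k. g (h k)) F"
proof -
  have "g (teval h F) = (\<Sum>k\<in>Poly_Mapping.keys F. g (Poly_Mapping.lookup F k *\<^sub>C h k))"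
    unfolding teval_def using assms(3) by (intro linear_on_sum[OF assms(1,2)] cvec.subspace_scale[OF assms(1)])
  then show ?thesis
    using assms(2,3) by (simp add: teval_def linear_on_def)
qed

lemma teval_in_subspace:
  assumes "cvec.subspace A" "\<And>k. k \<in> Poly_Mapping.keys F \<Longrightarrow> h k \<in> A"
  shows "teval h F \<in> A"
  unfolding teval_def using assms(2) by (intro cvec.subspace_sum[OF assms(1)] cvec.subspace_scale[OF assms(1)])

lemma multilinear_2D:
  assumes "multilinear_on A 2 f" "c \<in> A"
  shows "linear_on A (\<lambda>x. f [x, c])" "linear_on A (\<lambda>x. f [c, x])"
proof -
  have *: "linear_on A (\<lambda>x. f ([c, c][i := x]))" if "i < 2" for i
  proof -
    have "length [c, c] = 2" "set [c, c] \<subseteq> A" using assms(2) by auto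
    then show ?thesis using assms(1) that unfolding multilinear_on_def by blast
  qed
  show "linear_on A (\<lambda>x. f [x, c])" using *[of 0] by simp
  show "linear_on A (\<lambda>x. f [c, x])" using *[of 1] by simp
qed

lemma multilinear_3D:
  assumes "multilinear_on A 3 f" "b \<in> A" "c \<in> A"
  shows "linear_on A (\<lambda>x. f [x, b, c])" "linear_on A (\<lambda>x. f [b, x, c])" "linear_on A (\<lambda>x. f [b, c, x])"
proof -
  have *: "linear_on A (\<lambda>x. f (as[i := x]))" if "i < 3" "as \<in> {[b, b, c], [b, c, c]}" for i as
  proof -
    have "length as = 3" "set as \<subseteq> A" using that(2) assms(2,3) by auto
    then show ?thesis using assms(1) that(1) unfolding multilinear_on_def by blast
  qed
  show "linear_on A (\<lambda>x. f [x, b, c])" using *[of 0 "[b, b, c]"] by simp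
  show "linear_on A (\<lambda>x. f [b, x, c])" using *[of 1 "[b, b, c]"] by simp
  show "linear_on A (\<lambda>x. f [b, c, x])" using *[of 2 "[b, c, c]"] by simp
qed

lemma bilinear_onD2:
  assumes "bilinear_on A A m" "c \<in> A"
  shows "linear_on A (\<lambda>x. m x c)" "linear_on A (m c)"
  using assms by (auto simp: bilinear_on_def)

lemma list3E:
  assumes "length as = 3" "set as \<subseteq> A"
  obtains a b c where "as = [a, b, c]" "a \<in> A" "b \<in> A" "c \<in> A"
proof -
  have "as ! i \<in> A" if "i < 3" for i using assms that nth_mem[of i as] by auto
  then show ?thesis by (intro that[OF nth_3[OF assms(1)]]) simp_all
qed

lemma list2E:
  assumes "length as = 2" "set as \<subseteq> A"
  obtains a b where "as = [a, b]" "a \<in> A" "b \<in> A"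
proof -
  have "as ! i \<in> A" if "i < 2" for i using assms that nth_mem[of i as] by auto
  then show ?thesis by (intro that[OF nth_2[OF assms(1)]]) simp_all
qed

section \<open>Products as maps from the tensor cube to the tensor square\<close>

lemma quot_hom_mult_left:
  assumes "bilinear_on A A (m j)" "\<And>a b. a \<in> A \<Longrightarrow> b \<in> A \<Longrightarrow> m j a b \<in> A"
  shows "quot_hom (tensor_power A 3) (tensor_power A 2) (mult_left m j)"
  unfolding mult_left_def
proof (rule quot_hom_push)
  fix as assume "length as = 3" "set as \<subseteq> A"
  then show "length [m j (as ! 0) (as ! 1), as ! 2] = 2 \<and> set [m j (as ! 0) (as ! 1), as ! 2] \<subseteq> A"
    by (rule list3E) (simp add: assms(2))
next
  fix f :: "'a list \<Rightarrow> 'a" assume f: "multilinear_on A 2 f"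
  have "multilinear_on A 3 (\<lambda>as. f [m j (as ! 0) (as ! 1), as ! 2])"
  proof (rule multilinear_triple)
    fix x y assume xy: "x \<in> A" "y \<in> A"
    show "linear_on A (\<lambda>a. f [m j a x, y])"
      by (rule linear_on_comp[OF multilinear_2D(1)[OF f xy(2)] bilinear_onD2(1)[OF assms(1) xy(1)] assms(2)[OF _ xy(1)]])
    show "linear_on A (\<lambda>b. f [m j x b, y])"
      by (rule linear_on_comp[OF multilinear_2D(1)[OF f xy(2)] bilinear_onD2(2)[OF assms(1) xy(1)] assms(2)[OF xy(1)]])
    show "linear_on A (\<lambda>c. f [m j x y, c])"
      by (rule multilinear_2D(2)[OF f assms(2)[OF xy]])
  qed
  then show "\<exists>f'. multilinear_on A 3 f' \<and> (\<forall>as. length as = 3 \<longrightarrow> set as \<subseteq> A \<longrightarrow> f' as = f [m j (as ! 0) (as ! 1), as ! 2])"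
    by blast
qed

lemma quot_hom_mult_right:
  assumes "bilinear_on A A (m j)" "\<And>a b. a \<in> A \<Longrightarrow> b \<in> A \<Longrightarrow> m j a b \<in> A"
  shows "quot_hom (tensor_power A 3) (tensor_power A 2) (mult_right m j)"
  unfolding mult_right_def
proof (rule quot_hom_push)
  fix as assume "length as = 3" "set as \<subseteq> A"
  then show "length [as ! 0, m j (as ! 1) (as ! 2)] = 2 \<and> set [as ! 0, m j (as ! 1) (as ! 2)] \<subseteq> A"
    by (rule list3E) (simp add: assms(2))
next
  fix f :: "'a list \<Rightarrow> 'a" assume f: "multilinear_on A 2 f"
  have "multilinear_on A 3 (\<lambda>as. f [as ! 0, m j (as ! 1) (as ! 2)])"
  proof (rule multilinear_triple)
    fix x y assume xy: "x \<in> A" "y \<in> A"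
    show "linear_on A (\<lambda>a. f [a, m j x y])"
      by (rule multilinear_2D(1)[OF f assms(2)[OF xy]])
    show "linear_on A (\<lambda>b. f [x, m j b y])"
      by (rule linear_on_comp[OF multilinear_2D(2)[OF f xy(1)] bilinear_onD2(1)[OF assms(1) xy(2)] assms(2)[OF _ xy(2)]])
    show "linear_on A (\<lambda>c. f [x, m j y c])"
      by (rule linear_on_comp[OF multilinear_2D(2)[OF f xy(1)] bilinear_onD2(2)[OF assms(1) xy(2)] assms(2)[OF xy(2)]])
  qed
  then show "\<exists>f'. multilinear_on A 3 f' \<and> (\<forall>as. length as = 3 \<longrightarrow> set as \<subseteq> A \<longrightarrow> f' as = f [as ! 0, m j (as ! 1) (as ! 2)])"
    by blast
qed

lemma quot_hom_append:
  assumes "c \<in> A"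
  shows "quot_hom (tensor_power A 2) (tensor_power A 3) (push (\<lambda>as. as @ [c]))"
proof (rule quot_hom_push)
  fix f :: "'a list \<Rightarrow> 'a" assume f: "multilinear_on A 3 f"
  have "multilinear_on A 2 (\<lambda>as. f [as ! 0, as ! 1, c])"
    by (rule multilinear_pair) (simp add: bilinear_on_def multilinear_3D[OF f] assms)
  moreover have "f [as ! 0, as ! 1, c] = f (as @ [c])" if as: "length as = 2" "set as \<subseteq> A" for as
  proof -
    obtain x y where "as = [x, y]" using list2E[OF as] by blast
    then show ?thesis by simp
  qed
  ultimately show "\<exists>f'. multilinear_on A 2 f' \<and> (\<forall>as. length as = 2 \<longrightarrow> set as \<subseteq> A \<longrightarrow> f' as = f (as @ [c]))"
    by blast
qed (use assms in auto)

lemma quot_hom_prepend: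
  assumes "a \<in> A"
  shows "quot_hom (tensor_power A 2) (tensor_power A 3) (push ((#) a))"
proof (rule quot_hom_push)
  fix f :: "'a list \<Rightarrow> 'a" assume f: "multilinear_on A 3 f"
  have "multilinear_on A 2 (\<lambda>as. f [a, as ! 0, as ! 1])"
    by (rule multilinear_pair) (simp add: bilinear_on_def multilinear_3D[OF f] assms)
  moreover have "f [a, as ! 0, as ! 1] = f (a # as)" if as: "length as = 2" "set as \<subseteq> A" for as
  proof -
    obtain x y where "as = [x, y]" using list2E[OF as] by blast
    then show ?thesis by simp
  qed
  ultimately show "\<exists>f'. multilinear_on A 2 f' \<and> (\<forall>as. length as = 2 \<longrightarrow> set as \<subseteq> A \<longrightarrow> f' as = f (a # as))"
    by blast
qed (use assms in auto)

lemma quot_cong_linear_eq: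
  assumes "quot_space S'" "quot_hom (tensor_power A n) S' P" "quot_hom (tensor_power A n) S' Q"
    "\<And>as. length as = n \<Longrightarrow> set as \<subseteq> A \<Longrightarrow> P (tensor as) = Q (tensor as)"
  shows "quot_cong (tensor_power A n) S' P Q"
  unfolding quot_cong_def
proof
  fix F assume F: "F \<in> fst (tensor_power A n)"
  have "P F = Q F"
    by (rule linear_eqI[OF assms(2,3)]) (use F assms(4) in \<open>auto simp: tensor_power_fst\<close>)
  then show "P F - Q F \<in> snd S'" by (simp add: quot_spaceD(5)[OF assms(1)])
qed

text \<open>Tensoring with an element on the right leaves the strands 1 to 4 in place.\<close>

lemma intertwines_append:
  assumes "lie_module A \<rho>" "c \<in> A"
  shows "intertwines (tensor_power A 2) (tensor_power A 3) (push (\<lambda>as. as @ [c]))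
    (fusion_op \<Phi> (t_action t (strand_slots \<rho>)) {1} {2} {3} {4} n) (fusion_op \<Phi> (t_action t (strand_slots \<rho>)) {1} {2} {3} {4} n)"
proof (rule intertwines_fusion_op_slots[where B = "\<lambda>i. {i}", OF quot_space_tensor_power quot_space_tensor_power quot_hom_append[OF assms(2)]])
  have hom: "quot_hom (tensor_power A k) (tensor_power A k) (strand_slots \<rho> i x)" if "i \<in> {1..4}" "k \<in> {2, 3}" for i k x
    by (rule slot_systemD(2)[OF slot_system_strand_slots[OF assms(1)]]) (use that in auto)
  show "quot_hom (tensor_power A 2) (tensor_power A 2) (strand_slots \<rho> j x)" if "i \<in> {1, 2, 3, 4}" "j \<in> {i}" for i j x
    using that by (intro hom) auto
  show "intertwines (tensor_power A 2) (tensor_power A 3) (push (\<lambda>as. as @ [c])) (\<lambda>v. \<Sum>j\<in>{i}. strand_slots \<rho> j x v) (strand_slots \<rho> i x)"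
    if i: "i \<in> {1, 2, 3, 4}" for i x
  proof -
    have h: "quot_hom (tensor_power A 2) (tensor_power A 2) (strand_slots \<rho> i x)" "quot_hom (tensor_power A 3) (tensor_power A 3) (strand_slots \<rho> i x)"
      using i by (auto intro!: hom)
    have "quot_cong (tensor_power A 2) (tensor_power A 3) (\<lambda>v. push (\<lambda>as. as @ [c]) (strand_slots \<rho> i x v)) (\<lambda>v. strand_slots \<rho> i x (push (\<lambda>as. as @ [c]) v))"
    proof (rule quot_cong_linear_eq[OF quot_space_tensor_power quot_hom_comp[OF quot_hom_append[OF assms(2)] h(1)] quot_hom_comp[OF h(2) quot_hom_append[OF assms(2)]]])
      fix as assume "length as = 2" "set as \<subseteq> A"
      then show "push (\<lambda>as. as @ [c]) (strand_slots \<rho> i x (tensor as)) = strand_slots \<rho> i x (push (\<lambda>as. as @ [c]) (tensor as))"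
        using i by (elim list2E insertE emptyE) (simp_all add: strand_slots_simps[simplified] at_factor_tensor)
    qed
    then show ?thesis
      unfolding intertwines_def using h quot_homD(3)[OF h(1)] by simp
  qed
qed auto

text \<open>Tensoring with an element on the left shifts every factor by one and hence every strand
  by two.\<close>

lemma intertwines_prepend:
  assumes "lie_module A \<rho>" "a \<in> A"
  shows "intertwines (tensor_power A 2) (tensor_power A 3) (push ((#) a))
    (fusion_op \<Phi> (t_action t (strand_slots \<rho>)) {1} {2} {3} {4} n) (fusion_op \<Phi> (t_action t (strand_slots \<rho>)) {3} {4} {5} {6} n)"
proof -
  have "intertwines (tensor_power A 2) (tensor_power A 3) (push ((#) a))
    (fusion_op \<Phi> (t_action t (strand_slots \<rho>)) {3 - 2} {4 - 2} {5 - 2} {6 - 2} n) (fusion_op \<Phi> (t_action t (strand_slots \<rho>)) {3} {4} {5} {6} n)"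
  proof (rule intertwines_fusion_op_slots[where B = "\<lambda>i. {i - 2}", OF quot_space_tensor_power quot_space_tensor_power quot_hom_prepend[OF assms(2)]])
    have hom: "quot_hom (tensor_power A k) (tensor_power A k) (strand_slots \<rho> i x)" if "i \<in> {1..2 * k}" for i k x
      by (rule slot_systemD(2)[OF slot_system_strand_slots[OF assms(1)] that])
    show "quot_hom (tensor_power A 2) (tensor_power A 2) (strand_slots \<rho> j x)" if "i \<in> {3, 4, 5, 6}" "j \<in> {i - 2}" for i j x
      using that by (intro hom) auto
    show "intertwines (tensor_power A 2) (tensor_power A 3) (push ((#) a)) (\<lambda>v. \<Sum>j\<in>{i - 2}. strand_slots \<rho> j x v) (strand_slots \<rho> i x)"
      if i: "i \<in> {3, 4, 5, 6}" for i x
    proof -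
      have h: "quot_hom (tensor_power A 2) (tensor_power A 2) (strand_slots \<rho> (i - 2) x)" "quot_hom (tensor_power A 3) (tensor_power A 3) (strand_slots \<rho> i x)"
        using i by (auto intro!: hom)
      have "quot_cong (tensor_power A 2) (tensor_power A 3) (\<lambda>v. push ((#) a) (strand_slots \<rho> (i - 2) x v)) (\<lambda>v. strand_slots \<rho> i x (push ((#) a) v))"
      proof (rule quot_cong_linear_eq[OF quot_space_tensor_power quot_hom_comp[OF quot_hom_prepend[OF assms(2)] h(1)] quot_hom_comp[OF h(2) quot_hom_prepend[OF assms(2)]]])
        fix as assume "length as = 2" "set as \<subseteq> A"
        then show "push ((#) a) (strand_slots \<rho> (i - 2) x (tensor as)) = strand_slots \<rho> i x (push ((#) a) (tensor as))"
          using i by (elim list2E insertE emptyE) (simp_all add: strand_slots_simps[simplified] at_factor_tensor)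
      qed
      then show ?thesis
        unfolding intertwines_def using h quot_homD(3)[OF h(1)] by simp
    qed
  qed auto
  then show ?thesis by simp
qed


lemma strand_slots_tensor:
  "strand_slots \<rho> i x (Poly_Mapping.single as c) =
     Poly_Mapping.single (as[(i + 1) div 2 - 1 := \<rho> (if odd i then (x, 0, 0) else (0, x, 0)) (as ! ((i + 1) div 2 - 1))]) c"
  by (simp only: strand_slots_def at_factor_tensor)

lemma intertwines_multI:
  assumes \<rho>: "lie_module A \<rho>" and M: "quot_hom (tensor_power A 3) (tensor_power A 2) M"
    and B: "B \<subseteq> {1..6}" "i \<in> {1..4}"
    and eq: "\<And>a b c f. a \<in> A \<Longrightarrow> b \<in> A \<Longrightarrow> c \<in> A \<Longrightarrow> multilinear_on A 2 f \<Longrightarrow>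
      (\<Sum>j\<in>B. teval f (M (strand_slots \<rho> j x (tensor [a, b, c])))) = teval f (strand_slots \<rho> i x (M (tensor [a, b, c])))"
  shows "intertwines (tensor_power A 3) (tensor_power A 2) M (\<lambda>v. \<Sum>j\<in>B. strand_slots \<rho> j x v) (strand_slots \<rho> i x)"
proof -
  have hom: "quot_hom (tensor_power A k) (tensor_power A k) (strand_slots \<rho> i x)" if "i \<in> {1..2 * k}" for i k
    by (rule slot_systemD(2)[OF slot_system_strand_slots[OF \<rho>] that])
  have h: "quot_hom (tensor_power A 3) (tensor_power A 3) (\<lambda>v. \<Sum>j\<in>B. strand_slots \<rho> j x v)"
    by (intro quot_hom_sum quot_space_tensor_power hom) (use B in auto)
  have h': "quot_hom (tensor_power A 2) (tensor_power A 2) (strand_slots \<rho> i x)"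
    by (rule hom) (use B in auto)
  have "quot_cong (tensor_power A 3) (tensor_power A 2) (\<lambda>v. M (\<Sum>j\<in>B. strand_slots \<rho> j x v)) (\<lambda>v. strand_slots \<rho> i x (M v))"
  proof (rule tensor_power_congI[OF quot_hom_comp[OF M h] quot_hom_comp[OF h' M]])
    fix as f assume as: "length as = 3" "set as \<subseteq> A" and f: "multilinear_on A 2 f"
    obtain a b c where abc: "as = [a, b, c]" "a \<in> A" "b \<in> A" "c \<in> A"
      using list3E[OF as] by blast
    show "teval f (M (\<Sum>j\<in>B. strand_slots \<rho> j x (tensor as))) = teval f (strand_slots \<rho> i x (M (tensor as)))"
      unfolding quot_hom_simps(4)[OF M] teval_simps(4) abc(1) by (rule eq[OF abc(2-4) f])
  qed
  then show ?thesis
    unfolding intertwines_def using h' quot_homD(3)[OF h] by simp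
qed

text \<open>By invariance, acting on the product of the first two factors is acting on both in turn.
  So the strands 1 and 2 of the square are the blocks \<open>{1, 3}\<close> and
  \<open>{2, 4}\<close> of the cube, and 3, 4 are the strands 5, 6 of the third factor.\<close>

lemma intertwines_mult_left:
  assumes \<rho>: "lie_module A \<rho>" and m: "invariant_bilinear A \<rho> (m j)"
  shows "intertwines (tensor_power A 3) (tensor_power A 2) (mult_left m j)
    (fusion_op \<Phi> (t_action t (strand_slots \<rho>)) {1, 3} {2, 4} {5} {6} n)
    (fusion_op \<Phi> (t_action t (strand_slots \<rho>)) {1} {2} {3} {4} n)"
proof -
  note inv = invariant_bilinearD[OF m]
  define B where "B = (\<lambda>i :: nat. if i = 1 then {1, 3 :: nat} else if i = 2 then {2, 4} else if i = 3 then {5} else {6})"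
  have hom: "quot_hom (tensor_power A 3) (tensor_power A 2) (mult_left m j)"
    by (rule quot_hom_mult_left[where m = m and j = j, OF inv(1,2)])
  have Bsub: "B i \<subseteq> {1..6}" for i by (simp add: B_def)
  have "intertwines (tensor_power A 3) (tensor_power A 2) (mult_left m j)
    (fusion_op \<Phi> (t_action t (strand_slots \<rho>)) (B 1) (B 2) (B 3) (B 4) n)
    (fusion_op \<Phi> (t_action t (strand_slots \<rho>)) {1} {2} {3} {4} n)"
  proof (rule intertwines_fusion_op_slots[OF quot_space_tensor_power quot_space_tensor_power hom])
    show "quot_hom (tensor_power A 3) (tensor_power A 3) (strand_slots \<rho> k x)" if "k \<in> B i" for i k x
      by (rule slot_systemD(2)[OF slot_system_strand_slots[OF \<rho>]]) (use that Bsub[of i] in auto)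
    show "intertwines (tensor_power A 3) (tensor_power A 2) (mult_left m j) (\<lambda>v. \<Sum>k\<in>B i. strand_slots \<rho> k x v) (strand_slots \<rho> i x)"
      if i: "i \<in> {1, 2, 3, 4}" for i x
    proof (rule intertwines_multI[OF \<rho> hom Bsub])
      fix a b c f assume abc: "a \<in> A" "b \<in> A" "c \<in> A" and f: "multilinear_on A 2 f"
      have add: "f [u + v, c] = f [u, c] + f [v, c]" if "u \<in> A" "v \<in> A" for u v
        using multilinear_2D(1)[OF f abc(3)] that by (simp add: linear_on_def)
      have invf: "f [\<rho> z (m j a b), c] = f [m j (\<rho> z a) b, c] + f [m j a (\<rho> z b), c]" for z
        using abc lie_moduleD(2)[OF \<rho>] by (simp add: inv add)
      show "(\<Sum>k\<in>B i. teval f (mult_left m j (strand_slots \<rho> k x (tensor [a, b, c]))))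
          = teval f (strand_slots \<rho> i x (mult_left m j (tensor [a, b, c])))"
        using i by (elim insertE emptyE)
          (simp_all add: B_def strand_slots_tensor mult_left_def scaleC_one invf)
    qed (use i in auto)
  qed (auto simp: B_def)
  then show ?thesis by (simp add: B_def)
qed

text \<open>Here the last two factors are multiplied, so the strands 3 and 4 of the square become
  the blocks \<open>{3, 5}\<close> and \<open>{4, 6}\<close>.\<close>

lemma intertwines_mult_right:
  assumes \<rho>: "lie_module A \<rho>" and m: "invariant_bilinear A \<rho> (m j)"
  shows "intertwines (tensor_power A 3) (tensor_power A 2) (mult_right m j)
    (fusion_op \<Phi> (t_action t (strand_slots \<rho>)) {1} {2} {3, 5} {4, 6} n)
    (fusion_op \<Phi> (t_action t (strand_slots \<rho>)) {1} {2} {3} {4} n)"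
proof -
  note inv = invariant_bilinearD[OF m]
  define B where "B = (\<lambda>i :: nat. if i = 1 then {1 :: nat} else if i = 2 then {2} else if i = 3 then {3, 5} else {4, 6})"
  have hom: "quot_hom (tensor_power A 3) (tensor_power A 2) (mult_right m j)"
    by (rule quot_hom_mult_right[where m = m and j = j, OF inv(1,2)])
  have Bsub: "B i \<subseteq> {1..6}" for i by (simp add: B_def)
  have "intertwines (tensor_power A 3) (tensor_power A 2) (mult_right m j)
    (fusion_op \<Phi> (t_action t (strand_slots \<rho>)) (B 1) (B 2) (B 3) (B 4) n)
    (fusion_op \<Phi> (t_action t (strand_slots \<rho>)) {1} {2} {3} {4} n)"
  proof (rule intertwines_fusion_op_slots[OF quot_space_tensor_power quot_space_tensor_power hom])
    show "quot_hom (tensor_power A 3) (tensor_power A 3) (strand_slots \<rho> k x)" if "k \<in> B i" for i k x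
      by (rule slot_systemD(2)[OF slot_system_strand_slots[OF \<rho>]]) (use that Bsub[of i] in auto)
    show "intertwines (tensor_power A 3) (tensor_power A 2) (mult_right m j) (\<lambda>v. \<Sum>k\<in>B i. strand_slots \<rho> k x v) (strand_slots \<rho> i x)"
      if i: "i \<in> {1, 2, 3, 4}" for i x
    proof (rule intertwines_multI[OF \<rho> hom Bsub])
      fix a b c f assume abc: "a \<in> A" "b \<in> A" "c \<in> A" and f: "multilinear_on A 2 f"
      have add: "f [a, u + v] = f [a, u] + f [a, v]" if "u \<in> A" "v \<in> A" for u v
        using multilinear_2D(2)[OF f abc(1)] that by (simp add: linear_on_def)
      have invf: "f [a, \<rho> z (m j b c)] = f [a, m j (\<rho> z b) c] + f [a, m j b (\<rho> z c)]" for z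
        using abc lie_moduleD(2)[OF \<rho>] by (simp add: inv add)
      show "(\<Sum>k\<in>B i. teval f (mult_right m j (strand_slots \<rho> k x (tensor [a, b, c]))))
          = teval f (strand_slots \<rho> i x (mult_right m j (tensor [a, b, c])))"
        using i by (elim insertE emptyE)
          (simp_all add: B_def strand_slots_tensor mult_right_def scaleC_one invf)
    qed (use i in auto)
  qed (auto simp: B_def)
  then show ?thesis by (simp add: B_def)
qed

text \<open>The factors are exchanged term by term; the summation index is reversed because the
  coefficients then occur in the other order.\<close>

lemma quot_cong_series_swap:
  assumes "quot_space S'" "\<And>j n. intertwines S S' (M j) (P n) (P' n)"
  shows "quot_cong S S' ((M \<odot> P) n) ((P' \<odot> M) n)"
proof -
  have eq: "(P' \<odot> M) n = (\<lambda>v. \<Sum>j\<le>n. P' (n - j) (M j v))"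
    unfolding series_comp_def[abs_def]
    by (intro ext sum.reindex_bij_witness[where i = "\<lambda>j. n - j" and j = "\<lambda>j. n - j"]) auto
  have "quot_cong S S' (\<lambda>v. M j (P (n - j) v)) (\<lambda>v. P' (n - j) (M j v))" for j
    using assms(2) by (simp add: intertwines_def)
  then show ?thesis
    unfolding eq unfolding series_comp_def[abs_def] by (intro quot_cong_sum[OF assms(1)])
qed

lemma quot_hom_mult_op:
  assumes "cvec.subspace A" "invariant_bilinear A \<rho> (m i)"
  shows "quot_hom (tensor_power A 2) (A, {0}) (mult_op m i)"
proof -
  have "mult_op m i F \<in> A" if "F \<in> fst (tensor_power A 2)" for F
    unfolding mult_op_def
  proof (rule teval_in_subspace[OF assms(1)])
    fix as assume "as \<in> Poly_Mapping.keys F"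
    then have *: "length as = 2" "set as \<subseteq> A" using that by (auto simp: tensor_power_fst)
    obtain a b where "as = [a, b]" "a \<in> A" "b \<in> A" using list2E[OF *] by blast
    then show "m i (as ! 0) (as ! 1) \<in> A" by (simp add: invariant_bilinearD(2)[OF assms(2)])
  qed
  then show ?thesis
    using teval_quot_hom[OF multilinear_pair[OF invariant_bilinearD(1)[OF assms(2)]]]
    by (simp add: quot_hom_def mult_op_def)
qed

lemma quot_hom_UNIV_target: "quot_hom S (A, {0}) P \<Longrightarrow> quot_hom S (UNIV, {0}) P"
  by (simp add: quot_hom_def)

text \<open>The bilinearity relations are null in the tensor square, so a homomorphism into
  \<open>(A, {0})\<close> kills them.\<close>

lemma bilinear_of_quot_hom:
  assumes Q: "quot_hom (tensor_power A 2) (A, {0}) Q" and sub: "cvec.subspace A"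
  shows "bilinear_on A A (\<lambda>a b. Q (tensor [a, b]))" "a \<in> A \<Longrightarrow> b \<in> A \<Longrightarrow> Q (tensor [a, b]) \<in> A"
proof -
  let ?V = "tensor_power A 2"
  have T: "tensor [a, b] \<in> fst ?V" if "a \<in> A" "b \<in> A" for a b
    by (rule tensor_power_tensor) (use that in auto)
  have Qz: "Q x = Q y" if "x - y \<in> snd ?V" for x y
    using quot_homD(4)[OF Q that] by (simp add: quot_hom_simps[OF Q])
  have V: "cvec.subspace (fst ?V)" using quot_space_tensor_power[of A 2] by (simp add: quot_space_def)
  note vmem = cvec.subspace_add[OF V] cvec.subspace_diff[OF V] cvec.subspace_scale[OF V] T
    cvec.subspace_add[OF sub] cvec.subspace_scale[OF sub]
  have lin: "f [a + b, c] = f [a, c] + f [b, c]" "f [c, a + b] = f [c, a] + f [c, b]"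
    "f [s *\<^sub>C a, c] = s *\<^sub>C f [a, c]" "f [c, s *\<^sub>C a] = s *\<^sub>C f [c, a]"
    if "multilinear_on A 2 f" "a \<in> A" "b \<in> A" "c \<in> A" for f :: "'a list \<Rightarrow> 'a" and a b c s
    using multilinear_2D[OF that(1,4)] that(2,3) unfolding linear_on_def by blast+
  have "Q (tensor [a + b, c]) = Q (tensor [a, c] + tensor [b, c])" "Q (tensor [c, a + b]) = Q (tensor [c, a] + tensor [c, b])"
    "Q (tensor [s *\<^sub>C a, c]) = Q (s *\<^sub>C tensor [a, c])" "Q (tensor [c, s *\<^sub>C a]) = Q (s *\<^sub>C tensor [c, a])"
    if "a \<in> A" "b \<in> A" "c \<in> A" for a b c s
    by (rule Qz; unfold tensor_power_snd; intro conjI allI impI vmem that;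
        simp only: teval_simps teval_add teval_scale teval_single scaleC_one lin[OF _ that] diff_self)+
  then show "bilinear_on A A (\<lambda>a b. Q (tensor [a, b]))"
    by (simp add: bilinear_on_def linear_on_def quot_homD(1,2)[OF Q])
  show "a \<in> A \<Longrightarrow> b \<in> A \<Longrightarrow> Q (tensor [a, b]) \<in> A"
    using quot_homD(3)[OF Q T] by simp
qed

lemma quot_hom_fusion_strands:
  assumes "lie_module A \<rho>" "invariant_symmetric t" "B1 \<union> B2 \<union> B3 \<union> B4 \<subseteq> {1..2 * k}"
  shows "quot_hom (tensor_power A k) (tensor_power A k) (fusion_op \<Phi> (t_action t (strand_slots \<rho>)) B1 B2 B3 B4 n)"
proof (rule quot_hom_fusion_op[OF quot_space_tensor_power])
  fix I K assume "(I, K) \<in> {(B1, B3), (B3, B2 \<union> B4), (B3, B2), (B2, B4), (B2, B3), (B3, B4), (B1, B2), (B2, B3 \<union> B4)}"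
  then have "I \<subseteq> {1..2 * k}" "K \<subseteq> {1..2 * k}" using assms(3) by auto
  then show "quot_hom (tensor_power A k) (tensor_power A k) (t_action t (strand_slots \<rho>) I K)"
    by (rule t_action_hom[OF slot_system_strand_slots[OF assms(1)] assms(2)])
qed

section \<open>The fused product in terms of \<open>J\<close>\<close>

lemma fusion_product_eq:
  "fusion_product \<Phi> t \<rho> m n a b
    = (mult_op m \<odot> fusion_op \<Phi> (t_action t (strand_slots \<rho>)) {1} {2} {3} {4}) n (tensor [a, b])"
  by (simp add: fusion_product_def series_comp_def mult_op_def fusion_J_strand_slots)

text \<open>The inner product applies \<open>J\<close> to the tensor of \<open>a\<close> and
  \<open>b\<close>; up to null tensors it makes no difference whether \<open>c\<close> is appended
  before or after.\<close>

lemma mult_left_fusion: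
  assumes \<rho>: "lie_module A \<rho>" and t: "invariant_symmetric t" and m: "\<And>i. invariant_bilinear A \<rho> (m i)"
    and F: "quot_hom (tensor_power A 3) (tensor_power A 2) (mult_left (fusion_product \<Phi> t \<rho> m) j)"
  defines "J \<equiv> fusion_op \<Phi> (t_action t (strand_slots \<rho>)) {1} {2} {3} {4}"
  shows "quot_cong (tensor_power A 3) (tensor_power A 2) (mult_left (fusion_product \<Phi> t \<rho> m) j) ((mult_left m \<odot> J) j)"
proof (rule tensor_power_congI[OF F])
  note sub = lie_moduleD(1)[OF \<rho>]
  have J3: "quot_hom (tensor_power A 3) (tensor_power A 3) (J n)" and J2: "quot_hom (tensor_power A 2) (tensor_power A 2) (J n)" for n
    unfolding J_def by (rule quot_hom_fusion_strands[OF \<rho> t]; simp)+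
  have L: "quot_hom (tensor_power A 3) (tensor_power A 2) (mult_left m i)" for i
    by (rule quot_hom_mult_left[where m = m and j = i, OF invariant_bilinearD(1,2)[OF m]])
  show "quot_hom (tensor_power A 3) (tensor_power A 2) ((mult_left m \<odot> J) j)"
    by (rule quot_hom_series_comp[OF quot_space_tensor_power L J3])
  fix as f assume as: "length as = 3" "set as \<subseteq> A" and f: "multilinear_on A 2 f"
  obtain a b c where abc: "as = [a, b, c]" "a \<in> A" "b \<in> A" "c \<in> A" using list3E[OF as] by blast
  have T: "tensor [a, b] \<in> fst (tensor_power A 2)" by (rule tensor_power_tensor) (use abc in auto)
  have g: "linear_on A (\<lambda>x. f [x, c])" by (rule multilinear_2D(1)[OF f abc(4)])
  have M: "mult_op m i F \<in> A" if "F \<in> fst (tensor_power A 2)" for F i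
    using quot_homD(3)[OF quot_hom_mult_op[OF sub m] that] by simp
  have "teval f (mult_left m i (J k (tensor [a, b, c]))) = f [mult_op m i (J k (tensor [a, b])), c]" for i k
  proof -
    have h: "quot_hom (tensor_power A 3) (UNIV, {0}) (\<lambda>v. teval f (mult_left m i v))"
      by (rule quot_hom_comp[OF teval_quot_hom[OF f] L])
    have "push (\<lambda>as. as @ [c]) (J k (tensor [a, b])) - J k (push (\<lambda>as. as @ [c]) (tensor [a, b])) \<in> snd (tensor_power A 3)"
      using intertwines_append[OF \<rho> abc(4), of \<Phi> t k] T unfolding J_def intertwines_def quot_cong_def by blast
    from quot_homD(4)[OF h this]
    have "teval f (mult_left m i (J k (tensor [a, b, c]))) = teval f (mult_left m i (push (\<lambda>as. as @ [c]) (J k (tensor [a, b]))))"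
      by (simp add: quot_hom_simps[OF h])
    also have "\<dots> = teval (\<lambda>as. f [m i ((as @ [c]) ! 0) ((as @ [c]) ! 1), (as @ [c]) ! 2]) (J k (tensor [a, b]))"
      by (simp add: mult_left_def teval_push)
    also have "\<dots> = teval (\<lambda>as. f [m i (as ! 0) (as ! 1), c]) (J k (tensor [a, b]))"
    proof (rule teval_cong)
      fix as assume "as \<in> Poly_Mapping.keys (J k (tensor [a, b]))"
      then have *: "length as = 2" "set as \<subseteq> A" using quot_homD(3)[OF J2 T, of k] by (auto simp: tensor_power_fst)
      obtain x y where "as = [x, y]" using list2E[OF *] by blast
      then show "f [m i ((as @ [c]) ! 0) ((as @ [c]) ! 1), (as @ [c]) ! 2] = f [m i (as ! 0) (as ! 1), c]" by simp
    qed
    also have "\<dots> = f [mult_op m i (J k (tensor [a, b])), c]"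
      unfolding mult_op_def
    proof (rule linear_on_teval[OF sub g, symmetric])
      fix as assume "as \<in> Poly_Mapping.keys (J k (tensor [a, b]))"
      then have *: "length as = 2" "set as \<subseteq> A" using quot_homD(3)[OF J2 T, of k] by (auto simp: tensor_power_fst)
      obtain x y where "as = [x, y]" "x \<in> A" "y \<in> A" using list2E[OF *] by blast
      then show "m i (as ! 0) (as ! 1) \<in> A" by (simp add: invariant_bilinearD(2)[OF m])
    qed
    finally show ?thesis .
  qed
  then have "teval f ((mult_left m \<odot> J) j (tensor [a, b, c])) = (\<Sum>i\<le>j. f [mult_op m i (J (j - i) (tensor [a, b])), c])"
    by (simp add: series_comp_def teval_simps)
  also have "\<dots> = f [(\<Sum>i\<le>j. mult_op m i (J (j - i) (tensor [a, b]))), c]"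
    by (rule linear_on_sum[OF sub g, symmetric]) (rule M[OF quot_homD(3)[OF J2 T]])
  also have "\<dots> = f [fusion_product \<Phi> t \<rho> m j a b, c]"
    by (simp only: fusion_product_eq J_def series_comp_def)
  also have "\<dots> = teval f (mult_left (fusion_product \<Phi> t \<rho> m) j (tensor as))"
    by (simp add: abc(1) mult_left_def scaleC_one)
  finally show "teval f (mult_left (fusion_product \<Phi> t \<rho> m) j (tensor as)) = teval f ((mult_left m \<odot> J) j (tensor as))"
    by (simp only: abc(1))
qed

text \<open>Now \<open>a\<close> is prepended, so the inner \<open>J\<close> sits on the strands 3
  to 6.\<close>

lemma mult_right_fusion:
  assumes \<rho>: "lie_module A \<rho>" and t: "invariant_symmetric t" and m: "\<And>i. invariant_bilinear A \<rho> (m i)"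
    and F: "quot_hom (tensor_power A 3) (tensor_power A 2) (mult_right (fusion_product \<Phi> t \<rho> m) j)"
  defines "J \<equiv> fusion_op \<Phi> (t_action t (strand_slots \<rho>)) {1} {2} {3} {4}"
    and "J' \<equiv> fusion_op \<Phi> (t_action t (strand_slots \<rho>)) {3} {4} {5} {6}"
  shows "quot_cong (tensor_power A 3) (tensor_power A 2) (mult_right (fusion_product \<Phi> t \<rho> m) j) ((mult_right m \<odot> J') j)"
proof (rule tensor_power_congI[OF F])
  note sub = lie_moduleD(1)[OF \<rho>]
  have J3: "quot_hom (tensor_power A 3) (tensor_power A 3) (J' n)" and J2: "quot_hom (tensor_power A 2) (tensor_power A 2) (J n)" for n
    unfolding J_def J'_def by (rule quot_hom_fusion_strands[OF \<rho> t]; simp)+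
  have L: "quot_hom (tensor_power A 3) (tensor_power A 2) (mult_right m i)" for i
    by (rule quot_hom_mult_right[where m = m and j = i, OF invariant_bilinearD(1,2)[OF m]])
  show "quot_hom (tensor_power A 3) (tensor_power A 2) ((mult_right m \<odot> J') j)"
    by (rule quot_hom_series_comp[OF quot_space_tensor_power L J3])
  fix as f assume as: "length as = 3" "set as \<subseteq> A" and f: "multilinear_on A 2 f"
  obtain a b c where abc: "as = [a, b, c]" "a \<in> A" "b \<in> A" "c \<in> A" using list3E[OF as] by blast
  have T: "tensor [b, c] \<in> fst (tensor_power A 2)" by (rule tensor_power_tensor) (use abc in auto)
  have g: "linear_on A (\<lambda>x. f [a, x])" by (rule multilinear_2D(2)[OF f abc(2)])
  have M: "mult_op m i F \<in> A" if "F \<in> fst (tensor_power A 2)" for F i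
    using quot_homD(3)[OF quot_hom_mult_op[OF sub m] that] by simp
  have "teval f (mult_right m i (J' k (tensor [a, b, c]))) = f [a, mult_op m i (J k (tensor [b, c]))]" for i k
  proof -
    have h: "quot_hom (tensor_power A 3) (UNIV, {0}) (\<lambda>v. teval f (mult_right m i v))"
      by (rule quot_hom_comp[OF teval_quot_hom[OF f] L])
    have "push ((#) a) (J k (tensor [b, c])) - J' k (push ((#) a) (tensor [b, c])) \<in> snd (tensor_power A 3)"
      using intertwines_prepend[OF \<rho> abc(2), of \<Phi> t k] T unfolding J_def J'_def intertwines_def quot_cong_def by blast
    from quot_homD(4)[OF h this]
    have "teval f (mult_right m i (J' k (tensor [a, b, c]))) = teval f (mult_right m i (push ((#) a) (J k (tensor [b, c]))))"
      by (simp add: quot_hom_simps[OF h])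
    also have "\<dots> = teval (\<lambda>as. f [a, m i (as ! 0) (as ! 1)]) (J k (tensor [b, c]))"
      by (simp add: mult_right_def teval_push numeral_2_eq_2)
    also have "\<dots> = f [a, mult_op m i (J k (tensor [b, c]))]"
      unfolding mult_op_def
    proof (rule linear_on_teval[OF sub g, symmetric])
      fix as assume "as \<in> Poly_Mapping.keys (J k (tensor [b, c]))"
      then have *: "length as = 2" "set as \<subseteq> A" using quot_homD(3)[OF J2 T, of k] by (auto simp: tensor_power_fst)
      obtain x y where "as = [x, y]" "x \<in> A" "y \<in> A" using list2E[OF *] by blast
      then show "m i (as ! 0) (as ! 1) \<in> A" by (simp add: invariant_bilinearD(2)[OF m])
    qed
    finally show ?thesis .
  qed
  then have "teval f ((mult_right m \<odot> J') j (tensor [a, b, c])) = (\<Sum>i\<le>j. f [a, mult_op m i (J (j - i) (tensor [b, c]))])"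
    by (simp add: series_comp_def teval_simps)
  also have "\<dots> = f [a, (\<Sum>i\<le>j. mult_op m i (J (j - i) (tensor [b, c])))]"
    by (rule linear_on_sum[OF sub g, symmetric]) (rule M[OF quot_homD(3)[OF J2 T]])
  also have "\<dots> = f [a, fusion_product \<Phi> t \<rho> m j b c]"
    by (simp only: fusion_product_eq J_def series_comp_def)
  also have "\<dots> = teval f (mult_right (fusion_product \<Phi> t \<rho> m) j (tensor as))"
    by (simp add: abc(1) mult_right_def scaleC_one)
  finally show "teval f (mult_right (fusion_product \<Phi> t \<rho> m) j (tensor as)) = teval f ((mult_right m \<odot> J') j (tensor as))"
    by (simp only: abc(1))
qed


section \<open>The tensor cube as a representation of the braid algebra\<close>

lemma represents_strands:
  assumes \<rho>: "lie_module A \<rho>" and t: "invariant_symmetric t" and s: "invariant_symmetric s"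
  defines "r \<equiv> chord_op {1..6} t (strand_slots \<rho>) {7..9} s (extra_slots \<rho>)"
  shows "I \<subseteq> {1..6} \<Longrightarrow> K \<subseteq> {1..6} \<Longrightarrow> I \<inter> K = {} \<Longrightarrow>
      represents (tensor_power A 3) r (t_action t (strand_slots \<rho>) I K) (block_chord I K)"
    "i \<in> {7..9} \<Longrightarrow> k \<in> {7..9} \<Longrightarrow> i \<noteq> k \<Longrightarrow>
      represents (tensor_power A 3) r (t_action s (extra_slots \<rho>) {i} {k}) (block_chord {i} {k})"
proof -
  have S: "quot_space (tensor_power A 3)" by (rule quot_space_tensor_power)
  have rep: "braid_rep (tensor_power A 3) r" unfolding r_def by (rule braid_rep_strands[OF \<rho> t s])
  have hom: "quot_hom (tensor_power A 3) (tensor_power A 3) (r g)" for g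
    using rep unfolding braid_rep_def by blast
  show "represents (tensor_power A 3) r (t_action t (strand_slots \<rho>) I K) (block_chord I K)"
    if IK: "I \<subseteq> {1..6}" "K \<subseteq> {1..6}" "I \<inter> K = {}"
  proof -
    have eq: "t_action t (strand_slots \<rho>) I K = (\<lambda>v. \<Sum>i\<in>I. \<Sum>k\<in>K. t_action t (strand_slots \<rho>) {i} {k} v)"
      by (rule ext) (rule t_action_sum)
    show ?thesis
      unfolding eq
    proof (rule represents_block_chord[OF S, where r = r, OF hom])
      fix i k assume "i \<in> I" "k \<in> K"
      then have "i \<in> {1..6}" "k \<in> {1..6}" "i \<noteq> k" using IK by auto
      then have "r (i, k) = t_action t (strand_slots \<rho>) {i} {k}" unfolding r_def chord_op_def by simp
      with represents_chord[OF S, where r = r and i = i and j = k, OF hom]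
      show "represents (tensor_power A 3) r (t_action t (strand_slots \<rho>) {i} {k}) (abs_braid_algebra (chord i k))" by simp
    qed
  qed
  show "represents (tensor_power A 3) r (t_action s (extra_slots \<rho>) {i} {k}) (block_chord {i} {k})"
    if "i \<in> {7..9}" "k \<in> {7..9}" "i \<noteq> k"
  proof -
    have "r (i, k) = t_action s (extra_slots \<rho>) {i} {k}" using that unfolding r_def chord_op_def by auto
    with represents_chord[OF S, where r = r and i = i and j = k, OF hom]
    show ?thesis by (simp add: block_chord_def)
  qed
qed

text \<open>The diagonal element \<open>(x, x)\<close> is the sum of \<open>(x, 0)\<close> and
  \<open>(0, x)\<close>, so it acts on factor \<open>p\<close> through both strands
  \<open>2 * p - 1\<close> and \<open>2 * p\<close>.\<close>

lemma diagonal_cong: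
  assumes \<rho>: "lie_module A \<rho>" and t: "invariant_symmetric t" and p: "p \<in> {1..3}" "q \<in> {1..3}"
  shows "quot_cong (tensor_power A 3) (tensor_power A 3)
    (t_action t (\<lambda>i x. module_slots (diagonal_action \<rho>) i (x, 0)) {p} {q})
    (t_action t (strand_slots \<rho>) {2 * p - 1, 2 * p} {2 * q - 1, 2 * q})"
proof -
  let ?S = "tensor_power A 3" and ?\<sigma> = "strand_slots \<rho>"
  have S: "quot_space ?S" by (rule quot_space_tensor_power)
  note ms = slot_systemD[OF slot_system_module_slots[OF \<rho>, of 3]] and ss = slot_systemD(2)[OF slot_system_strand_slots[OF \<rho>, of 3]]
  have odd: "?\<sigma> (2 * i - 1) x = module_slots \<rho> i (x, 0, 0)" and even: "?\<sigma> (2 * i) x = module_slots \<rho> i (0, x, 0)"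
    if "i \<in> {1..3}" for i x
    using that by (auto simp: strand_slots_def module_slots_def)
  have d: "module_slots (diagonal_action \<rho>) i (x, 0) = module_slots \<rho> i ((x, 0, 0) + (0, x, 0))" for i x
    by (simp add: module_slots_def diagonal_action_def)
  have c: "quot_cong ?S ?S (module_slots (diagonal_action \<rho>) i (x, 0)) (\<lambda>v. ?\<sigma> (2 * i - 1) x v + ?\<sigma> (2 * i) x v)"
    if "i \<in> {1..3}" for i x
    unfolding d odd[OF that] even[OF that] by (rule ms(3)[OF that])
  have h: "quot_hom ?S ?S (\<lambda>v. ?\<sigma> (2 * i - 1) x v + ?\<sigma> (2 * i) x v)" "quot_hom ?S ?S (module_slots (diagonal_action \<rho>) i (x, 0))"
    if "i \<in> {1..3}" for i x
    unfolding d odd[OF that] even[OF that] by (intro quot_hom_add[OF S] ms(2)[OF that])+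
  have "quot_cong ?S ?S (\<lambda>v. case k of (x, y) \<Rightarrow> module_slots (diagonal_action \<rho>) p (x, 0) (module_slots (diagonal_action \<rho>) q (y, 0) v))
     (\<lambda>v. case k of (x, y) \<Rightarrow> ?\<sigma> (2 * p - 1) x (?\<sigma> (2 * q - 1) y v + ?\<sigma> (2 * q) y v) + ?\<sigma> (2 * p) x (?\<sigma> (2 * q - 1) y v + ?\<sigma> (2 * q) y v))" for k
  proof -
    obtain x y where k: "k = (x, y)" by (cases k)
    show ?thesis
      unfolding k prod.case
      by (rule quot_cong_comp[OF S h(2)[OF p(1)] quot_homD(3)[OF h(1)[OF p(2)]] c[OF p(1)] c[OF p(2)]])
  qed
  from quot_cong_teval[OF S this]
  have "quot_cong ?S ?S (t_action t (\<lambda>i x. module_slots (diagonal_action \<rho>) i (x, 0)) {p} {q})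
    (\<lambda>v. teval (\<lambda>(x, y). ?\<sigma> (2 * p - 1) x (?\<sigma> (2 * q - 1) y v + ?\<sigma> (2 * q) y v) + ?\<sigma> (2 * p) x (?\<sigma> (2 * q - 1) y v + ?\<sigma> (2 * q) y v)) t)"
    unfolding t_action_pair .
  moreover have "(\<lambda>v. teval (\<lambda>(x, y). ?\<sigma> (2 * p - 1) x (?\<sigma> (2 * q - 1) y v + ?\<sigma> (2 * q) y v) + ?\<sigma> (2 * p) x (?\<sigma> (2 * q - 1) y v + ?\<sigma> (2 * q) y v)) t)
    = t_action t ?\<sigma> {2 * p - 1, 2 * p} {2 * q - 1, 2 * q}"
  proof
    fix v
    have ne: "2 * p - 1 \<noteq> 2 * p" "2 * q - 1 \<noteq> 2 * q" using p by auto
    have lin: "?\<sigma> (2 * p - 1) x (u + w) = ?\<sigma> (2 * p - 1) x u + ?\<sigma> (2 * p - 1) x w" "?\<sigma> (2 * p) x (u + w) = ?\<sigma> (2 * p) x u + ?\<sigma> (2 * p) x w" for x u w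
      by (rule quot_homD(1)[OF ss]; use p in auto)+
    show "teval (\<lambda>(x, y). ?\<sigma> (2 * p - 1) x (?\<sigma> (2 * q - 1) y v + ?\<sigma> (2 * q) y v) + ?\<sigma> (2 * p) x (?\<sigma> (2 * q - 1) y v + ?\<sigma> (2 * q) y v)) t
        = t_action t ?\<sigma> {2 * p - 1, 2 * p} {2 * q - 1, 2 * q} v"
      unfolding lin t_action_def using ne by (simp add: case_prod_unfold teval_add_fun)
  qed
  ultimately show ?thesis by simp
qed

lemma teval_dsum: "teval f (t \<oplus>\<^sub>t s) = teval (\<lambda>(x, y). f ((x, 0), (y, 0))) t + teval (\<lambda>(u, v). f ((0, u), (0, v))) s"
  by (simp add: dsum_def teval_add teval_push case_prod_unfold)

text \<open>Each factor is represented by its power series in the braid algebra, and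
  \<open>associativity_braid\<close> identifies the two products.\<close>

lemma associativity_operators:
  assumes \<Phi>: "drinfeld_associator \<Phi>" and \<rho>: "lie_module A \<rho>" and \<rho>d: "lie_module A (diagonal_action \<rho>)"
    and t: "invariant_symmetric t" and s: "invariant_symmetric s"
  defines "J \<equiv> fusion_op \<Phi> (t_action t (strand_slots \<rho>))"
    and "\<Psi> \<equiv> placed \<Phi> (t_action (t \<oplus>\<^sub>t t \<oplus>\<^sub>t s) (module_slots \<rho>)) {1} {2} {3}"
    and "\<Psi>d \<equiv> placed \<Phi> (t_action (t \<oplus>\<^sub>t s) (module_slots (diagonal_action \<rho>))) {1} {2} {3}"
  shows "quot_cong (tensor_power A 3) (tensor_power A 3)
    ((\<Psi> \<star> J {1, 3} {2, 4} {5} {6} \<star> J {1} {2} {3} {4}) n) ((J {1} {2} {3, 5} {4, 6} \<star> J {3} {4} {5} {6} \<star> \<Psi>d) n)"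
proof -
  let ?S = "tensor_power A 3" and ?\<tau> = "t_action t (strand_slots \<rho>)" and ?\<tau>' = "t_action s (extra_slots \<rho>)"
  define r where "r = chord_op {1..6} t (strand_slots \<rho>) {7..9} s (extra_slots \<rho>)"
  have S: "quot_space ?S" by (rule quot_space_tensor_power)
  have rep: "braid_rep ?S r" unfolding r_def by (rule braid_rep_strands[OF \<rho> t s])
  have hom: "quot_hom ?S ?S (r g)" for g using rep unfolding braid_rep_def by blast
  note chords = represents_strands[OF \<rho> t s, folded r_def]
  note nc = represents_nc_eval[OF S, where r = r, OF hom] and ex = represents_exp_half[OF S, where r = r, OF hom]
    and om = represents_op_mult[OF S, where r = r, OF hom] and ad = represents_add[OF S, where r = r, OF hom]
  interpret B: braided_system "placed_series \<Phi>" "placed_series (nc_inverse \<Phi>)" "\<lambda>I K. exp_half_series (block_chord I K)"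
    by (rule braided_system_associator[OF \<Phi>])
  have placed: "represents ?S r (placed f ?\<tau> I K L n) (placed_series f I K L $ n)"
    if "I \<subseteq> {1..6}" "K \<subseteq> {1..6}" "L \<subseteq> {1..6}" "I \<inter> K = {}" "K \<inter> L = {}" for f I K L n
    unfolding placed_def placed_series_def by (rule nc[OF chords(1)[OF that(1,2,4)] chords(1)[OF that(2,3,5)]])
  have J: "represents ?S r (J I1 I2 I3 I4 n) (B.J I1 I2 I3 I4 $ n)"
    if sub: "I1 \<union> I2 \<union> I3 \<union> I4 \<subseteq> {1..6}" and bl: "blocks [I1, I2, I3, I4]" for I1 I2 I3 I4 n
    unfolding J_def fusion_op_def B.J_def mult.assoc
    by (intro om placed ex chords(1)) (use sub bl in \<open>auto simp: blocks_def\<close>)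
  \<comment> \<open>Between two neighbouring factors the tensor of the direct sum consists of one
    chord for each summand.\<close>
  have \<tau>1: "t_action (t \<oplus>\<^sub>t t \<oplus>\<^sub>t s) (module_slots \<rho>) {1} {2} = (\<lambda>v. ?\<tau> {1} {3} v + ?\<tau> {2} {4} v + ?\<tau>' {7} {8} v)"
    "t_action (t \<oplus>\<^sub>t t \<oplus>\<^sub>t s) (module_slots \<rho>) {2} {3} = (\<lambda>v. ?\<tau> {3} {5} v + ?\<tau> {4} {6} v + ?\<tau>' {8} {9} v)"
    by (simp_all add: fun_eq_iff teval_dsum t_action_pair module_slots_def strand_slots_def extra_slots_def zero_prod_def
        case_prod_unfold add.assoc)
  have \<Psi>: "represents ?S r (\<Psi> n) (nc_series \<Phi> (block_chord {1} {3} + block_chord {2} {4} + block_chord {7} {8})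
        (block_chord {3} {5} + block_chord {4} {6} + block_chord {8} {9}) $ n)" for n
    unfolding \<Psi>_def placed_def \<tau>1 by (intro nc ad chords) auto
  have \<tau>d: "t_action (t \<oplus>\<^sub>t s) (module_slots (diagonal_action \<rho>)) {1} {2}
      = (\<lambda>v. t_action t (\<lambda>i x. module_slots (diagonal_action \<rho>) i (x, 0)) {1} {2} v + ?\<tau>' {7} {8} v)"
    "t_action (t \<oplus>\<^sub>t s) (module_slots (diagonal_action \<rho>)) {2} {3}
      = (\<lambda>v. t_action t (\<lambda>i x. module_slots (diagonal_action \<rho>) i (x, 0)) {2} {3} v + ?\<tau>' {8} {9} v)"
    by (simp_all add: fun_eq_iff teval_dsum t_action_pair module_slots_def extra_slots_def diagonal_action_def case_prod_unfold)
  have hd: "quot_hom ?S ?S (t_action (t \<oplus>\<^sub>t s) (module_slots (diagonal_action \<rho>)) {p} {q})" if "p \<in> {1..3}" "q \<in> {1..3}" for p q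
    by (rule t_action_hom[OF slot_system_module_slots[OF \<rho>d] invariant_symmetric_dsum[OF t s]]) (use that in auto)
  have "represents ?S r (t_action (t \<oplus>\<^sub>t s) (module_slots (diagonal_action \<rho>)) {1} {2}) (block_chord {1, 2} {3, 4} + block_chord {7} {8})"
  proof (rule represents_cong_left[OF S _ hd])
    show "represents ?S r (\<lambda>v. ?\<tau> {1, 2} {3, 4} v + ?\<tau>' {7} {8} v) (block_chord {1, 2} {3, 4} + block_chord {7} {8})"
      by (intro ad chords) auto
    show "quot_cong ?S ?S (t_action (t \<oplus>\<^sub>t s) (module_slots (diagonal_action \<rho>)) {1} {2}) (\<lambda>v. ?\<tau> {1, 2} {3, 4} v + ?\<tau>' {7} {8} v)"
      unfolding \<tau>d using diagonal_cong[OF \<rho> t, of 1 2] by (intro quot_cong_add[OF S] quot_cong_refl[OF S]) simp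
  qed auto
  moreover have "represents ?S r (t_action (t \<oplus>\<^sub>t s) (module_slots (diagonal_action \<rho>)) {2} {3}) (block_chord {3, 4} {5, 6} + block_chord {8} {9})"
  proof (rule represents_cong_left[OF S _ hd])
    show "represents ?S r (\<lambda>v. ?\<tau> {3, 4} {5, 6} v + ?\<tau>' {8} {9} v) (block_chord {3, 4} {5, 6} + block_chord {8} {9})"
      by (intro ad chords) auto
    show "quot_cong ?S ?S (t_action (t \<oplus>\<^sub>t s) (module_slots (diagonal_action \<rho>)) {2} {3}) (\<lambda>v. ?\<tau> {3, 4} {5, 6} v + ?\<tau>' {8} {9} v)"
      unfolding \<tau>d using diagonal_cong[OF \<rho> t, of 2 3] by (intro quot_cong_add[OF S] quot_cong_refl[OF S]) simp
  qed auto
  ultimately have \<Psi>d: "represents ?S r (\<Psi>d n) (nc_series \<Phi> (block_chord {1, 2} {3, 4} + block_chord {7} {8})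
        (block_chord {3, 4} {5, 6} + block_chord {8} {9}) $ n)" for n
    unfolding \<Psi>d_def placed_def by (rule nc)
  have J': "represents ?S r (J {1, 3} {2, 4} {5} {6} n) (B.J {1, 3} {2, 4} {5} {6} $ n)"
    "represents ?S r (J {1} {2} {3} {4} n) (B.J {1} {2} {3} {4} $ n)"
    "represents ?S r (J {1} {2} {3, 5} {4, 6} n) (B.J {1} {2} {3, 5} {4, 6} $ n)"
    "represents ?S r (J {3} {4} {5} {6} n) (B.J {3} {4} {5} {6} $ n)" for n
    by (rule J; simp add: blocks_def)+
  have "represents ?S r ((\<Psi> \<star> J {1, 3} {2, 4} {5} {6} \<star> J {1} {2} {3} {4}) n)
    ((nc_series \<Phi> (block_chord {1} {3} + block_chord {2} {4} + block_chord {7} {8})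
        (block_chord {3} {5} + block_chord {4} {6} + block_chord {8} {9}) * (B.J {1, 3} {2, 4} {5} {6} * B.J {1} {2} {3} {4})) $ n)"
    by (rule om[OF \<Psi> om[OF J'(1,2)]])
  moreover have "represents ?S r ((J {1} {2} {3, 5} {4, 6} \<star> J {3} {4} {5} {6} \<star> \<Psi>d) n)
    ((B.J {1} {2} {3, 5} {4, 6} * (B.J {3} {4} {5} {6} * nc_series \<Phi> (block_chord {1, 2} {3, 4} + block_chord {7} {8})
        (block_chord {3, 4} {5, 6} + block_chord {8} {9}))) $ n)"
    by (rule om[OF J'(3) om[OF J'(4) \<Psi>d]])
  ultimately show ?thesis
    unfolding associativity_braid[OF \<Phi>] by (rule represents_cong[OF rep])
qed

lemma lie_module_pullback:
  assumes "lie_module A \<rho>" and e: "\<And>x y. e (x + y) = e x + e y" "\<And>c x. e (c *\<^sub>C x) = c *\<^sub>C e x"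
    "\<And>x y. e (lie x y) = lie (e x) (e y)"
  shows "lie_module A (\<lambda>x. \<rho> (e x))"
  unfolding lie_module_def bilinear_on_def linear_on_def[of UNIV]
proof (intro conjI allI ballI)
  note D = lie_moduleD[OF assms(1)]
  show "cvec.subspace A" by (rule D(1))
  fix a x y c
  show "linear_on A (\<rho> (e x))" by (rule D(3))
  assume "a \<in> A"
  then show "\<rho> (e x) a \<in> A" "\<rho> (e (x + y)) a = \<rho> (e x) a + \<rho> (e y) a" "\<rho> (e (c *\<^sub>C x)) a = c *\<^sub>C \<rho> (e x) a"
    "\<rho> (e (lie x y)) a = \<rho> (e x) (\<rho> (e y) a) - \<rho> (e y) (\<rho> (e x) a)"
    unfolding e by (simp_all add: D)
qed

lemma diagonal_action_eq: "diagonal_action \<rho> = (\<lambda>z. \<rho> (fst z, fst z, snd z))"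
  by (simp add: diagonal_action_def case_prod_unfold)

lemma lie_module_diagonal: "lie_module A \<rho> \<Longrightarrow> lie_module A (diagonal_action \<rho>)"
  unfolding diagonal_action_eq
  by (rule lie_module_pullback[where e = "\<lambda>z. (fst z, fst z, snd z)"])
    (simp_all only: add_Pair fst_add snd_add scaleC_prod_def lie_prod_def fst_conv snd_conv)


text \<open>The associators and their inverses have no linear term, so the first-order term of
  \<open>J\<close> comes from the braiding alone.\<close>

lemma fusion_op_low:
  assumes "drinfeld_associator \<Phi>"
  shows "fusion_op \<Phi> \<tau> A B C D 0 v = v" "fusion_op \<Phi> \<tau> A B C D (Suc 0) v = (1 / 2) *\<^sub>C \<tau> B C v"
proof -
  note low = associator_low[OF assms]
  note inv = nc_inverse_low[of \<Phi>, OF low(1)]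
  have p0: "placed \<Phi> \<tau> I K L 0 v = v" "placed (nc_inverse \<Phi>) \<tau> I K L 0 v = v"
    and p1: "placed \<Phi> \<tau> I K L (Suc 0) v = 0" "placed (nc_inverse \<Phi>) \<tau> I K L (Suc 0) v = 0" for I K L v
    unfolding placed_def by (rule nc_eval_0 nc_eval_1 low inv)+
  have e: "exp_half P 0 v = v" "exp_half P (Suc 0) v = (1 / 2) *\<^sub>C P v" for P :: "'a \<Rightarrow> 'a" and v
    by (simp_all add: exp_half_def scaleC_one)
  have om0: "(P \<star> Q) 0 v = P 0 (Q 0 v)" and om1: "(P \<star> Q) (Suc 0) v = P 0 (Q (Suc 0) v) + P (Suc 0) (Q 0 v)"
    for P Q :: "'a opseries" and v by (simp_all add: op_mult_def)
  show "fusion_op \<Phi> \<tau> A B C D 0 v = v" "fusion_op \<Phi> \<tau> A B C D (Suc 0) v = (1 / 2) *\<^sub>C \<tau> B C v"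
    unfolding fusion_op_def om0 om1 p0 p1 e by simp_all
qed

text \<open>\<open>E\<close> is the diagonal action of \<open>(u, w)\<close> on the tensor square,
  written strand by strand. A chord between \<open>i\<close> and \<open>k\<close> commutes with
  \<open>u\<close> acting on both its ends by invariance, with the other strands by disjointness,
  and with \<open>w\<close> because the summands commute.\<close>

lemma diagonal_commutes:
  fixes \<rho> :: "'g::lie_algebra \<times> 'g \<times> 'h::lie_algebra \<Rightarrow> 'a::complex_vector \<Rightarrow> 'a" and u :: 'g and w :: 'h
  assumes \<rho>: "lie_module A \<rho>" and t: "invariant_symmetric t"
    and IK: "I \<subseteq> {1..4}" "K \<subseteq> {1..4}" "I \<inter> K = {}"
  defines "E \<equiv> \<lambda>v. (\<Sum>s\<in>{1..4}. strand_slots \<rho> s u v) + (at_factor 1 (\<rho> (0, 0, w)) v + at_factor 2 (\<rho> (0, 0, w)) v)"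
  shows "intertwines (tensor_power A 2) (tensor_power A 2) E (t_action t (strand_slots \<rho>) I K) (t_action t (strand_slots \<rho>) I K)"
proof -
  let ?S = "tensor_power A 2" and ?\<sigma> = "strand_slots \<rho>"
  have S: "quot_space ?S" by (rule quot_space_tensor_power)
  have sl: "slot_system ?S {1..4} ?\<sigma>" using slot_system_strand_slots[OF \<rho>, of 2] by simp
  have h\<sigma>: "quot_hom ?S ?S (?\<sigma> s x)" if "s \<in> {1..4}" for s x by (rule slot_systemD(2)[OF sl that])
  have hp: "quot_hom ?S ?S (at_factor p (\<rho> z))" if "p \<in> {1..2}" for p z
    by (rule quot_hom_at_factor[OF lie_moduleD(3,2)[OF \<rho>] that])
  have hE: "quot_hom ?S ?S E"
    unfolding E_def by (intro quot_hom_add[OF S] quot_hom_sum[OF S] h\<sigma> hp) auto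
  have ht: "quot_hom ?S ?S (t_action t ?\<sigma> I K)" if "I \<subseteq> {1..4}" "K \<subseteq> {1..4}" for I K
    by (rule t_action_hom[OF sl t that])
  have "commutes_mod ?S (t_action t ?\<sigma> {i} {k}) E" if ik: "i \<in> {1..4}" "k \<in> {1..4}" "i \<noteq> k" for i k
  proof -
    have hik: "quot_hom ?S ?S (t_action t ?\<sigma> {i} {k})" by (rule ht) (use ik in auto)
    have "(\<Sum>s\<in>{1..4}. ?\<sigma> s u v) = (?\<sigma> i u v + ?\<sigma> k u v) + (\<Sum>s\<in>{1..4} - {i, k}. ?\<sigma> s u v)" for v
    proof -
      have "(\<Sum>s\<in>{1..4}. ?\<sigma> s u v) = (\<Sum>s\<in>{1..4} - {i, k}. ?\<sigma> s u v) + (\<Sum>s\<in>{i, k}. ?\<sigma> s u v)"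
        by (rule sum.subset_diff) (use ik in auto)
      then show ?thesis using ik(3) by (simp add: add.commute)
    qed
    then have E: "E = (\<lambda>v. ((?\<sigma> i u v + ?\<sigma> k u v) + (\<Sum>s\<in>{1..4} - {i, k}. ?\<sigma> s u v))
        + (at_factor 1 (\<rho> (0, 0, w)) v + at_factor 2 (\<rho> (0, 0, w)) v))"
      unfolding E_def by presburger
    have extra: "commutes_mod ?S (t_action t ?\<sigma> {i} {k}) (at_factor p (\<rho> (0, 0, w)))" if p: "p \<in> {1..2}" for p
    proof (rule commutes_mod_sym[OF S commutes_mod_t_action[OF sl t ik(1,2) hp[OF p]]])
      fix x
      have "commutes_mod ?S (at_factor p (\<rho> (0, 0, w))) (?\<sigma> s x)" if "s \<in> {1..4}" for s
        unfolding strand_slots_def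
        by (rule commutes_mod_at_factor[OF \<rho> p]) (use that in \<open>auto simp: lie_prod_def lie_zero zero_prod_def\<close>)
      then show "commutes_mod ?S (at_factor p (\<rho> (0, 0, w))) (?\<sigma> i x)" "commutes_mod ?S (at_factor p (\<rho> (0, 0, w))) (?\<sigma> k x)"
        using ik by blast+
    qed
    have other: "commutes_mod ?S (t_action t ?\<sigma> {i} {k}) (?\<sigma> s u)" if s: "s \<in> {1..4} - {i, k}" for s
    proof (rule commutes_mod_sym[OF S commutes_mod_t_action[OF sl t ik(1,2)]])
      show "quot_hom ?S ?S (?\<sigma> s u)" using s by (intro h\<sigma>) simp
      show "commutes_mod ?S (?\<sigma> s u) (?\<sigma> i x)" "commutes_mod ?S (?\<sigma> s u) (?\<sigma> k x)" for x
        by (rule slot_systemD(6)[OF sl]; use s ik in simp)+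
    qed
    show ?thesis
      unfolding E
    proof (rule commutes_mod_add[OF S hik commutes_mod_add[OF S hik] commutes_mod_add[OF S hik]])
      show "commutes_mod ?S (t_action t ?\<sigma> {i} {k}) (\<lambda>v. ?\<sigma> i u v + ?\<sigma> k u v)"
        by (rule t_action_invariant[OF sl t ik])
      show "commutes_mod ?S (t_action t ?\<sigma> {i} {k}) (\<lambda>v. \<Sum>s\<in>{1..4} - {i, k}. ?\<sigma> s u v)"
        by (rule commutes_mod_sum[OF S hik other])
    qed (rule extra, simp)+
  qed
  then have c: "commutes_mod ?S E (t_action t ?\<sigma> {i} {k})" if "i \<in> {1..4}" "k \<in> {1..4}" "i \<noteq> k" for i k
    by (rule commutes_mod_sym[OF S]) (use that in auto)
  have eq: "t_action t ?\<sigma> I K = (\<lambda>v. \<Sum>i\<in>I. \<Sum>k\<in>K. t_action t ?\<sigma> {i} {k} v)"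
    by (rule ext) (rule t_action_sum)
  have "commutes_mod ?S E (t_action t ?\<sigma> I K)"
    unfolding eq by (rule commutes_mod_sum[OF S hE], rule commutes_mod_sum[OF S hE], rule c) (use IK in auto)
  then show ?thesis
    unfolding intertwines_def commutes_mod_def
    using ht[OF IK(1,2)] quot_homD(3)[OF ht[OF IK(1,2)]] by blast
qed

text \<open>The product \<open>m\<close> is invariant under the whole sum
  \<open>\<gg> \<oplus> \<gg> \<oplus> \<hh>\<close>, whereas \<open>J\<close> commutes with the
  diagonal action; hence the smaller symmetry of the fused product.\<close>

lemma fusion_invariant_bilinear:
  assumes \<rho>: "lie_module A \<rho>" and t: "invariant_symmetric t" and m: "\<And>i. invariant_bilinear A \<rho> (m i)"
  shows "invariant_bilinear A (diagonal_action \<rho>) (fusion_product \<Phi> t \<rho> m n)"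
proof -
  note sub = lie_moduleD(1)[OF \<rho>]
  let ?S = "tensor_power A 2" and ?d = "diagonal_action \<rho>"
  let ?J = "fusion_op \<Phi> (t_action t (strand_slots \<rho>)) {1} {2} {3} {4}"
  have S: "quot_space ?S" by (rule quot_space_tensor_power)
  have J: "quot_hom ?S ?S (?J k)" for k by (rule quot_hom_fusion_strands[OF \<rho> t]) simp
  have mo: "quot_hom ?S (A, {0}) (mult_op m i)" for i by (rule quot_hom_mult_op[OF sub m])
  have target: "quot_space (A, {0})" using sub by (simp add: quot_space_def cvec.subspace_def)
  have Q: "quot_hom ?S (A, {0}) ((mult_op m \<odot> ?J) n)"
    by (rule quot_hom_series_comp[OF target mo J])
  have F: "fusion_product \<Phi> t \<rho> m n = (\<lambda>a b. (mult_op m \<odot> ?J) n (tensor [a, b]))"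
    by (intro ext) (rule fusion_product_eq)
  have inv: "?d z (fusion_product \<Phi> t \<rho> m n a b) = fusion_product \<Phi> t \<rho> m n (?d z a) b + fusion_product \<Phi> t \<rho> m n a (?d z b)"
    if ab: "a \<in> A" "b \<in> A" for z a b
  proof -
    obtain u w where z: "z = (u, w)" by (cases z)
    have dz: "?d z = \<rho> (u, u, w)" by (simp add: z diagonal_action_def)
    \<comment> \<open>Two forms of the same action: \<open>E\<close> fits the invariance of
      \<open>m\<close>, \<open>E'\<close> fits the commutation with \<open>J\<close>, and they agree
      up to null tensors.\<close>
    define E where "E = (\<lambda>v. at_factor 1 (\<rho> (u, u, w)) v + at_factor 2 (\<rho> (u, u, w)) v)"
    define E' where "E' = (\<lambda>v. (\<Sum>s\<in>{1..4}. strand_slots \<rho> s u v) + (at_factor 1 (\<rho> (0, 0, w)) v + at_factor 2 (\<rho> (0, 0, w)) v))"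
    have T: "tensor [a, b] \<in> fst ?S" by (rule tensor_power_tensor) (use ab in auto)
    note ms = slot_systemD[OF slot_system_module_slots[OF \<rho>, of 2]]
    have hp: "quot_hom ?S ?S (at_factor p (\<rho> x))" if "p \<in> {1..2}" for p x
      using ms(2)[OF that] by (simp add: module_slots_def)
    have split: "quot_cong ?S ?S (at_factor p (\<rho> (u, u, w)))
        (\<lambda>v. (at_factor p (\<rho> (u, 0, 0)) v + at_factor p (\<rho> (0, u, 0)) v) + at_factor p (\<rho> (0, 0, w)) v)" if p: "p \<in> {1..2}" for p
    proof -
      have "quot_cong ?S ?S (module_slots \<rho> p ((u, u, 0) + (0, 0, w))) (\<lambda>v. module_slots \<rho> p (u, u, 0) v + module_slots \<rho> p (0, 0, w) v)"
        by (rule ms(3)[OF p])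
      moreover have "quot_cong ?S ?S (module_slots \<rho> p ((u, 0, 0) + (0, u, 0))) (\<lambda>v. module_slots \<rho> p (u, 0, 0) v + module_slots \<rho> p (0, u, 0) v)"
        by (rule ms(3)[OF p])
      from quot_cong_add[OF S this quot_cong_refl[OF S]]
      have "quot_cong ?S ?S (\<lambda>v. module_slots \<rho> p ((u, 0, 0) + (0, u, 0)) v + module_slots \<rho> p (0, 0, w) v)
        (\<lambda>v. (module_slots \<rho> p (u, 0, 0) v + module_slots \<rho> p (0, u, 0) v) + module_slots \<rho> p (0, 0, w) v)" .
      ultimately show ?thesis
        using quot_cong_trans[OF S] by (simp add: module_slots_def)
    qed
    have E'eq: "E' = (\<lambda>v. ((at_factor 1 (\<rho> (u, 0, 0)) v + at_factor 1 (\<rho> (0, u, 0)) v) + at_factor 1 (\<rho> (0, 0, w)) v)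
      + ((at_factor 2 (\<rho> (u, 0, 0)) v + at_factor 2 (\<rho> (0, u, 0)) v) + at_factor 2 (\<rho> (0, 0, w)) v))"
    proof
      fix v
      have "{1..4 :: nat} = {1, 2, 3, 4}" by auto
      then show "E' v = ((at_factor 1 (\<rho> (u, 0, 0)) v + at_factor 1 (\<rho> (0, u, 0)) v) + at_factor 1 (\<rho> (0, 0, w)) v)
        + ((at_factor 2 (\<rho> (u, 0, 0)) v + at_factor 2 (\<rho> (0, u, 0)) v) + at_factor 2 (\<rho> (0, 0, w)) v)"
        by (simp add: E'_def strand_slots_def add_ac)
    qed
    have EE': "quot_cong ?S ?S E E'"
      unfolding E_def E'eq by (intro quot_cong_add[OF S] split) auto
    have hE: "quot_hom ?S ?S E" unfolding E_def by (intro quot_hom_add[OF S] hp) auto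
    have hE': "quot_hom ?S ?S E'" unfolding E'eq by (intro quot_hom_add[OF S] hp) auto
    have comm: "intertwines ?S ?S E' (?J k) (?J k)" for k
    proof (rule intertwines_fusion_op[OF S S hE', where h = "\<lambda>I. I"])
      fix I K :: "nat set" assume "(I, K) \<in> {({1}, {3}), ({3}, {2} \<union> {4}), ({3}, {2}), ({2}, {4}), ({2}, {3}), ({3}, {4}), ({1}, {2}), ({2}, {3} \<union> {4})}"
      then have "I \<subseteq> {1..4}" "K \<subseteq> {1..4}" "I \<inter> K = {}" by auto
      from diagonal_commutes[OF \<rho> t this, of u w, folded E'_def]
      show "intertwines ?S ?S E' (t_action t (strand_slots \<rho>) I K) (t_action t (strand_slots \<rho>) I K)" .
    qed (rule refl)
    have equi: "\<rho> (u, u, w) (mult_op m i G) = mult_op m i (E G)" if G: "G \<in> fst ?S" for i G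
    proof -
      have keys: "as ! 0 \<in> A \<and> as ! 1 \<in> A \<and> as = [as ! 0, as ! 1]" if "as \<in> Poly_Mapping.keys G" for as
      proof -
        have *: "length as = 2" "set as \<subseteq> A" using G that by (auto simp: tensor_power_fst)
        obtain x y where "as = [x, y]" "x \<in> A" "y \<in> A" using list2E[OF *] by blast
        then show ?thesis by simp
      qed
      have "\<rho> (u, u, w) (mult_op m i G) = teval (\<lambda>as. \<rho> (u, u, w) (m i (as ! 0) (as ! 1))) G"
        unfolding mult_op_def
        by (rule linear_on_teval[OF sub lie_moduleD(3)[OF \<rho>]]) (use keys invariant_bilinearD(2)[OF m] in blast)
      also have "\<dots> = teval (\<lambda>as. m i (\<rho> (u, u, w) (as ! 0)) (as ! 1) + m i (as ! 0) (\<rho> (u, u, w) (as ! 1))) G"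
        by (rule teval_cong) (use keys invariant_bilinearD(3)[OF m] in blast)
      also have "\<dots> = mult_op m i (E G)"
      proof -
        have "teval (\<lambda>as. m i (\<rho> (u, u, w) (as ! 0)) (as ! 1)) G = mult_op m i (at_factor 1 (\<rho> (u, u, w)) G)"
          "teval (\<lambda>as. m i (as ! 0) (\<rho> (u, u, w) (as ! 1))) G = mult_op m i (at_factor 2 (\<rho> (u, u, w)) G)"
          unfolding mult_op_def at_factor_def teval_push
          by (rule teval_cong, drule keys, elim conjE, erule ssubst, simp)+
        then show ?thesis by (simp add: E_def teval_add_fun quot_homD(1)[OF mo])
      qed
      finally show ?thesis .
    qed
    have mE: "mult_op m i (E G) = mult_op m i (E' G)" if G: "G \<in> fst ?S" for i G
      using quot_homD(4)[OF mo quot_congD[OF EE' G]] by (simp add: quot_hom_simps[OF mo])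
    have JE: "mult_op m i (E' (?J k v)) = mult_op m i (?J k (E' v))" if "v \<in> fst ?S" for i k v
    proof -
      have "E' (?J k v) - ?J k (E' v) \<in> snd ?S"
        using comm[of k] that unfolding intertwines_def quot_cong_def by blast
      from quot_homD(4)[OF mo this] show ?thesis by (simp add: quot_hom_simps[OF mo])
    qed
    have "?d z (fusion_product \<Phi> t \<rho> m n a b) = \<rho> (u, u, w) (\<Sum>i\<le>n. mult_op m i (?J (n - i) (tensor [a, b])))"
      by (simp only: dz F series_comp_def)
    also have "\<dots> = (\<Sum>i\<le>n. \<rho> (u, u, w) (mult_op m i (?J (n - i) (tensor [a, b]))))"
    proof (rule linear_on_sum[OF sub lie_moduleD(3)[OF \<rho>]])
      show "mult_op m i (?J (n - i) (tensor [a, b])) \<in> A" for i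
        using quot_homD(3)[OF mo quot_homD(3)[OF J T]] by simp
    qed
    also have "\<dots> = (\<Sum>i\<le>n. mult_op m i (?J (n - i) (E' (tensor [a, b]))))"
      by (simp only: equi[OF quot_homD(3)[OF J T]] mE[OF quot_homD(3)[OF J T]] JE[OF T])
    also have "\<dots> = (mult_op m \<odot> ?J) n (E' (tensor [a, b]))"
      by (simp only: series_comp_def)
    also have "\<dots> = (mult_op m \<odot> ?J) n (E (tensor [a, b]))"
      using quot_homD(4)[OF Q quot_congD[OF EE' T]] by (simp del: One_nat_def add: quot_hom_simps[OF Q])
    also have "E (tensor [a, b]) = tensor [\<rho> (u, u, w) a, b] + tensor [a, \<rho> (u, u, w) b]"
      by (simp add: E_def at_factor_tensor)
    finally show ?thesis
      unfolding F dz by (simp only: quot_homD(1)[OF Q])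
  qed
  show ?thesis
    unfolding invariant_bilinear_def
    using bilinear_of_quot_hom[OF Q sub] inv unfolding F by blast
qed

text \<open>A chain of congruences from \<open>(ab)c\<close> to \<open>a(bc)\<close>: the fused
  products are unfolded and the outer \<open>J\<close> is moved through the inner product, which
  turns slots into blocks; associativity of \<open>m\<close> and the braid identity follow, and the
  second half retraces the first.\<close>

lemma fusion_assoc_algebra:
  fixes \<rho> :: "'g::lie_algebra \<times> 'g \<times> 'h::lie_algebra \<Rightarrow> 'a::complex_vector \<Rightarrow> 'a"
  assumes \<Phi>: "drinfeld_associator \<Phi>" and t: "invariant_symmetric t" and s: "invariant_symmetric s"
    and alg: "assoc_algebra \<Phi> (t \<oplus>\<^sub>t t \<oplus>\<^sub>t s) A \<rho> m"
  shows "assoc_algebra \<Phi> (t \<oplus>\<^sub>t s) A (diagonal_action \<rho>) (fusion_product \<Phi> t \<rho> m)"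
proof -
  let ?V = "tensor_power A 3" and ?W = "tensor_power A 2" and ?K = "(UNIV, {0}) :: 'a set \<times> 'a set"
  let ?F = "fusion_product \<Phi> t \<rho> m"
  let ?J = "fusion_op \<Phi> (t_action t (strand_slots \<rho>))"
  define \<Psi> where "\<Psi> = placed \<Phi> (t_action (t \<oplus>\<^sub>t t \<oplus>\<^sub>t s) (module_slots \<rho>)) {1} {2} {3}"
  define \<Psi>d where "\<Psi>d = placed \<Phi> (t_action (t \<oplus>\<^sub>t s) (module_slots (diagonal_action \<rho>))) {1} {2} {3}"
  have \<rho>: "lie_module A \<rho>" and m: "\<And>i. invariant_bilinear A \<rho> (m i)"
    and eq: "\<And>n a b c. a \<in> A \<Longrightarrow> b \<in> A \<Longrightarrow> c \<in> A \<Longrightarrow>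
      (mult_op m \<odot> mult_right m \<odot> \<Psi>) n (tensor [a, b, c]) = (mult_op m \<odot> mult_left m) n (tensor [a, b, c])"
    using alg unfolding assoc_algebra_iff \<Psi>_def by blast+
  note sub = lie_moduleD(1)[OF \<rho>]
  have \<rho>d: "lie_module A (diagonal_action \<rho>)" by (rule lie_module_diagonal[OF \<rho>])
  have F: "invariant_bilinear A (diagonal_action \<rho>) (?F n)" for n
    by (rule fusion_invariant_bilinear[OF \<rho> t m])
  have V: "quot_space ?V" and W: "quot_space ?W" by (rule quot_space_tensor_power)+
  have K: "quot_space ?K" by (rule quot_space_UNIV)
  have mo: "quot_hom ?W ?K (mult_op m i)" and Fo: "quot_hom ?W ?K (mult_op ?F i)" for i
    by (rule quot_hom_UNIV_target, rule quot_hom_mult_op[OF sub], rule m F)+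
  have L: "quot_hom ?V ?W (mult_left m i)" for i
    by (rule quot_hom_mult_left[where m = m and j = i, OF invariant_bilinearD(1,2)[OF m]])
  have R: "quot_hom ?V ?W (mult_right m i)" for i
    by (rule quot_hom_mult_right[where m = m and j = i, OF invariant_bilinearD(1,2)[OF m]])
  have FL: "quot_hom ?V ?W (mult_left ?F i)" for i
    by (rule quot_hom_mult_left[where m = ?F and j = i, OF invariant_bilinearD(1,2)[OF F]])
  have FR: "quot_hom ?V ?W (mult_right ?F i)" for i
    by (rule quot_hom_mult_right[where m = ?F and j = i, OF invariant_bilinearD(1,2)[OF F]])
  have J2: "quot_hom ?W ?W (?J {1} {2} {3} {4} n)" for n
    by (rule quot_hom_fusion_strands[OF \<rho> t]) simp
  have J3: "quot_hom ?V ?V (?J B1 B2 B3 B4 n)" if "B1 \<union> B2 \<union> B3 \<union> B4 \<subseteq> {1..6}" for B1 B2 B3 B4 n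
    by (rule quot_hom_fusion_strands[OF \<rho> t]) (use that in simp)
  have J: "quot_hom ?V ?V (?J {1, 3} {2, 4} {5} {6} n)" "quot_hom ?V ?V (?J {1} {2} {3} {4} n)"
    "quot_hom ?V ?V (?J {1} {2} {3, 5} {4, 6} n)" "quot_hom ?V ?V (?J {3} {4} {5} {6} n)" for n
    by (rule J3; simp)+
  have h\<Psi>: "quot_hom ?V ?V (\<Psi> n)" and h\<Psi>d: "quot_hom ?V ?V (\<Psi>d n)" for n
    unfolding \<Psi>_def \<Psi>d_def placed_def
    by (intro quot_hom_nc_eval[OF V] t_action_hom[OF slot_system_module_slots[OF \<rho>]] t_action_hom[OF slot_system_module_slots[OF \<rho>d]]
        invariant_symmetric_dsum t s; simp)+
  have stable: "P n v \<in> fst S'" if "\<And>n. quot_hom S S' (P n)" "v \<in> fst S" for S S' n v and P :: "nat \<Rightarrow> 'x::complex_vector \<Rightarrow> 'y::complex_vector"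
    by (rule quot_homD(3)[OF that])
  have fused: "quot_cong ?W ?K (mult_op ?F n) ((mult_op m \<odot> ?J {1} {2} {3} {4}) n)" for n
  proof (rule quot_cong_linear_eq[OF K Fo quot_hom_series_comp[OF K mo J2]])
    fix as assume "length as = 2" "set as \<subseteq> A"
    then obtain a b where "as = [a, b]" using list2E by blast
    then show "mult_op ?F n (tensor as) = (mult_op m \<odot> ?J {1} {2} {3} {4}) n (tensor as)"
      using fusion_product_eq[of \<Phi> t \<rho> m n a b] by (simp add: mult_op_simps(1))
  qed
  have assoc: "quot_cong ?V ?K ((mult_op m \<odot> mult_left m) n) ((mult_op m \<odot> mult_right m \<odot> \<Psi>) n)" for n
  proof (rule quot_cong_linear_eq[OF K])
    show "quot_hom ?V ?K ((mult_op m \<odot> mult_left m) n)"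
      by (rule quot_hom_series_comp[OF K mo L])
    show "quot_hom ?V ?K ((mult_op m \<odot> mult_right m \<odot> \<Psi>) n)"
      by (rule quot_hom_series_comp[OF K mo quot_hom_series_comp[OF W R h\<Psi>]])
    fix as assume "length as = 3" "set as \<subseteq> A"
    then obtain a b c where "as = [a, b, c]" "a \<in> A" "b \<in> A" "c \<in> A" using list3E by blast
    then show "(mult_op m \<odot> mult_left m) n (tensor as) = (mult_op m \<odot> mult_right m \<odot> \<Psi>) n (tensor as)"
      using eq by simp
  qed
  note A1 = series_comp_assoc[OF mo] and A2 = series_comp_assoc[OF J2] and A3 = series_comp_assoc[OF L] and A4 = series_comp_assoc[OF R]
  note refl = quot_cong_refl
  \<comment> \<open>The outer fused product is unfolded here, the inner one in
    \<open>step2\<close>.\<close>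
  have step1: "quot_cong ?V ?K ((mult_op ?F \<odot> mult_left ?F) n) (((mult_op m \<odot> ?J {1} {2} {3} {4}) \<odot> mult_left ?F) n)" for n
    by (rule quot_cong_series_comp[where S' = ?W, OF K Fo stable[OF FL] fused refl[OF W]])
  have step2: "quot_cong ?V ?K ((mult_op m \<odot> (?J {1} {2} {3} {4} \<odot> mult_left ?F)) n)
      ((mult_op m \<odot> (?J {1} {2} {3} {4} \<odot> (mult_left m \<odot> ?J {1} {2} {3} {4}))) n)" for n
  proof (rule quot_cong_series_comp[where S' = ?W, OF K mo _ refl[OF K]])
    show "(?J {1} {2} {3} {4} \<odot> (mult_left m \<odot> ?J {1} {2} {3} {4})) n v \<in> fst ?W" if "v \<in> fst ?V" for n v
      by (rule stable[OF quot_hom_series_comp[OF W J2 quot_hom_series_comp[OF W L J(2)]] that])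
    show "quot_cong ?V ?W ((?J {1} {2} {3} {4} \<odot> mult_left ?F) n) ((?J {1} {2} {3} {4} \<odot> (mult_left m \<odot> ?J {1} {2} {3} {4})) n)" for n
      by (rule quot_cong_series_comp[where S' = ?W, OF W J2 stable[OF quot_hom_series_comp[OF W L J(2)]] refl[OF W] mult_left_fusion[OF \<rho> t m FL]])
  qed
  have swapL: "quot_cong ?V ?W ((?J {1} {2} {3} {4} \<odot> mult_left m) n) ((mult_left m \<odot> ?J {1, 3} {2, 4} {5} {6}) n)" for n
    by (rule quot_cong_sym[OF W quot_cong_series_swap[OF W intertwines_mult_left[OF \<rho> m]]])
  have swapR: "quot_cong ?V ?W ((mult_right m \<odot> ?J {1} {2} {3, 5} {4, 6}) n) ((?J {1} {2} {3} {4} \<odot> mult_right m) n)" for n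
    by (rule quot_cong_series_swap[OF W intertwines_mult_right[OF \<rho> m]])
  \<comment> \<open>The outer \<open>J\<close> passes the inner product and becomes \<open>J\<close>
    on blocks.\<close>
  have step3: "quot_cong ?V ?K ((mult_op m \<odot> ((?J {1} {2} {3} {4} \<odot> mult_left m) \<odot> ?J {1} {2} {3} {4})) n)
      ((mult_op m \<odot> ((mult_left m \<odot> ?J {1, 3} {2, 4} {5} {6}) \<odot> ?J {1} {2} {3} {4})) n)" for n
  proof (rule quot_cong_series_comp[where S' = ?W, OF K mo _ refl[OF K]])
    show "((mult_left m \<odot> ?J {1, 3} {2, 4} {5} {6}) \<odot> ?J {1} {2} {3} {4}) n v \<in> fst ?W" if "v \<in> fst ?V" for n v
      by (rule stable[OF quot_hom_series_comp[OF W quot_hom_series_comp[OF W L J(1)] J(2)] that])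
    show "quot_cong ?V ?W (((?J {1} {2} {3} {4} \<odot> mult_left m) \<odot> ?J {1} {2} {3} {4}) n)
        (((mult_left m \<odot> ?J {1, 3} {2, 4} {5} {6}) \<odot> ?J {1} {2} {3} {4}) n)" for n
      by (rule quot_cong_series_comp[where S' = ?V, OF W quot_hom_series_comp[OF W J2 L] stable[OF J(2)] swapL refl[OF V]])
  qed
  \<comment> \<open>Associativity of \<open>m\<close> brings in the associator of
    \<open>\<gg> \<oplus> \<gg> \<oplus> \<hh>\<close>.\<close>
  have step4: "quot_cong ?V ?K (((mult_op m \<odot> mult_left m) \<odot> (?J {1, 3} {2, 4} {5} {6} \<odot> ?J {1} {2} {3} {4})) n)
      (((mult_op m \<odot> mult_right m \<odot> \<Psi>) \<odot> (?J {1, 3} {2, 4} {5} {6} \<odot> ?J {1} {2} {3} {4})) n)" for n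
    by (rule quot_cong_series_comp[where S' = ?V, OF K quot_hom_series_comp[OF K mo L] stable[OF quot_hom_series_comp[OF V J(1,2)]]
        assoc refl[OF V]])
  have braid: "quot_cong ?V ?V ((\<Psi> \<odot> ?J {1, 3} {2, 4} {5} {6} \<odot> ?J {1} {2} {3} {4}) n) ((?J {1} {2} {3, 5} {4, 6} \<odot> ?J {3} {4} {5} {6} \<odot> \<Psi>d) n)" for n
    using associativity_operators[OF \<Phi> \<rho> \<rho>d t s, of n] unfolding \<Psi>_def \<Psi>d_def op_mult_eq_series_comp .
  \<comment> \<open>The braid identity trades it for the associator of
    \<open>\<gg> \<oplus> \<hh>\<close>, acting diagonally.\<close>
  have step5: "quot_cong ?V ?K (((mult_op m \<odot> mult_right m) \<odot> (\<Psi> \<odot> ?J {1, 3} {2, 4} {5} {6} \<odot> ?J {1} {2} {3} {4})) n)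
      (((mult_op m \<odot> mult_right m) \<odot> (?J {1} {2} {3, 5} {4, 6} \<odot> ?J {3} {4} {5} {6} \<odot> \<Psi>d)) n)" for n
    by (rule quot_cong_series_comp[where S' = ?V, OF K quot_hom_series_comp[OF K mo R]
        stable[OF quot_hom_series_comp[OF V J(3) quot_hom_series_comp[OF V J(4) h\<Psi>d]]] refl[OF K] braid])
  \<comment> \<open>\<open>J\<close> on blocks passes the other inner product in the opposite
    direction, which prepares refolding.\<close>
  have step6: "quot_cong ?V ?K ((mult_op m \<odot> ((mult_right m \<odot> ?J {1} {2} {3, 5} {4, 6}) \<odot> (?J {3} {4} {5} {6} \<odot> \<Psi>d))) n)
      ((mult_op m \<odot> ((?J {1} {2} {3} {4} \<odot> mult_right m) \<odot> (?J {3} {4} {5} {6} \<odot> \<Psi>d))) n)" for n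
  proof (rule quot_cong_series_comp[where S' = ?W, OF K mo _ refl[OF K]])
    show "((?J {1} {2} {3} {4} \<odot> mult_right m) \<odot> (?J {3} {4} {5} {6} \<odot> \<Psi>d)) n v \<in> fst ?W" if "v \<in> fst ?V" for n v
      by (rule stable[OF quot_hom_series_comp[OF W quot_hom_series_comp[OF W J2 R] quot_hom_series_comp[OF V J(4) h\<Psi>d]] that])
    show "quot_cong ?V ?W (((mult_right m \<odot> ?J {1} {2} {3, 5} {4, 6}) \<odot> (?J {3} {4} {5} {6} \<odot> \<Psi>d)) n)
        (((?J {1} {2} {3} {4} \<odot> mult_right m) \<odot> (?J {3} {4} {5} {6} \<odot> \<Psi>d)) n)" for n
      by (rule quot_cong_series_comp[where S' = ?V, OF W quot_hom_series_comp[OF W R J(3)] stable[OF quot_hom_series_comp[OF V J(4) h\<Psi>d]]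
          swapR refl[OF V]])
  qed
  have FRd: "quot_cong ?V ?W (((mult_right m \<odot> ?J {3} {4} {5} {6}) \<odot> \<Psi>d) n) ((mult_right ?F \<odot> \<Psi>d) n)" for n
    by (rule quot_cong_series_comp[where S' = ?V, OF W quot_hom_series_comp[OF W R J(4)] stable[OF h\<Psi>d]
        quot_cong_sym[OF W mult_right_fusion[OF \<rho> t m FR]] refl[OF V]])
  have step7: "quot_cong ?V ?K (((mult_op m \<odot> ?J {1} {2} {3} {4}) \<odot> ((mult_right m \<odot> ?J {3} {4} {5} {6}) \<odot> \<Psi>d)) n)
      ((mult_op ?F \<odot> (mult_right ?F \<odot> \<Psi>d)) n)" for n
    by (rule quot_cong_series_comp[where S' = ?W, OF K quot_hom_series_comp[OF K mo J2] stable[OF quot_hom_series_comp[OF W FR h\<Psi>d]]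
        quot_cong_sym[OF K fused] FRd])
  have "quot_cong ?V ?K ((mult_op ?F \<odot> mult_left ?F) n) ((mult_op ?F \<odot> mult_right ?F \<odot> \<Psi>d) n)" for n
  proof -
    note trans = quot_cong_trans[OF K]
    \<comment> \<open>The equations \<open>e1\<close> to \<open>e6\<close> only rebracket, so that
      the end of each step matches the start of the next.\<close>
    have e1: "(mult_op m \<odot> ?J {1} {2} {3} {4}) \<odot> mult_left ?F = mult_op m \<odot> (?J {1} {2} {3} {4} \<odot> mult_left ?F)"
      by (rule A1)
    have e2: "mult_op m \<odot> (?J {1} {2} {3} {4} \<odot> (mult_left m \<odot> ?J {1} {2} {3} {4}))
        = mult_op m \<odot> ((?J {1} {2} {3} {4} \<odot> mult_left m) \<odot> ?J {1} {2} {3} {4})"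
      by (simp only: A2)
    have e3: "mult_op m \<odot> ((mult_left m \<odot> ?J {1, 3} {2, 4} {5} {6}) \<odot> ?J {1} {2} {3} {4})
        = (mult_op m \<odot> mult_left m) \<odot> (?J {1, 3} {2, 4} {5} {6} \<odot> ?J {1} {2} {3} {4})"
      by (simp only: A1 A3)
    have e4: "(mult_op m \<odot> mult_right m \<odot> \<Psi>) \<odot> (?J {1, 3} {2, 4} {5} {6} \<odot> ?J {1} {2} {3} {4})
        = (mult_op m \<odot> mult_right m) \<odot> (\<Psi> \<odot> ?J {1, 3} {2, 4} {5} {6} \<odot> ?J {1} {2} {3} {4})"
      by (simp only: A1 A4)
    have e5: "(mult_op m \<odot> mult_right m) \<odot> (?J {1} {2} {3, 5} {4, 6} \<odot> ?J {3} {4} {5} {6} \<odot> \<Psi>d)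
        = mult_op m \<odot> ((mult_right m \<odot> ?J {1} {2} {3, 5} {4, 6}) \<odot> (?J {3} {4} {5} {6} \<odot> \<Psi>d))"
      by (simp only: A1 A4)
    have e6: "mult_op m \<odot> ((?J {1} {2} {3} {4} \<odot> mult_right m) \<odot> (?J {3} {4} {5} {6} \<odot> \<Psi>d))
        = (mult_op m \<odot> ?J {1} {2} {3} {4}) \<odot> ((mult_right m \<odot> ?J {3} {4} {5} {6}) \<odot> \<Psi>d)"
      by (simp only: A1 A2 A4)
    show ?thesis
      by (rule trans[OF step1[of n, unfolded e1] trans[OF step2[of n, unfolded e2] trans[OF step3[of n, unfolded e3]
          trans[OF step4[of n, unfolded e4] trans[OF step5[of n, unfolded e5] trans[OF step6[of n, unfolded e6] step7[of n]]]]]]])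
  qed
  then have "(mult_op ?F \<odot> mult_right ?F \<odot> \<Psi>d) n (tensor [a, b, c]) = (mult_op ?F \<odot> mult_left ?F) n (tensor [a, b, c])"
    if "a \<in> A" "b \<in> A" "c \<in> A" for n a b c
    using tensor_power_tensor[of "[a, b, c]" 3 A] that by (simp add: quot_cong_def)
  then show ?thesis
    unfolding assoc_algebra_iff \<Psi>d_def[symmetric] using \<rho>d F by blast
qed


text \<open>Lie algebra elements act by derivations of \<open>m0\<close>, and \<open>t\<close> acts
  by a finite sum of products of two of them.\<close>

lemma (in comm_algebra) bidiff_op_strands:
  assumes \<rho>: "lie_module A \<rho>" and inv: "invariant_bilinear A \<rho> m0" and IK: "I \<subseteq> {1..4}" "K \<subseteq> {1..4}"
  shows "bidiff_op (t_action t (strand_slots \<rho>) I K)"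
proof -
  have \<sigma>: "bidiff_op (strand_slots \<rho> i x)" if "i \<in> {1..4}" for i x
    unfolding strand_slots_def
    by (rule bidiff_op_at_factor[OF lie_moduleD(3)[OF \<rho>] lie_moduleD(2)[OF \<rho>] invariant_bilinearD(3)[OF inv]])
      (use that in auto)
  have "bidiff_op (\<lambda>v. \<Sum>i\<in>I. \<Sum>k\<in>K. \<Sum>p\<in>Poly_Mapping.keys t.
      Poly_Mapping.lookup t p *\<^sub>C strand_slots \<rho> i (fst p) (strand_slots \<rho> k (snd p) v))"
  proof (rule bidiff_op_sum, rule bidiff_op_sum, rule bidiff_op_sum, rule bidiff_op_scale)
    show "bidiff_op (\<lambda>v. strand_slots \<rho> i (fst p) (strand_slots \<rho> k (snd p) v))" if "i \<in> I" "k \<in> K" for i k p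
      by (rule bidiff_op_comp[OF \<sigma> \<sigma>]) (use that IK in auto)
  qed
  then show ?thesis
    by (simp add: t_action_def[abs_def] teval_def case_prod_unfold)
qed

lemma (in comm_algebra) bidifferential_fusion_product:
  assumes \<rho>: "lie_module A \<rho>" and inv: "invariant_bilinear A \<rho> m0" and m: "\<And>i. bidifferential A m0 (m i)"
  shows "bidifferential A m0 (fusion_product \<Phi> t \<rho> m n)"
proof -
  let ?J = "fusion_op \<Phi> (t_action t (strand_slots \<rho>)) {1} {2} {3} {4}"
  have sum: "bidifferential A m0 (\<lambda>a b. \<Sum>i\<in>I. D i a b)" if "\<And>i. bidifferential A m0 (D i)" for I :: "nat set" and D
  proof (induction I rule: infinite_finite_induct)
    case (insert i I)
    from bidifferential_linear_comb[OF that[of i] insert.IH, of 1] show ?case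
      using insert.hyps by (simp add: scaleC_one)
  qed (simp_all add: bidifferential_zero)
  have J: "bidiff_op (?J k)" for k
    by (rule bidiff_op_fusion_op, rule bidiff_op_strands[OF \<rho> inv]) auto
  have "bidifferential A m0 (\<lambda>a b. \<Sum>i\<in>{..n}. teval (\<lambda>as. m i (as ! 0) (as ! 1)) (?J (n - i) (tensor [a, b])))"
    by (rule sum) (use J m in \<open>unfold bidiff_op_def, blast\<close>)
  then show ?thesis
    by (simp add: fusion_product_def[abs_def] fusion_J_strand_slots)
qed

lemma comm_algebra_quasi_poisson:
  assumes qp: "quasi_poisson t A \<rho> m0 br"
  shows "comm_algebra A m0"
proof -
  have 1: "lie_module A \<rho>" "invariant_bilinear A \<rho> m0" "\<forall>a\<in>A. \<forall>b\<in>A. m0 a b = m0 b a"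
    "\<forall>a\<in>A. \<forall>b\<in>A. \<forall>c\<in>A. m0 (m0 a b) c = m0 a (m0 b c)"
    using qp unfolding quasi_poisson_def by blast+
  show ?thesis
    by unfold_locales (use 1 lie_moduleD(1)[OF 1(1)] invariant_bilinearD(1,2)[OF 1(2)] in blast)+
qed

text \<open>The fused bracket is recognized as the antisymmetrized first-order term; the
  quasi-Poisson axioms then come from \<open>quasi_poisson_semiclassical\<close> instead of a direct
  computation with brackets.\<close>

theorem deformation_quantization_fusion:
  fixes \<rho> :: "'g::lie_algebra \<times> 'g \<times> 'h::lie_algebra \<Rightarrow> 'a::complex_vector \<Rightarrow> 'a"
  assumes \<Phi>: "drinfeld_associator \<Phi>" and t: "invariant_symmetric t" and s: "invariant_symmetric s"
    and dq: "deformation_quantization \<Phi> (t \<oplus>\<^sub>t t \<oplus>\<^sub>t s) A \<rho> m0 br m"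
  shows "deformation_quantization \<Phi> (t \<oplus>\<^sub>t s) A (diagonal_action \<rho>)
    m0 (fusion_bracket t \<rho> m0 br) (fusion_product \<Phi> t \<rho> m)"
proof -
  let ?F = "fusion_product \<Phi> t \<rho> m" and ?\<tau> = "t_action t (strand_slots \<rho>) {2} {3}" and ?W = "tensor_power A 2"
  have qp: "quasi_poisson (t \<oplus>\<^sub>t t \<oplus>\<^sub>t s) A \<rho> m0 br" and alg: "assoc_algebra \<Phi> (t \<oplus>\<^sub>t t \<oplus>\<^sub>t s) A \<rho> m"
    and m0: "\<And>a b. a \<in> A \<Longrightarrow> b \<in> A \<Longrightarrow> m 0 a b = m0 a b"
    and br: "\<And>a b. a \<in> A \<Longrightarrow> b \<in> A \<Longrightarrow> br a b = m 1 a b - m 1 b a"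
    and bd: "\<And>i. bidifferential A m0 (m i)"
    using dq unfolding deformation_quantization_def by blast+
  interpret comm_algebra A m0 by (rule comm_algebra_quasi_poisson[OF qp])
  have \<rho>: "lie_module A \<rho>" and inv: "invariant_bilinear A \<rho> m0"
    using qp unfolding quasi_poisson_def by blast+
  have assoc_F: "assoc_algebra \<Phi> (t \<oplus>\<^sub>t s) A (diagonal_action \<rho>) ?F"
    by (rule fusion_assoc_algebra[OF \<Phi> t s alg])
  note low = fusion_op_low[OF \<Phi>]
  have F0: "?F 0 a b = m0 a b" if "a \<in> A" "b \<in> A" for a b
    by (simp add: fusion_product_eq series_comp_def low(1) mult_op_simps(1) m0[OF that] del: One_nat_def)
  \<comment> \<open>In order one the linear term of \<open>J\<close> is followed by
    \<open>m 0\<close>, and its constant term by \<open>m 1\<close>.\<close>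
  have F1: "?F 1 a b = mult_op m 0 ((1 / 2) *\<^sub>C ?\<tau> (tensor [a, b])) + m 1 a b" for a b
    by (simp only: fusion_product_eq series_comp_def One_nat_def atMost_Suc atMost_0)
      (simp add: low[unfolded One_nat_def] mult_op_simps(1))
  have \<tau>: "quot_hom ?W ?W ?\<tau>"
    by (rule t_action_hom[OF slot_system_strand_slots[OF \<rho>] t]) auto
  have slots: "t_action t (fusion_slots \<rho>) {2} {3} = ?\<tau>"
    by (simp add: t_action_pair fusion_slots_def strand_slots_simps[simplified])
  have mult: "teval (\<lambda>as. m0 (as ! 0) (as ! 1)) F = mult_op m 0 F" if "F \<in> fst ?W" for F
    unfolding mult_op_def
  proof (rule teval_cong)
    fix as assume "as \<in> Poly_Mapping.keys F"
    then have *: "length as = 2" "set as \<subseteq> A" using that by (auto simp: tensor_power_fst)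
    obtain a b where "as = [a, b]" "a \<in> A" "b \<in> A" using list2E[OF *] by blast
    then show "m0 (as ! 0) (as ! 1) = m 0 (as ! 0) (as ! 1)" by (simp add: m0)
  qed
  have bracket: "fusion_bracket t \<rho> m0 br a b = ?F 1 a b - ?F 1 b a" if ab: "a \<in> A" "b \<in> A" for a b
  proof -
    have T: "tensor [a, b] - tensor [b, a] \<in> fst ?W"
      using quot_space_tensor_power[of A 2] pair_tensor[OF ab] pair_tensor[OF ab(2,1)]
      unfolding quot_space_def by (blast intro: cvec.subspace_diff)
    show ?thesis
      unfolding fusion_bracket_def slots mult[OF quot_homD(3)[OF \<tau> T]] F1 br[OF ab]
      by (simp add: quot_hom_simps[OF \<tau>] quot_homD(2)[OF mult_op_hom] quot_hom_simps[OF mult_op_hom]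
          cvec.scale_right_diff_distrib)
  qed
  have "quasi_poisson (t \<oplus>\<^sub>t s) A (diagonal_action \<rho>) m0 (fusion_bracket t \<rho> m0 br)"
    by (rule quasi_poisson_semiclassical[OF \<Phi> invariant_symmetric_dsum[OF t s] assoc_F F0 comm bracket])
  then show ?thesis
    unfolding deformation_quantization_def
    using assoc_F F0 bracket bidifferential_fusion_product[where m = m, OF \<rho> inv bd] by blast
qed

section \<open>Quasi-Poisson-commutative algebras\<close>

theorem deformation_quantization_constant:
  fixes A :: "'a::complex_vector set"
  assumes \<Phi>: "drinfeld_associator \<Phi>" and t: "invariant_symmetric t" and qpc: "quasi_poisson_commutative t A \<rho> m0 br"
  shows "deformation_quantization \<Phi> t A \<rho> m0 br (constant_series m0)"
proof -
  let ?c = "constant_series m0" and ?\<tau> = "t_action t (module_slots \<rho>)" and ?V = "tensor_power A 3"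
  let ?M = "teval (\<lambda>as. m0 (as ! 0) (m0 (as ! 1) (as ! 2)))"
  have qp: "quasi_poisson t A \<rho> m0 br" and br: "\<And>a b. a \<in> A \<Longrightarrow> b \<in> A \<Longrightarrow> br a b = 0"
    and null: "\<And>a b. a \<in> A \<Longrightarrow> b \<in> A \<Longrightarrow> teval (\<lambda>as. m0 (as ! 0) (as ! 1)) (?\<tau> {1} {2} (tensor [a, b])) = 0"
    using qpc unfolding quasi_poisson_commutative_def by blast+
  interpret comm_algebra A m0 by (rule comm_algebra_quasi_poisson[OF qp])
  have \<rho>: "lie_module A \<rho>" and inv: "invariant_bilinear A \<rho> m0"
    using qp unfolding quasi_poisson_def by blast+
  note mod = lie_moduleD(2)[OF \<rho>]
  have V: "quot_hom ?V ?V (?\<tau> {i} {k})" if "i \<in> {1..3}" "k \<in> {1..3}" for i k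
    by (rule t_action_hom[OF slot_system_module_slots[OF \<rho>] t]) (use that in auto)
  have pair: "m0 c (teval (\<lambda>(x, y). m0 (\<rho> x a) (\<rho> y b)) t) = 0" if "a \<in> A" "b \<in> A" "c \<in> A" for a b c
    using null[OF that(1,2)]
    by (simp add: t_action_pair module_slots_def at_factor_tensor teval_hom_fun[OF teval_hom] case_prod_unfold scaleC_one mult_simps that)
  have pull: "m0 c (teval (\<lambda>(x, y). m0 (\<rho> x a) (\<rho> y b)) t) = teval (\<lambda>(x, y). m0 c (m0 (\<rho> x a) (\<rho> y b))) t"
    if "a \<in> A" "b \<in> A" "c \<in> A" for a b c
    unfolding case_prod_unfold by (rule linear_on_teval[OF subspace mult_linear[OF that(3)]]) (simp add: mod closed that)
  \<comment> \<open>The hypothesis concerns two factors; commutativity and associativity let the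
    remaining factor be multiplied in afterwards.\<close>
  have kill: "?M (?\<tau> {1} {2} F) = 0" "?M (?\<tau> {2} {3} F) = 0" if F: "F \<in> fst ?V" for F
  proof -
    have keys: "\<exists>a b c. as = [a, b, c] \<and> a \<in> A \<and> b \<in> A \<and> c \<in> A" if "as \<in> Poly_Mapping.keys F" for as
    proof -
      have *: "length as = 3" "set as \<subseteq> A" using F that by (auto simp: tensor_power_fst)
      show ?thesis using list3E[OF *] by blast
    qed
    have z: "quot_hom (UNIV, {0}) (UNIV, {0}) (\<lambda>v :: 'a list \<Rightarrow>\<^sub>0 complex. 0 :: 'a)" by (simp add: quot_hom_def)
    have 1: "?M (?\<tau> {1} {2} (tensor [a, b, c])) = 0" "?M (?\<tau> {2} {3} (tensor [a, b, c])) = 0"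
      if abc: "a \<in> A" "b \<in> A" "c \<in> A" for a b c
    proof -
      have swap: "m0 (\<rho> x a) (m0 (\<rho> y b) c) = m0 c (m0 (\<rho> x a) (\<rho> y b))" for x y
        unfolding comm[OF abc(3) closed[OF mod[OF abc(1)] mod[OF abc(2)]]]
        by (rule assoc[symmetric]) (use mod abc in blast)+
      have "?M (?\<tau> {1} {2} (tensor [a, b, c])) = teval (\<lambda>(x, y). m0 c (m0 (\<rho> x a) (\<rho> y b))) t"
        by (simp add: t_action_pair module_slots_def at_factor_tensor teval_hom_fun[OF teval_hom] case_prod_unfold scaleC_one swap)
      then show "?M (?\<tau> {1} {2} (tensor [a, b, c])) = 0" by (simp only: pull[OF abc, symmetric] pair[OF abc])
      have "?M (?\<tau> {2} {3} (tensor [a, b, c])) = teval (\<lambda>(x, y). m0 a (m0 (\<rho> x b) (\<rho> y c))) t"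
        by (simp add: t_action_pair module_slots_def at_factor_tensor teval_hom_fun[OF teval_hom] case_prod_unfold scaleC_one)
      then show "?M (?\<tau> {2} {3} (tensor [a, b, c])) = 0" by (simp only: pull[OF abc(2,3,1), symmetric] pair[OF abc(2,3,1)])
    qed
    have h: "quot_hom (UNIV, {0}) (UNIV, {0}) (\<lambda>F. ?M (?\<tau> {i} {k} F))" if "i \<in> {1..3}" "k \<in> {1..3}" for i k
      by (rule quot_hom_comp[OF teval_hom hom_UNIV[OF V[OF that]]])
    have H: "quot_hom (UNIV, {0}) (UNIV, {0}) (\<lambda>F. ?M (?\<tau> {1} {2} F))" "quot_hom (UNIV, {0}) (UNIV, {0}) (\<lambda>F. ?M (?\<tau> {2} {3} F))"
      by (rule h; simp)+
    show "?M (?\<tau> {1} {2} F) = 0"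
      by (rule linear_eqI[OF H(1) z]) (use keys 1(1) in blast)
    show "?M (?\<tau> {2} {3} F) = 0"
      by (rule linear_eqI[OF H(2) z]) (use keys 1(2) in blast)
  qed
  \<comment> \<open>\<open>kill\<close> applies to tensors over \<open>A\<close>, so the inner part
    of a word must not leave them.\<close>
  have stay: "word_op (?\<tau> {1} {2}) (?\<tau> {2} {3}) w F \<in> fst ?V" if "F \<in> fst ?V" for w F
    using that
  proof (induction w)
    case (Cons l w)
    have "?\<tau> {1} {2} (word_op (?\<tau> {1} {2}) (?\<tau> {2} {3}) w F) \<in> fst ?V" "?\<tau> {2} {3} (word_op (?\<tau> {1} {2}) (?\<tau> {2} {3}) w F) \<in> fst ?V"
      by (rule quot_homD(3)[OF V Cons.IH[OF Cons.prems]]; simp)+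
    then show ?case by (cases l) (simp_all del: One_nat_def)
  qed simp
  have vanish: "?M (placed \<Phi> ?\<tau> {1} {2} {3} n F) = 0" if n: "n > 0" and F: "F \<in> fst ?V" for n F
  proof -
    have "?M (word_op (?\<tau> {1} {2}) (?\<tau> {2} {3}) w F) = 0" if w: "length w = n" for w
    proof (cases w)
      case Nil
      then show ?thesis using n w by simp
    next
      case (Cons l w')
      then show ?thesis using kill[OF stay[OF F, of w']] by (cases l) (simp_all del: One_nat_def)
    qed
    then show ?thesis
      by (simp add: placed_def nc_eval_def teval_simps teval_scale del: One_nat_def)
  qed
  have alg: "assoc_algebra \<Phi> t A \<rho> ?c"
    unfolding assoc_algebra_def
  proof (intro conjI allI ballI \<rho>)
    have "invariant_bilinear A \<rho> (\<lambda>a b. 0)"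
      using linear_on_0[OF subspace lie_moduleD(3)[OF \<rho>]]
      by (simp add: invariant_bilinear_def bilinear_on_def linear_on_def mem(2))
    then show "invariant_bilinear A \<rho> (?c i)" for i
      by (simp add: constant_series_def inv)
    fix n a b c assume abc: "a \<in> A" "b \<in> A" "c \<in> A"
    let ?\<Psi> = "placed \<Phi> ?\<tau> {1} {2} {3}"
    have T: "tensor [a, b, c] \<in> fst ?V" by (rule tensor_power_tensor) (use abc in auto)
    have \<Psi>: "?\<Psi> k (tensor [a, b, c]) \<in> fst ?V" for k
      using quot_homD(3)[OF quot_hom_nc_eval[OF quot_space_tensor_power V V] T] by (simp add: placed_def)
    have first: "(\<Sum>i\<le>n. f i) = f 0" if "\<And>i. i \<noteq> 0 \<Longrightarrow> f i = 0" for n and f :: "nat \<Rightarrow> 'a"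
    proof -
      have "(\<Sum>i\<le>n. f i) = (\<Sum>i\<in>{0}. f i)" by (rule sum.mono_neutral_right) (auto simp: that)
      then show ?thesis by simp
    qed
    have nz: "teval (\<lambda>as. m0 (as ! 0) (?c j (as ! 1) (as ! 2))) F = 0" if "j \<noteq> 0" "F \<in> fst ?V" for j F
    proof -
      have "teval (\<lambda>as. m0 (as ! 0) (?c j (as ! 1) (as ! 2))) F = teval (\<lambda>as. 0) F"
      proof (rule teval_cong)
        fix as assume "as \<in> Poly_Mapping.keys F"
        then have *: "length as = 3" "set as \<subseteq> A" using that(2) by (auto simp: tensor_power_fst)
        obtain x y z where "as = [x, y, z]" "x \<in> A" using list3E[OF *] by blast
        then show "m0 (as ! 0) (?c j (as ! 1) (as ! 2)) = 0" using that(1) by (simp add: constant_series_def mult_simps(1))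
      qed
      then show ?thesis by (simp add: teval_def)
    qed
    have zero: "teval (\<lambda>as. 0) F = (0 :: 'a)" for F :: "'a list \<Rightarrow>\<^sub>0 complex" by (simp add: teval_def)
    have c0: "?c 0 = m0" by (simp add: constant_series_def)
    have ci: "?c i = (\<lambda>a b. 0)" if "i \<noteq> 0" for i using that by (simp add: constant_series_def)
    have "(\<Sum>(i, j, k) | i + j + k = n. teval (\<lambda>as. ?c i (as ! 0) (?c j (as ! 1) (as ! 2))) (?\<Psi> k (tensor [a, b, c])))
        = (\<Sum>j\<le>n - 0. teval (\<lambda>as. ?c 0 (as ! 0) (?c j (as ! 1) (as ! 2))) (?\<Psi> (n - 0 - j) (tensor [a, b, c])))"
      unfolding sum_triples by (rule first) (simp add: ci zero)
    also have "\<dots> = ?M (?\<Psi> (n - 0 - 0) (tensor [a, b, c]))"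
      unfolding c0 by (rule trans[OF first], rule nz[OF _ \<Psi>], assumption, simp only: c0)
    also have "\<dots> = (if n = 0 then m0 a (m0 b c) else 0)"
    proof (cases "n = 0")
      case True
      have "?\<Psi> 0 (tensor [a, b, c]) = tensor [a, b, c]"
        unfolding placed_def by (rule nc_eval_0) (rule associator_low(1)[OF \<Phi>])
      then show ?thesis using True by (simp add: scaleC_one)
    qed (use vanish[OF _ T, of n] in \<open>simp del: One_nat_def\<close>)
    also have "\<dots> = (\<Sum>(i, j) | i + j = n. ?c i (?c j a b) c)"
    proof -
      \<comment> \<open>For positive \<open>n\<close> the surviving term is \<open>m0 0 c\<close>,
        because the inner product of degree \<open>n\<close> is zero.\<close>
      have "m0 0 c = 0" using comm[OF mem(2) abc(3)] mult_simps(1)[OF abc(3)] by simp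
      moreover have "(\<Sum>i\<le>n. ?c i (?c (n - i) a b) c) = ?c 0 (?c (n - 0) a b) c" by (rule first) (simp add: ci)
      ultimately show ?thesis
        unfolding sum_pairs by (simp add: constant_series_def assoc[OF abc])
    qed
    finally show "(\<Sum>(i, j, k) | i + j + k = n. teval (\<lambda>as. ?c i (as ! 0) (?c j (as ! 1) (as ! 2))) (?\<Psi> k (tensor [a, b, c])))
        = (\<Sum>(i, j) | i + j = n. ?c i (?c j a b) c)" .
  qed
  have "bidifferential A m0 (?c i)" for i
    using bidifferential_mult bidifferential_zero by (simp add: constant_series_def)
  then show ?thesis
    unfolding deformation_quantization_def using qp alg br by (simp add: constant_series_def)
qed


section \<open>Reduction\<close>

lemma coset_of_add:
  assumes "cvec.subspace U"
  shows "{p + q | p q. p \<in> coset_of U x \<and> q \<in> coset_of U y} = coset_of U (x + y)"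
proof (intro set_eqI iffI)
  fix z assume "z \<in> {p + q | p q. p \<in> coset_of U x \<and> q \<in> coset_of U y}"
  then obtain u v where "z = (x + u) + (y + v)" "u \<in> U" "v \<in> U" by (auto simp: coset_of_def)
  then have "z = (x + y) + (u + v)" "u + v \<in> U" using cvec.subspace_add[OF assms] by (simp_all add: add_ac)
  then show "z \<in> coset_of U (x + y)" unfolding coset_of_def by blast
next
  fix z assume "z \<in> coset_of U (x + y)"
  then obtain u where u: "z = (x + u) + (y + 0)" "u \<in> U" by (auto simp: coset_of_def add_ac)
  have "x + u \<in> coset_of U x" "y + 0 \<in> coset_of U y"
    unfolding coset_of_def using u(2) cvec.subspace_0[OF assms] by blast+
  then show "z \<in> {p + q | p q. p \<in> coset_of U x \<and> q \<in> coset_of U y}" using u(1) by blast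
qed

lemma coset_of_scale:
  assumes "cvec.subspace U"
  shows "{c *\<^sub>C p + u | p u. p \<in> coset_of U x \<and> u \<in> U} = coset_of U (c *\<^sub>C x)"
proof (intro set_eqI iffI)
  fix z assume "z \<in> {c *\<^sub>C p + u | p u. p \<in> coset_of U x \<and> u \<in> U}"
  then obtain u v where "z = c *\<^sub>C (x + v) + u" "u \<in> U" "v \<in> U" by (auto simp: coset_of_def)
  then have "z = c *\<^sub>C x + (c *\<^sub>C v + u)" "c *\<^sub>C v + u \<in> U"
    using cvec.subspace_add[OF assms] cvec.subspace_scale[OF assms] by (simp_all add: scaleC_add_right add_ac)
  then show "z \<in> coset_of U (c *\<^sub>C x)" unfolding coset_of_def by blast
next
  fix z assume "z \<in> coset_of U (c *\<^sub>C x)"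
  then obtain u where u: "z = c *\<^sub>C x + u" "u \<in> U" by (auto simp: coset_of_def)
  have "x + 0 \<in> coset_of U x" unfolding coset_of_def using cvec.subspace_0[OF assms] by blast
  then show "z \<in> {c *\<^sub>C p + u | p u. p \<in> coset_of U x \<and> u \<in> U}" using u by auto
qed

text \<open>A bilinear map that vanishes as soon as one argument lies in \<open>\<cc>\<close>
  descends to the quotient, where the image of \<open>t\<close> is zero.\<close>

lemma coisotropic_teval:
  fixes b :: "'g::lie_algebra \<Rightarrow> 'g \<Rightarrow> 'b::complex_vector"
  assumes "coisotropic t \<cc>"
    and add: "\<And>x x' y. b (x + x') y = b x y + b x' y" "\<And>x y y'. b x (y + y') = b x y + b x y'"
    and scale: "\<And>c x y. b (c *\<^sub>C x) y = c *\<^sub>C b x y" "\<And>c x y. b x (c *\<^sub>C y) = c *\<^sub>C b x y"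
    and null: "\<And>x y. x \<in> \<cc> \<Longrightarrow> b x y = 0" "\<And>x y. y \<in> \<cc> \<Longrightarrow> b x y = 0"
  shows "teval (\<lambda>(x, y). b x y) t = 0"
proof -
  have sub: "cvec.subspace \<cc>" and mem: "push (\<lambda>(x, y). (coset_of \<cc> x, coset_of \<cc> y)) t \<in> quotient_tensor_null \<cc>"
    using assms(1) by (auto simp: coisotropic_def lie_subalgebra_def)
  \<comment> \<open>The descended map, by choice of representatives; \<open>null\<close> makes its
    values independent of them.\<close>
  define B where "B X Y = b (SOME x. x \<in> X) (SOME y. y \<in> Y)" for X Y
  have B: "B (coset_of \<cc> x) (coset_of \<cc> y) = b x y" for x y
  proof -
    have "\<exists>d\<in>\<cc>. (SOME z. z \<in> coset_of \<cc> x) = x + d" for x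
    proof -
      have "x + 0 \<in> coset_of \<cc> x" unfolding coset_of_def using cvec.subspace_0[OF sub] by blast
      then have "(SOME z. z \<in> coset_of \<cc> x) \<in> coset_of \<cc> x" by (rule someI)
      then show ?thesis by (auto simp: coset_of_def)
    qed
    then obtain d e where "d \<in> \<cc>" "e \<in> \<cc>" "(SOME z. z \<in> coset_of \<cc> x) = x + d" "(SOME z. z \<in> coset_of \<cc> y) = y + e"
      by metis
    then show ?thesis by (simp add: B_def add null)
  qed
  have "teval (\<lambda>(X, Y). B X Y) (push (\<lambda>(x, y). (coset_of \<cc> x, coset_of \<cc> y)) t) \<in> {0}"
  proof (rule tensor_null_teval[OF _ _ _ _ _ mem[unfolded quotient_tensor_null_def]])
    show "cvec.subspace {0 :: 'b}" by (rule cvec.subspace_single_0)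
  qed (auto simp: coset_of_add[OF sub] coset_of_scale[OF sub] B add scale)
  then show ?thesis by (simp add: teval_push case_prod_unfold B)
qed

section \<open>Restriction to the subspace of invariants\<close>

lemma lie_module_restrict:
  "lie_module A \<rho> \<Longrightarrow> cvec.subspace B \<Longrightarrow> B \<subseteq> A \<Longrightarrow> (\<And>x a. a \<in> B \<Longrightarrow> \<rho> x a \<in> B) \<Longrightarrow> lie_module B \<rho>"
  unfolding lie_module_def bilinear_on_def linear_on_def by (simp add: subset_iff)

lemma bidiff_below_restrict: "bidiff_below A m0 n D \<Longrightarrow> B \<subseteq> A \<Longrightarrow> bidiff_below B m0 n D"
  by (induction n arbitrary: D) (auto simp: subset_iff)

lemma bilinear_on_restrict: "bilinear_on A A m \<Longrightarrow> B \<subseteq> A \<Longrightarrow> bilinear_on B B m"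
  unfolding bilinear_on_def linear_on_def by (simp add: subset_iff)

lemma linear_on_restrict: "linear_on A f \<Longrightarrow> B \<subseteq> A \<Longrightarrow> linear_on B f"
  unfolding linear_on_def by blast

text \<open>Multilinear maps on \<open>A\<close> restrict to \<open>B\<close>, so tensors that are
  null over \<open>B\<close> stay null over \<open>A\<close>.\<close>

lemma quot_hom_tensor_power_mono:
  assumes "B \<subseteq> A"
  shows "quot_hom (tensor_power B n) (tensor_power A n) (\<lambda>v. v)"
proof -
  have "multilinear_on B n f" if "multilinear_on A n f" for f
    unfolding multilinear_on_def
  proof (intro allI impI)
    fix as :: "'a list" and i assume as: "length as = n" "set as \<subseteq> B" "i < n"
    then have "set as \<subseteq> A" using assms by blast
    then have "linear_on A (\<lambda>a. f (as[i := a]))" using that as unfolding multilinear_on_def by blast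
    then show "linear_on B (\<lambda>a. f (as[i := a]))" by (rule linear_on_restrict[OF _ assms])
  qed
  moreover have "v \<in> fst (tensor_power A n)" if "v \<in> fst (tensor_power B n)" for v
    using that assms unfolding tensor_power_fst by (meson subset_trans)
  ultimately show ?thesis
    by (simp add: quot_hom_def tensor_power_snd)
qed

context
  fixes A :: "'a::complex_vector set" and \<rho> :: "'g::lie_algebra \<times> 'h::lie_algebra \<Rightarrow> 'a \<Rightarrow> 'a" and \<cc> :: "'g set"
  assumes \<rho>: "lie_module A \<rho>"
begin

lemma invariants_subset: "invariants \<cc> A \<rho> \<subseteq> A"
  by (auto simp: invariants_def)

lemma subspace_invariants: "cvec.subspace (invariants \<cc> A \<rho>)"
  unfolding cvec.subspace_def
  using cvec.subspace_0[OF lie_moduleD(1)[OF \<rho>]] cvec.subspace_add[OF lie_moduleD(1)[OF \<rho>]] cvec.subspace_scale[OF lie_moduleD(1)[OF \<rho>]]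
    linear_on_0[OF lie_moduleD(1,3)[OF \<rho>]] lie_moduleD(3)[OF \<rho>]
  by (auto simp: invariants_def linear_on_def)

text \<open>The two summands commute, so \<open>\<hh>\<close> preserves the vectors annihilated by
  \<open>\<cc>\<close>.\<close>

lemma lie_module_invariants: "lie_module (invariants \<cc> A \<rho>) (\<lambda>v. \<rho> (0, v))"
proof (rule lie_module_restrict[OF _ subspace_invariants invariants_subset])
  show "lie_module A (\<lambda>v. \<rho> (0, v))"
    by (rule lie_module_pullback[where e = "\<lambda>v. (0, v)", OF \<rho>]) (simp_all add: scaleC_prod_def lie_prod_def lie_zero)
  fix v a assume a: "a \<in> invariants \<cc> A \<rho>"
  then have aA: "a \<in> A" and inv: "\<And>x. x \<in> \<cc> \<Longrightarrow> \<rho> (x, 0) a = 0" by (auto simp: invariants_def)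
  have "\<rho> (x, 0) (\<rho> (0, v) a) = 0" if "x \<in> \<cc>" for x
  proof -
    have "\<rho> (lie (x, 0) (0, v)) a = \<rho> (x, 0) (\<rho> (0, v) a) - \<rho> (0, v) (\<rho> (x, 0) a)"
      by (rule lie_moduleD(6)[OF \<rho> aA])
    moreover have "lie (x, 0) (0, v) = (0 :: 'g \<times> 'h)" by (simp add: lie_prod_def lie_zero zero_prod_def)
    ultimately show ?thesis
      by (simp add: lie_moduleD(7)[OF \<rho> aA] inv[OF that] linear_on_0[OF lie_moduleD(1,3)[OF \<rho>]])
  qed
  then show "\<rho> (0, v) a \<in> invariants \<cc> A \<rho>"
    using lie_moduleD(2)[OF \<rho> aA] by (simp add: invariants_def)
qed

lemma invariant_bilinear_invariants:
  assumes m: "invariant_bilinear A \<rho> m"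
  shows "invariant_bilinear (invariants \<cc> A \<rho>) (\<lambda>v. \<rho> (0, v)) m"
proof -
  note mD = invariant_bilinearD[OF m]
  have z: "m 0 b = 0" "m b 0 = 0" if "b \<in> A" for b
    using bilinear_onD(3,4)[OF mD(1) that that that, of 0] by simp_all
  have "m a b \<in> invariants \<cc> A \<rho>" if "a \<in> invariants \<cc> A \<rho>" "b \<in> invariants \<cc> A \<rho>" for a b
    using that mD(2,3) z by (simp add: invariants_def)
  then show ?thesis
    unfolding invariant_bilinear_def
    using bilinear_on_restrict[OF mD(1) invariants_subset] mD(3) invariants_subset by blast
qed

text \<open>With invariant vectors in two factors, a multilinear map becomes bilinear in the two
  legs of \<open>t\<close> and vanishes when a leg lies in \<open>\<cc>\<close>; coisotropy removes
  this summand and leaves \<open>s\<close>.\<close>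

lemma t_action_invariants:
  assumes t: "invariant_symmetric t" and s: "invariant_symmetric s" and co: "coisotropic t \<cc>"
    and p: "p \<in> {1..n}" "q \<in> {1..n}" "p \<noteq> q"
  shows "intertwines (tensor_power (invariants \<cc> A \<rho>) n) (tensor_power A n) (\<lambda>v. v)
    (t_action s (module_slots (\<lambda>v. \<rho> (0, v))) {p} {q}) (t_action (t \<oplus>\<^sub>t s) (module_slots \<rho>) {p} {q})"
proof -
  let ?B = "invariants \<cc> A \<rho>"
  let ?P = "t_action s (module_slots (\<lambda>v. \<rho> (0, v))) {p} {q}" and ?Q = "t_action (t \<oplus>\<^sub>t s) (module_slots \<rho>) {p} {q}"
  note D = lie_moduleD[OF \<rho>]
  have P: "quot_hom (tensor_power ?B n) (tensor_power ?B n) ?P"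
    by (rule t_action_hom[OF slot_system_module_slots[OF lie_module_invariants] s]) (use p in auto)
  have Q: "quot_hom (tensor_power A n) (tensor_power A n) ?Q"
    by (rule t_action_hom[OF slot_system_module_slots[OF \<rho>] invariant_symmetric_dsum[OF t s]]) (use p in auto)
  note M = quot_hom_tensor_power_mono[OF invariants_subset, of n]
  have "quot_cong (tensor_power ?B n) (tensor_power A n) (\<lambda>v. ?P v) (\<lambda>v. ?Q v)"
  proof (rule tensor_power_congI[OF quot_hom_comp[OF M P] quot_hom_comp[OF Q M]])
    fix as f assume as: "length as = n" "set as \<subseteq> ?B" and f: "multilinear_on A n f"
    define i k where "i = p - 1" and "k = q - 1"
    have ik: "i < n" "k < n" "i \<noteq> k" using p by (auto simp: i_def k_def)
    have asA: "set as \<subseteq> A" using as(2) invariants_subset by blast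
    have mem: "as ! i \<in> ?B" "as ! k \<in> ?B" "as ! i \<in> A" "as ! k \<in> A"
      using ik as asA nth_mem[of i as] nth_mem[of k as] by auto
    define g where "g u w = f (as[k := w, i := u])" for u w
    have upd: "set (as[j := w]) \<subseteq> A" if "w \<in> A" for j w
      using set_update_subset_insert[of as j w] asA that by auto
    have g1: "linear_on A (\<lambda>u. g u w)" if "w \<in> A" for w
    proof -
      have "length (as[k := w]) = n" using as(1) by simp
      then show ?thesis
        unfolding g_def using f upd[OF that, of k] ik(1) unfolding multilinear_on_def by blast
    qed
    have g2: "linear_on A (g u)" if "u \<in> A" for u
    proof -
      have "length (as[i := u]) = n" using as(1) by simp
      then have "linear_on A (\<lambda>w. f (as[i := u, k := w]))"
        using f upd[OF that, of i] ik(2) unfolding multilinear_on_def by blast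
      then show ?thesis unfolding g_def[abs_def] using ik(3) by (simp add: list_update_swap)
    qed
    have 0: "(x + y, 0) = (x, 0) + (y, 0 :: 'h)" "(c *\<^sub>C x, 0) = c *\<^sub>C (x, 0 :: 'h)" for x y :: 'g and c
      by (simp_all add: scaleC_prod_def)
    have gl: "g (u + u') w = g u w + g u' w" "g w (u + u') = g w u + g w u'" "g (c *\<^sub>C u) w = c *\<^sub>C g u w" "g w (c *\<^sub>C u) = c *\<^sub>C g w u"
      if "u \<in> A" "u' \<in> A" "w \<in> A" for u u' w c
      using g1[OF that(3)] g2[OF that(3)] that(1,2) unfolding linear_on_def by blast+
    have z: "g 0 w = 0" "g w 0 = 0" if "w \<in> A" for w
      using linear_on_0[OF D(1) g1[OF that]] linear_on_0[OF D(1) g2[OF that]] by simp_all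
    have "teval (\<lambda>(x, y). g (\<rho> (x, 0) (as ! i)) (\<rho> (y, 0) (as ! k))) t = 0"
    proof (rule coisotropic_teval[OF co])
      fix x x' y y' :: 'g and c
      show "g (\<rho> (x + x', 0) (as ! i)) (\<rho> (y, 0) (as ! k)) = g (\<rho> (x, 0) (as ! i)) (\<rho> (y, 0) (as ! k)) + g (\<rho> (x', 0) (as ! i)) (\<rho> (y, 0) (as ! k))"
        "g (\<rho> (x, 0) (as ! i)) (\<rho> (y + y', 0) (as ! k)) = g (\<rho> (x, 0) (as ! i)) (\<rho> (y, 0) (as ! k)) + g (\<rho> (x, 0) (as ! i)) (\<rho> (y', 0) (as ! k))"
        "g (\<rho> (c *\<^sub>C x, 0) (as ! i)) (\<rho> (y, 0) (as ! k)) = c *\<^sub>C g (\<rho> (x, 0) (as ! i)) (\<rho> (y, 0) (as ! k))"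
        "g (\<rho> (x, 0) (as ! i)) (\<rho> (c *\<^sub>C y, 0) (as ! k)) = c *\<^sub>C g (\<rho> (x, 0) (as ! i)) (\<rho> (y, 0) (as ! k))"
        unfolding 0 D(4,5)[OF mem(3)] D(4,5)[OF mem(4)] by (rule gl; rule D(2)[OF mem(3)] D(2)[OF mem(4)])+
      show "g (\<rho> (x, 0) (as ! i)) (\<rho> (y, 0) (as ! k)) = 0" if "x \<in> \<cc>"
        using mem(1) that z(1)[OF D(2)[OF mem(4)]] by (simp add: invariants_def)
      show "g (\<rho> (x, 0) (as ! i)) (\<rho> (y, 0) (as ! k)) = 0" if "y \<in> \<cc>"
        using mem(2) that z(2)[OF D(2)[OF mem(3)]] by (simp add: invariants_def)
    qed
    then have "teval f (t_action t (\<lambda>i x. module_slots \<rho> i (x, 0)) {p} {q} (tensor as)) = 0"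
      using ik unfolding g_def i_def k_def
      by (simp add: t_action_pair module_slots_def at_factor_tensor teval_hom_fun[OF teval_hom] case_prod_unfold scaleC_one)
    then have "teval f (?Q (tensor as)) = teval f (t_action s (\<lambda>i y. module_slots \<rho> i (0, y)) {p} {q} (tensor as))"
      by (simp add: t_action_dsum teval_add)
    then show "teval f (?P (tensor as)) = teval f (?Q (tensor as))"
      by (simp add: module_slots_def[abs_def])
  qed
  then show ?thesis
    unfolding intertwines_def using quot_homD(3)[OF P] Q by blast
qed

text \<open>On tensors of invariants the associators for \<open>\<hh>\<close> and for the direct sum
  agree up to null tensors over \<open>A\<close>, and the product of \<open>A\<close> does not see
  those.\<close>

lemma assoc_algebra_invariants:
  assumes \<Phi>: "drinfeld_associator \<Phi>" and t: "invariant_symmetric t" and s: "invariant_symmetric s" and co: "coisotropic t \<cc>"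
    and alg: "assoc_algebra \<Phi> (t \<oplus>\<^sub>t s) A \<rho> m"
  shows "assoc_algebra \<Phi> s (invariants \<cc> A \<rho>) (\<lambda>v. \<rho> (0, v)) m"
proof -
  let ?B = "invariants \<cc> A \<rho>" and ?K = "(UNIV, {0}) :: 'a set \<times> 'a set"
  define \<Psi> where "\<Psi> = placed \<Phi> (t_action (t \<oplus>\<^sub>t s) (module_slots \<rho>)) {1} {2} {3}"
  define \<Psi>' where "\<Psi>' = placed \<Phi> (t_action s (module_slots (\<lambda>v. \<rho> (0, v)))) {1} {2} {3}"
  have m: "\<And>i. invariant_bilinear A \<rho> (m i)"
    and eq: "\<And>n a b c. a \<in> A \<Longrightarrow> b \<in> A \<Longrightarrow> c \<in> A \<Longrightarrow>
      (mult_op m \<odot> mult_right m \<odot> \<Psi>) n (tensor [a, b, c]) = (mult_op m \<odot> mult_left m) n (tensor [a, b, c])"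
    using alg unfolding assoc_algebra_iff \<Psi>_def by blast+
  have V: "quot_space (tensor_power C n)" for C :: "'a set" and n by (rule quot_space_tensor_power)
  have K: "quot_space ?K" by (rule quot_space_UNIV)
  have mo: "quot_hom (tensor_power A 2) ?K (mult_op m i)" for i
    by (rule quot_hom_UNIV_target[OF quot_hom_mult_op[OF lie_moduleD(1)[OF \<rho>] m]])
  have R: "quot_hom (tensor_power A 3) (tensor_power A 2) (mult_right m i)" for i
    by (rule quot_hom_mult_right[where m = m and j = i, OF invariant_bilinearD(1,2)[OF m]])
  note M = quot_hom_tensor_power_mono[OF invariants_subset, of 3]
  have "intertwines (tensor_power ?B 3) (tensor_power A 3) (\<lambda>v. v) (\<Psi>' n) (\<Psi> n)" for n
    unfolding \<Psi>_def \<Psi>'_def placed_def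
    by (rule intertwines_nc_eval[OF V V M]; rule t_action_invariants[OF t s co]; simp)
  then have cong: "\<Psi>' n T - \<Psi> n T \<in> snd (tensor_power A 3)" if "T \<in> fst (tensor_power ?B 3)" for n T
    using that unfolding intertwines_def quot_cong_def by blast
  have same: "mult_op m i (mult_right m j (\<Psi>' k T)) = mult_op m i (mult_right m j (\<Psi> k T))" if "T \<in> fst (tensor_power ?B 3)" for i j k T
  proof -
    have h: "quot_hom (tensor_power A 3) ?K (\<lambda>v. mult_op m i (mult_right m j v))" by (rule quot_hom_comp[OF mo R])
    from quot_homD(4)[OF h cong[OF that]] show ?thesis by (simp add: quot_hom_simps[OF h])
  qed
  have "(mult_op m \<odot> mult_right m \<odot> \<Psi>') n (tensor [a, b, c]) = (mult_op m \<odot> mult_left m) n (tensor [a, b, c])"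
    if abc: "a \<in> ?B" "b \<in> ?B" "c \<in> ?B" for n a b c
  proof -
    have T: "tensor [a, b, c] \<in> fst (tensor_power ?B 3)" by (rule tensor_power_tensor) (use abc in auto)
    have "(mult_op m \<odot> mult_right m \<odot> \<Psi>') n (tensor [a, b, c]) = (mult_op m \<odot> mult_right m \<odot> \<Psi>) n (tensor [a, b, c])"
      by (simp add: series_comp_def quot_hom_simps(4)[OF mult_op_hom] same[OF T])
    then show ?thesis using eq abc invariants_subset by (simp add: subset_iff)
  qed
  then show ?thesis
    unfolding assoc_algebra_iff \<Psi>'_def[symmetric]
    using lie_module_invariants invariant_bilinear_invariants[OF m] by blast
qed

end

text \<open>The orders of the \<open>m i\<close> do not grow on the subalgebra, since commutators
  with its elements are among those with elements of \<open>A\<close>.\<close>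

theorem deformation_quantization_invariants:
  assumes \<Phi>: "drinfeld_associator \<Phi>" and t: "invariant_symmetric t" and s: "invariant_symmetric s"
    and dq: "deformation_quantization \<Phi> (t \<oplus>\<^sub>t s) A \<rho> m0 br m" and co: "coisotropic t \<cc>"
  shows "deformation_quantization \<Phi> s (invariants \<cc> A \<rho>) (\<lambda>v. \<rho> (0, v)) m0 br m"
proof -
  let ?B = "invariants \<cc> A \<rho>"
  have qp: "quasi_poisson (t \<oplus>\<^sub>t s) A \<rho> m0 br" and alg: "assoc_algebra \<Phi> (t \<oplus>\<^sub>t s) A \<rho> m"
    and m0: "\<And>a b. a \<in> A \<Longrightarrow> b \<in> A \<Longrightarrow> m 0 a b = m0 a b"
    and br: "\<And>a b. a \<in> A \<Longrightarrow> b \<in> A \<Longrightarrow> br a b = m 1 a b - m 1 b a"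
    and bd: "\<And>i. bidifferential A m0 (m i)"
    using dq unfolding deformation_quantization_def by blast+
  interpret comm_algebra A m0 by (rule comm_algebra_quasi_poisson[OF qp])
  have \<rho>: "lie_module A \<rho>" and m: "\<And>i. invariant_bilinear A \<rho> (m i)"
    using alg unfolding assoc_algebra_def by blast+
  note BA = subsetD[OF invariants_subset[OF \<rho>]]
  have alg': "assoc_algebra \<Phi> s ?B (\<lambda>v. \<rho> (0, v)) m"
    by (rule assoc_algebra_invariants[OF \<rho> \<Phi> t s co alg])
  have qp': "quasi_poisson s ?B (\<lambda>v. \<rho> (0, v)) m0 br"
    by (rule quasi_poisson_semiclassical[OF \<Phi> s alg']) (rule m0 comm br; rule BA, assumption)+
  have "bidifferential ?B m0 (m i)" for i
    using bd[of i] invariant_bilinearD(1,2)[OF invariant_bilinear_invariants[OF \<rho> m[of i]]]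
      bidiff_below_restrict[OF _ invariants_subset[OF \<rho>]]
    unfolding bidifferential_def by blast
  then show ?thesis
    unfolding deformation_quantization_def using qp' alg' m0 br BA by blast
qed

theorem theorem3:
  fixes \<Phi> :: ncseries
    and t\<^sub>g :: "'g::lie_algebra \<times> 'g \<Rightarrow>\<^sub>0 complex"
    and t\<^sub>h :: "'h::lie_algebra \<times> 'h \<Rightarrow>\<^sub>0 complex"
  assumes "drinfeld_associator \<Phi>"
    and "invariant_symmetric t\<^sub>g"
    and "invariant_symmetric t\<^sub>h"
  shows
    "(\<forall>(A :: 'a::complex_vector set) \<rho> m0 br.
        quasi_poisson_commutative t\<^sub>g A \<rho> m0 br \<longrightarrow>
        deformation_quantization \<Phi> t\<^sub>g A \<rho> m0 br (constant_series m0)) \<and>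
     (\<forall>(A :: 'a set) \<rho> m0 br m.
        deformation_quantization \<Phi> (t\<^sub>g \<oplus>\<^sub>t t\<^sub>g \<oplus>\<^sub>t t\<^sub>h) A \<rho> m0 br m \<longrightarrow>
        deformation_quantization \<Phi> (t\<^sub>g \<oplus>\<^sub>t t\<^sub>h) A (diagonal_action \<rho>)
          m0 (fusion_bracket t\<^sub>g \<rho> m0 br) (fusion_product \<Phi> t\<^sub>g \<rho> m)) \<and>
     (\<forall>(A :: 'a set) \<rho> m0 br m \<cc>.
        deformation_quantization \<Phi> (t\<^sub>g \<oplus>\<^sub>t t\<^sub>h) A \<rho> m0 br m \<longrightarrow>
        coisotropic t\<^sub>g \<cc> \<longrightarrow>
        deformation_quantization \<Phi> t\<^sub>h (invariants \<cc> A \<rho>) (\<lambda>v. \<rho> (0, v)) m0 br m)"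
  using deformation_quantization_constant[OF assms(1,2)] deformation_quantization_fusion[OF assms]
    deformation_quantization_invariants[OF assms]
  by blast


end
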